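(* Fix $C_\star>(3+\sqrt5)^2$ and $\kappa\ge 2C_\star$. Let $h,\gamma>0$ satisfy $h<2/\sqrt\kappa$, and set $$\beta=e^{-\gamma h},\qquad s=\frac{h^2}{2}(1+\beta),\qquad q_\kappa=\frac{1-C_\star/\kappa}{1+C_\star/\kappa}.$$ Let $\widetilde Q_{h,\gamma}^U$ denote the BAOAB kernel. Then at least one of the following two cases holds. (Q) There is $\lambda\in[1,\kappa]$ such that, for the quadratic potential $U_\lambda(x)=\lambda|x|^2/2$ on $\mathbb R^2$, two initial states $z,\widetilde z\in\mathbb R^4$ satisfy $$\lim_{n\to\infty}\bigl\|\delta_z(\widetilde Q_{h,\gamma}^{U_\lambda})^n-\delta_{\widetilde z}(\widetilde Q_{h,\gamma}^{U_\lambda})^n\bigr\|_{\mathrm{TV}}^{1/n}=\rho_{\mathrm q}(s,\beta;\kappa)\ge q_\kappa .$$ (C) There exist $U\in\mathcal U_\kappa^2$ and constants $c_0,C_0>0$ such that, for every $R\ge1$: the dilated potential $U_R(x)=R^2U(x/R)$ belongs to $\mathcal U_\kappa^2$, the kernel $\widetilde Q_{h,\gamma}^{U_R}$ has a unique invariant law $\pi_R$, and there is an initial state $z_R\in\mathbb R^4$ satisfying $W_2(\delta_{z_R},\pi_R)\le C_0(1+R)$ while $$\bigl\|\delta_{z_R}(\widetilde Q_{h,\gamma}^{U_R})^n-\pi_R\bigr\|_{\mathrm{TV}}\ge\frac38\qquad\text{for all integers }0\le n\le\Bigl\lfloor\frac1{32}e^{c_0R^2}\Bigr\rfloor .$$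
   Context: BAOAB chain. For a differentiable $U:\mathbb R^d\to\mathbb R$ and $h,\gamma>0$, put $\beta=e^{-\gamma h}$ and $\varsigma=(1-\beta^2)^{1/2}$. One BAOAB step, driven by a single $\xi\sim\mathcal N(0,\mathrm{Id}_d)$, maps $(x,v)\in\mathbb R^d\times\mathbb R^d$ to $(x^+,v^+)$ by $v^{(a)}=v-\frac h2\nabla U(x)$, $x^{(b)}=x+\frac h2v^{(a)}$, $v^{(c)}=\beta v^{(a)}+\varsigma\xi$, $x^+=x^{(b)}+\frac h2v^{(c)}$, $v^+=v^{(c)}-\frac h2\nabla U(x^+)$. Iterating with i.i.d. copies of $\xi$ defines a Markov chain with transition kernel $\widetilde Q_{h,\gamma}^U$. $\mathcal U_\kappa^d=\{U\in C^\infty(\mathbb R^d): \mathrm{Id}_d\preceq\nabla^2U(x)\preceq\kappa\,\mathrm{Id}_d\text{ for every }x\}$. $\|\nu-\widetilde\nu\|_{\mathrm{TV}}=\sup_A|\nu(A)-\widetilde\nu(A)|$; $W_2$ is the Euclidean $2$-Wasserstein distance; $\delta_z$ is the Dirac mass at $z$. $A_\lambda(s,\beta)=\begin{pmatrix}1+\beta-s\lambda&-\beta\\1&0\end{pmatrix}$ and $\rho_{\mathrm q}(s,\beta;\kappa)=\max_{\lambda\in[1,\kappa]}\rho(A_\lambda(s,\beta))$, with $\rho(\cdot)$ the spectral radius. *)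

theory Defs
  imports
    "HOL-Probability.Probability"
    "Jordan_Normal_Form.Spectral_Radius"
begin

primrec times_cont_diff :: "nat \<Rightarrow> ('a::real_normed_vector \<Rightarrow> 'b::real_normed_vector) \<Rightarrow> bool" where
  "times_cont_diff 0 f \<longleftrightarrow> continuous_on UNIV f"
| "times_cont_diff (Suc k) f \<longleftrightarrow>
     (\<forall>x. f differentiable (at x)) \<and>
     (\<forall>v. times_cont_diff k (\<lambda>x. frechet_derivative f (at x) v))"

definition smooth :: "('a::real_normed_vector \<Rightarrow> 'b::real_normed_vector) \<Rightarrow> bool" where
  "smooth f \<longleftrightarrow> (\<forall>k. times_cont_diff k f)"

definition grad :: "('a::real_inner \<Rightarrow> real) \<Rightarrow> 'a \<Rightarrow> 'a" where
  "grad U x = (THE D. GDERIV U x :> D)"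

definition hessian :: "('a::real_inner \<Rightarrow> real) \<Rightarrow> 'a \<Rightarrow> 'a \<Rightarrow> 'a" where
  "hessian U x = frechet_derivative (grad U) (at x)"

(* The Loewner order, on linear endomorphisms rather than on matrices. *)
definition loewner_le :: "('a::real_inner \<Rightarrow> 'a) \<Rightarrow> ('a \<Rightarrow> 'a) \<Rightarrow> bool" where
  "loewner_le A B \<longleftrightarrow> (\<forall>v. inner (A v) v \<le> inner (B v) v)"

definition potential_class :: "real \<Rightarrow> ('a::euclidean_space \<Rightarrow> real) set" where
  "potential_class \<kappa> =
     {U. smooth U \<and> (\<forall>x. loewner_le id (hessian U x) \<and> loewner_le (hessian U x) (\<lambda>v. \<kappa> *\<^sub>R v))}"

definition std_gaussian :: "'a::euclidean_space measure" where
  "std_gaussian = density lborel (\<lambda>\<xi>. ennreal (\<Prod>b\<in>Basis. std_normal_density (inner \<xi> b)))"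

definition baoab_step ::
  "real \<Rightarrow> real \<Rightarrow> ('a::euclidean_space \<Rightarrow> real) \<Rightarrow> 'a \<times> 'a \<Rightarrow> 'a \<Rightarrow> 'a \<times> 'a" where
  "baoab_step h \<gamma> U z \<xi> =
     (let \<beta> = exp (- \<gamma> * h);
          \<sigma> = sqrt (1 - \<beta>\<^sup>2);
          x = fst z; v = snd z;
          va = v - (h/2) *\<^sub>R grad U x;
          xb = x + (h/2) *\<^sub>R va;
          vc = \<beta> *\<^sub>R va + \<sigma> *\<^sub>R \<xi>;
          x' = xb + (h/2) *\<^sub>R vc;
          v' = vc - (h/2) *\<^sub>R grad U x'
      in (x', v'))"

definition baoab_kernel ::
  "real \<Rightarrow> real \<Rightarrow> ('a::euclidean_space \<Rightarrow> real) \<Rightarrow> 'a \<times> 'a \<Rightarrow> ('a \<times> 'a) measure" where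
  "baoab_kernel h \<gamma> U z = distr std_gaussian borel (baoab_step h \<gamma> U z)"

(* The law \<delta>_z Q^n. *)
definition law_from :: "('s::topological_space \<Rightarrow> 's measure) \<Rightarrow> 's \<Rightarrow> nat \<Rightarrow> 's measure" where
  "law_from Q z n = ((\<lambda>\<mu>. Giry_Monad.bind \<mu> Q) ^^ n) (return borel z)"

definition invariant_law :: "('s::topological_space \<Rightarrow> 's measure) \<Rightarrow> 's measure \<Rightarrow> bool" where
  "invariant_law Q \<pi> \<longleftrightarrow> prob_space \<pi> \<and> sets \<pi> = sets borel \<and> Giry_Monad.bind \<pi> Q = \<pi>"

(* Only meant for finite measures on the same sigma-algebra. *)
definition tv_dist :: "'s measure \<Rightarrow> 's measure \<Rightarrow> real" where
  "tv_dist \<mu> \<nu> = (SUP A\<in>sets \<mu>. \<bar>measure \<mu> A - measure \<nu> A\<bar>)"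

definition couplings :: "'s measure \<Rightarrow> 's measure \<Rightarrow> ('s \<times> 's) measure set" where
  "couplings \<mu> \<nu> =
     {\<pi>. sets \<pi> = sets (\<mu> \<Otimes>\<^sub>M \<nu>) \<and> distr \<pi> \<mu> fst = \<mu> \<and> distr \<pi> \<nu> snd = \<nu>}"

(* Extended-valued, so that a law without second moment is at infinite distance
   from a Dirac mass. *)
definition W2 :: "'s::euclidean_space measure \<Rightarrow> 's measure \<Rightarrow> ennreal" where
  "W2 \<mu> \<nu> =
     (let c = (INF \<pi>\<in>couplings \<mu> \<nu>. \<integral>\<^sup>+p. ennreal ((dist (fst p) (snd p))\<^sup>2) \<partial>\<pi>)
      in if c = \<infinity> then \<infinity> else ennreal (sqrt (enn2real c)))"

definition A_mat :: "real \<Rightarrow> real \<Rightarrow> real \<Rightarrow> real mat" where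
  "A_mat l s \<beta> = mat_of_rows_list 2 [[1 + \<beta> - s * l, - \<beta>], [1, 0]]"

(* The maximum over l is attained, by continuity of the spectral radius. *)
definition rho_q :: "real \<Rightarrow> real \<Rightarrow> real \<Rightarrow> real" where
  "rho_q s \<beta> \<kappa> =
     (GREATEST r. r \<in> (\<lambda>l. spectral_radius (map_mat complex_of_real (A_mat l s \<beta>))) ` {1..\<kappa>})"

end

theory Submission
  imports Defs
begin

text \<open>
  In the coordinates (next predicted position, current position) one BAOAB step is a heavy-ball step
  \<open>x'' = (1 + \<beta>) x' - \<beta> x - s \<nabla>U(x')\<close> with additive Gaussian noise.  For the quadratic potential of curvature
  \<open>l\<close> this is a linear recursion whose characteristic polynomial is \<open>z\<^sup>2 - (1 + \<beta> - s l) z + \<beta>\<close>, and the modulus of its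
  larger root is monotone in the absolute value of the trace.  The worst curvature is therefore \<open>1\<close> or \<open>\<kappa>\<close>
  (\<open>rho_q_endpoint\<close>).  The proof splits according to whether the quadratic rate is at least \<open>q\<close>.

  If it is, take the worst quadratic potential and identify the plane with the complex numbers.  Two starting
  states whose difference is the complex eigenvector for a root \<open>\<zeta>\<close> keep differing by exactly \<open>\<zeta>\<^sup>n\<close>.  Total variation
  is bounded below by testing with the sine of a linear functional, whose expectation is explicit because the
  laws are Gaussian, and above by absorbing the remaining difference into shifts of the last two noises.
  Both bounds are constant multiples of \<open>\<bar>\<zeta>\<bar>\<^sup>n\<close> (\<open>quadratic_tv_rate\<close>).

  If it is not, then \<open>1 - \<beta>\<close> is small, but large compared with \<open>1/\<kappa>\<close> (\<open>not_fast_imp_inequalities\<close>).  In this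
  regime the noiseless heavy-ball recursion can be trapped on a regular polygon:
  \<open>U(x) = \<bar>x\<bar>\<^sup>2/2 + \<Phi>(\<tau>(x))\<close>, where \<open>\<tau>\<close> is the support function of a smoothed regular polygon and \<open>\<Phi>\<close> becomes linear.
  Near the points of the cycle the gradient of the second summand is constant, equal to a vertex of that
  polygon, and the cycle closes when its points are turned by a suitable angle against the vertices; near the origin the second summand
  vanishes (\<open>cycle_potential_plane\<close>).  What \<open>\<kappa>\<close> has to provide is the curvature needed to round the polygon, and
  \<open>cycle_parameters\<close> checks that the available curvature suffices.

  Around the cycle and around the origin the recursion contracts in the quadratic form \<open>lyap\<close>, so tubes of radius
  proportional to the dilation factor \<open>R\<close> can be left only if some noise has size of order \<open>R\<close>, which has
  probability exponentially small in \<open>R\<^sup>2\<close>.  The same quadratic form is a Lyapunov function for the whole chain, since the force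
  is a bounded perturbation of \<open>x\<close>.  Two steps overlap on bounded sets, so Harris' theorem gives a unique invariant
  law \<open>\<pi>\<close> with second moment of order \<open>R\<^sup>2\<close> (\<open>unique_invariant_law\<close>).  The two tubes are disjoint, hence \<open>\<pi>\<close> gives
  mass at most \<open>1/2\<close> to one of them; a start there keeps total variation distance at least \<open>3/8\<close> from \<open>\<pi>\<close>
  until the tube is left (\<open>cycle_blocks_mixing\<close>).
\<close>

section \<open>Tails, translations and Fourier transform of the Gaussian law\<close>

lemma sets_std_gaussian [simp, measurable_cong]: "sets std_gaussian = sets borel"
  by (simp add: std_gaussian_def)

lemma space_std_gaussian [simp]: "space std_gaussian = UNIV"
  by (simp add: std_gaussian_def)

text \<open>The law is a product over an orthonormal basis, so product functions integrate coordinate by coordinate.\<close>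
lemma nn_integral_std_gaussian_prod:
  fixes f :: "'a::euclidean_space \<Rightarrow> real \<Rightarrow> real"
  assumes [measurable]: "\<And>b. b \<in> Basis \<Longrightarrow> f b \<in> borel_measurable borel"
    and nn: "\<And>b x. b \<in> Basis \<Longrightarrow> 0 \<le> f b x"
  shows "(\<integral>\<^sup>+\<xi>. ennreal (\<Prod>b\<in>Basis. f b (inner \<xi> b)) \<partial>std_gaussian)
       = (\<Prod>b\<in>Basis. \<integral>\<^sup>+x. ennreal (std_normal_density x * f b x) \<partial>lborel)"
proof -
  have "(\<integral>\<^sup>+\<xi>. ennreal (\<Prod>b\<in>Basis. f b (inner \<xi> b)) \<partial>std_gaussian)
      = (\<integral>\<^sup>+\<xi>. (\<Prod>b\<in>Basis. ennreal (std_normal_density (inner \<xi> b) * f b (inner \<xi> b))) \<partial>(lborel::'a measure))"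
  proof -
    have "ennreal (\<Prod>b\<in>Basis. std_normal_density (inner \<xi> b)) * ennreal (\<Prod>b\<in>Basis. f b (inner \<xi> b))
        = (\<Prod>b\<in>Basis. ennreal (std_normal_density (inner \<xi> b) * f b (inner \<xi> b)))" for \<xi> :: 'a
      by (subst prod_ennreal) (auto simp: nn prod.distrib ennreal_mult prod_nonneg)
    thus ?thesis
      unfolding std_gaussian_def by (subst nn_integral_density) auto
  qed
  also have "\<dots> = (\<Prod>b\<in>Basis. \<integral>\<^sup>+x. ennreal (std_normal_density x * f b x) \<partial>lborel)"
    by (rule nn_integral_lborel_prod) auto
  finally show ?thesis .
qed

lemma nn_integral_std_normal_density: "(\<integral>\<^sup>+x. ennreal (std_normal_density x) \<partial>lborel) = 1"
  using emeasure_density[of std_normal_density lborel UNIV] prob_space.emeasure_space_1[OF prob_space_normal_density[of 1 0]]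
  by (simp add: emeasure_density)

lemma prob_space_std_gaussian: "prob_space (std_gaussian :: 'a::euclidean_space measure)"
proof
  have "emeasure std_gaussian (UNIV::'a set) = (\<integral>\<^sup>+\<xi>. ennreal (\<Prod>b\<in>(Basis::'a set). 1) \<partial>(std_gaussian :: 'a measure))"
    by simp
  also have "\<dots> = 1"
    by (subst nn_integral_std_gaussian_prod[where f="\<lambda>_ _. 1"]) (auto simp: nn_integral_std_normal_density)
  finally show "emeasure std_gaussian (space (std_gaussian::'a measure)) = 1" by simp
qed

interpretation gauss: prob_space "std_gaussian :: 'a::euclidean_space measure"
  by (rule prob_space_std_gaussian)

text \<open>Completing the square turns the weight into a normal density of variance two.\<close>
lemma nn_integral_exp_quarter_square:
  "(\<integral>\<^sup>+x. ennreal (std_normal_density x * exp (x\<^sup>2 / 4)) \<partial>lborel) = ennreal (sqrt 2)"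
proof -
  have "std_normal_density x * exp (x\<^sup>2 / 4) = sqrt 2 * normal_density 0 (sqrt 2) x" for x
    by (simp add: normal_density_def real_sqrt_mult field_simps flip: exp_add)
  hence "(\<integral>\<^sup>+x. ennreal (std_normal_density x * exp (x\<^sup>2 / 4)) \<partial>lborel)
     = (\<integral>\<^sup>+x. ennreal (sqrt 2) * ennreal (normal_density 0 (sqrt 2) x) \<partial>lborel)"
    by (simp add: ennreal_mult)
  also have "\<dots> = ennreal (sqrt 2) * (\<integral>\<^sup>+x. ennreal (normal_density 0 (sqrt 2) x) \<partial>lborel)"
    by (rule nn_integral_cmult) simp
  also have "(\<integral>\<^sup>+x. ennreal (normal_density 0 (sqrt 2) x) \<partial>lborel) = 1"
    using prob_space.emeasure_space_1[OF prob_space_normal_density[of "sqrt 2" 0]]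
    by (simp add: emeasure_density)
  finally show ?thesis by simp
qed

lemma nn_integral_gaussian_exp_square:
  "(\<integral>\<^sup>+\<xi>. ennreal (exp ((norm \<xi>)\<^sup>2 / 4)) \<partial>(std_gaussian :: 'a::euclidean_space measure)) = ennreal (sqrt 2 ^ DIM('a))"
proof -
  have "exp ((norm \<xi>)\<^sup>2 / 4) = (\<Prod>b\<in>Basis. exp ((inner \<xi> b)\<^sup>2 / 4))" for \<xi> :: 'a
  proof -
    have "(norm \<xi>)\<^sup>2 = (\<Sum>b\<in>Basis. (inner \<xi> b)\<^sup>2)"
      unfolding power2_norm_eq_inner by (subst euclidean_inner) (simp add: power2_eq_square)
    thus ?thesis
      by (simp add: exp_sum[symmetric] sum_divide_distrib)
  qed
  hence "(\<integral>\<^sup>+\<xi>. ennreal (exp ((norm \<xi>)\<^sup>2 / 4)) \<partial>(std_gaussian :: 'a measure)) =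
     (\<integral>\<^sup>+\<xi>. ennreal (\<Prod>b\<in>Basis. exp ((inner \<xi> b)\<^sup>2 / 4)) \<partial>(std_gaussian :: 'a measure))" by simp
  also have "\<dots> = ennreal (sqrt 2 ^ DIM('a))"
    by (subst nn_integral_std_gaussian_prod[where f="\<lambda>_ x. exp (x\<^sup>2 / 4)"]) 
       (auto simp: nn_integral_exp_quarter_square ennreal_power)
  finally show ?thesis .
qed

lemma gaussian_integrable_exp_square:
  "integrable (std_gaussian :: 'a::euclidean_space measure) (\<lambda>\<xi>. exp ((norm \<xi>)\<^sup>2 / 4))"
  by (rule integrableI_nonneg) (auto simp: nn_integral_gaussian_exp_square)

lemma gaussian_integral_exp_square:
  "integral\<^sup>L (std_gaussian :: 'a::euclidean_space measure) (\<lambda>\<xi>. exp ((norm \<xi>)\<^sup>2 / 4)) = sqrt 2 ^ DIM('a)"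
  by (rule integral_eq_nn_integral[THEN trans]) (auto simp: nn_integral_gaussian_exp_square)

text \<open>Chernoff's bound with weight \<open>exp (\<bar>\<xi>\<bar>\<^sup>2 / 4)\<close>.  The constant is not sharp; only the rate matters for the
  escape probabilities.\<close>
lemma gaussian_tail:
  assumes "0 \<le> t"
  shows "measure (std_gaussian :: 'a::euclidean_space measure) {\<xi>. norm \<xi> > t} \<le> sqrt 2 ^ DIM('a) * exp (- t\<^sup>2 / 4)"
proof -
  have "measure (std_gaussian :: 'a measure) {\<xi>. norm \<xi> > t}
      \<le> measure (std_gaussian :: 'a measure) {\<xi> \<in> space std_gaussian. exp (t\<^sup>2/4) \<le> exp ((norm \<xi>)\<^sup>2 / 4)}"
    by (rule gauss.finite_measure_mono) (auto simp: assms power_mono)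
  also have "\<dots> \<le> integral\<^sup>L (std_gaussian :: 'a measure) (\<lambda>\<xi>. exp ((norm \<xi>)\<^sup>2 / 4)) / exp (t\<^sup>2/4)"
    by (rule integral_Markov_inequality_measure[where A="UNIV", THEN order_trans])
       (auto simp: gaussian_integrable_exp_square)
  finally show ?thesis
    by (simp add: gaussian_integral_exp_square exp_minus field_simps)
qed

lemma gaussian_density_eq:
  fixes \<xi> :: "'a::euclidean_space"
  shows "(\<Prod>b\<in>Basis. std_normal_density (inner \<xi> b)) = (1 / sqrt (2 * pi)) ^ DIM('a) * exp (- (norm \<xi>)\<^sup>2 / 2)"
proof -
  have "(norm \<xi>)\<^sup>2 = (\<Sum>b\<in>Basis. (inner \<xi> b)\<^sup>2)"
    unfolding power2_norm_eq_inner by (subst euclidean_inner) (simp add: power2_eq_square)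
  thus ?thesis
    unfolding std_normal_density_def prod.distrib
    by (simp only: exp_sum[OF finite_Basis, symmetric] sum_divide_distrib sum_negf prod_constant)
       (simp add: sum_divide_distrib sum_negf)
qed

text \<open>Translating the Gaussian multiplies its density by the Cameron--Martin factor.\<close>
lemma emeasure_gaussian_translate:
  fixes e :: "'a::euclidean_space"
  assumes [measurable]: "A \<in> sets borel"
  shows "emeasure std_gaussian {\<xi>. \<xi> + e \<in> A}
       = (\<integral>\<^sup>+u. ennreal (exp (inner u e - (norm e)\<^sup>2 / 2)) * indicator A u \<partial>std_gaussian)"
proof -
  define g where "g = (\<lambda>\<xi>::'a. \<Prod>b\<in>Basis. std_normal_density (inner \<xi> b))"
  have [measurable]: "g \<in> borel_measurable borel" unfolding g_def by measurable
  have g0: "0 \<le> g u" for u unfolding g_def by (simp add: prod_nonneg)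
  have g: "g (u - e) = g u * exp (inner u e - (norm e)\<^sup>2 / 2)" for u
    unfolding g_def gaussian_density_eq
    by (simp add: exp_add[symmetric] power2_norm_eq_inner inner_diff inner_commute field_simps)
  have S[measurable]: "{\<xi>. \<xi> + e \<in> A} \<in> sets borel" by measurable
  have "emeasure std_gaussian {\<xi>. \<xi> + e \<in> A} = (\<integral>\<^sup>+\<xi>. ennreal (g \<xi>) * indicator A (\<xi> + e) \<partial>lborel)"
    unfolding std_gaussian_def g_def[symmetric]
    by (subst emeasure_density) (auto intro!: nn_integral_cong simp: g_def split: split_indicator)
  also have "\<dots> = (\<integral>\<^sup>+u. ennreal (g (u - e)) * indicator A u \<partial>distr lborel borel ((+) e))"
    by (subst nn_integral_distr) (auto simp: add.commute)
  also have "\<dots> = (\<integral>\<^sup>+u. ennreal (g (u - e)) * indicator A u \<partial>lborel)"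
    by (simp add: lborel_distr_plus)
  also have "\<dots> = (\<integral>\<^sup>+u. ennreal (g u) * (ennreal (exp (inner u e - (norm e)\<^sup>2 / 2)) * indicator A u) \<partial>lborel)"
    by (intro nn_integral_cong) (simp add: g ennreal_mult g0 mult.assoc)
  also have "\<dots> = (\<integral>\<^sup>+u. ennreal (exp (inner u e - (norm e)\<^sup>2 / 2)) * indicator A u \<partial>std_gaussian)"
    unfolding std_gaussian_def by (subst nn_integral_density) (auto simp: g_def)
  finally show ?thesis .
qed

text \<open>The Cameron--Martin factor differs from \<open>1\<close> by \<open>O(\<bar>e\<bar>)\<close>, with a prefactor of exponential growth that the
  weight \<open>exp (\<bar>u\<bar>\<^sup>2 / 4)\<close> absorbs.  For \<open>\<bar>e\<bar> > 1\<close> the trivial bound \<open>1\<close> suffices.\<close>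
lemma gaussian_shift_tv:
  "\<exists>C\<ge>0. \<forall>(e::'a::euclidean_space) A. A \<in> sets borel \<longrightarrow>
     \<bar>measure std_gaussian {\<xi>. \<xi> \<in> A} - measure std_gaussian {\<xi>. \<xi> + e \<in> A}\<bar> \<le> C * norm e"
proof (intro exI[of _ "exp 5 * sqrt 2 ^ DIM('a)"] conjI allI impI)
  show "0 \<le> exp 5 * sqrt 2 ^ DIM('a)" by simp
  fix e :: 'a and A :: "'a set" assume [measurable]: "A \<in> sets borel"
  let ?C = "exp 5 * sqrt 2 ^ DIM('a)"
  let ?w = "\<lambda>u. inner u e - (norm e)\<^sup>2 / 2"
  show "\<bar>measure std_gaussian {\<xi>. \<xi> \<in> A} - measure std_gaussian {\<xi>. \<xi> + e \<in> A}\<bar> \<le> ?C * norm e"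
  proof (cases "norm e \<le> 1")
    case False
    have "1 \<le> ?C" 
      using mult_mono[of 1 "exp 5" 1 "sqrt 2 ^ DIM('a)"] by simp
    hence "1 \<le> ?C * norm e" using False mult_mono[of 1 ?C 1 "norm e"] by simp
    moreover have "\<bar>measure std_gaussian {\<xi>. \<xi> \<in> A} - measure std_gaussian {\<xi>. \<xi> + e \<in> A}\<bar> \<le> 1"
      using gauss.prob_le_1[of "{\<xi>. \<xi> \<in> A}"] gauss.prob_le_1[of "{\<xi>. \<xi> + e \<in> A}"]
        measure_nonneg[of std_gaussian "{\<xi>. \<xi> \<in> A}"] measure_nonneg[of std_gaussian "{\<xi>. \<xi> + e \<in> A}"]
      unfolding abs_le_iff by linarith
    ultimately show ?thesis by linarith
  next
    case True
    have tot: "(\<integral>\<^sup>+u. ennreal (exp (?w u)) \<partial>(std_gaussian::'a measure)) = 1"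
      using emeasure_gaussian_translate[of UNIV e] gauss.emeasure_space_1[where 'a='a] by simp
    have int: "integrable std_gaussian (\<lambda>u. exp (?w u))"
      by (rule integrableI_nonneg) (auto simp: tot)
    have intA: "integrable std_gaussian (\<lambda>u. exp (?w u) * indicator A u)"
      using integrable_mult_indicator[OF _ int, of A] by (simp add: mult.commute)
    have "measure std_gaussian {\<xi>. \<xi> + e \<in> A} = (\<integral>u. exp (?w u) * indicator A u \<partial>std_gaussian)"
    proof -
      have "ennreal (measure std_gaussian {\<xi>. \<xi> + e \<in> A}) = (\<integral>\<^sup>+u. ennreal (exp (?w u) * indicator A u) \<partial>std_gaussian)"
        using emeasure_gaussian_translate[of A e]
        by (simp add: gauss.emeasure_eq_measure ennreal_mult'' ennreal_indicator)
      also have "\<dots> = ennreal (\<integral>u. exp (?w u) * indicator A u \<partial>std_gaussian)"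
        by (rule nn_integral_eq_integral[OF intA]) auto
      finally show ?thesis by (simp add: ennreal_inj integral_nonneg_AE)
    qed
    moreover have "measure std_gaussian {\<xi>. \<xi> \<in> A} = (\<integral>u. indicator A u \<partial>std_gaussian)" by simp
    ultimately have "measure std_gaussian {\<xi>. \<xi> \<in> A} - measure std_gaussian {\<xi>. \<xi> + e \<in> A}
        = (\<integral>u. indicator A u - exp (?w u) * indicator A u \<partial>std_gaussian)"
      using intA by (simp add: Bochner_Integration.integral_diff gauss.integrable_const_bound[where B=1])
    moreover have "\<bar>\<integral>u. indicator A u - exp (?w u) * indicator A u \<partial>std_gaussian\<bar>
        \<le> (\<integral>u. norm e * (exp 5 * exp ((norm u)\<^sup>2 / 4)) \<partial>(std_gaussian::'a measure))"
    proof (rule order_trans[OF integral_abs_bound], rule integral_mono)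
      show "integrable std_gaussian (\<lambda>u. \<bar>indicator A u - exp (?w u) * indicator A u\<bar>)"
        using intA by (intro integrable_abs Bochner_Integration.integrable_diff) (auto simp: gauss.integrable_const_bound[where B=1])
      show "integrable std_gaussian (\<lambda>u::'a. norm e * (exp 5 * exp ((norm u)\<^sup>2 / 4)))"
        using gaussian_integrable_exp_square by auto
      fix u :: 'a
      have "\<bar>?w u\<bar> \<le> \<bar>inner u e\<bar> + norm e * norm e / 2"
        using abs_triangle_ineq4[of "inner u e" "(norm e)\<^sup>2 / 2"] by (simp add: power2_eq_square)
      also have "\<dots> \<le> norm u * norm e + norm e * 1"
        using Cauchy_Schwarz_ineq2[of u e] True mult_left_mono[OF True, of "norm e"] norm_ge_zero[of e] by linarith
      finally have w: "\<bar>?w u\<bar> \<le> norm e * (norm u + 1)" by (simp add: algebra_simps)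
      have w2: "\<bar>?w u\<bar> \<le> norm u + 1"
      proof -
        have "norm e * (norm u + 1) \<le> 1 * (norm u + 1)" by (intro mult_right_mono True) simp
        with w show ?thesis by (rule order_trans[THEN order_trans]) simp
      qed
      have exp1: "\<bar>1 - exp x\<bar> \<le> \<bar>x\<bar> * exp \<bar>x\<bar>" for x :: real
      proof (cases "0 \<le> x")
        case True
        have "1 - x \<le> exp (- x)" using exp_ge_add_one_self[of "-x"] by simp
        hence "(1 - x) * exp x \<le> 1" by (simp add: exp_minus field_simps)
        thus ?thesis using True by (simp add: algebra_simps)
      next
        case False
        have "1 + x \<le> exp x" by (rule exp_ge_add_one_self)
        moreover have "-x * 1 \<le> -x * exp (-x)" using False by (intro mult_left_mono) auto
        moreover have "\<bar>1 - exp x\<bar> = 1 - exp x" using False by simp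
        ultimately have "\<bar>1 - exp x\<bar> \<le> -x * exp (-x)" by linarith
        thus ?thesis using False by simp
      qed
      have sq: "2 * norm u + 1 \<le> 5 + (norm u)\<^sup>2 / 4"
      proof -
        have "0 \<le> (norm u / 2 - 2)\<^sup>2" by (rule zero_le_power2)
        also have "(norm u / 2 - 2)\<^sup>2 = (norm u)\<^sup>2 / 4 - 2 * norm u + 4"
          by (simp add: power2_diff power_divide)
        finally show ?thesis by linarith
      qed
      have n1: "norm u + 1 \<le> exp (norm u)" using exp_ge_add_one_self[of "norm u"] by linarith
      have "\<bar>indicator A u - exp (?w u) * indicator A u\<bar> \<le> \<bar>1 - exp (?w u)\<bar>"
        by (cases "u \<in> A") simp_all
      also have "\<dots> \<le> \<bar>?w u\<bar> * exp \<bar>?w u\<bar>" by (rule exp1)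
      also have "\<dots> \<le> (norm e * (norm u + 1)) * exp (norm u + 1)"
        using w2 by (intro mult_mono[OF w]) simp_all
      also have "\<dots> \<le> (norm e * exp (norm u)) * exp (norm u + 1)"
        by (intro mult_right_mono mult_left_mono n1) simp_all
      also have "\<dots> = norm e * exp (2 * norm u + 1)" by (simp add: mult.assoc exp_add[symmetric])
      also have "\<dots> \<le> norm e * exp (5 + (norm u)\<^sup>2 / 4)"
        using sq by (intro mult_left_mono) simp_all
      finally show "\<bar>indicator A u - exp (?w u) * indicator A u\<bar> \<le> norm e * (exp 5 * exp ((norm u)\<^sup>2 / 4))"
        by (simp add: exp_add)
    qed
    ultimately show ?thesis by (simp add: gaussian_integral_exp_square mult_ac)
  qed
qed

lemma gaussian_fourier:
  fixes t :: "'a::euclidean_space"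
  shows "(\<integral>\<xi>. exp (\<i> * complex_of_real (inner t \<xi>)) \<partial>std_gaussian) = complex_of_real (exp (- (norm t)\<^sup>2 / 2))"
proof -
  interpret P: product_sigma_finite "\<lambda>_::'a. lborel :: real measure" ..
  let ?f = "\<lambda>b x. std_normal_density x *\<^sub>R exp (\<i> * complex_of_real (inner t b * x))"
  have int: "integrable lborel (?f b)" for b
    by (rule Bochner_Integration.integrable_bound[OF integrable_normal_density[of 1 0]])
       (auto simp: norm_mult norm_exp_eq_Re)
  have one: "integral\<^sup>L lborel (?f b) = exp (- (inner t b)\<^sup>2 / 2)" for b
  proof -
    have "integral\<^sup>L lborel (?f b) = (CLINT x|std_normal_distribution. iexp (inner t b * x))"
      by (subst integral_density) (auto simp: std_normal_density_def)
    also have "\<dots> = char std_normal_distribution (inner t b)" by (simp add: char_def)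
    finally show ?thesis by (simp add: char_std_normal_distribution exp_of_real)
  qed
  have "(\<integral>\<xi>. exp (\<i> * complex_of_real (inner t \<xi>)) \<partial>std_gaussian)
     = (\<integral>\<xi>. (\<Prod>b\<in>Basis. ?f b (inner \<xi> b)) \<partial>(lborel::'a measure))"
  proof -
    have "exp (\<i> * complex_of_real (inner t \<xi>)) = (\<Prod>b\<in>Basis. exp (\<i> * complex_of_real (inner t b * inner \<xi> b)))" for \<xi>
      by (subst euclidean_inner) (simp add: exp_sum[symmetric] sum_distrib_left)
    hence *: "(\<Prod>b\<in>Basis. ?f b (inner \<xi> b)) = (\<Prod>b\<in>Basis. std_normal_density (inner \<xi> b)) *\<^sub>R exp (\<i> * complex_of_real (inner t \<xi>))" for \<xi> :: 'a
      by (simp add: scaleR_conv_of_real prod.distrib)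
    show ?thesis unfolding * std_gaussian_def
      by (rule integral_density) (auto simp: prod_nonneg)
  qed
  also have "\<dots> = (\<integral>\<omega>. (\<Prod>b\<in>Basis. ?f b (\<omega> b)) \<partial>(\<Pi>\<^sub>M b\<in>(Basis::'a set). lborel))"
    by (subst lborel_eq, subst integral_distr) (auto simp: inner_sum_left inner_Basis if_distrib sum.delta cong: if_cong)
  also have "\<dots> = (\<Prod>b\<in>(Basis::'a set). integral\<^sup>L lborel (?f b))"
    by (rule P.product_integral_prod) (simp, rule int)
  also have "\<dots> = (\<Prod>b\<in>(Basis::'a set). complex_of_real (exp (- (inner t b)\<^sup>2 / 2)))" by (simp only: one)
  also have "\<dots> = complex_of_real (\<Prod>b\<in>(Basis::'a set). exp (- (inner t b)\<^sup>2 / 2))" by simp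
  also have "(\<Prod>b\<in>(Basis::'a set). exp (- (inner t b)\<^sup>2 / 2)) = exp (- (norm t)\<^sup>2 / 2)"
  proof -
    have "(norm t)\<^sup>2 = (\<Sum>b\<in>Basis. (inner t b)\<^sup>2)"
      unfolding power2_norm_eq_inner by (subst euclidean_inner) (simp add: power2_eq_square)
    thus ?thesis by (simp add: exp_sum[symmetric] sum_divide_distrib sum_negf)
  qed
  finally show ?thesis .
qed

text \<open>Imaginary part of the characteristic function: averaging over the noise keeps the phase and damps the amplitude.\<close>
lemma gaussian_integral_sin:
  fixes t :: "'a::euclidean_space"
  shows "(\<integral>\<xi>. sin (x + inner t \<xi>) \<partial>std_gaussian) = exp (- (norm t)\<^sup>2 / 2) * sin x"
proof -
  have int: "integrable std_gaussian (\<lambda>\<xi>. exp (\<i> * complex_of_real (inner t \<xi>)))"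
    by (rule gauss.integrable_const_bound[where B=1]) auto
  have "(\<integral>\<xi>. sin (x + inner t \<xi>) \<partial>std_gaussian) = (\<integral>\<xi>. Im (cis x * exp (\<i> * complex_of_real (inner t \<xi>))) \<partial>std_gaussian)"
    by (simp add: cis_conv_exp exp_add[symmetric] Im_exp)
  also have "\<dots> = Im (\<integral>\<xi>. cis x * exp (\<i> * complex_of_real (inner t \<xi>)) \<partial>std_gaussian)"
    by (rule integral_bounded_linear[OF bounded_linear_Im]) (simp add: int)
  also have "\<dots> = exp (- (norm t)\<^sup>2 / 2) * sin x"
    by (simp add: gaussian_fourier del: of_real_exp)
  finally show ?thesis .
qed

text \<open>The density is at least its value on the boundary of the ball.\<close>
lemma gaussian_ball_lower_bound:
  assumes "0 \<le> r"
  shows "\<exists>\<epsilon>>0. \<forall>S\<in>sets borel. S \<subseteq> cball (0::'a::euclidean_space) r \<longrightarrow>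
    ennreal \<epsilon> * emeasure lborel S \<le> emeasure std_gaussian S"
proof (intro exI conjI ballI impI)
  let ?\<epsilon> = "(1 / sqrt (2 * pi)) ^ DIM('a) * exp (- r\<^sup>2 / 2)"
  show "?\<epsilon> > 0" by simp
  fix S assume [measurable]: "S \<in> sets borel" and S: "S \<subseteq> cball (0::'a) r"
  have "ennreal ?\<epsilon> * emeasure lborel S = (\<integral>\<^sup>+x. ennreal ?\<epsilon> * indicator S x \<partial>lborel)"
    by (rule nn_integral_cmult_indicator[symmetric]) simp
  also have "\<dots> \<le> (\<integral>\<^sup>+x. ennreal (\<Prod>b\<in>Basis. std_normal_density (inner x b)) * indicator S x \<partial>lborel)"
    unfolding gaussian_density_eq using S assms
    by (intro nn_integral_mono) (auto split: split_indicator intro!: ennreal_leI mult_left_mono power_mono)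
  also have "\<dots> = emeasure std_gaussian S"
    unfolding std_gaussian_def by (subst emeasure_density) auto
  finally show "ennreal ?\<epsilon> * emeasure lborel S \<le> emeasure std_gaussian S" .
qed

section \<open>Iterated kernels and total variation\<close>

lemma prob_algebra_borelD:
  assumes "\<mu> \<in> space (prob_algebra borel)"
  shows "prob_space \<mu>" "sets \<mu> = sets borel"
  using assms by (auto simp: space_prob_algebra)

lemma kernel_prob:
  assumes "Q \<in> borel \<rightarrow>\<^sub>M prob_algebra borel"
  shows "prob_space (Q z)" "sets (Q z) = sets borel" "Q z \<in> space (prob_algebra borel)"
proof -
  show "Q z \<in> space (prob_algebra borel)"
    using measurable_space[OF assms, of z] by simp
  thus "prob_space (Q z)" "sets (Q z) = sets borel" by (rule prob_algebra_borelD)+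
qed

lemma law_from_0 [simp]: "law_from Q z 0 = return borel z"
  by (simp add: law_from_def)

lemma law_from_Suc: "law_from Q z (Suc n) = Giry_Monad.bind (law_from Q z n) Q"
  by (simp add: law_from_def)

lemma measurable_law_from:
  assumes [measurable]: "Q \<in> borel \<rightarrow>\<^sub>M prob_algebra borel"
  shows "(\<lambda>z. law_from Q z n) \<in> borel \<rightarrow>\<^sub>M prob_algebra borel"
proof (induction n)
  case 0
  show ?case by (simp add: measurable_return_prob_space)
next
  case (Suc n)
  note this[measurable]
  show ?case unfolding law_from_Suc by measurable
qed

lemma law_from_1:
  assumes "Q \<in> borel \<rightarrow>\<^sub>M prob_algebra borel"
  shows "law_from Q z (Suc 0) = Q z"
  unfolding law_from_Suc law_from_0
  by (rule bind_return[of _ borel borel]) (use assms in \<open>auto intro: measurable_prob_algebraD\<close>)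

lemma law_from_add:
  assumes Q: "Q \<in> borel \<rightarrow>\<^sub>M prob_algebra borel"
  shows "law_from Q z (m + n) = Giry_Monad.bind (law_from Q z m) (\<lambda>y. law_from Q y n)"
proof (induction n)
  case 0
  have "sets (law_from Q z m) = sets borel"
    using kernel_prob(2)[OF measurable_law_from[OF Q]] .
  thus ?case by (simp add: bind_return'')
next
  case (Suc n)
  have s: "sets (law_from Q z m) = sets borel"
    using kernel_prob(2)[OF measurable_law_from[OF Q]] .
  have "law_from Q z (m + Suc n) = Giry_Monad.bind (Giry_Monad.bind (law_from Q z m) (\<lambda>y. law_from Q y n)) Q"
    by (simp add: law_from_Suc Suc)
  also have "\<dots> = Giry_Monad.bind (law_from Q z m) (\<lambda>y. Giry_Monad.bind (law_from Q y n) Q)"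
    using measurable_prob_algebraD[OF measurable_law_from[OF Q, of n]] measurable_prob_algebraD[OF Q] s
    by (intro bind_assoc[where N=borel and R=borel]) (auto cong: measurable_cong_sets)
  finally show ?case by (simp add: law_from_Suc)
qed

lemma law_from_Suc_front:
  assumes Q: "Q \<in> borel \<rightarrow>\<^sub>M prob_algebra borel"
  shows "law_from Q z (Suc n) = Giry_Monad.bind (Q z) (\<lambda>y. law_from Q y n)"
  using law_from_add[OF Q, of z "Suc 0" n] by (simp add: law_from_1[OF Q])

lemma measurable_cong_borel:
  "sets \<mu> = sets borel \<Longrightarrow> measurable \<mu> N = measurable borel N"
  by (rule measurable_cong_sets) auto

lemma bind_kernel_prob:
  assumes "Q \<in> borel \<rightarrow>\<^sub>M prob_algebra borel" "\<mu> \<in> space (prob_algebra borel)"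
  shows "Giry_Monad.bind \<mu> Q \<in> space (prob_algebra borel)"
proof -
  have "(\<lambda>_. Giry_Monad.bind \<mu> Q) \<in> (borel :: real measure) \<rightarrow>\<^sub>M prob_algebra borel"
    by (rule measurable_bind_prob_space[OF _ assms(1)]) (use assms(2) in simp)
  thus ?thesis using measurable_space[of _ "borel :: real measure" _ 0] by simp
qed

lemma measure_bind_kernel:
  assumes Q: "Q \<in> borel \<rightarrow>\<^sub>M prob_algebra borel" and \<mu>: "\<mu> \<in> space (prob_algebra borel)" and A: "A \<in> sets borel"
  shows "measure (Giry_Monad.bind \<mu> Q) A = (\<integral>y. measure (Q y) A \<partial>\<mu>)"
proof -
  interpret prob_space \<mu> using prob_algebra_borelD[OF \<mu>] by simp
  show ?thesis
    using measurable_prob_algebraD[OF Q] prob_algebra_borelD[OF \<mu>] A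
    by (intro measure_bind[where N=borel]) (auto cong: measurable_cong_sets)
qed

lemma measurable_kernel_measure:
  assumes Q[measurable]: "Q \<in> borel \<rightarrow>\<^sub>M prob_algebra borel" and A: "A \<in> sets borel"
  shows "(\<lambda>z. measure (Q z) A) \<in> borel_measurable borel"
  using measurable_compose[OF measurable_prob_algebraD[OF Q] measurable_measure_subprob_algebra[OF A]] .

lemma nn_integral_bind_kernel:
  assumes Q: "Q \<in> borel \<rightarrow>\<^sub>M prob_algebra borel" and \<mu>: "\<mu> \<in> space (prob_algebra borel)" and f: "f \<in> borel_measurable borel"
  shows "(\<integral>\<^sup>+x. f x \<partial>Giry_Monad.bind \<mu> Q) = (\<integral>\<^sup>+y. (\<integral>\<^sup>+x. f x \<partial>Q y) \<partial>\<mu>)"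
  using measurable_prob_algebraD[OF Q] prob_algebra_borelD[OF \<mu>] f
  by (intro nn_integral_bind[where B=borel]) (auto cong: measurable_cong_sets)

lemma integral_bind_kernel:
  fixes f :: "_ \<Rightarrow> real"
  assumes Q: "Q \<in> borel \<rightarrow>\<^sub>M prob_algebra borel" and \<mu>: "\<mu> \<in> space (prob_algebra borel)" and f: "f \<in> borel_measurable borel"
    and B: "\<And>x. \<bar>f x\<bar> \<le> B"
  shows "(\<integral>x. f x \<partial>Giry_Monad.bind \<mu> Q) = (\<integral>y. (\<integral>x. f x \<partial>Q y) \<partial>\<mu>)"
proof -
  interpret prob_space \<mu> using prob_algebra_borelD[OF \<mu>] by simp
  have "emeasure (Q x) (space (Q x)) \<le> ennreal 1" for x
    using prob_space.emeasure_space_1[OF kernel_prob(1)[OF Q, of x]] by simp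
  thus ?thesis
    using measurable_prob_algebraD[OF Q] prob_algebra_borelD[OF \<mu>] f B
    by (intro integral_bind[where K=borel and B=B and B'=1]) (auto simp: finite_measure_axioms cong: measurable_cong_sets)
qed

lemma measure_set_le_1: "prob_space \<mu> \<Longrightarrow> measure \<mu> A \<le> 1"
  by (rule prob_space.prob_le_1)

text \<open>Total variation controls integrals of functions with values in \<open>[0, 1]\<close> without a factor, since such a function
  is within \<open>1 / N\<close> of an average of \<open>N\<close> indicators of its superlevel sets.\<close>
lemma integral_diff_le_of_sets:
  fixes f :: "'s::topological_space \<Rightarrow> real"
  assumes \<mu>: "\<mu> \<in> space (prob_algebra borel)" and \<nu>: "\<nu> \<in> space (prob_algebra borel)"
    and f[measurable]: "f \<in> borel_measurable borel" and f01: "\<And>x. 0 \<le> f x" "\<And>x. f x \<le> 1"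
    and d: "\<And>A. A \<in> sets borel \<Longrightarrow> measure \<mu> A - measure \<nu> A \<le> d"
  shows "(\<integral>x. f x \<partial>\<mu>) - (\<integral>x. f x \<partial>\<nu>) \<le> d"
proof (rule field_le_epsilon)
  fix e :: real assume "0 < e"
  then obtain N :: nat where N: "2 / e < real N" using reals_Archimedean2 by blast
  have N0: "0 < real N" using N \<open>0 < e\<close> by (rule_tac le_less_trans[OF _ N]) simp
  have Ne: "2 / real N < e" using N N0 \<open>0 < e\<close> by (simp add: field_simps)
  interpret M: prob_space \<mu> using prob_algebra_borelD[OF \<mu>] by simp
  interpret N: prob_space \<nu> using prob_algebra_borelD[OF \<nu>] by simp
  note s = prob_algebra_borelD(2)[OF \<mu>] prob_algebra_borelD(2)[OF \<nu>]
  note [measurable_cong] = s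
  define S where "S k = {x. real k / real N \<le> f x}" for k :: nat
  have S[measurable]: "S k \<in> sets borel" for k unfolding S_def by measurable
  define g where "g x = (\<Sum>k=1..N. indicator (S k) x / real N :: real)" for x
  have gf: "\<bar>f x - g x\<bar> \<le> 1 / real N" for x
  proof -
    let ?m = "nat \<lfloor>real N * f x\<rfloor>"
    have fl: "real ?m \<le> real N * f x" "real N * f x < real ?m + 1"
      using f01(1)[of x] N0 by (auto simp: of_nat_nat intro: mult_nonneg_nonneg)
    have mN: "?m \<le> N" 
    proof -
      have "real N * f x \<le> real N * 1" using f01(2)[of x] by (intro mult_left_mono) auto
      thus ?thesis by (simp add: nat_le_iff floor_le_iff)
    qed
    have "(\<Sum>k=1..N. indicator (S k) x :: real) = real (card {k\<in>{1..N}. x \<in> S k})"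
      by (simp add: indicator_def sum.If_cases Int_def)
    also have "{k\<in>{1..N}. x \<in> S k} = {1..?m}"
      using mN N0 fl by (auto simp: S_def field_simps le_nat_floor)
    finally have "g x = real ?m / real N" unfolding g_def by (simp add: sum_divide_distrib[symmetric])
    with fl N0 show ?thesis by (simp add: abs_le_iff field_simps)
  qed
  have gm[measurable]: "g \<in> borel_measurable borel" unfolding g_def by measurable
  have g2: "\<bar>g x\<bar> \<le> 2" for x
  proof -
    have "1 / real N \<le> 1" using N0 by (simp add: field_simps)
    thus ?thesis using gf[of x] f01[of x] unfolding abs_le_iff by linarith
  qed
  have int: "integrable \<mu> f" "integrable \<nu> f" "integrable \<mu> g" "integrable \<nu> g"
    using f01 g2
    by (auto intro!: M.integrable_const_bound[where B=2] N.integrable_const_bound[where B=2] AE_I2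
             intro: order_trans[of _ 1])
  have "(\<integral>x. f x \<partial>\<mu>) - (\<integral>x. g x \<partial>\<mu>) \<le> 1 / real N"
  proof -
    have "(\<integral>x. f x \<partial>\<mu>) \<le> (\<integral>x. g x + 1 / real N \<partial>\<mu>)"
      using int gf by (intro integral_mono) (auto simp: abs_le_iff algebra_simps)
    thus ?thesis using int by (simp add: M.prob_space)
  qed
  moreover have "(\<integral>x. g x \<partial>\<nu>) - (\<integral>x. f x \<partial>\<nu>) \<le> 1 / real N"
  proof -
    have "(\<integral>x. g x \<partial>\<nu>) \<le> (\<integral>x. f x + 1 / real N \<partial>\<nu>)"
      using int gf by (intro integral_mono) (auto simp: abs_le_iff algebra_simps)
    thus ?thesis using int by (simp add: N.prob_space)
  qed
  moreover have "(\<integral>x. g x \<partial>\<mu>) - (\<integral>x. g x \<partial>\<nu>) \<le> d"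
  proof -
    have "(\<integral>x. g x \<partial>\<mu>) = (\<Sum>k=1..N. measure \<mu> (S k) / real N)"
      unfolding g_def by (subst Bochner_Integration.integral_sum) (auto simp: M.integrable_const_bound[where B=1])
    moreover have "(\<integral>x. g x \<partial>\<nu>) = (\<Sum>k=1..N. measure \<nu> (S k) / real N)"
      unfolding g_def by (subst Bochner_Integration.integral_sum) (auto simp: N.integrable_const_bound[where B=1])
    ultimately have "(\<integral>x. g x \<partial>\<mu>) - (\<integral>x. g x \<partial>\<nu>) = (\<Sum>k=1..N. (measure \<mu> (S k) - measure \<nu> (S k)) / real N)"
      by (simp add: sum_subtractf diff_divide_distrib)
    also have "\<dots> \<le> (\<Sum>k=1..N. d / real N)"
      using d[OF S] N0 by (intro sum_mono divide_right_mono) auto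
    also have "\<dots> = d" using N0 by simp
    finally show ?thesis .
  qed
  ultimately show "(\<integral>x. f x \<partial>\<mu>) - (\<integral>x. f x \<partial>\<nu>) \<le> d + e" using Ne by simp
qed

lemma tv_dist_bdd:
  assumes "prob_space \<mu>" "prob_space \<nu>"
  shows "bdd_above ((\<lambda>A. \<bar>measure \<mu> A - measure \<nu> A\<bar>) ` sets \<mu>)"
  using measure_set_le_1[OF assms(1)] measure_set_le_1[OF assms(2)]
  by (intro bdd_aboveI2[where M=1]) (smt (verit) measure_nonneg)

lemma tv_dist_upper:
  assumes "prob_space \<mu>" "prob_space \<nu>" "A \<in> sets \<mu>"
  shows "\<bar>measure \<mu> A - measure \<nu> A\<bar> \<le> tv_dist \<mu> \<nu>"
  unfolding tv_dist_def by (rule cSUP_upper[OF assms(3) tv_dist_bdd[OF assms(1,2)]])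

lemma tv_dist_least:
  assumes "\<And>A. A \<in> sets \<mu> \<Longrightarrow> \<bar>measure \<mu> A - measure \<nu> A\<bar> \<le> d"
  shows "tv_dist \<mu> \<nu> \<le> d"
  unfolding tv_dist_def by (rule cSUP_least) (use assms sets.empty_sets[of \<mu>] in auto)

section \<open>Harris' theorem\<close>

text \<open>The dual form of Harris' argument due to Hairer and Mattingly: the kernel contracts the seminorm of test functions
  whose oscillation between \<open>x\<close> and \<open>y\<close> is measured by the weight \<open>2 + b V x + b V y\<close>.  If \<open>V x + V y\<close> is large,
  the drift shrinks the weight.  If it is small, the overlap shrinks the summand \<open>2\<close>, provided \<open>b\<close> is
  so small that the drift constant \<open>K\<close> cannot undo the gain.\<close>
lemma harris_contraction:
  fixes P :: "'s::topological_space \<Rightarrow> 's measure" and V :: "'s \<Rightarrow> real"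
  assumes P: "P \<in> borel \<rightarrow>\<^sub>M prob_algebra borel"
    and V[measurable]: "V \<in> borel_measurable borel" and V0: "\<And>x. 0 \<le> V x"
    and g: "0 \<le> g" "g < 1" and K: "0 \<le> K"
    and intV: "\<And>x. integrable (P x) V" and drift: "\<And>x. (\<integral>y. V y \<partial>P x) \<le> g * V x + K"
    and overlap: "\<And>r. \<exists>\<alpha>>0. \<forall>x y A. V x \<le> r \<longrightarrow> V y \<le> r \<longrightarrow> A \<in> sets borel \<longrightarrow>
                     measure (P x) A - measure (P y) A \<le> 1 - \<alpha>"
  shows "\<exists>b>0. \<exists>\<theta>>0. \<theta> < 1 \<and> (\<forall>\<phi> B. \<phi> \<in> borel_measurable borel \<longrightarrow> (\<forall>x. \<bar>\<phi> x\<bar> \<le> B) \<longrightarrow>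
     (\<forall>x y. \<phi> x - \<phi> y \<le> 2 + b * V x + b * V y) \<longrightarrow>
     (\<forall>x y. (\<integral>u. \<phi> u \<partial>P x) - (\<integral>u. \<phi> u \<partial>P y) \<le> \<theta> * (2 + b * V x + b * V y)))"
proof -
  define r where "r = 8 * (K + 1) / (1 - g)"
  have r0: "0 < r" unfolding r_def using g K by simp
  obtain \<alpha> where \<alpha>: "\<alpha> > 0" and ov: "\<And>x y A. V x \<le> r \<Longrightarrow> V y \<le> r \<Longrightarrow> A \<in> sets borel \<Longrightarrow>
                     measure (P x) A - measure (P y) A \<le> 1 - \<alpha>"
    using overlap[of r] by blast
  have \<alpha>1: "\<alpha> \<le> 1" if "V x \<le> r" for x
    using ov[OF that that, of "{}"] by simp
  define b where "b = min 1 \<alpha> / (2 * (K + 1))"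
  have b0: "0 < b" unfolding b_def using \<alpha> K by simp
  have bK: "b * K \<le> \<alpha> / 2"
  proof -
    have "b * K \<le> b * (K + 1)" using b0 by simp
    also have "\<dots> = min 1 \<alpha> / 2" unfolding b_def using K by (simp add: field_simps)
    also have "\<dots> \<le> \<alpha> / 2" by simp
    finally show ?thesis .
  qed
  define \<eta> where "\<eta> = (b * r / (2 + b * r)) * (3 / 4 * (1 - g))"
  have \<eta>: "0 < \<eta>" "\<eta> \<le> 1"
  proof -
    show "0 < \<eta>" unfolding \<eta>_def using b0 r0 g by (intro mult_pos_pos divide_pos_pos) (auto intro: add_pos_pos)
    have "b * r / (2 + b * r) \<le> 1" using mult_pos_pos[OF b0 r0] by (subst divide_le_eq_1_pos) auto
    moreover have "3 / 4 * (1 - g) \<le> 1" using g by simp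
    ultimately have "\<eta> \<le> 1 * 1" unfolding \<eta>_def using g mult_pos_pos[OF b0 r0] by (intro mult_mono) auto
    thus "\<eta> \<le> 1" by simp
  qed
  define \<theta> where "\<theta> = max (1 - \<eta>) (max (1 - min 1 \<alpha> / 2) g)"
  have th: "0 < \<theta>" "\<theta> < 1" "1 - \<eta> \<le> \<theta>" "1 - min 1 \<alpha> / 2 \<le> \<theta>" "g \<le> \<theta>"
    unfolding \<theta>_def using g \<eta> \<alpha> by auto
  have "(\<integral>u. \<phi> u \<partial>P x) - (\<integral>u. \<phi> u \<partial>P y) \<le> \<theta> * (2 + b * V x + b * V y)"
    if \<phi>[measurable]: "\<phi> \<in> borel_measurable borel" and B: "\<And>x. \<bar>\<phi> x\<bar> \<le> B"
      and osc: "\<And>x y. \<phi> x - \<phi> y \<le> 2 + b * V x + b * V y" for \<phi> B x y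
  proof -
    note sP[measurable_cong] = kernel_prob(2)[OF P]
    interpret X: prob_space "P x" by (rule kernel_prob(1)[OF P])
    interpret Y: prob_space "P y" by (rule kernel_prob(1)[OF P])
    have mX: "f \<in> borel_measurable (P x)" "f \<in> borel_measurable (P y)" if "f \<in> borel_measurable borel" for f :: "'s \<Rightarrow> real"
      using that by (simp_all add: measurable_cong_borel[OF sP])
    have int\<phi>: "integrable (P x) \<phi>" "integrable (P y) \<phi>"
      using B by (auto intro!: X.integrable_const_bound[where B=B] Y.integrable_const_bound[where B=B] mX)
    \<comment> \<open>A centering constant turns the two-point bound into a one-point bound.\<close>
    define c where "c = (SUP u. \<phi> u - 1 - b * V u)"
    have "\<phi> u - 1 - b * V u \<le> B" for u
      using B[of u] mult_nonneg_nonneg[OF less_imp_le[OF b0] V0[of u]] unfolding abs_le_iff by linarith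
    hence bdd: "bdd_above (range (\<lambda>u. \<phi> u - 1 - b * V u))" by (intro bdd_aboveI2) auto
    have up: "\<phi> u \<le> c + 1 + b * V u" for u
      using cSUP_upper[OF UNIV_I bdd, of u] unfolding c_def by linarith
    have "c \<le> \<phi> u + 1 + b * V u" for u
      unfolding c_def using osc[of _ u] by (intro cSUP_least) (auto simp: algebra_simps)
    hence lo: "c - 1 - b * V u \<le> \<phi> u" for u by (simp add: algebra_simps)
    define S where "S = V x + V y"
    have S0: "0 \<le> S" unfolding S_def using V0[of x] V0[of y] by simp
    have PV: "(\<integral>u. V u \<partial>P x) + (\<integral>u. V u \<partial>P y) \<le> g * S + 2 * K"
      using drift[of x] drift[of y] unfolding S_def by (simp add: algebra_simps)
    show ?thesis
    proof (cases "r \<le> S")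
      case True
      have "(\<integral>u. \<phi> u \<partial>P x) \<le> (\<integral>u. c + 1 + b * V u \<partial>P x)"
        using up intV by (intro integral_mono int\<phi>) auto
      also have "\<dots> = c + 1 + b * (\<integral>u. V u \<partial>P x)" using intV[of x] by (simp add: X.prob_space)
      finally have 1: "(\<integral>u. \<phi> u \<partial>P x) \<le> c + 1 + b * (\<integral>u. V u \<partial>P x)" .
      have "(\<integral>u. c - 1 - b * V u \<partial>P y) \<le> (\<integral>u. \<phi> u \<partial>P y)"
        using lo intV by (intro integral_mono int\<phi>) auto
      hence 2: "c - 1 - b * (\<integral>u. V u \<partial>P y) \<le> (\<integral>u. \<phi> u \<partial>P y)" using intV[of y] by (simp add: Y.prob_space)
      have "(\<integral>u. \<phi> u \<partial>P x) - (\<integral>u. \<phi> u \<partial>P y) \<le> 2 + b * ((\<integral>u. V u \<partial>P x) + (\<integral>u. V u \<partial>P y))"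
        using 1 2 by (simp add: algebra_simps)
      also have "\<dots> \<le> 2 + b * (g * S + 2 * K)" using PV b0 by simp
      also have "\<dots> \<le> 2 + b * (g * S + (1 - g) / 4 * S)"
      proof -
        have "2 * K \<le> 2 * (K + 1)" by simp
        also have "\<dots> = (1 - g) / 4 * r"
        proof -
          have "r * (1 - g) = 8 * (K + 1)" unfolding r_def using g by simp
          thus ?thesis by (simp add: field_simps)
        qed
        also have "\<dots> \<le> (1 - g) / 4 * S" using True g by (intro mult_left_mono) auto
        finally show ?thesis using b0 by simp
      qed
      also have "\<dots> = (2 + b * S) - (b * S) * (3 / 4 * (1 - g))" by (simp add: field_simps)
      also have "\<dots> \<le> (2 + b * S) - \<eta> * (2 + b * S)"
      proof -
        have "b * r \<le> b * S" using True b0 by simp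
        hence "b * r / (2 + b * r) \<le> b * S / (2 + b * S)"
          using mult_pos_pos[OF b0 r0] by (simp add: field_simps)
        hence "b * r / (2 + b * r) * (2 + b * S) \<le> b * S / (2 + b * S) * (2 + b * S)"
          using mult_nonneg_nonneg[of b S] b0 S0 by (intro mult_right_mono) auto
        also have "b * S / (2 + b * S) * (2 + b * S) = b * S"
          using add_pos_nonneg[of 2 "b * S"] mult_nonneg_nonneg[of b S] b0 S0 by simp
        finally have "b * r / (2 + b * r) * (2 + b * S) \<le> b * S" .
        hence "b * r / (2 + b * r) * (2 + b * S) * (3 / 4 * (1 - g)) \<le> b * S * (3 / 4 * (1 - g))"
          using g by (intro mult_right_mono) auto
        thus ?thesis unfolding \<eta>_def by (simp add: mult_ac)
      qed
      also have "\<dots> = (1 - \<eta>) * (2 + b * S)" by (simp add: algebra_simps)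
      also have "\<dots> \<le> \<theta> * (2 + b * S)" using th b0 S0 by (intro mult_right_mono) auto
      finally show ?thesis unfolding S_def by (simp add: algebra_simps)
    next
      case False
      have Vr: "V x \<le> r" "V y \<le> r" using False V0[of x] V0[of y] unfolding S_def by linarith+
      \<comment> \<open>The truncated part sees the overlap; the remainder is dominated by \<open>b V\<close> and sees the drift.\<close>
      define \<psi> where "\<psi> u = max (-1) (min 1 (\<phi> u - c))" for u
      have [measurable]: "\<psi> \<in> borel_measurable borel" unfolding \<psi>_def by measurable
      have \<psi>b: "-1 \<le> \<psi> u" "\<psi> u \<le> 1" for u unfolding \<psi>_def by auto
      have int\<psi>: "integrable (P x) \<psi>" "integrable (P y) \<psi>"
        using \<psi>b by (auto intro!: X.integrable_const_bound[where B=1] Y.integrable_const_bound[where B=1] mX simp: abs_le_iff minus_le_iff)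
      have rest: "\<bar>\<phi> u - c - \<psi> u\<bar> \<le> b * V u" for u
        using up[of u] lo[of u] mult_nonneg_nonneg[OF less_imp_le[OF b0] V0[of u]] unfolding \<psi>_def by (auto simp: max_def min_def abs_le_iff)
      have "(\<integral>u. (\<psi> u + 1) / 2 \<partial>P x) - (\<integral>u. (\<psi> u + 1) / 2 \<partial>P y) \<le> 1 - \<alpha>"
      proof (rule integral_diff_le_of_sets[OF kernel_prob(3)[OF P] kernel_prob(3)[OF P]])
        show "(\<lambda>u. (\<psi> u + 1) / 2) \<in> borel_measurable borel" by measurable
        show "0 \<le> (\<psi> u + 1) / 2" "(\<psi> u + 1) / 2 \<le> 1" for u using \<psi>b[of u] by auto
        show "measure (P x) A - measure (P y) A \<le> 1 - \<alpha>" if "A \<in> sets borel" for A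
          by (rule ov[OF Vr that])
      qed
      hence 1: "(\<integral>u. \<psi> u \<partial>P x) - (\<integral>u. \<psi> u \<partial>P y) \<le> 2 * (1 - \<alpha>)"
        using int\<psi> by (simp add: X.prob_space Y.prob_space diff_divide_distrib[symmetric])
      have 2: "(\<integral>u. \<phi> u - c - \<psi> u \<partial>P x) \<le> (\<integral>u. b * V u \<partial>P x)"
        using rest intV int\<phi> int\<psi> by (intro integral_mono) (auto simp: abs_le_iff)
      have 3: "(\<integral>u. - (b * V u) \<partial>P y) \<le> (\<integral>u. \<phi> u - c - \<psi> u \<partial>P y)"
      proof (intro integral_mono)
        show "- (b * V u) \<le> \<phi> u - c - \<psi> u" for u using rest[of u] by linarith
      qed (use intV int\<phi> int\<psi> in auto)
      have "(\<integral>u. \<phi> u \<partial>P x) - (\<integral>u. \<phi> u \<partial>P y) \<le> 2 * (1 - \<alpha>) + b * ((\<integral>u. V u \<partial>P x) + (\<integral>u. V u \<partial>P y))"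
        using 1 2 3 int\<phi> int\<psi> intV by (simp add: X.prob_space Y.prob_space algebra_simps)
      also have "\<dots> \<le> 2 * (1 - \<alpha>) + b * (g * S + 2 * K)" using PV b0 by simp
      also have "\<dots> = 2 * (1 - \<alpha>) + 2 * (b * K) + g * (b * S)" by (simp add: algebra_simps)
      also have "\<dots> \<le> 2 * (1 - \<alpha> / 2) + g * (b * S)" using bK by simp
      also have "\<dots> \<le> 2 * \<theta> + \<theta> * (b * S)"
        using th \<alpha>1[OF Vr(1)] b0 S0 by (intro add_mono mult_left_mono mult_right_mono) auto
      finally show ?thesis unfolding S_def by (simp add: algebra_simps)
    qed
  qed
  thus ?thesis using b0 th by (intro exI[of _ b] exI[of _ \<theta>] conjI) auto
qed

text \<open>By the contraction, \<open>P\<^sup>n(x, A)\<close> is a Cauchy sequence with a rate that is uniform in \<open>A\<close>.  Uniformity makes the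
  setwise limit countably additive.  The limit does not depend on \<open>x\<close>, and integrating it against
  any other invariant law gives uniqueness, even for laws that do not integrate \<open>V\<close>.  The moment bound
  passes to the limit after truncating \<open>V\<close>.\<close>
theorem harris_invariant_law:
  fixes P :: "'s::topological_space \<Rightarrow> 's measure" and V :: "'s \<Rightarrow> real"
  assumes P: "P \<in> borel \<rightarrow>\<^sub>M prob_algebra borel"
    and V[measurable]: "V \<in> borel_measurable borel" and V0: "\<And>x. 0 \<le> V x"
    and g: "0 \<le> g" "g < 1" and K: "0 \<le> K"
    and intV: "\<And>x. integrable (P x) V" and drift: "\<And>x. (\<integral>y. V y \<partial>P x) \<le> g * V x + K"
    and overlap: "\<And>r. \<exists>\<alpha>>0. \<forall>x y A. V x \<le> r \<longrightarrow> V y \<le> r \<longrightarrow> A \<in> sets borel \<longrightarrow>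
                     measure (P x) A - measure (P y) A \<le> 1 - \<alpha>"
  shows "\<exists>\<pi>. invariant_law P \<pi> \<and> (\<forall>\<pi>'. invariant_law P \<pi>' \<longrightarrow> \<pi>' = \<pi>) \<and>
             (\<integral>\<^sup>+x. ennreal (V x) \<partial>\<pi>) \<le> ennreal (K / (1 - g))"
proof -
  obtain b \<theta> where b: "0 < b" and th: "0 < \<theta>" "\<theta> < 1" and
    step: "\<And>\<phi> B x y. \<phi> \<in> borel_measurable borel \<Longrightarrow> (\<And>x. \<bar>\<phi> x\<bar> \<le> B) \<Longrightarrow>
     (\<And>x y. \<phi> x - \<phi> y \<le> 2 + b * V x + b * V y) \<Longrightarrow>
     (\<integral>u. \<phi> u \<partial>P x) - (\<integral>u. \<phi> u \<partial>P y) \<le> \<theta> * (2 + b * V x + b * V y)"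
    using harris_contraction[OF P V V0 g K intV drift overlap] by (metis (no_types, lifting))
  define L where "L = (\<lambda>x n. law_from P x n)"
  define \<phi> where "\<phi> n A x = measure (L x n) A" for n A x
  have L: "L x n \<in> space (prob_algebra borel)" "prob_space (L x n)" "sets (L x n) = sets borel" for x n
    unfolding L_def using kernel_prob[OF measurable_law_from[OF P]] by blast+
  have Lm: "(\<lambda>x. L x n) \<in> borel \<rightarrow>\<^sub>M prob_algebra borel" for n
    unfolding L_def by (rule measurable_law_from[OF P])
  have phi01: "0 \<le> \<phi> n A x" "\<phi> n A x \<le> 1" for n A x
    unfolding \<phi>_def using measure_set_le_1[OF L(2)] by auto
  have phim: "\<phi> n A \<in> borel_measurable borel" if "A \<in> sets borel" for n A
    unfolding \<phi>_def by (rule measurable_kernel_measure[OF Lm that])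
  define W where "W x y = 2 + b * V x + b * V y" for x y
  have W2: "2 \<le> W x y" for x y unfolding W_def using b V0[of x] V0[of y] by simp
  \<comment> \<open>The test functions \<open>\<phi> n A / \<theta>\<^sup>n\<close> stay in the class that the kernel contracts.\<close>
  have iter: "\<phi> n A x - \<phi> n A y \<le> \<theta> ^ n * W x y" if A: "A \<in> sets borel" for n A x y
  proof (induction n arbitrary: x y)
    case 0
    show ?case using phi01[of 0 A x] phi01[of 0 A y] W2[of x y] by simp
  next
    case (Suc n)
    have front: "\<phi> (Suc n) A x = (\<integral>u. \<phi> n A u \<partial>P x)" for x
      unfolding \<phi>_def L_def law_from_Suc_front[OF P]
      by (rule measure_bind_kernel[OF measurable_law_from[OF P] kernel_prob(3)[OF P] A])
    have "(\<integral>u. \<phi> n A u / \<theta> ^ n \<partial>P x) - (\<integral>u. \<phi> n A u / \<theta> ^ n \<partial>P y) \<le> \<theta> * (2 + b * V x + b * V y)"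
    proof (rule step[where B="1 / \<theta> ^ n"])
      show "(\<lambda>u. \<phi> n A u / \<theta> ^ n) \<in> borel_measurable borel" using phim[OF A, of n] by measurable
      show "\<bar>\<phi> n A x / \<theta> ^ n\<bar> \<le> 1 / \<theta> ^ n" for x using phi01[of n A x] th by (simp add: divide_right_mono)
      show "\<phi> n A x / \<theta> ^ n - \<phi> n A y / \<theta> ^ n \<le> 2 + b * V x + b * V y" for x y
        using Suc[of x y] th by (simp add: diff_divide_distrib[symmetric] divide_le_eq W_def mult.commute)
    qed
    thus ?case unfolding front using th
      by (simp add: diff_divide_distrib[symmetric] divide_le_eq W_def mult_ac)
  qed
  define K' where "K' = K / (1 - g)"
  have K'0: "0 \<le> K'" unfolding K'_def using K g by simp
  have K'eq: "g * K' + K = K'" unfolding K'_def using g by (simp add: field_simps)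
  have nnP: "(\<integral>\<^sup>+y. ennreal (V y) \<partial>P x) \<le> ennreal (g * V x + K)" for x
    using nn_integral_eq_integral[OF intV[of x]] V0 drift[of x] by (auto intro: ennreal_leI)
  have nnL: "(\<integral>\<^sup>+y. ennreal (V y) \<partial>L x n) \<le> ennreal (g ^ n * V x + K')" for x n
  proof (induction n)
    case 0
    have "(\<integral>\<^sup>+y. ennreal (V y) \<partial>return borel x) = ennreal (V x)" by (subst nn_integral_return) auto
    thus ?case using K'0 by (simp add: L_def ennreal_leI)
  next
    case (Suc n)
    have "(\<integral>\<^sup>+y. ennreal (V y) \<partial>L x (Suc n)) = (\<integral>\<^sup>+y. (\<integral>\<^sup>+u. ennreal (V u) \<partial>P y) \<partial>L x n)"
      unfolding L_def law_from_Suc by (rule nn_integral_bind_kernel[OF P]) (use L(1) in \<open>auto simp: L_def\<close>)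
    also have "\<dots> \<le> (\<integral>\<^sup>+y. ennreal g * ennreal (V y) + ennreal K \<partial>L x n)"
    proof (intro nn_integral_mono)
      fix y
      have "ennreal (g * V y + K) = ennreal g * ennreal (V y) + ennreal K"
        using V0[of y] g K by (simp add: ennreal_mult)
      thus "(\<integral>\<^sup>+u. ennreal (V u) \<partial>P y) \<le> ennreal g * ennreal (V y) + ennreal K"
        using nnP[of y] by simp
    qed
    also have "\<dots> = ennreal g * (\<integral>\<^sup>+y. ennreal (V y) \<partial>L x n) + ennreal K"
      using measurable_cong_borel[OF L(3)[of x n], of "borel::ennreal measure"] prob_space.emeasure_space_1[OF L(2)]
      by (subst nn_integral_add) (auto simp: nn_integral_cmult)
    also have "\<dots> \<le> ennreal g * ennreal (g ^ n * V x + K') + ennreal K"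
      by (intro add_mono mult_left_mono Suc) auto
    also have "\<dots> = ennreal (g * (g ^ n * V x + K') + K)"
      using g K K'0 V0 by (simp add: ennreal_mult[symmetric] ennreal_plus[symmetric] del: ennreal_plus)
    also have "g * (g ^ n * V x + K') + K = g ^ Suc n * V x + K'" using K'eq by (simp add: algebra_simps)
    finally show ?case .
  qed
  have intL: "integrable (L x n) V" for x n
  proof (rule integrableI_nonneg)
    show "V \<in> borel_measurable (L x n)" by (simp only: measurable_cong_borel[OF L(3)] V)
    show "(\<integral>\<^sup>+y. ennreal (V y) \<partial>L x n) < \<infinity>" by (rule le_less_trans[OF nnL]) simp
  qed (simp add: V0)
  have VL0: "(\<integral>y. V y \<partial>L x n) \<le> g ^ n * V x + K'" for x n
  proof -
    have "ennreal (\<integral>y. V y \<partial>L x n) \<le> ennreal (g ^ n * V x + K')"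
      using nnL[of x n] nn_integral_eq_integral[OF intL[of x n]] V0 by simp
    moreover have "0 \<le> g ^ n * V x + K'" using g V0 K'0 by simp
    ultimately show ?thesis by (subst (asm) ennreal_le_iff)
  qed
  have VL: "(\<integral>y. V y \<partial>L x n) \<le> V x + K'" for x n
  proof -
    note VL0[of x n]
    moreover have "g ^ n * V x \<le> 1 * V x" using g V0 by (intro mult_right_mono power_le_one) auto
    ultimately show ?thesis by simp
  qed
  fix x0 :: 's
  show ?thesis
  proof -
  define D where "D = W x0 x0 + b * K'"
  have D0: "0 \<le> D" unfolding D_def using W2[of x0 x0] b K'0 by simp
  have cauchy: "\<bar>\<phi> (m + n) A x0 - \<phi> n A x0\<bar> \<le> \<theta> ^ n * D" if A: "A \<in> sets borel" for m n A
  proof -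
    interpret M: prob_space "L x0 m" by (rule L(2))
    have mb: "f \<in> borel_measurable (L x0 m)" if "f \<in> borel_measurable borel" for f :: "'s \<Rightarrow> real"
      using that by (simp add: measurable_cong_borel[OF L(3)])
    have eq: "\<phi> (m + n) A x0 = (\<integral>y. \<phi> n A y \<partial>L x0 m)"
      unfolding \<phi>_def L_def law_from_add[OF P]
      by (rule measure_bind_kernel[OF measurable_law_from[OF P] _ A]) (use L(1) in \<open>auto simp: L_def\<close>)
    have i1: "integrable (L x0 m) (\<phi> n A)"
      using phi01 by (intro M.integrable_const_bound[where B=1] mb phim A) auto
    have "(\<integral>y. \<phi> n A y - \<phi> n A x0 \<partial>L x0 m) \<le> (\<integral>y. \<theta> ^ n * W y x0 \<partial>L x0 m)"
      using iter[OF A] i1 intL by (intro integral_mono) (auto simp: W_def)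
    moreover have "(\<integral>y. - (\<theta> ^ n * W y x0) \<partial>L x0 m) \<le> (\<integral>y. \<phi> n A y - \<phi> n A x0 \<partial>L x0 m)"
    proof (intro integral_mono)
      show "- (\<theta> ^ n * W y x0) \<le> \<phi> n A y - \<phi> n A x0" for y
        using iter[OF A, of n x0 y] by (simp add: W_def algebra_simps)
    qed (use i1 intL in \<open>auto simp: W_def\<close>)
    moreover have "(\<integral>y. \<theta> ^ n * W y x0 \<partial>L x0 m) \<le> \<theta> ^ n * D"
    proof -
      have "(\<integral>y. \<theta> ^ n * W y x0 \<partial>L x0 m) = \<theta> ^ n * (2 + b * (\<integral>y. V y \<partial>L x0 m) + b * V x0)"
        using intL[of x0 m] by (simp add: W_def M.prob_space)
      also have "\<dots> \<le> \<theta> ^ n * (2 + b * (V x0 + K') + b * V x0)"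
        using VL[of x0 m] b th by (intro mult_left_mono add_mono) auto
      finally show ?thesis unfolding D_def W_def by (simp add: algebra_simps)
    qed
    moreover have "(\<integral>y. \<phi> n A y - \<phi> n A x0 \<partial>L x0 m) = \<phi> (m + n) A x0 - \<phi> n A x0"
      unfolding eq using i1 by (simp add: M.prob_space)
    ultimately show ?thesis by (simp add: abs_le_iff)
  qed
  define p where "p A = lim (\<lambda>n. \<phi> n A x0)" for A
  have thlim: "(\<lambda>n. \<theta> ^ n * D) \<longlonglongrightarrow> 0"
    using tendsto_mult_left_zero[OF LIMSEQ_realpow_zero[of \<theta>]] th by auto
  have conv: "(\<lambda>n. \<phi> n A x0) \<longlonglongrightarrow> p A" if A: "A \<in> sets borel" for A
  proof -
    have "Cauchy (\<lambda>n. \<phi> n A x0)"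
    proof (rule metric_CauchyI)
      fix e :: real assume "0 < e"
      then obtain N where N: "\<And>n. n \<ge> N \<Longrightarrow> norm (\<theta> ^ n * D - 0) < e / 2"
        using LIMSEQ_D[OF thlim, of "e / 2"] by auto
      have "dist (\<phi> m A x0) (\<phi> N A x0) < e / 2" if "m \<ge> N" for m
        using cauchy[OF A, of "m - N" N] that N[of N] by (simp add: dist_real_def)
      hence "dist (\<phi> m A x0) (\<phi> n A x0) < e" if "m \<ge> N" "n \<ge> N" for m n
        using dist_triangle_half_l that by blast
      thus "\<exists>M. \<forall>m\<ge>M. \<forall>n\<ge>M. dist (\<phi> m A x0) (\<phi> n A x0) < e" by blast
    qed
    thus ?thesis unfolding p_def using Cauchy_convergent_iff convergent_LIMSEQ_iff by blast
  qed
  have p_near: "\<bar>p A - \<phi> n A x0\<bar> \<le> \<theta> ^ n * D" if A: "A \<in> sets borel" for A n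
  proof (rule LIMSEQ_le_const2)
    show "(\<lambda>m. \<bar>\<phi> (m + n) A x0 - \<phi> n A x0\<bar>) \<longlonglongrightarrow> \<bar>p A - \<phi> n A x0\<bar>"
      by (intro tendsto_intros LIMSEQ_ignore_initial_segment conv A)
  qed (use cauchy[OF A] in blast)
  have p0: "0 \<le> p A" if "A \<in> sets borel" for A
    using conv[OF that] phi01 by (intro LIMSEQ_le_const[OF conv[OF that]]) auto
  define \<pi> where "\<pi> = measure_of UNIV (sets (borel :: 's measure)) (\<lambda>A. ennreal (p A))"
  have sets\<pi>: "sets \<pi> = sets borel" unfolding \<pi>_def using sets.sigma_sets_eq[of "borel :: 's measure"] by simp
  have em: "emeasure \<pi> A = ennreal (p A)" if A: "A \<in> sets borel" for A
  proof -
    interpret B: sigma_algebra UNIV "sets (borel :: 's measure)"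
      using sets.sigma_algebra_axioms[of "borel :: 's measure"] by simp
    have pos: "positive (sets borel) (\<lambda>A. ennreal (p A))"
      unfolding positive_def p_def \<phi>_def by simp
    have add: "additive (sets borel) (\<lambda>A. ennreal (p A))"
    unfolding Measure_Space.additive_def
    proof (intro ballI impI)
      fix A B :: "'s set" assume AB: "A \<in> sets borel" "B \<in> sets borel" "A \<inter> B = {}"
      have "\<phi> n (A \<union> B) x0 = \<phi> n A x0 + \<phi> n B x0" for n
        unfolding \<phi>_def using AB L(2,3)
        by (intro finite_measure.finite_measure_Union) (auto simp: prob_space_def)
      hence "(\<lambda>n. \<phi> n (A \<union> B) x0) \<longlonglongrightarrow> p A + p B"
        using tendsto_add[OF conv[OF AB(1)] conv[OF AB(2)]] by simp
      hence "p (A \<union> B) = p A + p B" using conv[of "A \<union> B"] AB LIMSEQ_unique by blast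
      thus "ennreal (p (A \<union> B)) = ennreal (p A) + ennreal (p B)" using p0 AB by simp
    qed
    have "countably_additive (sets borel) (\<lambda>A. ennreal (p A))"
    proof (rule B.empty_continuous_imp_countably_additive[OF pos add])
      fix A :: "nat \<Rightarrow> 's set" assume A: "range A \<subseteq> sets borel" "decseq A" "(\<Inter>i. A i) = {}"
      have "(\<lambda>i. p (A i)) \<longlonglongrightarrow> 0"
      proof (rule LIMSEQ_I)
        fix e :: real assume e: "0 < e"
        then obtain n where n: "\<theta> ^ n * D < e / 2"
          using LIMSEQ_D[OF thlim, of "e / 2"] D0 th by (auto simp: abs_of_nonneg)
        interpret M: prob_space "L x0 n" by (rule L(2))
        have "(\<lambda>i. measure (L x0 n) (A i)) \<longlonglongrightarrow> measure (L x0 n) (\<Inter>i. A i)"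
          using A L(3)[of x0 n] by (intro M.finite_Lim_measure_decseq) auto
        hence "(\<lambda>i. \<phi> n (A i) x0) \<longlonglongrightarrow> 0" using A(3) by (simp add: \<phi>_def)
        then obtain N where N: "\<And>i. i \<ge> N \<Longrightarrow> \<bar>\<phi> n (A i) x0\<bar> < e / 2"
          using LIMSEQ_D[of _ _ "e / 2"] e by (metis diff_zero half_gt_zero real_norm_def)
        have "norm (p (A i) - 0) < e" if "i \<ge> N" for i
        proof -
          have "A i \<in> sets borel" using A(1) by auto
          from p_near[OF this, of n] N[OF that] n show ?thesis by simp
        qed
        thus "\<exists>N. \<forall>i\<ge>N. norm (p (A i) - 0) < e" by blast
      qed
      thus "(\<lambda>i. ennreal (p (A i))) \<longlonglongrightarrow> 0" using tendsto_ennrealI by fastforce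
    qed auto
    from emeasure_measure_of_sigma[OF B.sigma_algebra_axioms pos this A] show ?thesis unfolding \<pi>_def .
  qed
  have me: "measure \<pi> A = p A" if "A \<in> sets borel" for A
    using em[OF that] p0[OF that] by (simp add: measure_def)
  have space\<pi>: "space \<pi> = UNIV" using sets_eq_imp_space_eq[OF sets\<pi>] by simp
  have prob\<pi>: "prob_space \<pi>"
  proof
    have "\<phi> n UNIV x0 = 1" for n
      using prob_space.prob_space[OF L(2)[of x0 n]] sets_eq_imp_space_eq[OF L(3)[of x0 n]] by (simp add: \<phi>_def)
    hence "p UNIV = 1" using conv[of UNIV] LIMSEQ_unique[OF _ tendsto_const] by (simp add: LIMSEQ_const_iff)
    thus "emeasure \<pi> (space \<pi>) = 1" using em[of UNIV] by (simp add: space\<pi>)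
  qed
  have pa\<pi>: "\<pi> \<in> space (prob_algebra borel)" using prob\<pi> sets\<pi> by (simp add: space_prob_algebra)
  have limint: "(\<lambda>n. \<integral>x. f x \<partial>L x0 n) \<longlonglongrightarrow> (\<integral>x. f x \<partial>\<pi>)"
    if f: "f \<in> borel_measurable borel" and f01: "\<And>x. 0 \<le> f x" "\<And>x. f x \<le> 1" for f :: "'s \<Rightarrow> real"
  proof (rule LIM_zero_cancel, rule Lim_null_comparison[OF _ thlim])
    have "norm ((\<integral>x. f x \<partial>L x0 n) - (\<integral>x. f x \<partial>\<pi>)) \<le> \<theta> ^ n * D" for n
    proof -
      have *: "measure (L x0 n) A - measure \<pi> A \<le> \<theta> ^ n * D \<and> measure \<pi> A - measure (L x0 n) A \<le> \<theta> ^ n * D"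
        if "A \<in> sets borel" for A
        using p_near[OF that, of n] me[OF that] by (simp add: \<phi>_def abs_le_iff)
      show ?thesis
        using integral_diff_le_of_sets[OF L(1)[of x0 n] pa\<pi> f f01, of "\<theta> ^ n * D"]
          integral_diff_le_of_sets[OF pa\<pi> L(1)[of x0 n] f f01, of "\<theta> ^ n * D"] * by (simp add: abs_le_iff)
    qed
    thus "\<forall>\<^sub>F n in sequentially. norm ((\<integral>x. f x \<partial>L x0 n) - (\<integral>x. f x \<partial>\<pi>)) \<le> \<theta> ^ n * D" by simp
  qed
  have inv: "invariant_law P \<pi>"
  proof -
    have "Giry_Monad.bind \<pi> P = \<pi>"
    proof (rule measure_eqI)
      have bp: "Giry_Monad.bind \<pi> P \<in> space (prob_algebra borel)" by (rule bind_kernel_prob[OF P pa\<pi>])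
      thus "sets (Giry_Monad.bind \<pi> P) = sets \<pi>" using prob_algebra_borelD(2)[OF bp] sets\<pi> by simp
      fix A assume "A \<in> sets (Giry_Monad.bind \<pi> P)"
      hence A: "A \<in> sets borel" using prob_algebra_borelD(2)[OF bp] by simp
      have "(\<lambda>n. \<integral>x. measure (P x) A \<partial>L x0 n) \<longlonglongrightarrow> (\<integral>x. measure (P x) A \<partial>\<pi>)"
        by (rule limint[OF measurable_kernel_measure[OF P A]]) (auto simp: measure_set_le_1[OF kernel_prob(1)[OF P]])
      moreover have "(\<integral>x. measure (P x) A \<partial>L x0 n) = \<phi> (Suc n) A x0" for n
        unfolding \<phi>_def L_def law_from_Suc by (rule measure_bind_kernel[OF P _ A, symmetric]) (use L(1) in \<open>auto simp: L_def\<close>)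
      ultimately have "(\<integral>x. measure (P x) A \<partial>\<pi>) = p A"
        using LIMSEQ_Suc[OF conv[OF A]] LIMSEQ_unique by simp
      hence "measure (Giry_Monad.bind \<pi> P) A = measure \<pi> A"
        using measure_bind_kernel[OF P pa\<pi> A] me[OF A] by simp
      thus "emeasure (Giry_Monad.bind \<pi> P) A = emeasure \<pi> A"
        using prob_algebra_borelD(1)[OF bp] prob\<pi> by (simp add: finite_measure.emeasure_eq_measure prob_space_def)
    qed
    thus ?thesis unfolding invariant_law_def using prob\<pi> sets\<pi> by simp
  qed
  have uniq: "\<pi>' = \<pi>" if "invariant_law P \<pi>'" for \<pi>'
  proof -
    have p': "prob_space \<pi>'" "sets \<pi>' = sets borel" "Giry_Monad.bind \<pi>' P = \<pi>'"
      using that by (auto simp: invariant_law_def)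
    hence pa': "\<pi>' \<in> space (prob_algebra borel)" by (simp add: space_prob_algebra)
    interpret M: prob_space \<pi>' by fact
    show ?thesis
    proof (rule measure_eqI)
      show "sets \<pi>' = sets \<pi>" using p' sets\<pi> by simp
      fix A assume "A \<in> sets \<pi>'"
      hence A: "A \<in> sets borel" using p' by simp
      have "measure \<pi>' A = (\<integral>y. \<phi> n A y \<partial>\<pi>')" for n
      proof -
        have "Giry_Monad.bind \<pi>' (\<lambda>y. L y n) = \<pi>'"
        proof (induction n)
          case 0
          show ?case by (simp add: L_def bind_return'' p')
        next
          case (Suc n)
          have "Giry_Monad.bind \<pi>' (\<lambda>y. L y (Suc n)) = Giry_Monad.bind (Giry_Monad.bind \<pi>' (\<lambda>y. L y n)) P"
            unfolding L_def law_from_Suc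
            using measurable_prob_algebraD[OF Lm[of n]] measurable_prob_algebraD[OF P] p'(2)
            by (intro bind_assoc[where N=borel and R=borel, symmetric]) (auto simp: L_def cong: measurable_cong_sets)
          thus ?case by (simp add: Suc p')
        qed
        thus ?thesis using measure_bind_kernel[OF Lm[of n] pa' A] by (simp add: \<phi>_def)
      qed
      moreover have "(\<lambda>n. \<integral>y. \<phi> n A y \<partial>\<pi>') \<longlonglongrightarrow> (\<integral>y. p A \<partial>\<pi>')"
      proof (rule integral_dominated_convergence[where w="\<lambda>_. 1"])
        have "(\<lambda>n. \<phi> n A y) \<longlonglongrightarrow> p A" for y
        proof -
          have "(\<lambda>n. \<phi> n A y - \<phi> n A x0) \<longlonglongrightarrow> 0"
          proof (rule Lim_null_comparison)
            show "\<forall>\<^sub>F n in sequentially. norm (\<phi> n A y - \<phi> n A x0) \<le> \<theta> ^ n * W y x0"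
              using iter[OF A, of _ y x0] iter[OF A, of _ x0 y] by (simp add: abs_le_iff W_def algebra_simps)
            show "(\<lambda>n. \<theta> ^ n * W y x0) \<longlonglongrightarrow> 0"
              using tendsto_mult_left_zero[OF LIMSEQ_realpow_zero[of \<theta>]] th by auto
          qed
          from tendsto_add[OF this conv[OF A]] show ?thesis by simp
        qed
        thus "AE y in \<pi>'. (\<lambda>n. \<phi> n A y) \<longlonglongrightarrow> p A" by simp
        show "\<phi> n A \<in> borel_measurable \<pi>'" for n by (simp only: measurable_cong_borel[OF p'(2)] phim[OF A])
      qed (use phi01 in auto)
      ultimately have "(\<lambda>n. measure \<pi>' A) \<longlonglongrightarrow> p A" by (simp add: M.prob_space)
      hence "measure \<pi>' A = p A" by (simp add: LIMSEQ_const_iff)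
      thus "emeasure \<pi>' A = emeasure \<pi> A" using em[OF A] by (simp add: M.emeasure_eq_measure)
    qed
  qed
  have "(\<integral>\<^sup>+x. ennreal (V x) \<partial>\<pi>) \<le> ennreal K'"
  proof -
    interpret M: prob_space \<pi> by (rule prob\<pi>)
    note sets\<pi>[measurable_cong]
    have fin: "(\<integral>\<^sup>+x. ennreal (min (V x) (real N)) \<partial>\<pi>) \<le> ennreal K'" for N :: nat
    proof (cases "N = 0")
      case True
      thus ?thesis using V0 by (simp add: min_absorb2)
    next
      case False
      let ?f = "\<lambda>x. min (V x) (real N) / real N"
      have f: "?f \<in> borel_measurable borel" by measurable
      have f01: "0 \<le> ?f x" "?f x \<le> 1" for x using V0[of x] False by (auto simp: min_def)
      have "(\<integral>x. ?f x \<partial>\<pi>) \<le> K' / real N"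
      proof (rule LIMSEQ_le[OF limint[OF f f01]])
        have "(\<lambda>n. g ^ n * V x0) \<longlonglongrightarrow> 0"
          using tendsto_mult_left_zero[OF LIMSEQ_realpow_zero[OF g]] by auto
        from tendsto_divide[OF tendsto_add[OF this tendsto_const[of K']] tendsto_const[of "real N"]]
        show "(\<lambda>n. (g ^ n * V x0 + K') / real N) \<longlonglongrightarrow> K' / real N" using False by simp
        have "(\<integral>x. ?f x \<partial>L x0 n) \<le> (g ^ n * V x0 + K') / real N" for n
        proof -
          interpret Ln: prob_space "L x0 n" by (rule L(2))
          have "(\<integral>x. ?f x \<partial>L x0 n) \<le> (\<integral>x. V x / real N \<partial>L x0 n)"
          proof (rule integral_mono)
            have "?f \<in> borel_measurable (L x0 n)" by (simp only: measurable_cong_borel[OF L(3)] f)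
            thus "integrable (L x0 n) ?f"
              by (intro Ln.integrable_const_bound[where B=1] AE_I2) (simp_all only: real_norm_def abs_of_nonneg[OF f01(1)] f01(2))
            show "integrable (L x0 n) (\<lambda>x. V x / real N)" using intL[of x0 n] by simp
            show "?f x \<le> V x / real N" for x by (simp add: divide_right_mono)
          qed
          also have "\<dots> = (\<integral>x. V x \<partial>L x0 n) / real N" by simp
          also have "\<dots> \<le> (g ^ n * V x0 + K') / real N"
            using VL0[of x0 n] by (intro divide_right_mono) auto
          finally show ?thesis .
        qed
        thus "\<exists>n0. \<forall>n\<ge>n0. (\<integral>x. ?f x \<partial>L x0 n) \<le> (g ^ n * V x0 + K') / real N" by simp
      qed
      hence "(\<integral>x. min (V x) (real N) \<partial>\<pi>) \<le> K'" using False by (simp add: divide_le_cancel)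
      moreover have "integrable \<pi> (\<lambda>x. min (V x) (real N))"
        using V0 measurable_cong_borel[OF sets\<pi>, of "borel::real measure"]
        by (intro M.integrable_const_bound[where B="real N"]) (auto simp: min_def)
      ultimately show ?thesis
        using V0 by (subst nn_integral_eq_integral) (auto intro: ennreal_leI)
    qed
    have "(\<integral>\<^sup>+x. ennreal (V x) \<partial>\<pi>) = (\<integral>\<^sup>+x. (SUP N::nat. ennreal (min (V x) (real N))) \<partial>\<pi>)"
    proof (intro nn_integral_cong)
      fix x
      obtain N0 :: nat where "V x \<le> real N0" using real_arch_simple by blast
      hence "ennreal (V x) \<le> (SUP N::nat. ennreal (min (V x) (real N)))" by (intro SUP_upper2[of N0]) auto
      moreover have "(SUP N::nat. ennreal (min (V x) (real N))) \<le> ennreal (V x)" by (intro SUP_least ennreal_leI) auto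
      ultimately show "ennreal (V x) = (SUP N::nat. ennreal (min (V x) (real N)))" by (rule antisym)
    qed
    also have "\<dots> = (SUP N::nat. \<integral>\<^sup>+x. ennreal (min (V x) (real N)) \<partial>\<pi>)"
      by (intro nn_integral_monotone_convergence_SUP) (auto simp: incseq_def le_fun_def intro!: ennreal_leI)
    also have "\<dots> \<le> ennreal K'" by (rule SUP_least) (rule fin)
    finally show ?thesis .
  qed
  with inv uniq show ?thesis unfolding K'_def by (intro exI[of _ \<pi>] conjI allI impI)
  qed
qed

text \<open>One step of the chain moves only half of the coordinates at random, so overlap can be expected
  only after two steps; the invariant law of the two-step kernel is then invariant for the kernel itself,
  because its image under one step is again invariant for two steps.\<close>
theorem harris_invariant_law_two_step:
  fixes Q :: "'s::topological_space \<Rightarrow> 's measure" and V :: "'s \<Rightarrow> real"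
  assumes Q: "Q \<in> borel \<rightarrow>\<^sub>M prob_algebra borel"
    and V[measurable]: "V \<in> borel_measurable borel" and V0: "\<And>x. 0 \<le> V x"
    and g: "0 \<le> g" "g < 1" and K: "0 \<le> K"
    and drift: "\<And>x. (\<integral>\<^sup>+y. ennreal (V y) \<partial>Q x) \<le> ennreal (g * V x + K)"
    and overlap: "\<And>r. \<exists>\<alpha>>0. \<forall>x y A. V x \<le> r \<longrightarrow> V y \<le> r \<longrightarrow> A \<in> sets borel \<longrightarrow>
                     measure (law_from Q x 2) A - measure (law_from Q y 2) A \<le> 1 - \<alpha>"
  shows "\<exists>\<pi>. invariant_law Q \<pi> \<and> (\<forall>\<pi>'. invariant_law Q \<pi>' \<longrightarrow> \<pi>' = \<pi>) \<and>
             (\<integral>\<^sup>+x. ennreal (V x) \<partial>\<pi>) \<le> ennreal (K / (1 - g))"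
proof -
  define P where "P = (\<lambda>x. law_from Q x 2)"
  have P: "P \<in> borel \<rightarrow>\<^sub>M prob_algebra borel" unfolding P_def by (rule measurable_law_from[OF Q])
  have Peq: "P x = Giry_Monad.bind (Q x) Q" for x
    unfolding P_def numeral_2_eq_2 law_from_Suc[of Q x "Suc 0"] law_from_1[OF Q] ..
  have gK: "0 \<le> g * V x + K" for x using g K V0[of x] by simp
  have nnP: "(\<integral>\<^sup>+y. ennreal (V y) \<partial>P x) \<le> ennreal (g\<^sup>2 * V x + (g * K + K))" for x
  proof -
    have "(\<integral>\<^sup>+y. ennreal (V y) \<partial>P x) = (\<integral>\<^sup>+y. (\<integral>\<^sup>+u. ennreal (V u) \<partial>Q y) \<partial>Q x)"
      unfolding Peq by (rule nn_integral_bind_kernel[OF Q kernel_prob(3)[OF Q]]) simp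
    also have "\<dots> \<le> (\<integral>\<^sup>+y. ennreal g * ennreal (V y) + ennreal K \<partial>Q x)"
    proof (rule nn_integral_mono)
      fix y
      have "ennreal (g * V y + K) = ennreal g * ennreal (V y) + ennreal K"
        using V0[of y] g K by (simp add: ennreal_mult)
      thus "(\<integral>\<^sup>+u. ennreal (V u) \<partial>Q y) \<le> ennreal g * ennreal (V y) + ennreal K"
        using drift[of y] by simp
    qed
    also have "\<dots> = ennreal g * (\<integral>\<^sup>+y. ennreal (V y) \<partial>Q x) + ennreal K"
      using measurable_cong_borel[OF kernel_prob(2)[OF Q, of x], of "borel::ennreal measure"]
        prob_space.emeasure_space_1[OF kernel_prob(1)[OF Q]]
      by (subst nn_integral_add) (auto simp: nn_integral_cmult)
    also have "\<dots> \<le> ennreal g * ennreal (g * V x + K) + ennreal K"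
      by (intro add_mono mult_left_mono drift) auto
    also have "\<dots> = ennreal (g * (g * V x + K) + K)"
      using g K gK[of x] by (simp add: ennreal_mult[symmetric] ennreal_plus[symmetric] del: ennreal_plus)
    finally show ?thesis by (simp add: algebra_simps power2_eq_square)
  qed
  have intP: "integrable (P x) V" for x
  proof (rule integrableI_nonneg)
    show "V \<in> borel_measurable (P x)" by (simp only: measurable_cong_borel[OF kernel_prob(2)[OF P]] V)
    show "(\<integral>\<^sup>+y. ennreal (V y) \<partial>P x) < \<infinity>" by (rule le_less_trans[OF nnP]) simp
  qed (simp add: V0)
  have driftP: "(\<integral>y. V y \<partial>P x) \<le> g\<^sup>2 * V x + (g * K + K)" for x
  proof -
    have "ennreal (\<integral>y. V y \<partial>P x) \<le> ennreal (g\<^sup>2 * V x + (g * K + K))"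
      using nnP[of x] nn_integral_eq_integral[OF intP[of x]] V0 by simp
    moreover have "0 \<le> g\<^sup>2 * V x + (g * K + K)" using g K V0[of x] by simp
    ultimately show ?thesis by (subst (asm) ennreal_le_iff)
  qed
  have g2: "0 \<le> g\<^sup>2" "g\<^sup>2 < 1" using g by (auto simp: power_less_one_iff abs_square_less_1)
  have "\<exists>\<pi>. invariant_law P \<pi> \<and> (\<forall>\<pi>'. invariant_law P \<pi>' \<longrightarrow> \<pi>' = \<pi>) \<and>
             (\<integral>\<^sup>+x. ennreal (V x) \<partial>\<pi>) \<le> ennreal ((g * K + K) / (1 - g\<^sup>2))"
  proof (rule harris_invariant_law[OF P V V0 g2 _ intP driftP])
    show "0 \<le> g * K + K" using g K by simp
    show "\<exists>\<alpha>>0. \<forall>x y A. V x \<le> r \<longrightarrow> V y \<le> r \<longrightarrow> A \<in> sets borel \<longrightarrow>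
                     measure (P x) A - measure (P y) A \<le> 1 - \<alpha>" for r
      unfolding P_def by (rule overlap)
  qed
  then obtain \<pi> where inv: "invariant_law P \<pi>" and uniq: "\<And>\<pi>'. invariant_law P \<pi>' \<Longrightarrow> \<pi>' = \<pi>"
    and mom: "(\<integral>\<^sup>+x. ennreal (V x) \<partial>\<pi>) \<le> ennreal ((g * K + K) / (1 - g\<^sup>2))" by blast
  have bindP: "Giry_Monad.bind \<mu> P = Giry_Monad.bind (Giry_Monad.bind \<mu> Q) Q" if "sets \<mu> = sets borel" for \<mu>
  proof -
    have "P = (\<lambda>x. Giry_Monad.bind (Q x) Q)" by (rule ext) (rule Peq)
    thus ?thesis using measurable_prob_algebraD[OF Q] that
      by (simp only:) (rule bind_assoc[where N=borel and R=borel, symmetric], auto cong: measurable_cong_sets)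
  qed
  have \<pi>: "\<pi> \<in> space (prob_algebra borel)" "Giry_Monad.bind \<pi> P = \<pi>"
    using inv by (auto simp: invariant_law_def space_prob_algebra)
  define \<pi>1 where "\<pi>1 = Giry_Monad.bind \<pi> Q"
  have \<pi>1: "\<pi>1 \<in> space (prob_algebra borel)" unfolding \<pi>1_def by (rule bind_kernel_prob[OF Q \<pi>(1)])
  have "Giry_Monad.bind \<pi>1 P = Giry_Monad.bind (Giry_Monad.bind \<pi>1 Q) Q"
    by (rule bindP[OF prob_algebra_borelD(2)[OF \<pi>1]])
  also have "Giry_Monad.bind \<pi>1 Q = \<pi>"
    unfolding \<pi>1_def using bindP[OF prob_algebra_borelD(2)[OF \<pi>(1)]] \<pi>(2) by simp
  finally have "invariant_law P \<pi>1"
    using prob_algebra_borelD[OF \<pi>1] by (simp add: invariant_law_def \<pi>1_def)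
  hence "\<pi>1 = \<pi>" by (rule uniq)
  hence invQ: "invariant_law Q \<pi>"
    using prob_algebra_borelD[OF \<pi>(1)] by (simp add: invariant_law_def \<pi>1_def)
  have uniqQ: "\<pi>' = \<pi>" if "invariant_law Q \<pi>'" for \<pi>'
  proof (rule uniq)
    show "invariant_law P \<pi>'" using that by (simp add: invariant_law_def bindP)
  qed
  have "(g * K + K) / (1 - g\<^sup>2) = K / (1 - g)"
  proof -
    have "1 - g\<^sup>2 = (1 + g) * (1 - g)" by (simp add: power2_eq_square algebra_simps)
    moreover have "g * K + K = (1 + g) * K" by (simp add: algebra_simps)
    ultimately show ?thesis using g by simp
  qed
  with mom have "(\<integral>\<^sup>+x. ennreal (V x) \<partial>\<pi>) \<le> ennreal (K / (1 - g))" by simp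
  with invQ uniqQ show ?thesis by (intro exI[of _ \<pi>] conjI allI impI)
qed

section \<open>The heavy-ball form of a BAOAB step\<close>

definition lyap :: "real \<Rightarrow> real \<Rightarrow> 'a::real_inner \<Rightarrow> 'a \<Rightarrow> real" where
  "lyap k \<tau> a b = (norm a)\<^sup>2 - 2 * k * inner a b + \<tau> * (norm b)\<^sup>2"

lemma quadratic_form_nonneg:
  fixes a b :: "'a::real_inner"
  assumes B: "0 < B" and AB: "m\<^sup>2 \<le> A * B"
  shows "0 \<le> A * (norm a)\<^sup>2 - 2 * m * inner a b + B * (norm b)\<^sup>2"
proof -
  have "0 \<le> (norm (B *\<^sub>R b - m *\<^sub>R a))\<^sup>2 + (A * B - m\<^sup>2) * (norm a)\<^sup>2"
    using AB by (intro add_nonneg_nonneg mult_nonneg_nonneg) auto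
  also have "\<dots> = B * (A * (norm a)\<^sup>2 - 2 * m * inner a b + B * (norm b)\<^sup>2)"
    unfolding power2_norm_eq_inner by (simp add: inner_diff inner_commute algebra_simps power2_eq_square)
  finally show ?thesis using B by (simp add: zero_le_mult_iff)
qed

text \<open>For \<open>k = T / (1 + \<beta>)\<close> and \<open>\<tau> = 1\<close> the heavy-ball map lowers the form by \<open>(1 - \<beta>\<^sup>2) \<bar>k a - b\<bar>\<^sup>2\<close>, which vanishes
  on a subspace.  Lowering \<open>\<tau>\<close> a little makes the loss definite, so the contraction becomes strict; the perturbations
  \<open>e\<close> and \<open>f\<close> then cost a constant factor by Young's inequality.\<close>
lemma heavy_ball_lyapunov:
  fixes T \<beta> :: real
  assumes \<beta>: "0 < \<beta>" "\<beta> < 1" and T: "\<bar>T\<bar> < 1 + \<beta>"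
  shows "\<exists>k \<tau> \<rho> c C. 0 \<le> \<rho> \<and> \<rho> < 1 \<and> 0 < c \<and> 0 < C \<and>
     (\<forall>a b::'a::real_inner. c * ((norm a)\<^sup>2 + (norm b)\<^sup>2) \<le> lyap k \<tau> a b \<and> lyap k \<tau> a b \<le> 2 * ((norm a)\<^sup>2 + (norm b)\<^sup>2)) \<and>
     (\<forall>a b e f::'a. lyap k \<tau> (T *\<^sub>R a - \<beta> *\<^sub>R b + e) (a + f) \<le> \<rho> * lyap k \<tau> a b + C * ((norm e)\<^sup>2 + (norm f)\<^sup>2))"
proof -
  define k where "k = T / (1 + \<beta>)"
  have Tk: "T = k * (1 + \<beta>)" unfolding k_def using \<beta> by simp
  have k1: "\<bar>k\<bar> < 1" unfolding k_def using T \<beta> by (simp add: abs_divide)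
  define n where "n = 1 - \<beta>\<^sup>2"
  have n: "0 < n" "n < 1" unfolding n_def using \<beta> by (auto simp: power_less_one_iff abs_square_less_1)
  define q where "q = 1 - k\<^sup>2"
  have q: "0 < q" "q \<le> 1" unfolding q_def using k1 by (auto simp: abs_square_less_1)
  define \<delta> where "\<delta> = n * q / 4"
  have d: "0 < \<delta>" "\<delta> \<le> n / 4" "\<delta> \<le> q / 4"
    unfolding \<delta>_def using n q mult_left_mono[of q 1 n] mult_right_mono[of n 1 q] by auto
  define \<rho> where "\<rho> = 1 - \<delta> / 2"
  have \<rho>: "0 < \<rho>" "\<rho> < 1" unfolding \<rho>_def using d n by auto
  define c where "c = (1 - \<bar>k\<bar>) / 2"
  have c: "0 < c" unfolding c_def using k1 by simp
  let ?V = "lyap k (1 - \<delta>) :: 'a \<Rightarrow> 'a \<Rightarrow> real"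
  have two: "2 * \<bar>inner a b\<bar> \<le> (norm a)\<^sup>2 + (norm b)\<^sup>2" for a b :: 'a
  proof -
    have "0 \<le> (norm a - norm b)\<^sup>2" by simp
    hence "2 * (norm a * norm b) \<le> (norm a)\<^sup>2 + (norm b)\<^sup>2" by (simp add: power2_diff)
    thus ?thesis using Cauchy_Schwarz_ineq2[of a b] by linarith
  qed
  have kab: "\<bar>2 * k * inner a b\<bar> \<le> \<bar>k\<bar> * ((norm a)\<^sup>2 + (norm b)\<^sup>2)" for a b :: 'a
    using mult_left_mono[OF two[of a b], of "\<bar>k\<bar>"] by (simp add: abs_mult mult_ac)
  have qk: "q / 4 \<le> c"
  proof -
    have "q = (1 - \<bar>k\<bar>) * (1 + \<bar>k\<bar>)" unfolding q_def by (simp add: algebra_simps power2_eq_square)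
    also have "\<dots> \<le> (1 - \<bar>k\<bar>) * 2" using k1 by (intro mult_left_mono) auto
    finally show ?thesis unfolding c_def by simp
  qed
  have lo: "c * ((norm a)\<^sup>2 + (norm b)\<^sup>2) \<le> ?V a b" for a b :: 'a
  proof -
    have "?V a b \<ge> (1 - \<bar>k\<bar>) * ((norm a)\<^sup>2 + (norm b)\<^sup>2) - \<delta> * (norm b)\<^sup>2"
      using kab[of a b] unfolding lyap_def abs_le_iff by (simp add: algebra_simps)
    moreover have "\<delta> * (norm b)\<^sup>2 \<le> c * (norm b)\<^sup>2" using d qk by (intro mult_right_mono) auto
    moreover have "0 \<le> c * (norm a)\<^sup>2" using c by simp
    moreover have "1 - \<bar>k\<bar> = 2 * c" unfolding c_def by simp
    ultimately have "?V a b \<ge> (2 * c) * ((norm a)\<^sup>2 + (norm b)\<^sup>2) - c * (norm b)\<^sup>2 - c * (norm a)\<^sup>2"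
      by (simp only:)
    moreover have "(2 * c) * ((norm a)\<^sup>2 + (norm b)\<^sup>2) - c * (norm b)\<^sup>2 - c * (norm a)\<^sup>2 = c * ((norm a)\<^sup>2 + (norm b)\<^sup>2)"
      by (simp add: algebra_simps)
    ultimately show ?thesis by simp
  qed
  have up: "?V a b \<le> 2 * ((norm a)\<^sup>2 + (norm b)\<^sup>2)" for a b :: 'a
  proof -
    have "\<bar>k\<bar> * ((norm a)\<^sup>2 + (norm b)\<^sup>2) \<le> 1 * ((norm a)\<^sup>2 + (norm b)\<^sup>2)" using k1 by (intro mult_right_mono) auto
    moreover have "0 \<le> \<delta> * (norm b)\<^sup>2" using d by simp
    ultimately show ?thesis using kab[of a b] unfolding lyap_def abs_le_iff by (simp add: algebra_simps)
  qed
  have contr: "?V (T *\<^sub>R a - \<beta> *\<^sub>R b) a \<le> \<rho> * ?V a b" for a b :: 'a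
  proof -
    define m where "m = \<rho> - \<beta>\<^sup>2"
    have "m - \<rho> * \<delta> = n - 3 * \<delta> / 2 + \<delta>\<^sup>2 / 2" unfolding m_def \<rho>_def n_def by (simp add: field_simps power2_eq_square)
    hence B: "0 < m - \<rho> * \<delta>" using d n zero_le_power2[of \<delta>] by linarith
    have "(m - n * q + \<delta>) * (m - \<rho> * \<delta>) - (k * m)\<^sup>2
        = (\<delta> / 2) * (n * q - k\<^sup>2 * \<delta> / 2 + n * k\<^sup>2 * \<delta> - 3 * \<delta> / 2 + \<delta>\<^sup>2 / 2)"
      unfolding m_def \<rho>_def n_def q_def by (simp add: field_simps power2_eq_square)
    moreover have "0 \<le> n * q - k\<^sup>2 * \<delta> / 2 + n * k\<^sup>2 * \<delta> - 3 * \<delta> / 2 + \<delta>\<^sup>2 / 2"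
    proof -
      have "k\<^sup>2 * \<delta> \<le> 1 * \<delta>" using d k1 by (intro mult_right_mono) (auto simp: abs_square_le_1)
      moreover have "0 \<le> n * k\<^sup>2 * \<delta>" using n d by simp
      moreover have "n * q = 4 * \<delta>" unfolding \<delta>_def by simp
      ultimately show ?thesis using d(1) zero_le_power2[of \<delta>] by linarith
    qed
    ultimately have "0 \<le> (m - n * q + \<delta>) * (m - \<rho> * \<delta>) - (k * m)\<^sup>2"
      using d(1) by (simp only:) (intro mult_nonneg_nonneg, auto)
    hence AB: "(k * m)\<^sup>2 \<le> (m - n * q + \<delta>) * (m - \<rho> * \<delta>)" by simp
    have "\<rho> * ?V a b - ?V (T *\<^sub>R a - \<beta> *\<^sub>R b) a
       = (m - n * q + \<delta>) * (norm a)\<^sup>2 - 2 * (k * m) * inner a b + (m - \<rho> * \<delta>) * (norm b)\<^sup>2"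
      unfolding lyap_def Tk m_def n_def q_def power2_norm_eq_inner
      by (simp add: inner_diff inner_commute algebra_simps power2_eq_square)
    with quadratic_form_nonneg[OF B AB, of a b] show ?thesis by simp
  qed
  define \<eta> where "\<eta> = (1 - \<rho>) / 2"
  have \<eta>: "0 < \<eta>" unfolding \<eta>_def using \<rho> by simp
  have split: "?V (a + e) (b + f) \<le> (1 + \<eta>) * ?V a b + (1 + 1 / \<eta>) * ?V e f" for a b e f :: 'a
  proof -
    have "0 \<le> ?V (\<eta> *\<^sub>R a - e) (\<eta> *\<^sub>R b - f)"
      using lo[of "\<eta> *\<^sub>R a - e" "\<eta> *\<^sub>R b - f"] c by (smt (verit) mult_nonneg_nonneg zero_le_power2)
    also have "\<dots> = \<eta> * ((1 + \<eta>) * ?V a b + (1 + 1 / \<eta>) * ?V e f - ?V (a + e) (b + f))"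
      unfolding lyap_def power2_norm_eq_inner using \<eta>
      by (simp add: inner_diff inner_add inner_commute field_simps power2_eq_square)
    finally show ?thesis using \<eta> by (simp add: zero_le_mult_iff)
  qed
  have r1: "(1 + \<eta>) * \<rho> < 1" "0 \<le> (1 + \<eta>) * \<rho>"
  proof -
    have "(1 + \<eta>) * \<rho> = \<rho> + (1 - \<rho>) * \<rho> / 2" unfolding \<eta>_def by (simp add: field_simps)
    also have "(1 - \<rho>) * \<rho> / 2 \<le> (1 - \<rho>) * 1 / 2" using \<rho> by (intro divide_right_mono mult_left_mono) auto
    also have "\<rho> + (1 - \<rho>) * 1 / 2 < 1" using \<rho> by (simp add: field_simps)
    finally show "(1 + \<eta>) * \<rho> < 1" by simp
    show "0 \<le> (1 + \<eta>) * \<rho>" using \<eta> \<rho> by simp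
  qed
  have main: "?V (T *\<^sub>R a - \<beta> *\<^sub>R b + e) (a + f) \<le> ((1 + \<eta>) * \<rho>) * ?V a b + (2 * (1 + 1 / \<eta>)) * ((norm e)\<^sup>2 + (norm f)\<^sup>2)"
    for a b e f :: 'a
  proof -
    have "(1 + \<eta>) * ?V (T *\<^sub>R a - \<beta> *\<^sub>R b) a \<le> (1 + \<eta>) * (\<rho> * ?V a b)"
      using contr \<eta> by (intro mult_left_mono) auto
    moreover have "(1 + 1 / \<eta>) * ?V e f \<le> (1 + 1 / \<eta>) * (2 * ((norm e)\<^sup>2 + (norm f)\<^sup>2))"
      using up \<eta> by (intro mult_left_mono) auto
    ultimately show ?thesis using split[of "T *\<^sub>R a - \<beta> *\<^sub>R b" e a f]
      unfolding mult.assoc mult.left_commute[of "1 + 1 / \<eta>" 2] by linarith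
  qed
  show ?thesis
    by (rule exI[of _ k], rule exI[of _ "1 - \<delta>"], rule exI[of _ "(1 + \<eta>) * \<rho>"], rule exI[of _ c], rule exI[of _ "2 * (1 + 1 / \<eta>)"])
       (use r1 c \<eta> lo up main in \<open>auto intro!: add_pos_pos\<close>)
qed

text \<open>The position after the next step, before its noise is added.  Together with the current position it
  determines the state.\<close>
definition next_pos :: "real \<Rightarrow> real \<Rightarrow> ('a::euclidean_space \<Rightarrow> 'a) \<Rightarrow> 'a \<times> 'a \<Rightarrow> 'a" where
  "next_pos h \<beta> g z = fst z + (h / 2 * (1 + \<beta>)) *\<^sub>R (snd z - (h / 2) *\<^sub>R g (fst z))"

text \<open>The function that makes the velocity update additive: a step maps \<open>v\<close> to
  \<open>half_kick x' - half_kick x - v\<close>.\<close>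
definition half_kick :: "real \<Rightarrow> ('a::euclidean_space \<Rightarrow> 'a) \<Rightarrow> 'a \<Rightarrow> 'a" where
  "half_kick h g x = (2 / h) *\<^sub>R x - (h / 2) *\<^sub>R g x"

definition noise_scale :: "real \<Rightarrow> real \<Rightarrow> real" where
  "noise_scale h \<beta> = h / 2 * sqrt (1 - \<beta>\<^sup>2)"

text \<open>The last equation is the heavy-ball recursion: the noise enters the new position and the new prediction with
  the same coefficient.\<close>
lemma baoab_step_coordinates:
  fixes U :: "'a::euclidean_space \<Rightarrow> real"
  assumes g: "grad U = g" and h: "h > 0" and \<beta>: "\<beta> = exp (- \<gamma> * h)"
  shows fst_baoab_step: "fst (baoab_step h \<gamma> U z \<xi>) = next_pos h \<beta> g z + noise_scale h \<beta> *\<^sub>R \<xi>"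
    and snd_baoab_step: "snd (baoab_step h \<gamma> U z \<xi>) =
       half_kick h g (fst (baoab_step h \<gamma> U z \<xi>)) - half_kick h g (fst z) - snd z"
    and next_pos_baoab_step: "next_pos h \<beta> g (baoab_step h \<gamma> U z \<xi>) =
       (1 + \<beta>) *\<^sub>R fst (baoab_step h \<gamma> U z \<xi>) - \<beta> *\<^sub>R fst z
        - (h\<^sup>2 / 2 * (1 + \<beta>)) *\<^sub>R g (fst (baoab_step h \<gamma> U z \<xi>)) + noise_scale h \<beta> *\<^sub>R \<xi>"
proof -
  define \<sigma> where "\<sigma> = sqrt (1 - \<beta>\<^sup>2)"
  define va where "va = snd z - (h/2) *\<^sub>R g (fst z)"
  define x' where "x' = fst z + (h/2) *\<^sub>R va + (h/2) *\<^sub>R (\<beta> *\<^sub>R va + \<sigma> *\<^sub>R \<xi>)"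
  have st: "baoab_step h \<gamma> U z \<xi> = (x', \<beta> *\<^sub>R va + \<sigma> *\<^sub>R \<xi> - (h/2) *\<^sub>R g x')"
    unfolding baoab_step_def Let_def g x'_def va_def \<sigma>_def \<beta> by simp
  show 1: "fst (baoab_step h \<gamma> U z \<xi>) = next_pos h \<beta> g z + noise_scale h \<beta> *\<^sub>R \<xi>"
    unfolding st next_pos_def noise_scale_def x'_def va_def[symmetric] \<sigma>_def[symmetric]
    by (simp add: algebra_simps add_divide_distrib)
  have x'v: "(2 / h) *\<^sub>R x' = (2 / h) *\<^sub>R fst z + (1 + \<beta>) *\<^sub>R va + \<sigma> *\<^sub>R \<xi>"
    unfolding x'_def using h by (simp add: algebra_simps)
  show "snd (baoab_step h \<gamma> U z \<xi>) =
       half_kick h g (fst (baoab_step h \<gamma> U z \<xi>)) - half_kick h g (fst z) - snd z"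
    unfolding st half_kick_def fst_conv snd_conv x'v by (simp add: va_def algebra_simps add_divide_distrib)
  show "next_pos h \<beta> g (baoab_step h \<gamma> U z \<xi>) =
       (1 + \<beta>) *\<^sub>R fst (baoab_step h \<gamma> U z \<xi>) - \<beta> *\<^sub>R fst z
        - (h\<^sup>2 / 2 * (1 + \<beta>)) *\<^sub>R g (fst (baoab_step h \<gamma> U z \<xi>)) + noise_scale h \<beta> *\<^sub>R \<xi>"
    unfolding st next_pos_def noise_scale_def fst_conv snd_conv \<sigma>_def[symmetric]
  proof (rule euclidean_eqI)
    fix b :: 'a
    have x'b: "inner x' b = inner (fst z) b + h / 2 * (1 + \<beta>) * inner va b + h / 2 * \<sigma> * inner \<xi> b"
      unfolding x'_def by (simp add: inner_add_left algebra_simps)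
    show "inner (x' + (h / 2 * (1 + \<beta>)) *\<^sub>R (\<beta> *\<^sub>R va + \<sigma> *\<^sub>R \<xi> - (h / 2) *\<^sub>R g x' - (h / 2) *\<^sub>R g x')) b =
       inner ((1 + \<beta>) *\<^sub>R x' - \<beta> *\<^sub>R fst z - (h\<^sup>2 / 2 * (1 + \<beta>)) *\<^sub>R g x' + (h / 2 * \<sigma>) *\<^sub>R \<xi>) b"
      by (simp add: inner_add_left inner_diff_left x'b) (simp add: field_simps power2_eq_square)
  qed
qed

lemma baoab_kernel_measurable:
  fixes U :: "'a::euclidean_space \<Rightarrow> real"
  assumes g: "grad U = g" and cont: "continuous_on UNIV g" and P: "prob_space (std_gaussian :: 'a measure)"
  shows "baoab_kernel h \<gamma> U \<in> borel \<rightarrow>\<^sub>M prob_algebra borel"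
proof -
  have gm[measurable]: "g \<in> borel_measurable borel" by (rule borel_measurable_continuous_onI[OF cont])
  have s: "sets (std_gaussian :: 'a measure) = sets borel" by (simp add: std_gaussian_def)
  have "(\<lambda>p. baoab_step h \<gamma> U (fst p) (snd p)) \<in> borel_measurable borel"
  proof -
    have "continuous_on UNIV (\<lambda>p::('a \<times> 'a) \<times> 'a. baoab_step h \<gamma> U (fst p) (snd p))"
      unfolding baoab_step_def Let_def g
      by (intro continuous_intros continuous_on_compose2[OF cont]) auto
    thus ?thesis by (rule borel_measurable_continuous_onI)
  qed
  hence m: "(\<lambda>(z, \<xi>). baoab_step h \<gamma> U z \<xi>) \<in> borel \<Otimes>\<^sub>M std_gaussian \<rightarrow>\<^sub>M borel"
    by (simp add: split_beta' borel_prod[symmetric] measurable_cong_sets[OF sets_pair_measure_cong[OF refl s] refl])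
  show ?thesis unfolding baoab_kernel_def[abs_def]
    by (rule measurable_distr_prob_space2[where M=std_gaussian, OF _ m])
       (use P in \<open>simp add: space_prob_algebra\<close>)
qed

section \<open>Smooth functions on open sets\<close>

text \<open>The notion of class \<open>C\<^sup>k\<close> used for potentials, restricted to a set, so that smoothness can be
  checked separately near the origin and in polar coordinates away from it.\<close>
primrec ck :: "nat \<Rightarrow> 'a::real_normed_vector set \<Rightarrow> ('a \<Rightarrow> 'b::real_normed_vector) \<Rightarrow> bool" where
  "ck 0 S f \<longleftrightarrow> continuous_on S f"
| "ck (Suc k) S f \<longleftrightarrow> (\<forall>x\<in>S. f differentiable (at x)) \<and> (\<forall>v. ck k S (\<lambda>x. frechet_derivative f (at x) v))"

lemma times_cont_diff_iff_ck: "times_cont_diff k f \<longleftrightarrow> ck k UNIV f"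
  by (induction k arbitrary: f) simp_all

lemma smooth_iff_ck: "smooth f \<longleftrightarrow> (\<forall>k. ck k UNIV f)"
  by (simp add: smooth_def times_cont_diff_iff_ck)

lemma ck_cong:
  assumes "open S" "\<And>x. x \<in> S \<Longrightarrow> f x = g x"
  shows "ck k S f \<longleftrightarrow> ck k S g"
  using assms(2)
proof (induction k arbitrary: f g)
  case 0
  thus ?case by (simp cong: continuous_on_cong)
next
  case (Suc k)
  have der: "(f has_derivative D) (at x) \<longleftrightarrow> (g has_derivative D) (at x)" if "x \<in> S" for x D
    using has_derivative_transform_within_open[OF _ assms(1) that, of f D UNIV g]
      has_derivative_transform_within_open[OF _ assms(1) that, of g D UNIV f] Suc.prems by auto
  hence "frechet_derivative f (at x) = frechet_derivative g (at x)" if "x \<in> S" for x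
    using that by (simp add: frechet_derivative_def)
  hence "ck k S (\<lambda>x. frechet_derivative f (at x) v) = ck k S (\<lambda>x. frechet_derivative g (at x) v)" for v
    by (intro Suc.IH) simp
  thus ?case using der by (simp add: differentiable_def)
qed

lemma ck_SucI:
  assumes "open S" and D: "\<And>x. x \<in> S \<Longrightarrow> (f has_derivative D x) (at x)" and "\<And>v. ck k S (\<lambda>x. D x v)"
  shows "ck (Suc k) S f"
proof -
  have "ck k S (\<lambda>x. frechet_derivative f (at x) v) = ck k S (\<lambda>x. D x v)" for v
    by (rule ck_cong[OF assms(1)]) (use frechet_derivative_at[OF D] in simp)
  thus ?thesis using assms by (auto intro: differentiableI)
qed

lemma ck_SucD:
  assumes "ck (Suc k) S f"
  shows "\<And>x. x \<in> S \<Longrightarrow> (f has_derivative frechet_derivative f (at x)) (at x)"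
    and "\<And>v. ck k S (\<lambda>x. frechet_derivative f (at x) v)"
  using assms by (auto simp: frechet_derivative_works)

lemma ck_Suc_imp: "ck (Suc k) S f \<Longrightarrow> ck k S f"
proof (induction k arbitrary: f)
  case 0
  thus ?case by (auto intro!: continuous_at_imp_continuous_on differentiable_imp_continuous_within)
next
  case (Suc k)
  show ?case unfolding ck.simps(2)[of k]
    using Suc.prems Suc.IH unfolding ck.simps(2)[of "Suc k"] by blast
qed

lemma ck_imp_continuous_on: "ck k S f \<Longrightarrow> continuous_on S f"
proof (induction k)
  case (Suc k) thus ?case using ck_Suc_imp by blast
qed simp

lemma ck_subset: "ck k S f \<Longrightarrow> T \<subseteq> S \<Longrightarrow> ck k T f"
proof (induction k arbitrary: f)
  case 0 thus ?case by (auto intro: continuous_on_subset)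
qed auto

lemma ck_local:
  assumes "\<And>x. x \<in> S \<Longrightarrow> \<exists>T. open T \<and> x \<in> T \<and> ck k T f"
  shows "ck k S f"
  using assms
proof (induction k arbitrary: f)
  case 0
  have "isCont f x" if "x \<in> S" for x
    using 0[OF that] by (auto simp: continuous_on_eq_continuous_at)
  thus ?case by (simp add: continuous_at_imp_continuous_on)
next
  case (Suc k)
  show ?case
  proof (simp, intro conjI ballI allI)
    show "f differentiable at x" if "x \<in> S" for x using Suc.prems[OF that] by auto
    show "ck k S (\<lambda>x. frechet_derivative f (at x) v)" for v
    proof (rule Suc.IH)
      fix x assume "x \<in> S"
      then obtain T where "open T" "x \<in> T" "ck (Suc k) T f" using Suc.prems by blast
      thus "\<exists>T. open T \<and> x \<in> T \<and> ck k T (\<lambda>x. frechet_derivative f (at x) v)"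
        using ck_SucD(2)[of k T f v] by (intro exI[of _ T]) simp
    qed
  qed
qed

lemma ck_const: "open S \<Longrightarrow> ck k S (\<lambda>x. c)"
proof (induction k arbitrary: c)
  case (Suc k)
  show ?case by (rule ck_SucI[OF Suc.prems, where D="\<lambda>_ _. 0"]) (use Suc in auto)
qed simp

lemma ck_add: "open S \<Longrightarrow> ck k S f \<Longrightarrow> ck k S g \<Longrightarrow> ck k S (\<lambda>x. f x + g x)"
proof (induction k arbitrary: f g)
  case 0 thus ?case by (auto intro: continuous_intros)
next
  case (Suc k)
  show ?case
    by (rule ck_SucI[OF Suc.prems(1), where D="\<lambda>x v. frechet_derivative f (at x) v + frechet_derivative g (at x) v"])
       (auto intro!: has_derivative_add ck_SucD(1)[OF Suc.prems(2)] ck_SucD(1)[OF Suc.prems(3)]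
          Suc.IH[OF Suc.prems(1)] ck_SucD(2)[OF Suc.prems(2)] ck_SucD(2)[OF Suc.prems(3)])
qed

lemma ck_bounded_linear: "open S \<Longrightarrow> bounded_linear L \<Longrightarrow> ck k S L"
proof (cases k)
  case 0
  assume "bounded_linear L"
  thus ?thesis using 0 by (auto intro: linear_continuous_on)
next
  case (Suc j)
  assume "open S" "bounded_linear L"
  thus ?thesis unfolding Suc
    by (intro ck_SucI[where D="\<lambda>_. L"]) (auto intro: bounded_linear_imp_has_derivative ck_const)
qed

lemma ck_mult:
  fixes f g :: "'a::real_normed_vector \<Rightarrow> real"
  shows "open S \<Longrightarrow> ck k S f \<Longrightarrow> ck k S g \<Longrightarrow> ck k S (\<lambda>x. f x * g x)"
proof (induction k arbitrary: f g)
  case 0 thus ?case by (auto intro: continuous_intros)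
next
  case (Suc k)
  show ?case
  proof (rule ck_SucI[OF Suc.prems(1), where D="\<lambda>x v. f x * frechet_derivative g (at x) v + frechet_derivative f (at x) v * g x"])
    show "((\<lambda>x. f x * g x) has_derivative (\<lambda>v. f x * frechet_derivative g (at x) v + frechet_derivative f (at x) v * g x)) (at x)"
      if "x \<in> S" for x
      by (rule has_derivative_mult[OF ck_SucD(1)[OF Suc.prems(2) that] ck_SucD(1)[OF Suc.prems(3) that]])
    show "ck k S (\<lambda>x. f x * frechet_derivative g (at x) v + frechet_derivative f (at x) v * g x)" for v
      by (intro ck_add Suc.IH Suc.prems(1) ck_SucD(2)[OF Suc.prems(2)] ck_SucD(2)[OF Suc.prems(3)]
          ck_Suc_imp[OF Suc.prems(2)] ck_Suc_imp[OF Suc.prems(3)])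
  qed
qed

lemma ck_cmult: "open S \<Longrightarrow> ck k S f \<Longrightarrow> ck k S (\<lambda>x. c * f x)" for f :: "'a::real_normed_vector \<Rightarrow> real"
  by (intro ck_mult ck_const)

lemma ck_minus: "open S \<Longrightarrow> ck k S f \<Longrightarrow> ck k S (\<lambda>x. - f x)" for f :: "'a::real_normed_vector \<Rightarrow> real"
  using ck_cmult[of S k f "-1"] by simp

lemma ck_diff: "open S \<Longrightarrow> ck k S f \<Longrightarrow> ck k S g \<Longrightarrow> ck k S (\<lambda>x. f x - g x)" for f g :: "'a::real_normed_vector \<Rightarrow> real"
  using ck_add[of S k f "\<lambda>x. - g x"] ck_minus[of S k g] by simp

text \<open>Chain rule for a scalar outer function; the derivative is a product of functions of class one less.\<close>
lemma ck_compose_real: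
  fixes h :: "real \<Rightarrow> real" and f :: "'a::real_normed_vector \<Rightarrow> real"
  assumes S: "open S"
  shows "ck k I h \<Longrightarrow> ck k S f \<Longrightarrow> f ` S \<subseteq> I \<Longrightarrow> ck k S (\<lambda>x. h (f x))"
proof (induction k arbitrary: h)
  case 0
  thus ?case using continuous_on_compose2[of I h S f] by simp
next
  case (Suc k)
  have hd: "frechet_derivative h (at t) = (\<lambda>v. frechet_derivative h (at t) 1 * v)" if "t \<in> I" for t
  proof
    fix v
    have "linear (frechet_derivative h (at t))"
      using has_derivative_linear[OF ck_SucD(1)[OF Suc.prems(1) that]] .
    from linear_scale[OF this, of v 1] show "frechet_derivative h (at t) v = frechet_derivative h (at t) 1 * v"
      by (simp add: mult.commute)
  qed
  show ?case
  proof (rule ck_SucI[OF S, where D="\<lambda>x v. frechet_derivative h (at (f x)) 1 * frechet_derivative f (at x) v"])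
    show "((\<lambda>x. h (f x)) has_derivative (\<lambda>v. frechet_derivative h (at (f x)) 1 * frechet_derivative f (at x) v)) (at x)"
      if x: "x \<in> S" for x
    proof -
      have fx: "f x \<in> I" using Suc.prems(3) x by blast
      show ?thesis
        using has_derivative_compose[OF ck_SucD(1)[OF Suc.prems(2) x] ck_SucD(1)[OF Suc.prems(1) fx]]
        by (subst (asm) hd[OF fx])
    qed
    show "ck k S (\<lambda>x. frechet_derivative h (at (f x)) 1 * frechet_derivative f (at x) v)" for v
      by (rule ck_mult[OF S Suc.IH[OF ck_SucD(2)[OF Suc.prems(1)] ck_Suc_imp[OF Suc.prems(2)] Suc.prems(3)] ck_SucD(2)[OF Suc.prems(2)]])
  qed
qed

lemma ck_compose_linear:
  fixes f :: "'b::real_normed_vector \<Rightarrow> 'c::real_normed_vector"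
  assumes L: "bounded_linear L"
  shows "ck k UNIV f \<Longrightarrow> ck k UNIV (\<lambda>x. f (L x))"
proof (induction k arbitrary: f)
  case 0
  thus ?case using linear_continuous_on[OF L] by (auto intro: continuous_on_compose2)
next
  case (Suc k)
  show ?case
  proof (rule ck_SucI[where D="\<lambda>x v. frechet_derivative f (at (L x)) (L v)"])
    show "((\<lambda>x. f (L x)) has_derivative (\<lambda>v. frechet_derivative f (at (L x)) (L v))) (at x)" for x
      by (rule has_derivative_compose[OF bounded_linear_imp_has_derivative[OF L] ck_SucD(1)[OF Suc.prems UNIV_I]])
    show "ck k UNIV (\<lambda>x. frechet_derivative f (at (L x)) (L v))" for v
      using Suc.IH[OF ck_SucD(2)[OF Suc.prems, of "L v"]] .
  qed simp
qed

lemma ck_SucI_real: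
  fixes f f' :: "real \<Rightarrow> real"
  assumes "open S" "\<And>x. x \<in> S \<Longrightarrow> (f has_real_derivative f' x) (at x)" "ck k S f'"
  shows "ck (Suc k) S f"
proof (rule ck_SucI[OF assms(1)])
  show "(f has_derivative (\<lambda>v. v * f' x)) (at x)" if "x \<in> S" for x
  proof -
    have "(\<lambda>v. v * f' x) = (*) (f' x)" by (auto simp: fun_eq_iff)
    thus ?thesis using assms(2)[OF that] by (simp add: has_field_derivative_def)
  qed
  show "ck k S (\<lambda>x. v * f' x)" for v by (intro ck_cmult assms)
qed

lemma ck_all_SucI_real:
  fixes f f' :: "real \<Rightarrow> real"
  assumes "\<And>x. (f has_real_derivative f' x) (at x)" "\<And>k. ck k UNIV f'"
  shows "ck k UNIV f"
  using ck_Suc_imp[OF ck_SucI_real[OF open_UNIV assms(1,2)]] .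

lemma ck_inverse: "ck k {t::real. t \<noteq> 0} inverse"
proof (induction k)
  case 0 show ?case by (auto intro!: continuous_intros)
next
  case (Suc k)
  have op: "open {t::real. t \<noteq> 0}" by (simp add: open_Collect_neq)
  show ?case
    by (rule ck_SucI_real[OF op, where f'="\<lambda>t. - (inverse t * inverse t)"])
       (auto intro!: derivative_eq_intros ck_minus ck_mult op Suc)
qed

lemma ck_sqrt: "ck k {0::real<..} sqrt"
proof (induction k)
  case 0 show ?case by (auto intro!: continuous_intros)
next
  case (Suc k)
  have "ck k {0::real<..} (\<lambda>t. inverse (sqrt t))"
    by (rule ck_compose_real[OF _ ck_inverse Suc]) auto
  hence "ck k {0::real<..} (\<lambda>t. inverse (sqrt t) * (1 / 2))"
    by (rule ck_mult[rotated, OF _ ck_const]) auto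
  thus ?case
    by (intro ck_SucI_real[where f'="\<lambda>t. inverse (sqrt t) * (1 / 2)"]) (auto intro!: DERIV_real_sqrt[THEN DERIV_cong] simp: field_simps)
qed

lemma ck_sin_cos: "ck k UNIV (sin :: real \<Rightarrow> real) \<and> ck k UNIV (cos :: real \<Rightarrow> real)"
proof (induction k)
  case 0 show ?case by (auto intro!: continuous_intros)
next
  case (Suc k)
  have "ck (Suc k) UNIV (sin :: real \<Rightarrow> real)"
    by (rule ck_SucI_real[where f'=cos]) (use Suc in \<open>auto intro!: derivative_eq_intros\<close>)
  moreover have "ck (Suc k) UNIV (cos :: real \<Rightarrow> real)"
    by (rule ck_SucI_real[where f'="\<lambda>x. - sin x"]) (use Suc in \<open>auto intro!: derivative_eq_intros ck_minus\<close>)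
  ultimately show ?case by blast
qed

text \<open>The standard flat function.  The power in the denominator closes the family under differentiation.\<close>
definition flat_exp :: "real \<Rightarrow> nat \<Rightarrow> real \<Rightarrow> real" where
  "flat_exp \<alpha> n t = (if 0 < t then exp (- \<alpha> / t) / t ^ n else 0)"

text \<open>The exponential beats every power at \<open>0\<close>; a quadratic bound is what differentiability at \<open>0\<close> needs.\<close>
lemma flat_exp_le_square:
  assumes "0 < \<alpha>"
  shows "\<exists>C\<ge>0. \<forall>t. \<bar>flat_exp \<alpha> n t\<bar> \<le> C * t\<^sup>2"
proof (intro exI conjI allI)
  let ?m = "n + 2"
  show "0 \<le> (real ?m / \<alpha>) ^ ?m" using assms by simp
  fix t :: real
  show "\<bar>flat_exp \<alpha> n t\<bar> \<le> (real ?m / \<alpha>) ^ ?m * t\<^sup>2"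
  proof (cases "0 < t")
    case True
    have "\<alpha> / (real ?m * t) \<le> exp (\<alpha> / (real ?m * t))"
      using exp_ge_add_one_self[of "\<alpha> / (real ?m * t)"] by linarith
    hence "(\<alpha> / (real ?m * t)) ^ ?m \<le> exp (\<alpha> / (real ?m * t)) ^ ?m"
      using True assms by (intro power_mono) auto
    also have "\<dots> = exp (real ?m * (\<alpha> / (real ?m * t)))" by (rule exp_of_nat_mult[symmetric])
    also have "real ?m * (\<alpha> / (real ?m * t)) = \<alpha> / t" by simp
    finally have "inverse (exp (\<alpha> / t)) \<le> inverse ((\<alpha> / (real ?m * t)) ^ ?m)"
      using True assms by (intro le_imp_inverse_le) auto
    also have "\<dots> = (real ?m / \<alpha>) ^ ?m * t ^ ?m"
      using True assms by (simp add: power_mult_distrib power_divide)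
    finally have "exp (- \<alpha> / t) \<le> (real ?m / \<alpha>) ^ ?m * t ^ ?m" by (simp add: exp_minus)
    hence "exp (- \<alpha> / t) / t ^ n \<le> (real ?m / \<alpha>) ^ ?m * t ^ ?m / t ^ n"
      using True by (intro divide_right_mono) auto
    also have "\<dots> = (real ?m / \<alpha>) ^ ?m * t\<^sup>2" using True by (simp add: power_add power2_eq_square)
    finally show ?thesis using True by (simp add: flat_exp_def)
  qed (use assms in \<open>simp add: flat_exp_def\<close>)
qed

lemma flat_exp_derivative:
  assumes "0 < \<alpha>"
  shows "(flat_exp \<alpha> n has_real_derivative \<alpha> * flat_exp \<alpha> (n + 2) t - real n * flat_exp \<alpha> (n + 1) t) (at t)"
proof (cases "t = 0")
  case False
  show ?thesis
  proof (cases "0 < t")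
    case True
    have "((\<lambda>t. exp (- \<alpha> / t) / t ^ n) has_real_derivative \<alpha> * flat_exp \<alpha> (n + 2) t - real n * flat_exp \<alpha> (n + 1) t) (at t)"
    proof -
      have e: "((\<lambda>t. exp (- \<alpha> / t)) has_real_derivative exp (- \<alpha> / t) * (\<alpha> / t\<^sup>2)) (at t)"
        using True by (auto intro!: derivative_eq_intros simp: power2_eq_square)
      have p: "((\<lambda>t. t ^ n) has_real_derivative real n * t ^ (n - 1)) (at t)"
        using DERIV_pow[of n t UNIV] by simp
      have "real n * t ^ (n - 1) = real n * t ^ n / t" using True by (cases n) auto
      moreover have tn: "t ^ n \<noteq> 0" using True by simp
      ultimately show ?thesis using True
        by (intro DERIV_cong[OF DERIV_divide[OF e p tn]]) (simp add: flat_exp_def field_simps power2_eq_square, metis)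
    qed
    thus ?thesis
      by (rule has_field_derivative_transform_within_open[where S="{0<..}"]) (use True in \<open>auto simp: flat_exp_def\<close>)
  next
    case neg: False
    have "((\<lambda>t. 0) has_real_derivative 0) (at t)" by simp
    hence "(flat_exp \<alpha> n has_real_derivative 0) (at t)"
      by (rule has_field_derivative_transform_within_open[where S="{..<0}"]) (use neg False in \<open>auto simp: flat_exp_def\<close>)
    thus ?thesis using neg by (simp add: flat_exp_def)
  qed
next
  case True
  obtain C where C: "C \<ge> 0" "\<And>t. \<bar>flat_exp \<alpha> n t\<bar> \<le> C * t\<^sup>2" using flat_exp_le_square[OF assms] by blast
  have "((\<lambda>h. flat_exp \<alpha> n h / h) \<longlongrightarrow> 0) (at 0)"
  proof (rule Lim_null_comparison)
    have "\<bar>flat_exp \<alpha> n h / h\<bar> \<le> C * \<bar>h\<bar>" if "h \<noteq> 0" for h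
      using C(2)[of h] that by (simp add: abs_divide divide_le_eq power2_eq_square mult.assoc flip: abs_mult)
    thus "\<forall>\<^sub>F h in at 0. norm (flat_exp \<alpha> n h / h) \<le> C * \<bar>h\<bar>" by (auto simp: eventually_at_filter)
    show "((\<lambda>h. C * \<bar>h\<bar>) \<longlongrightarrow> 0) (at 0)" by (auto intro!: tendsto_eq_intros)
  qed
  thus ?thesis using True by (simp add: DERIV_def flat_exp_def)
qed

lemma ck_flat_exp:
  assumes "0 < \<alpha>"
  shows "ck k UNIV (flat_exp \<alpha> n)"
proof (induction k arbitrary: n)
  case 0
  show ?case by (simp add: continuous_at_imp_continuous_on DERIV_isCont[OF flat_exp_derivative[OF assms]])
next
  case (Suc k)
  show ?case
    by (rule ck_SucI_real[OF open_UNIV flat_exp_derivative[OF assms]], rule ck_diff[OF open_UNIV])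
       (rule ck_cmult[OF open_UNIV Suc])+
qed

lemma flat_exp_bounds: "0 < \<alpha> \<Longrightarrow> 0 \<le> flat_exp \<alpha> 0 t \<and> flat_exp \<alpha> 0 t \<le> 1"
  by (auto simp: flat_exp_def)

lemma flat_exp_lower:
  assumes "0 < \<alpha>" "0 < d" "d \<le> t"
  shows "1 - \<alpha> / d \<le> flat_exp \<alpha> 0 t"
proof -
  have "1 - \<alpha> / d \<le> 1 - \<alpha> / t" using assms by (simp add: frac_le)
  also have "\<dots> \<le> exp (- \<alpha> / t)" using exp_ge_add_one_self[of "- \<alpha> / t"] by simp
  finally show ?thesis using assms by (simp add: flat_exp_def)
qed

lemma antiderivative_real:
  fixes f :: "real \<Rightarrow> real"
  assumes "continuous_on UNIV f"
  shows "\<exists>F. (\<forall>x. (F has_real_derivative f x) (at x)) \<and> F a = c"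
proof -
  have "\<exists>F. \<forall>x::real. -\<infinity> < ereal x \<longrightarrow> ereal x < \<infinity> \<longrightarrow> (F has_vector_derivative f x) (at x)"
    using assms by (intro einterval_antiderivative) (auto simp: continuous_on_eq_continuous_at)
  then obtain F where F: "\<And>x. (F has_real_derivative f x) (at x)"
    by (auto simp: has_real_derivative_iff_has_vector_derivative)
  have "((\<lambda>x. F x - F a + c) has_real_derivative f x) (at x)" for x
    by (auto intro!: derivative_eq_intros F)
  thus ?thesis by (intro exI[of _ "\<lambda>x. F x - F a + c"]) simp
qed

section \<open>Radial and angular profiles\<close>

lemma ck_flat_exp_compose:
  assumes "0 < \<alpha>" "open S" "ck k S f"
  shows "ck k S (\<lambda>x. flat_exp \<alpha> 0 (f x))"
  by (rule ck_compose_real[OF assms(2) ck_flat_exp[OF assms(1)] assms(3)]) simp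

lemma mono_of_deriv_nonneg:
  fixes f :: "real \<Rightarrow> real"
  assumes "a \<le> b" "\<And>x. (f has_real_derivative f' x) (at x)" "\<And>x. a \<le> x \<Longrightarrow> x \<le> b \<Longrightarrow> 0 \<le> f' x"
  shows "f a \<le> f b"
  by (rule DERIV_nonneg_imp_nondecreasing[OF assms(1)]) (use assms(2,3) in blast)

lemma const_of_deriv_zero:
  fixes f :: "real \<Rightarrow> real"
  assumes "a \<le> b" "\<And>x. (f has_real_derivative f' x) (at x)" "\<And>x. a \<le> x \<Longrightarrow> x \<le> b \<Longrightarrow> f' x = 0"
  shows "f a = f b"
proof (rule antisym)
  show "f a \<le> f b" by (rule mono_of_deriv_nonneg[OF assms(1,2)]) (simp add: assms(3))
  have "- f a \<le> - f b"
    by (rule mono_of_deriv_nonneg[where f="\<lambda>x. - f x" and f'="\<lambda>x. - f' x", OF assms(1)])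
       (auto intro!: derivative_eq_intros assms(2) simp: assms(3))
  thus "f b \<le> f a" by simp
qed

lemma zero_deriv_imp_const:
  fixes f :: "real \<Rightarrow> real"
  assumes "\<And>x. (f has_real_derivative 0) (at x)"
  shows "f x = f y"
proof (cases "x \<le> y")
  case True
  show ?thesis by (rule const_of_deriv_zero[OF True assms]) simp
next
  case False
  hence "y \<le> x" by simp
  from const_of_deriv_zero[OF this assms] show ?thesis by simp
qed

text \<open>A smooth convex function that vanishes near \<open>0\<close>, has slope \<open>1\<close> from \<open>1\<close> on, and wastes almost no curvature: a slope
  rising from \<open>0\<close> to \<open>1\<close> over a unit interval must have maximal derivative at least \<open>1\<close>, and here
  it is at most \<open>1 + \<epsilon>\<close>.  The second derivative is a normalised plateau built from two flat functions.\<close>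
lemma radial_profile:
  fixes \<epsilon> :: real
  assumes "0 < \<epsilon>"
  shows "\<exists>\<Phi> \<Phi>1 \<Phi>2 \<tau>0. 0 < \<tau>0 \<and> (\<forall>t. (\<Phi> has_real_derivative \<Phi>1 t) (at t)) \<and> (\<forall>t. (\<Phi>1 has_real_derivative \<Phi>2 t) (at t)) \<and>
     (\<forall>k. ck k UNIV \<Phi>) \<and> (\<forall>t\<le>\<tau>0. \<Phi> t = 0 \<and> \<Phi>1 t = 0) \<and> (\<forall>t\<ge>1. \<Phi>1 t = 1) \<and>
     (\<forall>t. 0 \<le> \<Phi>1 t \<and> \<Phi>1 t \<le> 1 \<and> 0 \<le> \<Phi>2 t \<and> \<Phi>2 t \<le> 1 + \<epsilon>) \<and> (\<forall>t\<ge>0. \<Phi>1 t \<le> (1 + \<epsilon>) * t)"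
proof -
  define \<eta> where "\<eta> = \<epsilon> / (6 * (1 + \<epsilon>))"
  have \<eta>: "0 < \<eta>" "6 * \<eta> < 1" "1 - 6 * \<eta> = 1 / (1 + \<epsilon>)" unfolding \<eta>_def using assms by (auto simp: field_simps)
  define \<alpha> where "\<alpha> = 3 * \<eta>\<^sup>2 / 2"
  have \<alpha>: "0 < \<alpha>" unfolding \<alpha>_def using \<eta> by simp
  let ?F = "flat_exp \<alpha> 0"
  define w where "w t = ?F (t - \<eta>) * ?F (1 - t)" for t
  have wck: "ck k UNIV w" for k
    unfolding w_def
    by (rule ck_mult[OF open_UNIV ck_flat_exp_compose[OF \<alpha> open_UNIV ck_diff[OF open_UNIV]] ck_flat_exp_compose[OF \<alpha> open_UNIV ck_diff[OF open_UNIV]]])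
       (auto intro!: ck_const ck_bounded_linear[OF _ bounded_linear_ident])
  have w0: "w t = 0" if "t \<le> \<eta> \<or> 1 \<le> t" for t using that by (auto simp: w_def flat_exp_def)
  have w01: "0 \<le> w t" "w t \<le> 1" for t
    unfolding w_def using flat_exp_bounds[OF \<alpha>, of "t - \<eta>"] flat_exp_bounds[OF \<alpha>, of "1 - t"]
    by (auto intro: mult_le_one)
  obtain W where W: "\<And>t. (W has_real_derivative w t) (at t)" and W0: "W \<eta> = 0"
    using antiderivative_real[OF ck_imp_continuous_on[OF wck], of \<eta> 0] by blast
  have wlow: "(1 - \<alpha> / \<eta>)\<^sup>2 \<le> w t" if "2 * \<eta> \<le> t" "t \<le> 1 - \<eta>" for t
  proof -
    have "\<alpha> / \<eta> = 3 * \<eta> / 2" unfolding \<alpha>_def using \<eta> by (simp add: field_simps power2_eq_square)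
    hence "0 \<le> 1 - \<alpha> / \<eta>" using \<eta> by linarith
    thus ?thesis unfolding w_def power2_eq_square
      using flat_exp_lower[OF \<alpha> \<eta>(1), of "t - \<eta>"] flat_exp_lower[OF \<alpha> \<eta>(1), of "1 - t"] that flat_exp_bounds[OF \<alpha>, of "t - \<eta>"]
      by (intro mult_mono) auto
  qed
  have W1: "1 / (1 + \<epsilon>) \<le> W 1"
  proof -
    have "W (2 * \<eta>) - (1 - \<alpha> / \<eta>)\<^sup>2 * (2 * \<eta>) \<le> W (1 - \<eta>) - (1 - \<alpha> / \<eta>)\<^sup>2 * (1 - \<eta>)"
      by (rule mono_of_deriv_nonneg[where f="\<lambda>t. W t - (1 - \<alpha> / \<eta>)\<^sup>2 * t" and f'="\<lambda>t. w t - (1 - \<alpha> / \<eta>)\<^sup>2"])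
         (use \<eta> wlow in \<open>auto intro!: derivative_eq_intros W\<close>)
    moreover have "W \<eta> \<le> W (2 * \<eta>)" by (rule mono_of_deriv_nonneg[OF _ W]) (use \<eta> w01 in auto)
    moreover have "W (1 - \<eta>) \<le> W 1" by (rule mono_of_deriv_nonneg[OF _ W]) (use \<eta> w01 in auto)
    ultimately have "(1 - \<alpha> / \<eta>)\<^sup>2 * (1 - 3 * \<eta>) \<le> W 1" using W0 by (simp add: algebra_simps)
    moreover have "1 - 3 * \<eta> \<le> (1 - \<alpha> / \<eta>)\<^sup>2"
    proof -
      have "\<alpha> / \<eta> = 3 * \<eta> / 2" unfolding \<alpha>_def using \<eta> by (simp add: field_simps power2_eq_square)
      moreover have "(1 - \<alpha> / \<eta>)\<^sup>2 = 1 - 2 * (\<alpha> / \<eta>) + (\<alpha> / \<eta>)\<^sup>2" by (simp add: power2_diff)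
      ultimately show ?thesis using zero_le_power2[of "\<alpha> / \<eta>"] by linarith
    qed
    hence "(1 - 3 * \<eta>) * (1 - 3 * \<eta>) \<le> (1 - \<alpha> / \<eta>)\<^sup>2 * (1 - 3 * \<eta>)" using \<eta> by (intro mult_right_mono) auto
    moreover have "1 - 6 * \<eta> \<le> (1 - 3 * \<eta>) * (1 - 3 * \<eta>)" using \<eta> by (simp add: algebra_simps)
    ultimately show ?thesis using \<eta>(3) by linarith
  qed
  have W1p: "0 < W 1" using W1 assms by (smt (verit) divide_pos_pos)
  define N where "N = 1 / W 1"
  have N: "0 < N" "N \<le> 1 + \<epsilon>" unfolding N_def using W1 W1p assms by (auto simp: field_simps)
  have N1: "N * W 1 = 1" unfolding N_def using W1p by simp
  define \<Phi>1 where "\<Phi>1 t = N * W t" for t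
  define \<Phi>2 where "\<Phi>2 t = N * w t" for t
  have d1: "(\<Phi>1 has_real_derivative \<Phi>2 t) (at t)" for t
    unfolding \<Phi>1_def \<Phi>2_def by (auto intro!: derivative_eq_intros W)
  have ck2: "ck k UNIV \<Phi>2" for k unfolding \<Phi>2_def by (rule ck_cmult[OF open_UNIV wck])
  have ck1: "ck k UNIV \<Phi>1" for k by (rule ck_all_SucI_real[OF d1 ck2])
  obtain \<Phi> where d0: "\<And>t. (\<Phi> has_real_derivative \<Phi>1 t) (at t)" and \<Phi>0: "\<Phi> \<eta> = 0"
    using antiderivative_real[OF ck_imp_continuous_on[OF ck1], of \<eta> 0] by blast
  have ck0: "ck k UNIV \<Phi>" for k by (rule ck_all_SucI_real[OF d0 ck1])
  have b2: "0 \<le> \<Phi>2 t" "\<Phi>2 t \<le> 1 + \<epsilon>" for t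
    unfolding \<Phi>2_def using w01[of t] N mult_mono[of N "1 + \<epsilon>" "w t" 1] by auto
  have z1: "\<Phi>1 t = 0" if "t \<le> \<eta>" for t
    using const_of_deriv_zero[OF that W] w0 W0 by (simp add: \<Phi>1_def)
  have z0: "\<Phi> t = 0" if "t \<le> \<eta>" for t
    using const_of_deriv_zero[OF that d0] z1 \<Phi>0 by simp
  have o1: "\<Phi>1 t = 1" if "1 \<le> t" for t
    using const_of_deriv_zero[OF that W] w0 N1 by (simp add: \<Phi>1_def)
  have mono1: "\<Phi>1 s \<le> \<Phi>1 t" if "s \<le> t" for s t
    by (rule mono_of_deriv_nonneg[OF that d1]) (simp add: b2)
  have b1: "0 \<le> \<Phi>1 t" "\<Phi>1 t \<le> 1" for t
    using mono1[of "min t \<eta>" t] z1[of "min t \<eta>"] mono1[of t "max t 1"] o1[of "max t 1"] by auto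
  have lin: "\<Phi>1 t \<le> (1 + \<epsilon>) * t" if "0 \<le> t" for t
  proof -
    have "(1 + \<epsilon>) * 0 - \<Phi>1 0 \<le> (1 + \<epsilon>) * t - \<Phi>1 t"
      by (rule mono_of_deriv_nonneg[where f="\<lambda>t. (1 + \<epsilon>) * t - \<Phi>1 t" and f'="\<lambda>t. (1 + \<epsilon>) - \<Phi>2 t", OF that])
         (use b2 in \<open>auto intro!: derivative_eq_intros d1\<close>)
    thus ?thesis using z1[of 0] \<eta> by simp
  qed
  show ?thesis
    by (rule exI[of _ \<Phi>], rule exI[of _ \<Phi>1], rule exI[of _ \<Phi>2], rule exI[of _ \<eta>])
       (use \<eta>(1) d0 d1 ck0 z0 z1 o1 b1 b2 lin in blast)
qed

lemma scaled_sum_squares: "l * c * c + l * s * s = l * (s\<^sup>2 + c\<^sup>2)" for l c s :: real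
  by (simp add: power2_eq_square algebra_simps)

lemma rotation_sum_squares: "(a * c + b * s)\<^sup>2 + (b * c - a * s)\<^sup>2 = (a\<^sup>2 + b\<^sup>2) * (s\<^sup>2 + c\<^sup>2)" for a b c s :: real
  by (simp add: power2_eq_square algebra_simps)

text \<open>The function \<open>p\<close> is the support function, as a function of the angle of the normal, of a regular \<open>K\<close>-gon with vertices of
  modulus \<open>l\<close> whose sides have been bent outwards.  On the normal cone of a vertex, away from the side normals,
  \<open>p\<close> is a pure cosine.  The radius of curvature \<open>q = p + p''\<close> lives near
  the side normals, within \<open>w2\<close>; it is nearly constant within \<open>w1\<close>, which gives the bound on its maximum.
  The last bound on \<open>p\<^sup>2 + p'\<^sup>2\<close> says how far the curved sides can bulge.\<close>
lemma angular_profile: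
  fixes K :: nat and w1 w2 l \<epsilon> :: real
  assumes K: "3 \<le> K" and w: "0 < w1" "w1 < w2" "w2 < pi / K" and l: "0 < l" and \<epsilon>: "0 < \<epsilon>" "\<epsilon> < 1"
  shows "\<exists>p p1 q :: real \<Rightarrow> real. (\<forall>k. ck k UNIV p) \<and> (\<forall>x. (p has_real_derivative p1 x) (at x)) \<and>
     (\<forall>x. (p1 has_real_derivative q x - p x) (at x)) \<and> (\<forall>x. p (x + 2 * pi) = p x) \<and>
     (\<forall>x. 0 \<le> q x \<and> q x \<le> l * sin (pi / K) / ((1 - \<epsilon>) * sin w1)) \<and>
     (\<forall>x. 0 < p x \<and> (p x)\<^sup>2 + (p1 x)\<^sup>2 \<le> l\<^sup>2 * (1 / (cos (pi / K))\<^sup>2 + (sin (pi / K))\<^sup>2)) \<and>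
     (\<forall>x. w2 \<le> x \<longrightarrow> x \<le> 2 * pi / K - w2 \<longrightarrow> p x = l * cos (x - pi / K) \<and> p1 x = - l * sin (x - pi / K)) \<and>
     (\<forall>x. p (x + 2 * pi / K) = p x \<and> p1 (x + 2 * pi / K) = p1 x \<and> q (x + 2 * pi / K) = q x)"
proof -
  define t where "t = pi / real K"
  have K0: "0 < real K" using K by simp
  have t: "0 < t" "t < pi / 2" unfolding t_def using K K0 pi_gt_zero by (auto simp: field_simps)
  have Kt: "real K * t = pi" unfolding t_def using K0 by simp
  have tK: "2 * pi / real K = 2 * t" unfolding t_def by simp
  have wt: "w2 < t" using w unfolding t_def by simp
  have sc: "0 < sin t" "0 < cos t" using t by (auto intro: sin_gt_zero cos_gt_zero simp: field_simps)
  define c2 where "c2 = cos (real K * w2)"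
  define d where "d = cos (real K * w1) - c2"
  have d: "0 < d" unfolding d_def c2_def
  proof -
    have "real K * w1 < real K * w2" using w K0 by simp
    moreover have "real K * w2 \<le> pi" using mult_left_mono[OF less_imp_le[OF wt], of "real K"] Kt K0 by simp
    ultimately have "cos (real K * w2) < cos (real K * w1)" using w K0 by (intro cos_monotone_0_pi) auto
    thus "0 < cos (real K * w1) - cos (real K * w2)" by simp
  qed
  define \<alpha> where "\<alpha> = \<epsilon> * d"
  have \<alpha>: "0 < \<alpha>" "\<alpha> / d = \<epsilon>" unfolding \<alpha>_def using \<epsilon> d by auto
  \<comment> \<open>The shape of \<open>q\<close>: even, periodic, equal to \<open>0\<close> at distance at least \<open>w2\<close> from the side normals and at least \<open>1 - \<epsilon>\<close> within \<open>w1\<close>.\<close>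
  define bmp where "bmp x = flat_exp \<alpha> 0 (cos (real K * x) - c2)" for x
  have bmp_ck: "ck k UNIV bmp" for k
  proof -
    have "ck k UNIV (\<lambda>x. cos (real K * x))"
      by (rule ck_compose_real[OF open_UNIV ck_sin_cos[THEN conjunct2] ck_cmult[OF open_UNIV ck_bounded_linear[OF open_UNIV bounded_linear_ident]]]) simp
    thus ?thesis unfolding bmp_def by (intro ck_flat_exp_compose[OF \<alpha>(1) open_UNIV] ck_diff[OF open_UNIV] ck_const[OF open_UNIV])
  qed
  have bmp_01: "0 \<le> bmp x" "bmp x \<le> 1" for x unfolding bmp_def using flat_exp_bounds[OF \<alpha>(1)] by auto
  have bmp_even: "bmp (- x) = bmp x" for x unfolding bmp_def by simp
  have bmp_per: "bmp (x + 2 * t) = bmp x" for x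
  proof -
    have "real K * (x + 2 * t) = real K * x + 2 * pi" using Kt by (simp add: algebra_simps)
    thus ?thesis unfolding bmp_def by (simp add: cos_add)
  qed
  have bmp_low: "1 - \<epsilon> \<le> bmp x" if "0 \<le> x" "x \<le> w1" for x
  proof -
    have "real K * w1 \<le> pi" using mult_left_mono[of w1 t "real K"] w wt Kt K0 by simp
    hence "cos (real K * w1) \<le> cos (real K * x)" using that K0 by (intro cos_monotone_0_pi_le) auto
    hence "1 - \<alpha> / d \<le> flat_exp \<alpha> 0 (cos (real K * x) - c2)"
      by (intro flat_exp_lower[OF \<alpha>(1) d]) (simp add: d_def)
    thus ?thesis unfolding bmp_def \<alpha>(2) .
  qed
  have bmp_zero: "bmp x = 0" if "w2 \<le> x" "x \<le> 2 * t - w2" for x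
  proof -
    have le: "real K * w2 \<le> real K * x" using that K0 by simp
    have le2: "real K * x \<le> 2 * pi - real K * w2" using mult_left_mono[OF that(2), of "real K"] Kt by (simp add: algebra_simps)
    have "cos (real K * x) \<le> c2"
    proof (cases "real K * x \<le> pi")
      case True
      thus ?thesis unfolding c2_def using le w K0 by (intro cos_monotone_0_pi_le) auto
    next
      case False
      have "cos (real K * x) = cos (2 * pi - real K * x)" by simp
      also have "\<dots> \<le> c2" unfolding c2_def using le2 False w K0 by (intro cos_monotone_0_pi_le) auto
      finally show ?thesis .
    qed
    thus ?thesis unfolding bmp_def flat_exp_def by simp
  qed
  have sck: "ck k UNIV (\<lambda>x. bmp x * cos x)" "ck k UNIV (\<lambda>x. bmp x * sin x)" for k
    using ck_mult[OF open_UNIV bmp_ck] ck_sin_cos by blast+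
  obtain B1 where B1: "\<And>x. (B1 has_real_derivative bmp x * cos x) (at x)" and B10: "B1 0 = 0"
    using antiderivative_real[OF ck_imp_continuous_on[OF sck(1)], of 0 0] by blast
  have cospos: "0 \<le> cos x" if "0 \<le> x" "x \<le> t" for x using that t by (intro cos_ge_zero) auto
  have sinpos: "0 \<le> sin x" if "0 \<le> x" "x \<le> t" for x using that t by (intro sin_ge_zero) auto
  have B1t: "(1 - \<epsilon>) * sin w1 \<le> B1 t"
  proof -
    have "B1 0 - (1 - \<epsilon>) * sin 0 \<le> B1 w1 - (1 - \<epsilon>) * sin w1"
    proof (rule mono_of_deriv_nonneg[where f="\<lambda>x. B1 x - (1 - \<epsilon>) * sin x" and f'="\<lambda>x. bmp x * cos x - (1 - \<epsilon>) * cos x"])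
      show "0 \<le> bmp x * cos x - (1 - \<epsilon>) * cos x" if "0 \<le> x" "x \<le> w1" for x
        using mult_right_mono[OF bmp_low[OF that] cospos[of x]] that w wt by simp
    qed (use w in \<open>auto intro!: derivative_eq_intros B1\<close>)
    moreover have "B1 w1 \<le> B1 t"
      by (rule mono_of_deriv_nonneg[OF _ B1]) (use w wt bmp_01 cospos in auto)
    ultimately show ?thesis using B10 by simp
  qed
  have sw1: "0 < sin w1" using w wt t by (intro sin_gt_zero) auto
  have B1p: "0 < B1 t" using B1t sw1 \<epsilon> by (smt (verit) mult_pos_pos)
  \<comment> \<open>The boundary point with outer normal angle \<open>x\<close> is \<open>(A x, B x)\<close>; scale \<open>q\<close> so that it travels from the middle of a
  side at \<open>x = 0\<close> to the vertex at angle \<open>t\<close>.\<close>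
  define Q where "Q = l * sin t / B1 t"
  have Q: "0 < Q" "Q \<le> l * sin t / ((1 - \<epsilon>) * sin w1)"
    unfolding Q_def using B1p B1t sw1 l sc \<epsilon> by (auto intro!: divide_left_mono)
  define q where "q x = Q * bmp x" for x
  define B where "B x = Q * B1 x" for x
  have Bd: "(B has_real_derivative q x * cos x) (at x)" for x
    unfolding B_def q_def by (auto intro!: derivative_eq_intros B1)
  have Bt: "B t = l * sin t" "B 0 = 0" unfolding B_def Q_def using B1p B10 by auto
  obtain A1 where A1: "\<And>x. (A1 has_real_derivative bmp x * sin x) (at x)" and A1t: "A1 t = 0"
    using antiderivative_real[OF ck_imp_continuous_on[OF sck(2)], of t 0] by blast
  define A where "A x = l * cos t - Q * A1 x" for x
  have Ad: "(A has_real_derivative - (q x * sin x)) (at x)" for x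
    unfolding A_def q_def by (auto intro!: derivative_eq_intros A1)
  have At: "A t = l * cos t" unfolding A_def using A1t by simp
  have q0: "0 \<le> q x" "q x \<le> Q" for x unfolding q_def using Q bmp_01[of x] mult_left_mono[of "bmp x" 1 Q] by auto
  have qeven: "q (- x) = q x" and qper: "q (x + 2 * t) = q x" for x unfolding q_def using bmp_even bmp_per by auto
  have Aeven: "A (- x) = A x" for x
  proof -
    have "((\<lambda>x. A (- x) - A x) has_real_derivative 0) (at x)" for x
      using DERIV_diff[OF DERIV_mirror[THEN iffD1, OF Ad[of "- x"]] Ad[of x]] by (simp add: qeven)
    from zero_deriv_imp_const[OF this, of x 0] show ?thesis by simp
  qed
  have Bodd: "B (- x) = - B x" for x
  proof -
    have "((\<lambda>x. B (- x) + B x) has_real_derivative 0) (at x)" for x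
      using DERIV_add[OF DERIV_mirror[THEN iffD1, OF Bd[of "- x"]] Bd[of x]] by (simp add: qeven)
    from zero_deriv_imp_const[OF this, of x 0] show ?thesis using Bt by simp
  qed
  define p where "p x = A x * cos x + B x * sin x" for x
  define p1 where "p1 x = B x * cos x - A x * sin x" for x
  have pd: "(p has_real_derivative p1 x) (at x)" for x
    unfolding p_def[abs_def] p1_def
    by (rule derivative_eq_intros Ad Bd refl)+ (simp add: algebra_simps)
  have p1d: "(p1 has_real_derivative q x - p x) (at x)" for x
  proof -
    have "q x * cos x * cos x + q x * sin x * sin x = q x * ((sin x)\<^sup>2 + (cos x)\<^sup>2)"
      by (rule scaled_sum_squares)
    hence *: "q x * cos x * cos x + q x * sin x * sin x = q x" by simp
    show ?thesis
      unfolding p_def p1_def[abs_def]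
      by (rule derivative_eq_intros Ad Bd refl)+ (use * in \<open>simp add: algebra_simps\<close>)
  qed
  have peven: "p (- x) = p x" and p1odd: "p1 (- x) = - p1 x" for x
    unfolding p_def p1_def by (simp_all add: Aeven Bodd)
  have pt: "p t = l" "p1 t = 0"
  proof -
    have "p t = l * ((sin t)\<^sup>2 + (cos t)\<^sup>2)" unfolding p_def At Bt by (rule scaled_sum_squares)
    thus "p t = l" by simp
    show "p1 t = 0" unfolding p1_def At Bt by simp
  qed
  \<comment> \<open>The difference of \<open>p\<close> and its translate solves the harmonic oscillator equation and vanishes at \<open>- t\<close> with its derivative.\<close>
  have per: "p (x + 2 * t) = p x \<and> p1 (x + 2 * t) = p1 x" for x
  proof -
    define D where "D x = p (x + 2 * t) - p x" for x
    define D1 where "D1 x = p1 (x + 2 * t) - p1 x" for x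
    have D: "(D has_real_derivative D1 x) (at x)" for x
      unfolding D_def[abs_def] D1_def
      using DERIV_diff[OF DERIV_shift[THEN iffD1, OF pd[of "x + 2 * t"]] pd[of x]] by simp
    have D1: "(D1 has_real_derivative - D x) (at x)" for x
      unfolding D_def D1_def[abs_def]
      using DERIV_diff[OF DERIV_shift[THEN iffD1, OF p1d[of "x + 2 * t"]] p1d[of x]] by (simp add: qper)
    have "((\<lambda>x. (D x)\<^sup>2 + (D1 x)\<^sup>2) has_real_derivative 0) (at x)" for x
      by (rule derivative_eq_intros D D1 refl)+ simp
    from zero_deriv_imp_const[OF this, of x "- t"]
    have "(D x)\<^sup>2 + (D1 x)\<^sup>2 = (D (- t))\<^sup>2 + (D1 (- t))\<^sup>2" .
    also have "\<dots> = 0" unfolding D_def D1_def by (simp add: peven p1odd pt)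
    finally show ?thesis unfolding D_def D1_def by (simp add: sum_power2_eq_zero_iff)
  qed
  have pern: "p (x + real n * (2 * t)) = p x \<and> p1 (x + real n * (2 * t)) = p1 x" for x n
  proof (induction n)
    case (Suc n)
    have "x + real (Suc n) * (2 * t) = (x + real n * (2 * t)) + 2 * t" by (simp add: algebra_simps)
    thus ?case using per[of "x + real n * (2 * t)"] Suc by (simp only:)
  qed simp
  have per2pi: "p (x + 2 * pi) = p x" for x
  proof -
    have "real K * (2 * t) = 2 * pi" using Kt by simp
    thus ?thesis using pern[of x K] by (simp only:)
  qed
  have red: "\<exists>x'. \<bar>x'\<bar> \<le> t \<and> p x' = p x \<and> p1 x' = p1 x" for x
  proof -
    define m where "m = \<lfloor>(x + t) / (2 * t)\<rfloor>"
    have "of_int m \<le> (x + t) / (2 * t)" "(x + t) / (2 * t) < of_int m + 1" unfolding m_def by linarith+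
    hence m: "of_int m * (2 * t) \<le> x + t" "x + t < (of_int m + 1) * (2 * t)" using t by (auto simp: field_simps)
    define x' where "x' = x - of_int m * (2 * t)"
    have "\<bar>x'\<bar> \<le> t" unfolding x'_def using m by (simp add: abs_le_iff algebra_simps)
    moreover have "p x' = p x \<and> p1 x' = p1 x"
    proof (cases "0 \<le> m")
      case True
      thus ?thesis using pern[of x' "nat m"] unfolding x'_def by (simp add: of_nat_nat)
    next
      case False
      thus ?thesis using pern[of x "nat (- m)"] unfolding x'_def by simp
    qed
    ultimately show ?thesis by blast
  qed
  have Bmono: "0 \<le> B x" "B x \<le> l * sin t" if "0 \<le> x" "x \<le> t" for x
  proof -
    show "0 \<le> B x" using mono_of_deriv_nonneg[OF that(1) Bd] Bt(2) q0 cospos that by (smt (verit) mult_nonneg_nonneg)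
    show "B x \<le> l * sin t" using mono_of_deriv_nonneg[OF that(2) Bd] Bt(1) q0 cospos that by (smt (verit) mult_nonneg_nonneg)
  qed
  have Abd: "l * cos t \<le> A x" "A x \<le> l / cos t" if x: "0 \<le> x" "x \<le> t" for x
  proof -
    have "- A x \<le> - A t"
      by (rule mono_of_deriv_nonneg[where f="\<lambda>x. - A x" and f'="\<lambda>x. q x * sin x", OF x(2)])
         (use q0 sinpos x in \<open>auto intro!: derivative_eq_intros Ad\<close>)
    thus "l * cos t \<le> A x" using At by simp
    have "A x * cos t + B x * sin t \<le> A t * cos t + B t * sin t"
    proof (rule mono_of_deriv_nonneg[where f="\<lambda>x. A x * cos t + B x * sin t" and f'="\<lambda>x. q x * sin (t - x)", OF x(2)])
      show "((\<lambda>x. A x * cos t + B x * sin t) has_real_derivative q x * sin (t - x)) (at x)" for x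
        by (rule derivative_eq_intros Ad Bd refl)+ (simp add: sin_diff algebra_simps)
      show "0 \<le> q y * sin (t - y)" if "x \<le> y" "y \<le> t" for y
        using q0 sinpos[of "t - y"] that x by simp
    qed
    also have "A t * cos t + B t * sin t = l * ((sin t)\<^sup>2 + (cos t)\<^sup>2)"
      unfolding At Bt by (rule scaled_sum_squares)
    finally have "A x * cos t + B x * sin t \<le> l" by simp
    moreover have "0 \<le> B x * sin t" using Bmono(1)[OF x] sc by simp
    ultimately show "A x \<le> l / cos t" using sc by (simp add: field_simps)
  qed
  have sq: "(p x)\<^sup>2 + (p1 x)\<^sup>2 = (A x)\<^sup>2 + (B x)\<^sup>2" for x
  proof -
    have "(p x)\<^sup>2 + (p1 x)\<^sup>2 = ((A x)\<^sup>2 + (B x)\<^sup>2) * ((sin x)\<^sup>2 + (cos x)\<^sup>2)"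
      unfolding p_def p1_def by (rule rotation_sum_squares)
    thus ?thesis by simp
  qed
  have bnd0: "0 < p x \<and> (p x)\<^sup>2 + (p1 x)\<^sup>2 \<le> l\<^sup>2 * (1 / (cos t)\<^sup>2 + (sin t)\<^sup>2)" if x: "0 \<le> x" "x \<le> t" for x
  proof
    have "0 < cos x" using x t by (intro cos_gt_zero_pi) auto
    moreover have "0 < A x" using Abd(1)[OF x] l sc by (smt (verit) mult_pos_pos)
    ultimately show "0 < p x" unfolding p_def using Bmono(1)[OF x] sinpos[OF x] by (simp add: add_pos_nonneg)
    have "(A x)\<^sup>2 \<le> (l / cos t)\<^sup>2" using Abd[OF x] \<open>0 < A x\<close> by (intro power_mono) auto
    moreover have "(B x)\<^sup>2 \<le> (l * sin t)\<^sup>2" using Bmono[OF x] by (intro power_mono) auto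
    ultimately show "(p x)\<^sup>2 + (p1 x)\<^sup>2 \<le> l\<^sup>2 * (1 / (cos t)\<^sup>2 + (sin t)\<^sup>2)"
      unfolding sq by (simp add: power_mult_distrib power_divide algebra_simps)
  qed
  have bnd1: "0 < p x \<and> (p x)\<^sup>2 + (p1 x)\<^sup>2 \<le> l\<^sup>2 * (1 / (cos t)\<^sup>2 + (sin t)\<^sup>2)" if "\<bar>x\<bar> \<le> t" for x
  proof (cases "0 \<le> x")
    case True
    show ?thesis by (rule bnd0) (use True that in auto)
  next
    case False
    have "0 < p (- x) \<and> (p (- x))\<^sup>2 + (p1 (- x))\<^sup>2 \<le> l\<^sup>2 * (1 / (cos t)\<^sup>2 + (sin t)\<^sup>2)"
      by (rule bnd0) (use False that in auto)
    thus ?thesis by (simp only: peven p1odd power2_minus)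
  qed
  have bnd: "0 < p x \<and> (p x)\<^sup>2 + (p1 x)\<^sup>2 \<le> l\<^sup>2 * (1 / (cos t)\<^sup>2 + (sin t)\<^sup>2)" for x
  proof -
    obtain x' where "\<bar>x'\<bar> \<le> t" "p x' = p x" "p1 x' = p1 x" using red[of x] by (elim exE conjE)
    thus ?thesis using bnd1[of x'] by simp
  qed
  have flatp: "p x = l * cos (x - t) \<and> p1 x = - l * sin (x - t)" if x: "w2 \<le> x" "x \<le> 2 * t - w2" for x
  proof -
    have "A x = A t \<and> B x = B t"
    proof (cases "x \<le> t")
      case True
      have z: "q y = 0" if "x \<le> y" "y \<le> t" for y using bmp_zero[of y] that x wt by (simp add: q_def)
      show ?thesis using const_of_deriv_zero[OF True Ad] const_of_deriv_zero[OF True Bd] z by simp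
    next
      case False
      hence le: "t \<le> x" by simp
      have z: "q y = 0" if "t \<le> y" "y \<le> x" for y using bmp_zero[of y] that x wt by (simp add: q_def)
      show ?thesis using const_of_deriv_zero[OF le Ad] const_of_deriv_zero[OF le Bd] z by simp
    qed
    thus ?thesis unfolding p_def p1_def using At Bt by (simp add: cos_diff sin_diff algebra_simps)
  qed
  have pck: "ck k UNIV p" for k
  proof -
    have qck: "ck k UNIV q" for k unfolding q_def by (rule ck_cmult[OF open_UNIV bmp_ck])
    have Ack: "ck k UNIV A" for k
      by (rule ck_all_SucI_real[OF Ad ck_minus[OF open_UNIV ck_mult[OF open_UNIV qck ck_sin_cos[THEN conjunct1]]]])
    have Bck: "ck k UNIV B" for k
      by (rule ck_all_SucI_real[OF Bd ck_mult[OF open_UNIV qck ck_sin_cos[THEN conjunct2]]])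
    show ?thesis unfolding p_def[abs_def]
      by (rule ck_add[OF open_UNIV ck_mult[OF open_UNIV Ack ck_sin_cos[THEN conjunct2]] ck_mult[OF open_UNIV Bck ck_sin_cos[THEN conjunct1]]])
  qed
  have qb: "0 \<le> q x \<and> q x \<le> l * sin t / ((1 - \<epsilon>) * sin w1)" for x using q0[of x] Q by simp
  show ?thesis unfolding tK t_def[symmetric]
    by (rule exI[of _ p], rule exI[of _ p1], rule exI[of _ q])
       (use pck pd p1d per2pi qb bnd flatp per qper in blast)
qed

section \<open>Convex potentials in polar coordinates\<close>

lemma periodic_int:
  fixes P :: "real \<Rightarrow> real"
  assumes "\<And>x. P (x + 2 * pi) = P x"
  shows "P (x + 2 * pi * of_int n) = P x"
proof -
  have nat: "P (x + 2 * pi * real m) = P x" for x m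
  proof (induction m)
    case (Suc m)
    have "x + 2 * pi * real (Suc m) = (x + 2 * pi * real m) + 2 * pi" by (simp add: algebra_simps)
    thus ?case using assms[of "x + 2 * pi * real m"] Suc by (simp only:)
  qed simp
  show ?thesis
  proof (cases "0 \<le> n")
    case True
    thus ?thesis using nat[of x "nat n"] by simp
  next
    case False
    thus ?thesis using nat[of "x + 2 * pi * of_int n" "nat (- n)"] by simp
  qed
qed

text \<open>Periodic functions of the angle depend only on the direction, so the jump of the principal argument is harmless.\<close>
lemma periodic_cis:
  fixes P :: "real \<Rightarrow> real"
  assumes "\<And>x. P (x + 2 * pi) = P x" "cis a = cis b"
  shows "P a = P b"
proof -
  have "cos a = cos b" "sin a = sin b" using assms(2) by (auto simp: complex_eq_iff)
  then obtain n :: int where "a = b + 2 * pi * of_int n" using sin_cos_eq_iff[of a b] by auto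
  thus ?thesis using periodic_int[of P, OF assms(1)] by simp
qed

text \<open>A smooth branch of the argument near \<open>z0\<close>: the principal argument itself is discontinuous on the negative real axis.\<close>
definition angle_branch :: "complex \<Rightarrow> complex \<Rightarrow> real" where
  "angle_branch z0 z = Arg z0 + Im (Ln (z / z0))"

definition branch_dom :: "complex \<Rightarrow> complex set" where
  "branch_dom z0 = {z. z / z0 \<notin> \<real>\<^sub>\<le>\<^sub>0}"

lemma branch_dom: 
  assumes "z0 \<noteq> 0"
  shows "open (branch_dom z0)" "z0 \<in> branch_dom z0" "branch_dom z0 \<subseteq> - {0}"
proof -
  have "open ((\<lambda>z. z / z0) -` (- \<real>\<^sub>\<le>\<^sub>0))"
    by (intro open_vimage) (auto intro!: continuous_intros simp: assms open_Compl closed_nonpos_Reals_complex)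
  thus "open (branch_dom z0)" by (simp add: branch_dom_def vimage_def)
  show "z0 \<in> branch_dom z0" using assms by (simp add: branch_dom_def)
  show "branch_dom z0 \<subseteq> - {0}" by (auto simp: branch_dom_def)
qed

lemma cis_angle_branch:
  assumes "z0 \<noteq> 0" "z \<noteq> 0"
  shows "cis (angle_branch z0 z) = cis (Arg z)"
proof -
  have "angle_branch z0 z = Arg z0 + Arg (z / z0)"
    using assms by (simp add: angle_branch_def Arg_eq_Im_Ln)
  hence "cis (angle_branch z0 z) = sgn z0 * sgn (z / z0)"
    using assms by (simp add: cis_mult[symmetric] cis_Arg)
  also have "\<dots> = sgn z" using assms by (simp add: sgn_eq norm_divide)
  finally show ?thesis using assms by (simp add: cis_Arg)
qed

lemma angle_branch_derivative:
  assumes "z0 \<noteq> 0" "z \<in> branch_dom z0"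
  shows "(angle_branch z0 has_derivative (\<lambda>v. Im (v / z))) (at z)"
proof -
  have z: "z \<noteq> 0" using assms branch_dom(3) by auto
  have "((\<lambda>z. Ln (z / z0)) has_field_derivative inverse (z / z0) * (1 / z0)) (at z)"
    using assms z by (auto intro!: derivative_eq_intros simp: branch_dom_def)
  hence "((\<lambda>z. Ln (z / z0)) has_derivative (\<lambda>v. v / z)) (at z)"
    unfolding has_field_derivative_def
    by (rule has_derivative_eq_rhs) (use assms z in \<open>auto simp: fun_eq_iff field_simps\<close>)
  from bounded_linear.has_derivative[OF bounded_linear_Im this]
  have "((\<lambda>z. Im (Ln (z / z0))) has_derivative (\<lambda>v. Im (v / z))) (at z)" .
  from has_derivative_add[OF has_derivative_const this] show ?thesis
    unfolding angle_branch_def[abs_def] by simp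
qed

lemma open_punctured: "open (- {0::complex})"
  by (simp add: open_Compl)

lemma ck_Re_Im: "open S \<Longrightarrow> ck k S Re" "open S \<Longrightarrow> ck k S Im"
  by (auto intro: ck_bounded_linear bounded_linear_Re bounded_linear_Im)

lemma ck_Im_div: "ck k (- {0}) (\<lambda>z. Im (v / z))"
proof -
  note o = open_punctured
  have nz: "Re z * Re z + Im z * Im z \<noteq> 0" if "z \<noteq> 0" for z
    using that by (simp add: complex_eq_iff sum_squares_eq_zero_iff)
  have 1: "ck k (- {0}) (\<lambda>z. inverse (Re z * Re z + Im z * Im z))"
    by (rule ck_compose_real[OF o ck_inverse ck_add[OF o ck_mult[OF o ck_Re_Im(1)[OF o] ck_Re_Im(1)[OF o]] ck_mult[OF o ck_Re_Im(2)[OF o] ck_Re_Im(2)[OF o]]]])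
       (use nz in auto)
  have 2: "ck k (- {0}) (\<lambda>z. (Im v * Re z - Re v * Im z) * inverse (Re z * Re z + Im z * Im z))"
    by (rule ck_mult[OF o ck_diff[OF o ck_cmult[OF o ck_Re_Im(1)[OF o]] ck_cmult[OF o ck_Re_Im(2)[OF o]]] 1])
  show ?thesis
    by (rule ck_cong[OF o, THEN iffD1, OF _ 2]) (simp add: Im_divide power2_eq_square divide_inverse algebra_simps)
qed

lemma ck_angle_branch:
  assumes "z0 \<noteq> 0"
  shows "ck k (branch_dom z0) (angle_branch z0)"
  by (rule ck_Suc_imp, rule ck_SucI[OF branch_dom(1)[OF assms] angle_branch_derivative[OF assms]])
     (auto intro: ck_subset[OF ck_Im_div branch_dom(3)[OF assms]])

lemma ck_Arg:
  fixes P :: "real \<Rightarrow> real"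
  assumes per: "\<And>x. P (x + 2 * pi) = P x" and P: "\<And>k. ck k UNIV P"
  shows "ck k (- {0}) (\<lambda>z. P (Arg z))"
proof (rule ck_local)
  fix z0 :: complex assume "z0 \<in> - {0}"
  hence z0: "z0 \<noteq> 0" by simp
  have "ck k (branch_dom z0) (\<lambda>z. P (angle_branch z0 z))"
    by (rule ck_compose_real[OF branch_dom(1)[OF z0] P ck_angle_branch[OF z0]]) simp
  moreover have "P (angle_branch z0 z) = P (Arg z)" if "z \<in> branch_dom z0" for z
    using that branch_dom(3)[OF z0] by (intro periodic_cis[of P, OF per cis_angle_branch[OF z0]]) auto
  ultimately have "ck k (branch_dom z0) (\<lambda>z. P (Arg z))"
    using ck_cong[OF branch_dom(1)[OF z0], of "\<lambda>z. P (angle_branch z0 z)" "\<lambda>z. P (Arg z)" k] by simp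
  thus "\<exists>T. open T \<and> z0 \<in> T \<and> ck k T (\<lambda>z. P (Arg z))" using branch_dom[OF z0] by blast
qed

lemma has_derivative_Arg:
  fixes P :: "real \<Rightarrow> real"
  assumes per: "\<And>x. P (x + 2 * pi) = P x" and P: "\<And>x. (P has_real_derivative P' x) (at x)" and z0: "z0 \<noteq> 0"
  shows "((\<lambda>z. P (Arg z)) has_derivative (\<lambda>v. P' (Arg z0) * Im (v / z0))) (at z0)"
proof -
  have eq: "angle_branch z0 z0 = Arg z0" using z0 by (simp add: angle_branch_def)
  have "((\<lambda>z. P (angle_branch z0 z)) has_derivative (\<lambda>v. P' (angle_branch z0 z0) * Im (v / z0))) (at z0)"
    using has_derivative_compose[OF angle_branch_derivative[OF z0 branch_dom(2)[OF z0]] P[unfolded has_field_derivative_def]] .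
  hence "((\<lambda>z. P (angle_branch z0 z)) has_derivative (\<lambda>v. P' (Arg z0) * Im (v / z0))) (at z0)"
    unfolding eq .
  thus ?thesis
  proof (rule has_derivative_transform_within_open[OF _ branch_dom(1)[OF z0] branch_dom(2)[OF z0]])
    show "P (angle_branch z0 z) = P (Arg z)" if "z \<in> branch_dom z0" for z
      using that branch_dom(3)[OF z0] by (intro periodic_cis[of P, OF per cis_angle_branch[OF z0]]) auto
  qed
qed

lemma ck_cmod: "ck k (- {0::complex}) cmod"
proof -
  note o = open_punctured
  have "ck k (- {0}) (\<lambda>z. sqrt (Re z * Re z + Im z * Im z))"
    by (rule ck_compose_real[OF o ck_sqrt ck_add[OF o ck_mult[OF o ck_Re_Im(1)[OF o] ck_Re_Im(1)[OF o]] ck_mult[OF o ck_Re_Im(2)[OF o] ck_Re_Im(2)[OF o]]]])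
       (auto simp: complex_eq_iff sum_squares_gt_zero_iff)
  thus ?thesis by (simp add: cmod_def[abs_def] power2_eq_square)
qed

text \<open>Write \<open>\<tau> = \<bar>z\<bar> p (Arg z)\<close>.  It is homogeneous of degree one with gradient \<open>c z\<close>, and the derivative of \<open>c\<close> acts only in
  the tangential direction, with coefficient \<open>q / \<bar>z\<bar>\<close>.  Hence the Hessian of \<open>U\<close> is the identity plus two
  nonnegative rank-one terms, \<open>\<Phi>'' c c\<^sup>T / \<tau>1\<close> and \<open>\<Phi>' q / \<bar>z\<bar>\<close> times a projection.  The linear bound on \<open>\<Phi>'\<close> removes
  the factor \<open>1 / \<bar>z\<bar>\<close>, so both terms are controlled by \<open>(1 + \<epsilon>) / \<tau>1\<close>.  Near the origin \<open>\<Phi>\<close> vanishes, which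
  removes the singularity of polar coordinates.\<close>
theorem polar_potential:
  fixes p p1 q \<Phi> \<Phi>1 \<Phi>2 :: "real \<Rightarrow> real" and \<epsilon> \<tau>0 \<tau>1 M N :: real
  assumes pck: "\<And>k. ck k UNIV p" and pd: "\<And>x. (p has_real_derivative p1 x) (at x)"
    and p1d: "\<And>x. (p1 has_real_derivative q x - p x) (at x)" and per: "\<And>x. p (x + 2 * pi) = p x"
    and q0: "\<And>x. 0 \<le> q x" and p0: "\<And>x. 0 < p x"
    and M: "0 < M" "\<And>x. (p x)\<^sup>2 + (p1 x)\<^sup>2 \<le> M\<^sup>2" and N: "\<And>x. (p x)\<^sup>2 + (p1 x)\<^sup>2 + p x * q x \<le> N"
    and \<tau>: "0 < \<tau>0" "0 < \<tau>1" and \<epsilon>: "0 < \<epsilon>"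
    and \<Phi>d: "\<And>t. (\<Phi> has_real_derivative \<Phi>1 t) (at t)" and \<Phi>1d: "\<And>t. (\<Phi>1 has_real_derivative \<Phi>2 t) (at t)"
    and \<Phi>ck: "\<And>k. ck k UNIV \<Phi>" and \<Phi>z: "\<And>t. t \<le> \<tau>0 \<Longrightarrow> \<Phi> t = 0 \<and> \<Phi>1 t = 0"
    and \<Phi>b: "\<And>t. 0 \<le> \<Phi>1 t \<and> \<Phi>1 t \<le> 1 \<and> 0 \<le> \<Phi>2 t \<and> \<Phi>2 t \<le> 1 + \<epsilon>"
    and \<Phi>l: "\<And>t. 0 \<le> t \<Longrightarrow> \<Phi>1 t \<le> (1 + \<epsilon>) * t"
  defines "c \<equiv> (\<lambda>z. Complex (p (Arg z)) (p1 (Arg z)) * cis (Arg z))"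
  defines "U \<equiv> (\<lambda>z::complex. (norm z)\<^sup>2 / 2 + \<tau>1 * \<Phi> (norm z * p (Arg z) / \<tau>1))"
  defines "G \<equiv> (\<lambda>z. z + \<Phi>1 (norm z * p (Arg z) / \<tau>1) *\<^sub>R c z)"
  shows "\<And>k. ck k UNIV U"
    and "\<And>z. (U has_derivative (\<lambda>v. inner (G z) v)) (at z)"
    and "\<And>z. \<exists>H. (G has_derivative H) (at z) \<and> (\<forall>v. (norm v)\<^sup>2 \<le> inner (H v) v \<and> inner (H v) v \<le> (1 + (1 + \<epsilon>) / \<tau>1 * N) * (norm v)\<^sup>2)
            \<and> (\<forall>v. norm (H v) \<le> (1 + (1 + \<epsilon>) / \<tau>1 * N) * norm v)"
    and "\<And>z. norm (G z - z) \<le> M"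
    and "\<And>z. norm z \<le> \<tau>0 * \<tau>1 / M \<Longrightarrow> G z = z"
proof -
  define \<tau> where "\<tau> z = norm z * p (Arg z)" for z
  have pM: "p x \<le> M" for x
    using M(2)[of x] p0[of x] M(1) power2_le_imp_le[of "p x" M] by (smt (verit) zero_le_power2)
  have cn: "norm (c z) = sqrt ((p (Arg z))\<^sup>2 + (p1 (Arg z))\<^sup>2)" for z
    unfolding c_def by (simp add: norm_mult complex_norm)
  have cM: "norm (c z) \<le> M" for z
    unfolding cn using M(2)[of "Arg z"] M(1) by (simp add: real_le_lsqrt)
  have \<tau>0': "0 \<le> \<tau> z" for z unfolding \<tau>_def using p0[of "Arg z"] by simp
  define r where "r = \<tau>0 * \<tau>1 / M"
  have r: "0 < r" unfolding r_def using \<tau> M by simp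
  have small: "\<tau> z / \<tau>1 \<le> \<tau>0" if "norm z \<le> r" for z
  proof -
    have "\<tau> z \<le> r * M" unfolding \<tau>_def using that pM p0[of "Arg z"] r by (intro mult_mono) auto
    also have "\<dots> = \<tau>0 * \<tau>1" unfolding r_def using M by simp
    finally show ?thesis using \<tau> by (simp add: field_simps)
  qed
  have Ueq: "U z = (norm z)\<^sup>2 / 2 + \<tau>1 * \<Phi> (\<tau> z / \<tau>1)" and Geq: "G z = z + \<Phi>1 (\<tau> z / \<tau>1) *\<^sub>R c z" for z
    unfolding U_def G_def \<tau>_def by simp_all
  have near: "U z = (norm z)\<^sup>2 / 2 \<and> G z = z" if "norm z \<le> r" for z
    unfolding Ueq Geq using \<Phi>z[OF small[OF that]] by simp
  show "G z = z" if "norm z \<le> \<tau>0 * \<tau>1 / M" for z using near[of z] that unfolding r_def by simp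
  show "norm (G z - z) \<le> M" for z
    unfolding Geq using \<Phi>b[of "\<tau> z / \<tau>1"] mult_mono[of "\<Phi>1 (\<tau> z / \<tau>1)" 1 "norm (c z)" M] cM[of z] by simp
  have ball_nhd: "open (ball 0 r)" "(0::complex) \<in> ball 0 r" using r by auto
  have normsq: "(norm z)\<^sup>2 / 2 = (Re z * Re z + Im z * Im z) * (1 / 2)" for z :: complex
    unfolding cmod_power2 by (simp add: power2_eq_square)
  have normck: "ck k S (\<lambda>z::complex. (norm z)\<^sup>2 / 2)" if o: "open S" for k S
    unfolding normsq
    by (rule ck_mult[OF o ck_add[OF o ck_mult[OF o ck_Re_Im(1)[OF o] ck_Re_Im(1)[OF o]] ck_mult[OF o ck_Re_Im(2)[OF o] ck_Re_Im(2)[OF o]]] ck_const[OF o]])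
  have \<tau>ck: "ck k (- {0}) \<tau>" for k
    unfolding \<tau>_def[abs_def] by (rule ck_mult[OF open_punctured ck_cmod ck_Arg[of p, OF per pck]])
  show "ck k UNIV U" for k
  proof (rule ck_local)
    fix z :: complex
    show "\<exists>T. open T \<and> z \<in> T \<and> ck k T U"
    proof (cases "z = 0")
      case True
      have "ck k (ball 0 r) U"
        by (rule ck_cong[OF ball_nhd(1), THEN iffD1, OF _ normck[OF ball_nhd(1)]]) (use near in auto)
      thus ?thesis using ball_nhd True by blast
    next
      case False
      have "ck k (- {0}) (\<lambda>z. \<Phi> (\<tau> z * (1 / \<tau>1)))"
        by (rule ck_compose_real[OF open_punctured \<Phi>ck ck_mult[OF open_punctured \<tau>ck ck_const[OF open_punctured]]]) simp
      hence "ck k (- {0}) U" unfolding Ueq[abs_def]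
        by (intro ck_add[OF open_punctured normck[OF open_punctured]] ck_cmult[OF open_punctured]) simp
      thus ?thesis using open_punctured False by blast
    qed
  qed
  have Im_div: "Im (v / z) = inner (\<i> * cis (Arg z)) v / norm z" if "z \<noteq> 0" for v z
  proof -
    have z: "z = norm z * cis (Arg z)" using that by (simp add: cis_Arg sgn_eq)
    have "v / z = v * inverse (cis (Arg z)) / norm z"
      by (subst z) (simp add: divide_inverse mult_ac)
    hence "Im (v / z) = Im (v * inverse (cis (Arg z))) / norm z" by (simp only: Im_divide_of_real)
    thus ?thesis by (simp add: inner_complex_def algebra_simps)
  qed
  have nd: "(norm has_derivative (\<lambda>v. inner (cis (Arg z)) v)) (at z)" if "z \<noteq> 0" for z :: complex
  proof -
    have "(\<lambda>h. inner h (sgn z)) = (\<lambda>v. inner (cis (Arg z)) v)" using that by (auto simp: cis_Arg inner_commute)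
    thus ?thesis using has_derivative_norm[OF that] by simp
  qed
  have \<tau>d: "(\<tau> has_derivative (\<lambda>v. inner (c z) v)) (at z)" if z: "z \<noteq> 0" for z
  proof -
    have "(\<tau> has_derivative (\<lambda>v. norm z * (p1 (Arg z) * Im (v / z)) + inner (cis (Arg z)) v * p (Arg z))) (at z)"
      unfolding \<tau>_def[abs_def] by (rule has_derivative_mult[OF nd[OF z] has_derivative_Arg[of p, OF per pd z]])
    moreover have "norm z * (p1 (Arg z) * Im (v / z)) + inner (cis (Arg z)) v * p (Arg z) = inner (c z) v" for v
    proof -
      have "norm z * (p1 (Arg z) * Im (v / z)) = p1 (Arg z) * inner (\<i> * cis (Arg z)) v"
        using z by (simp add: Im_div)
      thus ?thesis by (simp add: c_def inner_complex_def algebra_simps)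
    qed
    ultimately show ?thesis by simp
  qed
  have sqd: "((\<lambda>z::complex. (norm z)\<^sup>2 / 2) has_derivative (\<lambda>v. inner z v)) (at z)" for z
    unfolding power2_norm_eq_inner
    by (rule has_derivative_eq_rhs, (rule derivative_eq_intros refl)+) (auto simp: inner_commute)
  show "(U has_derivative (\<lambda>v. inner (G z) v)) (at z)" for z
  proof (cases "z = 0")
    case True
    have "(U has_derivative (\<lambda>v. inner z v)) (at z)"
      by (rule has_derivative_transform_within_open[OF sqd ball_nhd(1)]) (use near True r in auto)
    moreover have "G z = z" using near[of z] True r by simp
    ultimately show ?thesis by simp
  next
    case False
    have "((\<lambda>z. \<tau> z / \<tau>1) has_derivative (\<lambda>v. inner (c z) v / \<tau>1)) (at z)"
      using has_derivative_mult_right[OF \<tau>d[OF False], of "1 / \<tau>1"] by simp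
    from has_derivative_compose[OF this \<Phi>d[of "\<tau> z / \<tau>1", unfolded has_field_derivative_def]]
    have "((\<lambda>z. \<Phi> (\<tau> z / \<tau>1)) has_derivative (\<lambda>v. \<Phi>1 (\<tau> z / \<tau>1) * (inner (c z) v / \<tau>1))) (at z)" .
    from has_derivative_add[OF sqd has_derivative_mult_right[OF this, of \<tau>1]]
    have "(U has_derivative (\<lambda>v. inner z v + \<tau>1 * (\<Phi>1 (\<tau> z / \<tau>1) * (inner (c z) v / \<tau>1)))) (at z)"
      unfolding Ueq[abs_def] .
    moreover have "inner z v + \<tau>1 * (\<Phi>1 (\<tau> z / \<tau>1) * (inner (c z) v / \<tau>1)) = inner (G z) v" for v
      unfolding Geq using \<tau> by (simp add: inner_add_left)
    ultimately show ?thesis by simp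
  qed
  have p1per: "p1 (x + 2 * pi) = p1 x" for x
  proof -
    have "((\<lambda>x. p (x + 2 * pi)) has_real_derivative p1 (x + 2 * pi)) (at x)"
      using DERIV_shift[THEN iffD1, OF pd[of "x + 2 * pi"]] .
    thus ?thesis using DERIV_unique[OF _ pd[of x]] by (simp add: per)
  qed
  have cd: "(c has_derivative (\<lambda>v. (q (Arg z) * Im (v / z)) *\<^sub>R (\<i> * cis (Arg z)))) (at z)" if z: "z \<noteq> 0" for z
  proof -
    define Pa where "Pa x = p x * cos x - p1 x * sin x" for x
    define Pb where "Pb x = p x * sin x + p1 x * cos x" for x
    have Pad: "(Pa has_real_derivative - (q x * sin x)) (at x)" for x
      unfolding Pa_def[abs_def] by (rule derivative_eq_intros pd p1d refl)+ (simp add: algebra_simps)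
    have Pbd: "(Pb has_real_derivative q x * cos x) (at x)" for x
      unfolding Pb_def[abs_def] by (rule derivative_eq_intros pd p1d refl)+ (simp add: algebra_simps)
    have Pper: "Pa (x + 2 * pi) = Pa x" "Pb (x + 2 * pi) = Pb x" for x
      unfolding Pa_def Pb_def by (simp_all add: per p1per)
    have ceq: "c = (\<lambda>z. complex_of_real (Pa (Arg z)) + \<i> * complex_of_real (Pb (Arg z)))"
      unfolding c_def Pa_def Pb_def by (auto simp: fun_eq_iff complex_eq_iff algebra_simps)
    have "(c has_derivative (\<lambda>v. complex_of_real (- (q (Arg z) * sin (Arg z)) * Im (v / z)) + \<i> * complex_of_real (q (Arg z) * cos (Arg z) * Im (v / z)))) (at z)"
      unfolding ceq
      by (intro has_derivative_add has_derivative_mult_right has_derivative_of_real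
            has_derivative_Arg[of Pa, OF Pper(1) Pad z] has_derivative_Arg[of Pb, OF Pper(2) Pbd z])
    moreover have "complex_of_real (- (q (Arg z) * sin (Arg z)) * Im (v / z)) + \<i> * complex_of_real (q (Arg z) * cos (Arg z) * Im (v / z))
        = (q (Arg z) * Im (v / z)) *\<^sub>R (\<i> * cis (Arg z))" for v
      by (simp add: complex_eq_iff)
    ultimately show ?thesis by simp
  qed
  have N0: "0 \<le> N" using N[of 0] q0[of 0] p0[of 0] by (smt (verit) mult_nonneg_nonneg zero_le_power2)
  define B where "B = (1 + \<epsilon>) / \<tau>1"
  have B0: "0 \<le> B" unfolding B_def using \<epsilon> \<tau> by simp
  show "\<exists>H. (G has_derivative H) (at z) \<and> (\<forall>v. (norm v)\<^sup>2 \<le> inner (H v) v \<and> inner (H v) v \<le> (1 + (1 + \<epsilon>) / \<tau>1 * N) * (norm v)\<^sup>2)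
            \<and> (\<forall>v. norm (H v) \<le> (1 + (1 + \<epsilon>) / \<tau>1 * N) * norm v)" for z
  proof (cases "z = 0")
    case True
    have "((\<lambda>z. z) has_derivative (\<lambda>v. v)) (at z)" by simp
    hence "(G has_derivative (\<lambda>v. v)) (at z)"
      by (rule has_derivative_transform_within_open[OF _ ball_nhd(1)]) (use near True r in auto)
    moreover have D: "1 \<le> 1 + (1 + \<epsilon>) / \<tau>1 * N" using N0 \<epsilon> \<tau> by simp
    have "x \<le> (1 + (1 + \<epsilon>) / \<tau>1 * N) * x" if "0 \<le> x" for x :: real
      using mult_right_mono[OF D that] by simp
    ultimately show ?thesis
      by (intro exI[of _ "\<lambda>v. v"] conjI allI) (simp_all add: power2_norm_eq_inner[symmetric] del: times_divide_eq_left)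
  next
    case False
    let ?t = "\<tau> z / \<tau>1" and ?u = "\<i> * cis (Arg z)"
    define H where "H v = v + (\<Phi>2 ?t * (inner (c z) v / \<tau>1)) *\<^sub>R c z + (\<Phi>1 ?t * q (Arg z) / norm z * inner ?u v) *\<^sub>R ?u" for v
    have "((\<lambda>z. \<tau> z / \<tau>1) has_derivative (\<lambda>v. inner (c z) v / \<tau>1)) (at z)"
      using has_derivative_mult_right[OF \<tau>d[OF False], of "1 / \<tau>1"] by simp
    from has_derivative_compose[OF this \<Phi>1d[of ?t, unfolded has_field_derivative_def]]
    have "((\<lambda>z. \<Phi>1 (\<tau> z / \<tau>1)) has_derivative (\<lambda>v. \<Phi>2 ?t * (inner (c z) v / \<tau>1))) (at z)" .
    from has_derivative_add[OF has_derivative_ident has_derivative_scaleR[OF this cd[OF False]]]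
    have "(G has_derivative (\<lambda>v. v + (\<Phi>1 ?t *\<^sub>R ((q (Arg z) * Im (v / z)) *\<^sub>R ?u) + (\<Phi>2 ?t * (inner (c z) v / \<tau>1)) *\<^sub>R c z))) (at z)"
      unfolding Geq[abs_def] .
    moreover have "v + (\<Phi>1 ?t *\<^sub>R ((q (Arg z) * Im (v / z)) *\<^sub>R ?u) + (\<Phi>2 ?t * (inner (c z) v / \<tau>1)) *\<^sub>R c z) = H v" for v
      unfolding H_def Im_div[OF False] by (simp add: algebra_simps)
    ultimately have GH: "(G has_derivative H) (at z)" by simp
    define a where "a = \<Phi>2 ?t / \<tau>1"
    define b where "b = \<Phi>1 ?t * q (Arg z) / norm z"
    have Hab: "H v = v + (a * inner (c z) v) *\<^sub>R c z + (b * inner ?u v) *\<^sub>R ?u" for v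
      unfolding H_def a_def b_def by simp
    have a: "0 \<le> a" "a \<le> B" unfolding a_def B_def using \<Phi>b[of ?t] \<tau> by (auto intro: divide_right_mono)
    have b: "0 \<le> b" "b \<le> B * (p (Arg z) * q (Arg z))"
    proof -
      show "0 \<le> b" unfolding b_def using \<Phi>b[of ?t] q0[of "Arg z"] by simp
      have "\<Phi>1 ?t \<le> (1 + \<epsilon>) * ?t" using \<tau>0'[of z] \<tau> by (intro \<Phi>l) simp
      hence "b \<le> (1 + \<epsilon>) * ?t * q (Arg z) / norm z"
        unfolding b_def using q0[of "Arg z"] by (intro divide_right_mono mult_right_mono) auto
      also have "\<dots> = B * (p (Arg z) * q (Arg z))" proof -
        have "\<tau> z / norm z = p (Arg z)" unfolding \<tau>_def using False by simp
        moreover have "(1 + \<epsilon>) * ?t * q (Arg z) / norm z = B * ((\<tau> z / norm z) * q (Arg z))" by (simp add: B_def)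
        ultimately show ?thesis by simp
      qed
      finally show "b \<le> B * (p (Arg z) * q (Arg z))" .
    qed
    have sum: "a * (norm (c z))\<^sup>2 + b \<le> B * N"
    proof -
      have "a * (norm (c z))\<^sup>2 + b \<le> B * (norm (c z))\<^sup>2 + B * (p (Arg z) * q (Arg z))"
        using a b by (intro add_mono mult_right_mono) auto
      also have "\<dots> = B * ((p (Arg z))\<^sup>2 + (p1 (Arg z))\<^sup>2 + p (Arg z) * q (Arg z))"
        unfolding cn by (simp add: algebra_simps)
      also have "\<dots> \<le> B * N" using N B0 by (intro mult_left_mono)
      finally show ?thesis .
    qed
    have nu: "norm ?u = 1" by (simp add: norm_mult)
    have form: "inner (H v) v = (norm v)\<^sup>2 + a * (inner (c z) v)\<^sup>2 + b * (inner ?u v)\<^sup>2" for v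
      unfolding Hab power2_norm_eq_inner by (simp add: inner_add_left power2_eq_square)
    have cs: "(inner (c z) v)\<^sup>2 \<le> (norm (c z))\<^sup>2 * (norm v)\<^sup>2" "(inner ?u v)\<^sup>2 \<le> (norm v)\<^sup>2" for v
      using Cauchy_Schwarz_ineq[of "c z" v] Cauchy_Schwarz_ineq[of ?u v] nu
      by (simp_all add: power2_norm_eq_inner[symmetric])
    have "(norm v)\<^sup>2 \<le> inner (H v) v \<and> inner (H v) v \<le> (1 + B * N) * (norm v)\<^sup>2" for v
    proof
      show "(norm v)\<^sup>2 \<le> inner (H v) v" unfolding form using a b by simp
      have "inner (H v) v \<le> (norm v)\<^sup>2 + a * ((norm (c z))\<^sup>2 * (norm v)\<^sup>2) + b * (norm v)\<^sup>2"
        unfolding form using cs[of v] a b by (intro add_mono mult_left_mono order_refl) auto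
      also have "\<dots> = (norm v)\<^sup>2 + (a * (norm (c z))\<^sup>2 + b) * (norm v)\<^sup>2" by (simp add: algebra_simps)
      also have "\<dots> \<le> (norm v)\<^sup>2 + (B * N) * (norm v)\<^sup>2" using sum by (intro add_left_mono mult_right_mono) auto
      finally show "inner (H v) v \<le> (1 + B * N) * (norm v)\<^sup>2" by (simp add: algebra_simps)
    qed
    moreover have "norm (H v) \<le> (1 + B * N) * norm v" for v
    proof -
      have "norm (H v) \<le> norm v + norm ((a * inner (c z) v) *\<^sub>R c z) + norm ((b * inner ?u v) *\<^sub>R ?u)"
        unfolding Hab by (intro order_trans[OF norm_triangle_ineq] add_right_mono norm_triangle_ineq)
      also have "norm ((a * inner (c z) v) *\<^sub>R c z) = a * \<bar>inner (c z) v\<bar> * norm (c z)" using a by (simp add: abs_mult)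
      also have "norm ((b * inner ?u v) *\<^sub>R ?u) = b * \<bar>inner ?u v\<bar>" unfolding norm_scaleR nu using b by (simp add: abs_mult)
      also have "norm v + a * \<bar>inner (c z) v\<bar> * norm (c z) + b * \<bar>inner ?u v\<bar>
         \<le> norm v + a * (norm (c z) * norm v) * norm (c z) + b * (1 * norm v)"
        using Cauchy_Schwarz_ineq2[of "c z" v] Cauchy_Schwarz_ineq2[of ?u v] nu a b
        by (intro add_mono mult_left_mono mult_right_mono order_refl) auto
      also have "\<dots> = norm v + (a * (norm (c z))\<^sup>2 + b) * norm v" by (simp add: algebra_simps power2_eq_square)
      also have "\<dots> \<le> norm v + (B * N) * norm v" using sum by (intro add_left_mono mult_right_mono) auto
      finally show ?thesis by (simp add: algebra_simps)
    qed
    ultimately show ?thesis using GH unfolding B_def by blast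
  qed
qed

section \<open>A potential whose gradient dynamics has a cycle\<close>

text \<open>The points \<open>y n\<close> form a regular \<open>K\<close>-gon, and the gradient of the potential at \<open>y n\<close> has to be \<open>(1 + g1 - \<i> g2) y n\<close>.
  The perturbation must therefore have gradient \<open>(g1 - \<i> g2) y n\<close>, which has modulus \<open>l\<close> and lags behind \<open>y n\<close> by the angle
  \<open>\<omega> = arctan (g2 / g1)\<close>.  These are the vertices of the polygon whose support function is \<open>p\<close>.  The hypothesis
  on \<open>\<omega> + w2\<close> puts \<open>y n\<close> inside the normal cone of its vertex, so the gradient of the
  perturbation is constant near \<open>y n\<close>, and the long inequality is the bound on the Hessian.\<close>
theorem cycle_potential_complex:
  fixes K :: nat and w1 w2 \<epsilon> g1 g2 \<kappa> :: real
  assumes K: "3 \<le> K" and g: "0 < g1" "0 < g2" and w: "0 < w1" "w1 < w2" "arctan (g2 / g1) + w2 < pi / K"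
    and \<epsilon>: "0 < \<epsilon>" "\<epsilon> < 1"
    and \<kappa>: "(1 + \<epsilon>)\<^sup>2 * ((g1\<^sup>2 + g2\<^sup>2) / g1) *
       (1 / (cos (pi / K))\<^sup>2 + (sin (pi / K))\<^sup>2 + sqrt (1 / (cos (pi / K))\<^sup>2 + (sin (pi / K))\<^sup>2) * (sin (pi / K) / ((1 - \<epsilon>) * sin w1))) \<le> \<kappa> - 1"
  defines "y \<equiv> (\<lambda>n::nat. cis (pi / K + arctan (g2 / g1) + real n * (2 * pi / K)))"
  shows "\<exists>U G B r. (\<forall>k. ck k UNIV U) \<and> (\<forall>z. (U has_derivative (\<lambda>v. inner (G z) v)) (at z)) \<and>
     (\<forall>z. \<exists>H. (G has_derivative H) (at z) \<and> (\<forall>v. (norm v)\<^sup>2 \<le> inner (H v) v \<and> inner (H v) v \<le> \<kappa> * (norm v)\<^sup>2) \<and> (\<forall>v. norm (H v) \<le> \<kappa> * norm v)) \<and>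
     (\<forall>z. norm (G z - z) \<le> B) \<and> 0 < r \<and> (\<forall>z. norm z \<le> r \<longrightarrow> G z = z) \<and>
     (\<forall>n e. norm e \<le> r \<longrightarrow> G (y n + e) = Complex (1 + g1) (- g2) * y n + e)"
proof -
  define \<omega> where "\<omega> = arctan (g2 / g1)"
  define l where "l = sqrt (g1\<^sup>2 + g2\<^sup>2)"
  have l: "0 < l" unfolding l_def using g by (simp add: add_pos_pos)
  have gl: "g1 = l * cos \<omega>" "g2 = l * sin \<omega>"
  proof -
    have "sqrt (1 + (g2 / g1)\<^sup>2) = l / g1"
    proof -
      have "1 + (g2 / g1)\<^sup>2 = (g1\<^sup>2 + g2\<^sup>2) / g1\<^sup>2" using g by (simp add: field_simps)
      thus ?thesis unfolding l_def using g by (simp add: real_sqrt_divide)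
    qed
    thus "g1 = l * cos \<omega>" "g2 = l * sin \<omega>"
      unfolding \<omega>_def cos_arctan sin_arctan using g l by simp_all
  qed
  have \<omega>: "0 < \<omega>" "\<omega> < pi / 2" unfolding \<omega>_def using g arctan_ubound by (auto simp: zero_less_arctan_iff)
  define t where "t = pi / real K"
  have K0: "0 < real K" using K by simp
  have t: "0 < t" "t < pi / 2" unfolding t_def using K K0 pi_gt_zero by (auto simp: field_simps)
  have wt: "\<omega> + w2 < t" using w(3) unfolding \<omega>_def t_def .
  have w2t: "w2 < pi / real K" using wt \<omega> unfolding t_def by simp
  have sc: "0 < sin t" "0 < cos t" "0 < sin w1" using t w wt \<omega> by (auto intro!: sin_gt_zero cos_gt_zero_pi)
  define m where "m = sqrt (1 / (cos t)\<^sup>2 + (sin t)\<^sup>2)"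
  have m: "0 < m" "m\<^sup>2 = 1 / (cos t)\<^sup>2 + (sin t)\<^sup>2" unfolding m_def using sc by (auto simp: add_pos_nonneg)
  define qm where "qm = l * sin t / ((1 - \<epsilon>) * sin w1)"
  have tK: "2 * pi / real K = 2 * t" unfolding t_def by simp
  obtain p p1 q :: "real \<Rightarrow> real" where AP: "\<forall>k. ck k UNIV p" "\<forall>x. (p has_real_derivative p1 x) (at x)"
     "\<forall>x. (p1 has_real_derivative q x - p x) (at x)" "\<forall>x. p (x + 2 * pi) = p x"
     "\<forall>x. 0 \<le> q x \<and> q x \<le> qm" "\<forall>x. 0 < p x \<and> (p x)\<^sup>2 + (p1 x)\<^sup>2 \<le> l\<^sup>2 * m\<^sup>2"
     "\<forall>x. w2 \<le> x \<longrightarrow> x \<le> 2 * t - w2 \<longrightarrow> p x = l * cos (x - t) \<and> p1 x = - l * sin (x - t)"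
     "\<forall>x. p (x + 2 * t) = p x \<and> p1 (x + 2 * t) = p1 x \<and> q (x + 2 * t) = q x"
    using angular_profile[OF K w(1,2) w2t l \<epsilon>] unfolding tK t_def[symmetric] m(2)[symmetric] qm_def[symmetric]
    by (elim exE conjE)
  note pck = AP(1)[rule_format] and pd = AP(2)[rule_format] and p1d = AP(3)[rule_format] and per2 = AP(4)[rule_format]
    and q = AP(5)[rule_format] and pb = AP(6)[rule_format] and flat = AP(7)[rule_format] and per = AP(8)[rule_format]
  obtain \<Phi> \<Phi>1 \<Phi>2 \<tau>0 where RP: "0 < \<tau>0" "\<forall>t. (\<Phi> has_real_derivative \<Phi>1 t) (at t)" "\<forall>t. (\<Phi>1 has_real_derivative \<Phi>2 t) (at t)"
     "\<forall>k. ck k UNIV \<Phi>" "\<forall>t\<le>\<tau>0. \<Phi> t = 0 \<and> \<Phi>1 t = 0" "\<forall>t\<ge>1. \<Phi>1 t = 1"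
     "\<forall>t. 0 \<le> \<Phi>1 t \<and> \<Phi>1 t \<le> 1 \<and> 0 \<le> \<Phi>2 t \<and> \<Phi>2 t \<le> 1 + \<epsilon>" "\<forall>t\<ge>0. \<Phi>1 t \<le> (1 + \<epsilon>) * t"
    using radial_profile[OF \<epsilon>(1)] by (elim exE conjE)
  note \<tau>0 = RP(1) and \<Phi> = RP(2-5)[rule_format] and \<Phi>one = RP(6)[rule_format] and \<Phi>b = RP(7,8)[rule_format]
  \<comment> \<open>At the cycle points \<open>\<tau>\<close> equals \<open>l cos \<omega> = g1\<close>; the slope must have reached \<open>1\<close> strictly before.\<close>
  define \<tau>1 where "\<tau>1 = g1 / (1 + \<epsilon>)"
  have \<tau>1: "0 < \<tau>1" "\<tau>1 < g1" unfolding \<tau>1_def using g \<epsilon> by (auto simp: field_simps)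
  define M where "M = l * m"
  have M: "0 < M" "(p x)\<^sup>2 + (p1 x)\<^sup>2 \<le> M\<^sup>2" for x unfolding M_def using l m pb[of x] by (auto simp: power_mult_distrib)
  have pM: "p x \<le> M" for x
  proof (rule power2_le_imp_le)
    show "(p x)\<^sup>2 \<le> M\<^sup>2" using M(2)[of x] zero_le_power2[of "p1 x"] by linarith
  qed (use M in simp)
  define N where "N = M\<^sup>2 + M * qm"
  have N: "(p x)\<^sup>2 + (p1 x)\<^sup>2 + p x * q x \<le> N" for x
  proof -
    have "p x * q x \<le> M * qm" using pM[of x] q[of x] M(1) by (intro mult_mono) auto
    thus ?thesis unfolding N_def using M(2)[of x] by linarith
  qed
  have bound: "1 + (1 + \<epsilon>) / \<tau>1 * N \<le> \<kappa>"
  proof -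
    have "(1 + \<epsilon>) / \<tau>1 = (1 + \<epsilon>)\<^sup>2 / g1" unfolding \<tau>1_def using \<epsilon> by (simp add: power2_eq_square)
    moreover have "N = (g1\<^sup>2 + g2\<^sup>2) * (m\<^sup>2 + m * (sin t / ((1 - \<epsilon>) * sin w1)))"
    proof -
      have "l * l = g1\<^sup>2 + g2\<^sup>2" unfolding l_def by simp
      moreover have "N = (l * l) * (m\<^sup>2 + m * (sin t / ((1 - \<epsilon>) * sin w1)))"
        unfolding N_def M_def qm_def by (simp add: algebra_simps power2_eq_square)
      ultimately show ?thesis by simp
    qed
    ultimately have "(1 + \<epsilon>) / \<tau>1 * N = (1 + \<epsilon>)\<^sup>2 * ((g1\<^sup>2 + g2\<^sup>2) / g1) * (m\<^sup>2 + m * (sin t / ((1 - \<epsilon>) * sin w1)))"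
      by simp
    also have "\<dots> \<le> \<kappa> - 1"
    proof -
      have sm: "sqrt (m\<^sup>2) = m" using m(1) by simp
      show ?thesis using \<kappa> unfolding t_def[symmetric] m(2)[symmetric] sm .
    qed
    finally show ?thesis by simp
  qed
  define c where "c z = Complex (p (Arg z)) (p1 (Arg z)) * cis (Arg z)" for z
  define U where "U z = (norm z)\<^sup>2 / 2 + \<tau>1 * \<Phi> (norm z * p (Arg z) / \<tau>1)" for z :: complex
  define G where "G z = z + \<Phi>1 (norm z * p (Arg z) / \<tau>1) *\<^sub>R c z" for z
  have q0: "\<And>x. 0 \<le> q x" and p0: "\<And>x. 0 < p x" using q pb by auto
  note PP = polar_potential[of p p1 q M N \<tau>0 \<tau>1 \<epsilon> \<Phi> \<Phi>1 \<Phi>2, OF pck pd p1d per2 q0 p0 M N \<tau>0 \<tau>1(1) \<epsilon>(1) \<Phi>(1-4) \<Phi>b(1) \<Phi>b(2)]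
  have PP1: "ck k UNIV U" for k unfolding U_def[abs_def] by (rule PP(1)) assumption+
  have PP2: "(U has_derivative (\<lambda>v. inner (G z) v)) (at z)" for z
    unfolding U_def[abs_def] G_def c_def by (rule PP(2)) assumption+
  have PP3: "\<exists>H. (G has_derivative H) (at z) \<and> (\<forall>v. (norm v)\<^sup>2 \<le> inner (H v) v \<and> inner (H v) v \<le> (1 + (1 + \<epsilon>) / \<tau>1 * N) * (norm v)\<^sup>2)
            \<and> (\<forall>v. norm (H v) \<le> (1 + (1 + \<epsilon>) / \<tau>1 * N) * norm v)" for z
    unfolding G_def[abs_def] c_def by (rule PP(3)) assumption+
  have PP4: "norm (G z - z) \<le> M" for z unfolding G_def c_def by (rule PP(4)) assumption+
  have PP5: "G z = z" if "norm z \<le> \<tau>0 * \<tau>1 / M" for z unfolding G_def c_def by (rule PP(5)[OF _ _ that]) assumption+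
  have p1per2: "p1 (x + 2 * pi) = p1 x" for x
  proof -
    have "((\<lambda>x. p (x + 2 * pi)) has_real_derivative p1 (x + 2 * pi)) (at x)"
      using DERIV_shift[THEN iffD1, OF pd[of "x + 2 * pi"]] .
    thus ?thesis using DERIV_unique[OF _ pd[of x]] by (simp add: per2)
  qed
  have pern: "p (x + real n * (2 * t)) = p x \<and> p1 (x + real n * (2 * t)) = p1 x" for x n
  proof (induction n)
    case (Suc n)
    have "x + real (Suc n) * (2 * t) = (x + real n * (2 * t)) + 2 * t" by (simp add: algebra_simps)
    thus ?case using per[of "x + real n * (2 * t)"] Suc by (simp only:)
  qed simp
  have polar: "G (rr * cis \<phi>) = rr * cis \<phi> + \<Phi>1 (rr * p \<phi> / \<tau>1) *\<^sub>R (Complex (p \<phi>) (p1 \<phi>) * cis \<phi>)" if "0 < rr" for rr \<phi>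
  proof -
    define z where "z = complex_of_real rr * cis \<phi>"
    have z: "z \<noteq> 0" "norm z = rr" unfolding z_def using that by (auto simp: norm_mult)
    have "cis (Arg z) = cis \<phi>" using z(1) that unfolding z_def by (simp add: cis_Arg sgn_mult sgn_of_real del: of_real_mult)
    hence "p (Arg z) = p \<phi>" "p1 (Arg z) = p1 \<phi>" "cis (Arg z) = cis \<phi>"
      using periodic_cis[of p, OF per2] periodic_cis[of p1, OF p1per2] by blast+
    thus ?thesis unfolding z_def[symmetric] G_def c_def z(2) by simp
  qed
  define \<delta> where "\<delta> = t - \<omega> - w2"
  have \<delta>: "0 < \<delta>" unfolding \<delta>_def using wt by simp
  have "((\<lambda>w. norm w * cos (\<omega> + Arg w)) \<longlongrightarrow> norm (1::complex) * cos (\<omega> + Arg 1)) (at 1)"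
    by (intro tendsto_intros isCont_tendsto_compose[OF isCont_cos] continuous_at_Arg[THEN isContD]) auto
  hence ev1: "\<forall>\<^sub>F w in at (1::complex). \<tau>1 / l < norm w * cos (\<omega> + Arg w)"
    by (rule order_tendstoD) (use \<tau>1 l gl in \<open>simp add: field_simps\<close>)
  have "(Arg \<longlongrightarrow> Arg 1) (at 1)" by (intro continuous_at_Arg[THEN isContD]) auto
  hence ev2: "\<forall>\<^sub>F w in at (1::complex). dist (Arg w) (Arg 1) < \<delta>" using \<delta> by (rule tendstoD)
  obtain d where d: "0 < d" and dw: "\<And>w. w \<noteq> 1 \<Longrightarrow> dist w 1 < d \<Longrightarrow> \<tau>1 / l < norm w * cos (\<omega> + Arg w) \<and> dist (Arg w) (Arg 1) < \<delta>"
    using eventually_conj[OF ev1 ev2] unfolding eventually_at by auto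
  have dw': "\<tau>1 / l < norm w * cos (\<omega> + Arg w) \<and> \<bar>Arg w\<bar> < \<delta>" if "dist w 1 < d" for w :: complex
  proof (cases "w = 1")
    case True
    thus ?thesis using \<tau>1 l gl \<delta> by (simp add: field_simps)
  next
    case False
    thus ?thesis using dw[OF False that] by (simp add: dist_real_def)
  qed
  \<comment> \<open>One radius serves both the cycle points and the origin.\<close>
  define r where "r = min (min (d / 2) (1 / 2)) (\<tau>0 * \<tau>1 / M)"
  have r: "0 < r" "r < d" "r < 1" "r \<le> \<tau>0 * \<tau>1 / M" 
  proof -
    show "0 < r" unfolding r_def using d \<tau>0 \<tau>1 M(1) by simp
    have "r \<le> d / 2" "r \<le> 1 / 2" unfolding r_def by (simp_all only: min_le_iff_disj order_refl simp_thms)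
    thus "r < d" "r < 1" using d by simp_all
    show "r \<le> \<tau>0 * \<tau>1 / M" unfolding r_def by simp
  qed
  have local: "G (y n + e) = Complex (1 + g1) (- g2) * y n + e" if e: "norm e \<le> r" for n e
  proof -
    have ny: "norm (y n) = 1" unfolding y_def by simp
    define w where "w = 1 + e / y n"
    have yw: "y n + e = y n * w" unfolding w_def using ny by (auto simp: field_simps)
    have dist: "dist w 1 \<le> r" unfolding w_def using e ny by (simp add: dist_norm norm_divide)
    have w0: "w \<noteq> 0" using dist r by auto
    note W = dw'[of w]
    have W: "\<tau>1 / l < norm w * cos (\<omega> + Arg w)" "\<bar>Arg w\<bar> < \<delta>" using dw'[of w] dist r by auto
    define \<phi> where "\<phi> = t + \<omega> + Arg w"
    define \<phi>n where "\<phi>n = \<phi> + real n * (2 * t)"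
    have "w = norm w * cis (Arg w)" using w0 by (simp add: cis_Arg sgn_eq)
    hence "y n * w = y n * (norm w * cis (Arg w))" by simp
    also have "\<dots> = norm w * (cis (t + \<omega> + real n * (2 * t)) * cis (Arg w))"
      unfolding y_def tK t_def[symmetric] \<omega>_def[symmetric] by (simp add: mult_ac)
    also have "cis (t + \<omega> + real n * (2 * t)) * cis (Arg w) = cis \<phi>n"
      unfolding cis_mult \<phi>n_def \<phi>_def by (simp add: algebra_simps)
    finally have "y n * w = norm w * cis \<phi>n" .
    hence yn: "y n + e = norm w * cis \<phi>n" using yw by simp
    have rng: "w2 \<le> \<phi>" "\<phi> \<le> 2 * t - w2" unfolding \<phi>_def using W(2) \<omega> unfolding \<delta>_def by (simp_all add: abs_less_iff)
    have pf: "p \<phi>n = l * cos (\<phi> - t)" "p1 \<phi>n = - l * sin (\<phi> - t)"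
      unfolding \<phi>n_def using pern[of \<phi> n] flat[OF rng] by auto
    have "1 \<le> norm w * p \<phi>n / \<tau>1"
      using W(1) \<tau>1 l unfolding pf \<phi>_def by (simp add: field_simps)
    hence one: "\<Phi>1 (norm w * p \<phi>n / \<tau>1) = 1" by (rule \<Phi>one)
    have cc: "Complex (p \<phi>n) (p1 \<phi>n) = l * cis (t - \<phi>)"
      unfolding pf by (simp add: complex_eq_iff cos_diff sin_diff algebra_simps)
    have Geq: "G (y n + e) = (y n + e) + l * cis (t - \<phi>) * cis \<phi>n"
      using polar[of "norm w" \<phi>n] w0 unfolding yn one cc by simp
    have "l * cis (t - \<phi>) * cis \<phi>n = l * cis (t + real n * (2 * t))"
      unfolding \<phi>n_def by (simp add: cis_mult mult.assoc)
    also have "t + real n * (2 * t) = - \<omega> + (pi / K + arctan (g2 / g1) + real n * (2 * pi / K))"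
      unfolding \<omega>_def t_def by simp
    also have "l * cis \<dots> = l * cis (- \<omega>) * y n" unfolding y_def by (simp only: cis_mult[symmetric] mult.assoc)
    also have "l * cis (- \<omega>) = Complex g1 (- g2)" by (simp add: complex_eq_iff gl)
    finally have "G (y n + e) = (y n + e) + Complex g1 (- g2) * y n" unfolding Geq by simp
    moreover have "Complex (1 + g1) (- g2) = 1 + Complex g1 (- g2)" by (simp add: complex_eq_iff)
    ultimately show ?thesis by (simp add: algebra_simps)
  qed
  have hess: "\<exists>H. (G has_derivative H) (at z) \<and> (\<forall>v. (norm v)\<^sup>2 \<le> inner (H v) v \<and> inner (H v) v \<le> \<kappa> * (norm v)\<^sup>2) \<and> (\<forall>v. norm (H v) \<le> \<kappa> * norm v)" for z
  proof -
    obtain H where H: "(G has_derivative H) (at z)" "\<And>v. (norm v)\<^sup>2 \<le> inner (H v) v \<and> inner (H v) v \<le> (1 + (1 + \<epsilon>) / \<tau>1 * N) * (norm v)\<^sup>2"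
       "\<And>v. norm (H v) \<le> (1 + (1 + \<epsilon>) / \<tau>1 * N) * norm v" using PP3[of z] by blast
    show ?thesis
    proof (intro exI[of _ H] conjI allI H(1))
      fix v
      show "(norm v)\<^sup>2 \<le> inner (H v) v" using H(2) by blast
      show "inner (H v) v \<le> \<kappa> * (norm v)\<^sup>2"
        using H(2)[of v] mult_right_mono[OF bound zero_le_power2[of "norm v"]] by linarith
      show "norm (H v) \<le> \<kappa> * norm v"
        using H(3)[of v] mult_right_mono[OF bound norm_ge_zero[of v]] by linarith
    qed
  qed
  have small: "G z = z" if "norm z \<le> r" for z by (rule PP5) (use that r(4) in simp)
  show ?thesis
    by (rule exI[of _ U], rule exI[of _ G], rule exI[of _ M], rule exI[of _ r])
       (intro conjI allI impI PP1 PP2 hess PP4 r(1), erule small, erule local)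
qed

text \<open>The potential is built in the complex plane; these isometries carry it over.\<close>
definition to_C :: "real^2 \<Rightarrow> complex" where "to_C x = Complex (vec_nth x 1) (vec_nth x 2)"
definition of_C :: "complex \<Rightarrow> real^2" where "of_C z = vector [Re z, Im z]"

lemma of_C_nth [simp]: "vec_nth (of_C z) 1 = Re z" "vec_nth (of_C z) 2 = Im z"
  by (simp_all add: of_C_def)

lemma to_of_C [simp]: "to_C (of_C z) = z" "of_C (to_C x) = x"
  by (simp_all add: to_C_def Finite_Cartesian_Product.vec_eq_iff forall_2)

lemma inner_of_C: "inner (of_C w) x = inner w (to_C x)" "inner x (of_C w) = inner (to_C x) w"
  by (simp_all add: inner_vec_def sum_2 inner_complex_def to_C_def)

lemma linear_of_C: "linear of_C" and linear_to_C: "linear to_C"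
  by (rule linearI; simp add: Finite_Cartesian_Product.vec_eq_iff forall_2 to_C_def complex_eq_iff)+

lemma bounded_linear_C: "bounded_linear of_C" "bounded_linear to_C"
  using linear_of_C linear_to_C linear_conv_bounded_linear by blast+

lemma norm_C [simp]: "norm (of_C z) = norm z" "norm (to_C x) = norm x"
  by (simp_all add: norm_eq_sqrt_inner inner_of_C) (simp_all add: inner_vec_def sum_2 inner_complex_def to_C_def)

lemma grad_eqI:
  assumes "\<And>x. (U has_derivative (\<lambda>v. inner (g x) v)) (at x)"
  shows "grad U = g"
proof
  fix x
  have 1: "GDERIV U x :> g x" unfolding gderiv_def using assms[of x] by (simp add: inner_commute)
  show "grad U x = g x" unfolding grad_def
  proof (rule the_equality[where P="\<lambda>D. GDERIV U x :> D", OF 1])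
    fix D assume "GDERIV U x :> D"
    hence "(U has_derivative (\<lambda>h. inner h D)) (at x)" by (simp add: gderiv_def)
    from has_derivative_unique[OF this 1[unfolded gderiv_def]]
    have "inner h D = inner h (g x)" for h by (drule_tac x=h in fun_cong) simp
    hence "inner (D - g x) (D - g x) = 0" by (simp add: inner_diff_right)
    thus "D = g x" by simp
  qed
qed

text \<open>Membership in the class, from an explicit gradient and explicit second derivatives.\<close>
lemma potential_classI:
  assumes "\<And>k. ck k UNIV U" and gd: "\<And>x. (U has_derivative (\<lambda>v. inner (g x) v)) (at x)"
    and H: "\<And>x. \<exists>H. (g has_derivative H) (at x) \<and> (\<forall>v. (norm v)\<^sup>2 \<le> inner (H v) v \<and> inner (H v) v \<le> \<kappa> * (norm v)\<^sup>2)"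
  shows "U \<in> potential_class \<kappa>"
proof -
  have g: "grad U = g" by (rule grad_eqI[OF gd])
  have "loewner_le id (hessian U x) \<and> loewner_le (hessian U x) (\<lambda>v. \<kappa> *\<^sub>R v)" for x
  proof -
    obtain H where H: "(g has_derivative H) (at x)" "\<And>v. (norm v)\<^sup>2 \<le> inner (H v) v \<and> inner (H v) v \<le> \<kappa> * (norm v)\<^sup>2"
      using H[of x] by blast
    have "hessian U x = H" unfolding hessian_def g using frechet_derivative_at[OF H(1)] by simp
    thus ?thesis using H(2) unfolding loewner_le_def by (simp add: power2_norm_eq_inner)
  qed
  thus ?thesis unfolding potential_class_def smooth_iff_ck using assms(1) by simp
qed

text \<open>With \<open>y n = y 0 \<cdot> exp (\<i> n \<theta>)\<close> and \<open>\<theta> = 2 \<pi> / K\<close>, the cycle equation divided by \<open>y (n + 1)\<close> reads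
  \<open>exp (\<i> \<theta>) + \<beta> exp (- \<i> \<theta>) = 1 + \<beta> - s (1 + g1 - \<i> g2)\<close>; its real and imaginary parts are the two equations
  for \<open>g1\<close> and \<open>g2\<close>.\<close>
theorem cycle_potential_plane:
  fixes K :: nat and w1 w2 \<epsilon> g1 g2 \<kappa> \<beta> s :: real
  assumes K: "3 \<le> K" and g: "0 < g1" "0 < g2" and w: "0 < w1" "w1 < w2" "arctan (g2 / g1) + w2 < pi / K"
    and \<epsilon>: "0 < \<epsilon>" "\<epsilon> < 1"
    and \<kappa>: "(1 + \<epsilon>)\<^sup>2 * ((g1\<^sup>2 + g2\<^sup>2) / g1) *
       (1 / (cos (pi / K))\<^sup>2 + (sin (pi / K))\<^sup>2 + sqrt (1 / (cos (pi / K))\<^sup>2 + (sin (pi / K))\<^sup>2) * (sin (pi / K) / ((1 - \<epsilon>) * sin w1))) \<le> \<kappa> - 1"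
    and s1: "s * (1 + g1) = (1 + \<beta>) * (1 - cos (2 * pi / K))" and s2: "s * g2 = (1 - \<beta>) * sin (2 * pi / K)"
  shows "\<exists>(U :: real^2 \<Rightarrow> real) g B r (y :: nat \<Rightarrow> real^2). U \<in> potential_class \<kappa> \<and> (\<forall>k. ck k UNIV U) \<and>
     (\<forall>x. (U has_derivative (\<lambda>v. inner (g x) v)) (at x)) \<and>
     (\<forall>x. \<exists>H. (g has_derivative H) (at x) \<and> (\<forall>v. (norm v)\<^sup>2 \<le> inner (H v) v \<and> inner (H v) v \<le> \<kappa> * (norm v)\<^sup>2) \<and> (\<forall>v. norm (H v) \<le> \<kappa> * norm v)) \<and>
     (\<forall>x. norm (g x - x) \<le> B) \<and> 0 < r \<and> (\<forall>x. norm x \<le> r \<longrightarrow> g x = x) \<and>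
     (\<forall>n. norm (y n) = 1) \<and> (\<forall>n. y (Suc (Suc n)) = (1 + \<beta>) *\<^sub>R y (Suc n) - \<beta> *\<^sub>R y n - s *\<^sub>R g (y (Suc n))) \<and>
     (\<forall>n e. norm e \<le> r \<longrightarrow> g (y n + e) = g (y n) + e)"
proof -
  define \<theta> where "\<theta> = 2 * pi / real K"
  define a where "a = pi / K + arctan (g2 / g1)"
  define Y where "Y n = cis (a + real n * \<theta>)" for n :: nat
  obtain V G B r where V: "\<forall>k. ck k UNIV V" "\<forall>z. (V has_derivative (\<lambda>v. inner (G z) v)) (at z)"
     "\<forall>z. \<exists>H. (G has_derivative H) (at z) \<and> (\<forall>v. (norm v)\<^sup>2 \<le> inner (H v) v \<and> inner (H v) v \<le> \<kappa> * (norm v)\<^sup>2) \<and> (\<forall>v. norm (H v) \<le> \<kappa> * norm v)"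
     "\<forall>z. norm (G z - z) \<le> B" "0 < r" "\<forall>z. norm z \<le> r \<longrightarrow> G z = z"
     "\<forall>n e. norm e \<le> r \<longrightarrow> G (Y n + e) = Complex (1 + g1) (- g2) * Y n + e"
    using cycle_potential_complex[OF K g w \<epsilon> \<kappa>] unfolding Y_def a_def \<theta>_def by (elim exE conjE)
  define U where "U x = V (to_C x)" for x
  define g where "g x = of_C (G (to_C x))" for x
  define y where "y n = of_C (Y n)" for n
  note Cadd = linear_add[OF linear_of_C] linear_add[OF linear_to_C] linear_diff[OF linear_of_C] linear_diff[OF linear_to_C]
  have Uck: "ck k UNIV U" for k unfolding U_def[abs_def] by (rule ck_compose_linear[OF bounded_linear_C(2)]) (use V(1) in simp)
  have toCd: "(to_C has_derivative to_C) (at x)" for x by (rule bounded_linear_imp_has_derivative[OF bounded_linear_C(2)])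
  have gd: "(U has_derivative (\<lambda>v. inner (g x) v)) (at x)" for x
    using has_derivative_compose[OF toCd V(2)[rule_format, of "to_C x"]] unfolding U_def[abs_def] g_def inner_of_C .
  have H: "\<exists>H. (g has_derivative H) (at x) \<and> (\<forall>v. (norm v)\<^sup>2 \<le> inner (H v) v \<and> inner (H v) v \<le> \<kappa> * (norm v)\<^sup>2) \<and> (\<forall>v. norm (H v) \<le> \<kappa> * norm v)" for x
  proof -
    obtain H where H: "(G has_derivative H) (at (to_C x))" "\<forall>v. (norm v)\<^sup>2 \<le> inner (H v) v \<and> inner (H v) v \<le> \<kappa> * (norm v)\<^sup>2"
      "\<forall>v. norm (H v) \<le> \<kappa> * norm v"
      using V(3)[rule_format, of "to_C x"] by (elim exE conjE)
    have "(g has_derivative (\<lambda>v. of_C (H (to_C v)))) (at x)"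
      unfolding g_def[abs_def]
      by (rule bounded_linear.has_derivative[OF bounded_linear_C(1) has_derivative_compose[OF toCd H(1)]])
    thus ?thesis
      by (intro exI[of _ "\<lambda>v. of_C (H (to_C v))"] conjI allI) (use H(2,3)[rule_format, of "to_C _"] in \<open>simp_all add: inner_of_C\<close>)
  qed
  have B: "norm (g x - x) \<le> B" for x
  proof -
    have "g x - x = of_C (G (to_C x) - to_C x)" unfolding g_def by (simp add: Cadd)
    thus ?thesis using V(4) by simp
  qed
  have small: "g x = x" if "norm x \<le> r" for x unfolding g_def using V(6) that by simp
  have gy: "G (Y n + e) = Complex (1 + g1) (- g2) * Y n + e" if "norm e \<le> r" for n e using V(7) that by blast
  have gy0: "G (Y n) = Complex (1 + g1) (- g2) * Y n" for n using gy[of 0 n] V(5) by simp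
  have loc: "g (y n + e) = g (y n) + e" if "norm e \<le> r" for n e
    unfolding g_def y_def using gy[of "to_C e" n] gy0[of n] that by (simp add: Cadd)
  have cyc: "y (Suc (Suc n)) = (1 + \<beta>) *\<^sub>R y (Suc n) - \<beta> *\<^sub>R y n - s *\<^sub>R g (y (Suc n))" for n
  proof -
    have Yn: "Y n = cis (- \<theta>) * Y (Suc n)" "Y (Suc (Suc n)) = cis \<theta> * Y (Suc n)"
      unfolding Y_def by (simp_all add: cis_mult algebra_simps)
    have sG: "s *\<^sub>R Complex (1 + g1) (- g2) = Complex ((1 + \<beta>) * (1 - cos \<theta>)) (- ((1 - \<beta>) * sin \<theta>))"
      using s1 s2 unfolding \<theta>_def[symmetric] by (simp add: complex_eq_iff)
    have "cis \<theta> = of_real (1 + \<beta>) - \<beta> * cis (- \<theta>) - s *\<^sub>R Complex (1 + g1) (- g2)"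
      unfolding sG by (simp add: complex_eq_iff algebra_simps)
    hence "cis \<theta> * Y (Suc n) = (of_real (1 + \<beta>) - \<beta> * cis (- \<theta>) - s *\<^sub>R Complex (1 + g1) (- g2)) * Y (Suc n)"
      by (rule arg_cong)
    also have "\<dots> = (1 + \<beta>) *\<^sub>R Y (Suc n) - \<beta> *\<^sub>R (cis (- \<theta>) * Y (Suc n)) - s *\<^sub>R (Complex (1 + g1) (- g2) * Y (Suc n))"
      by (simp add: scaleR_conv_of_real algebra_simps)
    finally have "Y (Suc (Suc n)) = (1 + \<beta>) *\<^sub>R Y (Suc n) - \<beta> *\<^sub>R Y n - s *\<^sub>R G (Y (Suc n))"
      unfolding Yn[symmetric] gy0 .
    thus ?thesis unfolding y_def g_def by (simp add: Cadd linear_scale[OF linear_of_C])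
  qed
  have U: "U \<in> potential_class \<kappa>"
    by (rule potential_classI[OF Uck gd]) (use H in blast)
  have ny: "norm (y n) = 1" for n unfolding y_def Y_def by simp
  show ?thesis
    by (rule exI[of _ U], rule exI[of _ g], rule exI[of _ B], rule exI[of _ r], rule exI[of _ y])
       (intro conjI allI impI U Uck gd H B V(5) ny cyc, erule small, erule loc)
qed

section \<open>Admissible parameters for the cycle\<close>

lemma sin_scale_ge:
  fixes a t :: real
  assumes "0 \<le> a" "a \<le> 1" "0 \<le> t" "t \<le> pi"
  shows "a * sin t \<le> sin (a * t)"
proof -
  have "sin (a * 0) - a * sin 0 \<le> sin (a * t) - a * sin t"
  proof (rule mono_of_deriv_nonneg[where f="\<lambda>t. sin (a * t) - a * sin t" and f'="\<lambda>t. a * cos (a * t) - a * cos t", OF assms(3)])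
    show "((\<lambda>t. sin (a * t) - a * sin t) has_real_derivative a * cos (a * x) - a * cos x) (at x)" for x
      by (auto intro!: derivative_eq_intros)
    show "0 \<le> a * cos (a * x) - a * cos x" if x: "0 \<le> x" "x \<le> t" for x
    proof -
      have "a * x \<le> x" using mult_right_mono[OF assms(2) x(1)] by simp
      hence "cos x \<le> cos (a * x)" using x assms by (intro cos_monotone_0_pi_le) auto
      thus ?thesis using mult_left_mono[of "cos x" "cos (a * x)" a] assms by simp
    qed
  qed
  thus ?thesis by simp
qed

text \<open>Take the last \<open>K\<close> before the value drops below \<open>b\<close>.  For \<open>K \<ge> 6\<close> passing from \<open>K\<close> to \<open>K + 1\<close> shrinks the sine by a
  factor of at least \<open>6 / 7\<close>, so the value at \<open>K\<close> overshoots \<open>b\<close> by at most \<open>(7 / 6)\<^sup>2\<close>.\<close>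
lemma polygon_size:
  fixes b :: real
  assumes b: "0 < b" "b < 1/4"
  shows "\<exists>K::nat. (6::nat) \<le> K \<and> b \<le> (sin (pi / K))\<^sup>2 \<and> (sin (pi / K))\<^sup>2 \<le> 49 / 36 * b"
proof -
  obtain n0 :: nat where n0: "pi / sqrt b < real n0" using reals_Archimedean2 by blast
  define P where "P K \<longleftrightarrow> 7 \<le> K \<and> (sin (pi / real K))\<^sup>2 < b" for K :: nat
  have "P (max 7 n0)"
  proof -
    let ?K = "real (max 7 n0)"
    have "pi / sqrt b < ?K" using n0 by simp
    hence "pi / ?K < sqrt b" using b by (simp add: field_simps)
    moreover have "0 \<le> pi / ?K" "pi / ?K \<le> pi" by (auto simp: field_simps)
    ultimately have "sin (pi / ?K) < sqrt b" "0 \<le> sin (pi / ?K)"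
      using sin_x_le_x[of "pi / ?K"] by (auto intro: sin_ge_zero)
    hence "(sin (pi / ?K))\<^sup>2 < (sqrt b)\<^sup>2" by (intro power_strict_mono) auto
    thus ?thesis unfolding P_def using b by simp
  qed
  define N where "N = (LEAST K. P K)"
  have PN: "P N" unfolding N_def by (rule LeastI) fact
  define K where "K = N - 1"
  have K: "6 \<le> K" "N = Suc K" using PN unfolding P_def K_def by auto
  have K0: "0 < real K" using K by simp
  have low: "b \<le> (sin (pi / real K))\<^sup>2"
  proof (cases "K = 6")
    case True
    have "sin (pi / real K) = 1 / 2" unfolding True using sin_30 by simp
    thus ?thesis unfolding \<open>sin (pi / real K) = 1 / 2\<close> using b by (simp add: power2_eq_square)
  next
    case False
    have "\<not> P K" using not_less_Least[of K P] K(2) unfolding N_def by simp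
    thus ?thesis using False K(1) unfolding P_def by simp
  qed
  have "(sin (pi / real K))\<^sup>2 \<le> 49 / 36 * b"
  proof -
    let ?a = "real K / real (Suc K)"
    have a: "6 / 7 \<le> ?a" "?a \<le> 1" using K by (auto simp: field_simps)
    have s0: "0 \<le> sin (pi / real K)" using K0 by (intro sin_ge_zero) (auto simp: field_simps)
    have "6 / 7 * sin (pi / real K) \<le> ?a * sin (pi / real K)" using a s0 by (intro mult_right_mono) auto
    also have "\<dots> \<le> sin (?a * (pi / real K))" using a K0 by (intro sin_scale_ge) (auto simp: field_simps)
    also have "?a * (pi / real K) = pi / real N" using K by simp
    finally have "(6 / 7 * sin (pi / real K))\<^sup>2 \<le> (sin (pi / real N))\<^sup>2" using s0 by (intro power_mono) auto
    also have "\<dots> \<le> b" using PN unfolding P_def by simp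
    finally show ?thesis by (simp add: power_mult_distrib power_divide)
  qed
  with low K(1) show ?thesis by blast
qed

text \<open>The two hypotheses on \<open>q\<close> express that both roots of the characteristic polynomial for unit curvature have modulus
  below \<open>q\<close>: their product is \<open>\<beta>\<close>, and the polynomial is positive at \<open>q\<close>.  Writing \<open>e = C / \<kappa>\<close>, they
  give \<open>e (1 - \<beta>) \<le> s\<close>, that is \<open>C (1 - \<beta>) \<le> s \<kappa>\<close>, and stability bounds \<open>s \<kappa>\<close> by \<open>4\<close>.  The fraction \<open>137 / 5\<close>
  rounds \<open>(3 + sqrt 5)\<^sup>2 = 27.41\<dots>\<close> down.\<close>
lemma not_fast_imp_inequalities:
  fixes C \<kappa> \<beta> s q :: real
  assumes C: "C > (3 + sqrt 5)\<^sup>2" and \<kappa>: "\<kappa> \<ge> 2 * C" and \<beta>: "0 < \<beta>" "\<beta> < 1" and q: "q = (1 - C / \<kappa>) / (1 + C / \<kappa>)"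
    and slow1: "\<beta> < q\<^sup>2" and slow2: "(1 - q) * (q - \<beta>) < s * q" and stable: "s * \<kappa> < 2 * (1 + \<beta>)"
  shows "137/5 * (1 - \<beta>) \<le> s * \<kappa>" "90 \<le> \<kappa> * (1 - \<beta>)" "1 - \<beta> \<le> 13607/100000"
proof -
  have "2236/1000 \<le> sqrt 5" by (rule real_le_rsqrt) (simp add: power2_eq_square)
  moreover have "(3 + sqrt 5)\<^sup>2 = 14 + 6 * sqrt 5" by (simp add: power2_sum)
  ultimately have C27: "C \<ge> 137/5" using C by linarith
  define e where "e = C / \<kappa>"
  have k0: "0 < \<kappa>" using \<kappa> C27 by simp
  have e: "0 < e" "e \<le> 1/2" unfolding e_def using \<kappa> C27 k0 by (auto simp: field_simps)
  have eC: "e * \<kappa> = C" unfolding e_def using k0 by simp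
  have qe: "q * (1 + e) = 1 - e" unfolding q e_def[symmetric] using e by simp
  have q0: "0 < q" "q < 1" unfolding q e_def[symmetric] using e by (auto simp: field_simps)
  define b where "b = 1 - \<beta>"
  have b: "0 < b" unfolding b_def using \<beta> by simp
  have q1: "(1 - q) = e * (1 + q)" using qe by (simp add: algebra_simps)
  have se: "e * b \<le> s"
  proof -
    have "(1 - q) * (1 + q) < b" using slow1 unfolding b_def by (simp add: algebra_simps power2_eq_square)
    hence "b * q \<le> (q - \<beta>) * (1 + q)" unfolding b_def by (simp add: algebra_simps)
    hence "(1 - q) * (b * q) \<le> (1 - q) * ((q - \<beta>) * (1 + q))" using q0 by (intro mult_left_mono) auto
    also have "\<dots> = ((1 - q) * (q - \<beta>)) * (1 + q)" by simp
    also have "\<dots> \<le> (s * q) * (1 + q)" using slow2 q0 by (intro mult_right_mono) auto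
    finally have "e * (1 + q) * (b * q) \<le> s * q * (1 + q)" unfolding q1 .
    hence "(e * b) * (q * (1 + q)) \<le> s * (q * (1 + q))" by (simp add: mult_ac)
    thus ?thesis using q0 by (simp add: mult_le_cancel_right)
  qed
  have "C * b \<le> s * \<kappa>"
  proof -
    have "C * b = (e * b) * \<kappa>" unfolding eC[symmetric] by simp
    also have "\<dots> \<le> s * \<kappa>" using se k0 by (intro mult_right_mono) auto
    finally show ?thesis .
  qed
  moreover have Cb: "137/5 * b \<le> C * b" using C27 b by simp
  ultimately show 1: "137/5 * (1 - \<beta>) \<le> s * \<kappa>" unfolding b_def by simp
  from 1 stable show b2: "1 - \<beta> \<le> 13607/100000" by simp
  have be: "4 * e \<le> b * (1 + e)\<^sup>2"
  proof -
    have "q\<^sup>2 * (1 + e)\<^sup>2 = (1 - e)\<^sup>2" using qe by (simp add: power_mult_distrib[symmetric])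
    moreover have "\<beta> * (1 + e)\<^sup>2 \<le> q\<^sup>2 * (1 + e)\<^sup>2" using slow1 by (intro mult_right_mono) auto
    ultimately have "(1 - b) * (1 + e)\<^sup>2 \<le> (1 - e)\<^sup>2" unfolding b_def by simp
    thus ?thesis by (simp add: algebra_simps power2_eq_square)
  qed
  \<comment> \<open>Bootstrap: the crude bound on \<open>e\<close> is fed back into the inequality to get \<open>90\<close>.\<close>
  have e2: "(1 + e)\<^sup>2 \<le> 9/4" using power_mono[of "1 + e" "3/2" 2] e by (simp add: power2_eq_square)
  have "4 * e \<le> b * (9/4)" using be mult_left_mono[OF e2, of b] b by linarith
  hence e3: "e \<le> 77/1000" using b2 unfolding b_def by simp
  hence e4: "(1 + e)\<^sup>2 \<le> (1077/1000)\<^sup>2" using e by (intro power_mono) auto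
  have "4 * e \<le> b * (1077/1000)\<^sup>2" using be mult_left_mono[OF e4, of b] b by linarith
  hence "4 * e * \<kappa> \<le> b * (1077/1000)\<^sup>2 * \<kappa>" using k0 by (intro mult_right_mono) auto
  hence "4 * C \<le> (\<kappa> * b) * (1077/1000)\<^sup>2" using eC by (simp add: mult_ac)
  thus "90 \<le> \<kappa> * (1 - \<beta>)" using C27 unfolding b_def by (simp add: power2_eq_square)
qed

text \<open>The equations for the cycle determine \<open>g1\<close> and \<open>g2\<close> from the angle \<open>2 t = 2 \<pi> / K\<close>.  A small angle keeps the
  Hessian of order \<open>g1 \<approx> 4 sin\<^sup>2 t / s\<close> small; on the other hand \<open>g2 / g1 \<approx> (1 - \<beta>) / (2 tan t)\<close> must stay well below \<open>t\<close>, which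
  forces \<open>sin\<^sup>2 t\<close> to be comparable with \<open>1 - \<beta>\<close>.  The choice \<open>sin\<^sup>2 t \<approx> 1 - \<beta>\<close> makes the lag about half of \<open>t\<close> and leaves
  the rest for rounding the sides, whence the fractions \<open>0.44\<close> and \<open>0.45\<close> of \<open>t\<close>.\<close>
lemma cycle_parameters:
  fixes \<kappa> \<beta> s :: real
  assumes \<beta>: "0 < \<beta>" "\<beta> < 1" and s: "0 < s" and stable: "s * \<kappa> < 2 * (1 + \<beta>)"
    and i1: "137/5 * (1 - \<beta>) \<le> s * \<kappa>" and i2: "90 \<le> \<kappa> * (1 - \<beta>)" and i3: "1 - \<beta> \<le> 13607/100000"
  shows "\<exists>(K::nat) \<epsilon> w1 w2 g1 g2. (3::nat) \<le> K \<and> 0 < g1 \<and> 0 < g2 \<and> 0 < w1 \<and> w1 < w2 \<and> arctan (g2 / g1) + w2 < pi / K \<and> 0 < \<epsilon> \<and> \<epsilon> < 1 \<and>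
    (1 + \<epsilon>)\<^sup>2 * ((g1\<^sup>2 + g2\<^sup>2) / g1) *
       (1 / (cos (pi / K))\<^sup>2 + (sin (pi / K))\<^sup>2 + sqrt (1 / (cos (pi / K))\<^sup>2 + (sin (pi / K))\<^sup>2) * (sin (pi / K) / ((1 - \<epsilon>) * sin w1))) \<le> \<kappa> - 1 \<and>
    s * (1 + g1) = (1 + \<beta>) * (1 - cos (2 * pi / K)) \<and> s * g2 = (1 - \<beta>) * sin (2 * pi / K)"
proof -
  define b where "b = 1 - \<beta>"
  have b: "0 < b" "b \<le> 13607/100000" "\<beta> = 1 - b" unfolding b_def using \<beta> i3 by auto
  obtain K :: nat where K: "6 \<le> K" and ylo: "b \<le> (sin (pi / K))\<^sup>2" and yhi: "(sin (pi / K))\<^sup>2 \<le> 49 / 36 * b"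
    using polygon_size[of b] b by auto
  define t where "t = pi / real K"
  have K0: "0 < real K" using K by simp
  have t: "0 < t" "t < pi / 2" unfolding t_def using K K0 pi_gt_zero by (auto simp: field_simps)
  define S where "S = sin t"
  define c where "c = cos t"
  have S: "0 < S" unfolding S_def using t by (intro sin_gt_zero) auto
  have c: "0 < c" "c \<le> 1" unfolding c_def using t by (auto intro: cos_gt_zero)
  define y where "y = S\<^sup>2"
  have y: "b \<le> y" "y \<le> 49 / 36 * b" using ylo yhi unfolding y_def S_def t_def by auto
  have y2: "y \<le> 1853/10000" using y b by simp
  have y0: "0 < y" using y b by simp
  have c2: "c\<^sup>2 = 1 - y" unfolding y_def S_def c_def by (simp add: cos_squared_eq)
  have k0: "0 < \<kappa>"
  proof (rule ccontr)
    assume "\<not> 0 < \<kappa>"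
    hence "\<kappa> * (1 - \<beta>) \<le> 0" using \<beta> by (intro mult_nonpos_nonneg) auto
    thus False using i2 by simp
  qed
  have s4: "s * \<kappa> < 4" using stable \<beta> by simp
  have s_small: "s \<le> 4 / 90 * b"
  proof -
    have "s * 90 \<le> s * (\<kappa> * b)" using i2 s unfolding b_def by (intro mult_left_mono) auto
    also have "\<dots> = (s * \<kappa>) * b" by simp
    also have "\<dots> \<le> 4 * b" using s4 b by (intro mult_right_mono) auto
    finally show ?thesis by simp
  qed
  have s_large: "b / s \<le> 5 / 137 * \<kappa>" using i1 s unfolding b_def by (simp add: field_simps)
  have th: "2 * pi / real K = 2 * t" unfolding t_def by simp
  have cos2: "1 - cos (2 * t) = 2 * y" unfolding y_def S_def by (simp add: cos_double_sin)
  have sin2: "sin (2 * t) = 2 * (S * c)" unfolding S_def c_def by (simp add: sin_double)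
  define g1 where "g1 = (2 - b) * (2 * y) / s - 1"
  define g2 where "g2 = b * (2 * (S * c)) / s"
  have g2: "0 < g2" unfolding g2_def using b S c s by simp
  have g1s: "s * g1 = (2 - b) * (2 * y) - s" unfolding g1_def using s by (simp add: field_simps)
  have g2s: "s * g2 = 2 * b * S * c" unfolding g2_def using s by simp
  have big: "2 * b < 55/100 * (s * g1)"
  proof -
    have "(186393/100000) * b \<le> (2 - b) * y" using b y by (intro mult_mono) auto
    thus ?thesis unfolding g1s using s_small b by simp
  qed
  have g1: "0 < g1"
  proof -
    have "0 < s * g1" using big b by simp
    thus ?thesis using s by (simp add: zero_less_mult_iff)
  qed
  have rat: "g2 / g1 < 55/100 * S"
  proof -
    have "2 * b * S * c \<le> 2 * b * S * 1" using b S c by (intro mult_left_mono) auto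
    also have "\<dots> = (2 * b) * S" by simp
    also have "\<dots> < (55/100 * (s * g1)) * S" using big S by (intro mult_strict_right_mono) auto
    finally have "s * g2 < s * (55/100 * S * g1)" unfolding g2s by (simp add: mult_ac)
    hence "g2 < 55/100 * S * g1" using s by (simp add: mult_less_cancel_left_pos)
    thus ?thesis using g1 by (simp add: divide_less_eq)
  qed
  have rat0: "0 < g2 / g1" using g1 g2 by simp
  define w1 where "w1 = 44/100 * t"
  define w2 where "w2 = 45/100 * t"
  have w: "0 < w1" "w1 < w2" unfolding w1_def w2_def using t by auto
  have w3: "arctan (g2 / g1) + w2 < t"
  proof -
    have "arctan (g2 / g1) \<le> g2 / g1" using rat0 by (intro arctan_le_self) simp
    also have "\<dots> < 55/100 * S" by (rule rat)
    also have "\<dots> \<le> 55/100 * t" unfolding S_def using sin_x_le_x[of t] t by simp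
    finally show ?thesis unfolding w2_def by simp
  qed
  have sw: "44/100 * S \<le> sin w1" unfolding w1_def S_def using t by (intro sin_scale_ge) auto
  have sw0: "0 < sin w1" using sw S by simp
  define m2 where "m2 = 1 / c\<^sup>2 + S\<^sup>2"
  have m2: "0 < m2" "m2 \<le> 14130/10000"
  proof -
    have "1 / c\<^sup>2 \<le> 1 / (8147/10000)" unfolding c2 using y2 by (intro divide_left_mono) auto
    thus "m2 \<le> 14130/10000" unfolding m2_def y_def[symmetric] using y2 by simp
    show "0 < m2" unfolding m2_def using c S by (simp add: add_pos_pos)
  qed
  have m: "sqrt m2 \<le> 1189/1000" by (rule real_le_lsqrt) (use m2 in \<open>auto simp: power2_eq_square\<close>)
  have rS: "S / ((1 - 1/100) * sin w1) \<le> 22958/10000"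
  proof -
    have "S / ((1 - 1/100) * sin w1) \<le> S / ((1 - 1/100) * (44/100 * S))"
      using sw S sw0 by (intro divide_left_mono mult_left_mono mult_pos_pos) auto
    also have "\<dots> \<le> 22958/10000" using S by simp
    finally show ?thesis .
  qed
  \<comment> \<open>The Hessian bound is \<open>X g1\<close>; the two factors are estimated separately.\<close>
  define X where "X = (1 + 1/100)\<^sup>2 * (1 + (g2 / g1)\<^sup>2) * (m2 + sqrt m2 * (S / ((1 - 1/100) * sin w1)))"
  have tan2: "(g2 / g1)\<^sup>2 \<le> 561/10000"
  proof -
    have "(g2 / g1)\<^sup>2 \<le> (55/100 * S)\<^sup>2" using rat rat0 by (intro power_mono) auto
    also have "\<dots> = (55/100)\<^sup>2 * y" unfolding y_def by (simp only: power_mult_distrib)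
    also have "\<dots> \<le> 561/10000" using y2 by (simp add: power2_eq_square)
    finally show ?thesis .
  qed
  have inner0: "0 \<le> sqrt m2 * (S / ((1 - 1/100) * sin w1))" using m2 S sw0 by simp
  have X: "1 \<le> X" "X \<le> 45/10"
  proof -
    have "sqrt m2 * (S / ((1 - 1/100) * sin w1)) \<le> 1189/1000 * (22958/10000)"
      using m rS S sw0 by (intro mult_mono) auto
    hence A: "m2 + sqrt m2 * (S / ((1 - 1/100) * sin w1)) \<le> 4143/1000" using m2 by simp
    have "(1 + 1/100)\<^sup>2 * (1 + (g2 / g1)\<^sup>2) \<le> (1 + 1/100)\<^sup>2 * (10561/10000)" using tan2 by (intro mult_left_mono) auto
    hence Bd: "(1 + 1/100)\<^sup>2 * (1 + (g2 / g1)\<^sup>2) \<le> 10774/10000" by (simp add: power2_eq_square)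
    have "X \<le> 10774/10000 * (4143/1000)" unfolding X_def using A Bd m2 inner0 by (intro mult_mono) auto
    thus "X \<le> 45/10" by simp
    have "0 < c\<^sup>2" "c\<^sup>2 \<le> 1" using c by (auto simp: power_le_one)
    hence "1 \<le> 1 / c\<^sup>2" by simp
    hence "1 \<le> m2" unfolding m2_def by (simp add: add_increasing2)
    hence "1 * 1 * 1 \<le> X" unfolding X_def using inner0
      by (intro mult_mono) (auto simp: power2_eq_square)
    thus "1 \<le> X" by simp
  qed
  have g1up: "g1 \<le> 1988/10000 * \<kappa> - 1"
  proof -
    have "(2 - b) * (2 * y) / s \<le> 2 * (2 * (49/36 * b)) / s"
      using b y s y0 by (intro divide_right_mono mult_mono) auto
    also have "\<dots> = 49/9 * (b / s)" by simp
    also have "\<dots> \<le> 49/9 * (5/137 * \<kappa>)" using s_large by (intro mult_left_mono) auto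
    also have "\<dots> \<le> 1988/10000 * \<kappa>" using k0 by simp
    finally show ?thesis unfolding g1_def by simp
  qed
  have main: "(1 + 1/100)\<^sup>2 * ((g1\<^sup>2 + g2\<^sup>2) / g1) * (m2 + sqrt m2 * (S / ((1 - 1/100) * sin w1))) \<le> \<kappa> - 1"
  proof -
    have "(g1\<^sup>2 + g2\<^sup>2) / g1 = g1 * (1 + (g2 / g1)\<^sup>2)" using g1 by (simp add: field_simps power2_eq_square)
    hence "(1 + 1/100)\<^sup>2 * ((g1\<^sup>2 + g2\<^sup>2) / g1) * (m2 + sqrt m2 * (S / ((1 - 1/100) * sin w1))) = X * g1"
      unfolding X_def by (simp add: mult_ac)
    also have "\<dots> \<le> X * (1988/10000 * \<kappa> - 1)" using g1up X by (intro mult_left_mono) auto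
    also have "\<dots> = X * (1988/10000) * \<kappa> - X" by (simp add: algebra_simps)
    also have "\<dots> \<le> 1 * \<kappa> - 1"
      using X k0 by (intro diff_mono mult_right_mono) auto
    finally show ?thesis by simp
  qed
  have e1: "s * (1 + g1) = (1 + \<beta>) * (1 - cos (2 * t))" unfolding cos2 b(3) using g1s by (simp add: algebra_simps)
  have e2: "s * g2 = (1 - \<beta>) * sin (2 * t)" unfolding sin2 b(3) using g2s by simp
  show ?thesis
    by (rule exI[of _ K], rule exI[of _ "1/100"], rule exI[of _ w1], rule exI[of _ w2], rule exI[of _ g1], rule exI[of _ g2],
        unfold th t_def[symmetric] S_def[symmetric] c_def[symmetric] m2_def[symmetric])
       (intro conjI g1 g2 w w3 main e1 e2, use K in auto)
qed

section \<open>The spectral radius of the quadratic recursion\<close>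

text \<open>The larger modulus of the two roots of \<open>z\<^sup>2 - T z + \<beta>\<close>: complex conjugate roots have product \<open>\<beta>\<close>.\<close>
definition root_mod :: "real \<Rightarrow> real \<Rightarrow> real" where
  "root_mod \<beta> T = (if T\<^sup>2 \<le> 4 * \<beta> then sqrt \<beta> else (\<bar>T\<bar> + sqrt (T\<^sup>2 - 4 * \<beta>)) / 2)"

lemma root_mod_mono:
  assumes "\<bar>T\<bar> \<le> \<bar>T'\<bar>" "0 \<le> \<beta>"
  shows "root_mod \<beta> T \<le> root_mod \<beta> T'"
proof -
  have sq: "T\<^sup>2 \<le> T'\<^sup>2" using power_mono[OF assms(1), of 2] by simp
  have big: "sqrt \<beta> \<le> (\<bar>T'\<bar> + sqrt (T'\<^sup>2 - 4 * \<beta>)) / 2" if "\<not> T'\<^sup>2 \<le> 4 * \<beta>"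
  proof -
    have "sqrt (4 * \<beta>) \<le> sqrt (T'\<^sup>2)" using that by (intro real_sqrt_le_mono) simp
    hence "2 * sqrt \<beta> \<le> \<bar>T'\<bar>" by (simp add: real_sqrt_mult)
    moreover have "0 \<le> sqrt (T'\<^sup>2 - 4 * \<beta>)" using that by simp
    ultimately have "2 * sqrt \<beta> \<le> \<bar>T'\<bar> + sqrt (T'\<^sup>2 - 4 * \<beta>)" by (rule add_increasing2[rotated])
    thus ?thesis by simp
  qed
  show ?thesis
  proof (cases "T\<^sup>2 \<le> 4 * \<beta>")
    case True
    thus ?thesis using big by (simp add: root_mod_def)
  next
    case False
    hence "\<not> T'\<^sup>2 \<le> 4 * \<beta>" using sq by simp
    moreover have "sqrt (T\<^sup>2 - 4 * \<beta>) \<le> sqrt (T'\<^sup>2 - 4 * \<beta>)" using sq by simp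
    ultimately have "(\<bar>T\<bar> + sqrt (T\<^sup>2 - 4 * \<beta>)) / 2 \<le> (\<bar>T'\<bar> + sqrt (T'\<^sup>2 - 4 * \<beta>)) / 2"
      using assms(1) by (intro divide_right_mono add_mono) simp_all
    thus ?thesis using False \<open>\<not> T'\<^sup>2 \<le> 4 * \<beta>\<close> by (simp only: root_mod_def if_False)
  qed
qed

lemma root_mod_ge_sqrt: "0 \<le> \<beta> \<Longrightarrow> sqrt \<beta> \<le> root_mod \<beta> T"
  using root_mod_mono[of 0 T \<beta>] by (simp add: root_mod_def)

lemma quadratic_roots_mod:
  fixes z :: complex and T \<beta> :: real
  assumes \<beta>: "0 \<le> \<beta>" and z: "z\<^sup>2 - T * z + \<beta> = 0"
  shows "norm z \<le> root_mod \<beta> T"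
proof -
  define x where "x = Re z"
  define y where "y = Im z"
  have zz: "z = Complex x y" by (simp add: x_def y_def)
  have re: "x\<^sup>2 - y\<^sup>2 - T * x + \<beta> = 0" and im: "2 * x * y - T * y = 0"
    using z unfolding zz by (auto simp: complex_eq_iff power2_eq_square)
  have nz: "norm z = sqrt (x\<^sup>2 + y\<^sup>2)" unfolding zz by (simp add: complex_norm)
  show ?thesis
  proof (cases "y = 0")
    case False
    have xT: "T = 2 * x" using im False by (simp add: left_diff_distrib[symmetric])
    have "x\<^sup>2 + y\<^sup>2 = \<beta>" using re unfolding xT by (simp add: power2_eq_square)
    hence "norm z = sqrt \<beta>" unfolding nz by simp
    thus ?thesis using root_mod_ge_sqrt[OF \<beta>] by simp
  next
    case True
    have D: "(2 * x - T)\<^sup>2 = T\<^sup>2 - 4 * \<beta>" using re True by (simp add: power2_eq_square algebra_simps)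
    have nx: "norm z = \<bar>x\<bar>" unfolding nz True by simp
    show ?thesis
    proof (cases "T\<^sup>2 \<le> 4 * \<beta>")
      case le: True
      have "(2 * x - T)\<^sup>2 = 0" using D le zero_le_power2[of "2 * x - T"] by linarith
      hence "T = 2 * x" by simp
      hence "x\<^sup>2 = \<beta>" using re True by (simp add: power2_eq_square)
      hence "\<bar>x\<bar> = sqrt \<beta>" using real_sqrt_abs[of x] by simp
      thus ?thesis using root_mod_ge_sqrt[OF \<beta>] nx by simp
    next
      case False
      have "\<bar>2 * x - T\<bar> = sqrt (T\<^sup>2 - 4 * \<beta>)" using real_sqrt_abs[of "2 * x - T"] unfolding D by simp
      hence "2 * \<bar>x\<bar> \<le> \<bar>T\<bar> + sqrt (T\<^sup>2 - 4 * \<beta>)" by linarith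
      thus ?thesis unfolding nx root_mod_def using False by simp
    qed
  qed
qed

lemma quadratic_root_exists:
  fixes T \<beta> :: real
  assumes \<beta>: "0 \<le> \<beta>"
  shows "\<exists>z::complex. z\<^sup>2 - T * z + \<beta> = 0 \<and> norm z = root_mod \<beta> T"
proof (cases "T\<^sup>2 \<le> 4 * \<beta>")
  case True
  define y where "y = sqrt (4 * \<beta> - T\<^sup>2) / 2"
  have y: "y\<^sup>2 = \<beta> - T\<^sup>2 / 4" unfolding y_def using True by (simp add: power_divide)
  have "(Complex (T / 2) y)\<^sup>2 - T * Complex (T / 2) y + \<beta> = 0"
    using y by (simp add: complex_eq_iff power2_eq_square)
  moreover have "norm (Complex (T / 2) y) = sqrt \<beta>" unfolding complex_norm y by (simp add: power_divide)
  ultimately show ?thesis using True by (auto simp: root_mod_def)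
next
  case False
  define D where "D = sqrt (T\<^sup>2 - 4 * \<beta>)"
  have D: "D\<^sup>2 = T\<^sup>2 - 4 * \<beta>" "0 \<le> D" unfolding D_def using False by auto
  define x where "x = (if 0 \<le> T then (T + D) / 2 else (T - D) / 2)"
  have "x\<^sup>2 - T * x + \<beta> = 0" unfolding x_def using D(1) by (simp add: power2_eq_square field_simps)
  hence "(complex_of_real x)\<^sup>2 - T * complex_of_real x + \<beta> = 0"
    by (simp flip: of_real_power of_real_mult of_real_diff of_real_add)
  moreover have "norm (complex_of_real x) = (\<bar>T\<bar> + D) / 2" unfolding x_def using D(2) by auto
  ultimately show ?thesis using False unfolding D_def by (auto simp: root_mod_def)
qed

lemma eigenvalue_A_mat:
  "eigenvalue (map_mat complex_of_real (A_mat l s \<beta>)) z \<longleftrightarrow> z\<^sup>2 - complex_of_real (1 + \<beta> - s * l) * z + \<beta> = 0"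
proof -
  let ?A = "map_mat complex_of_real (A_mat l s \<beta>)"
  define T where "T = complex_of_real (1 + \<beta> - s * l)"
  have dimA: "dim_row ?A = 2" "dim_col ?A = 2" by (simp_all add: A_mat_def mat_of_rows_list_def)
  have carr: "?A \<in> carrier_mat 2 2" using dimA by auto
  have ent: "?A $$ (0,0) = T" "?A $$ (0,1) = - of_real \<beta>" "?A $$ (1,0) = 1" "?A $$ (1,1) = 0"
    by (simp_all add: A_mat_def mat_of_rows_list_def T_def)
  have mv: "vec_index (?A *\<^sub>v v) 0 = T * vec_index v 0 - \<beta> * vec_index v 1"
           "vec_index (?A *\<^sub>v v) 1 = vec_index v 0" if "v \<in> carrier_vec 2" for v
    using that dimA ent by (simp_all add: scalar_prod_def sum.atLeast0_lessThan_Suc numeral_2_eq_2)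
  have "eigenvalue ?A z \<longleftrightarrow> (\<exists>v. v \<in> carrier_vec 2 \<and> v \<noteq> 0\<^sub>v 2 \<and> ?A *\<^sub>v v = z \<cdot>\<^sub>v v)"
    unfolding eigenvalue_def eigenvector_def dimA ..
  also have "\<dots> \<longleftrightarrow> z\<^sup>2 - T * z + \<beta> = 0"
  proof
    assume "\<exists>v. v \<in> carrier_vec 2 \<and> v \<noteq> 0\<^sub>v 2 \<and> ?A *\<^sub>v v = z \<cdot>\<^sub>v v"
    then obtain v where v: "v \<in> carrier_vec 2" "v \<noteq> 0\<^sub>v 2" "?A *\<^sub>v v = z \<cdot>\<^sub>v v" by (elim exE conjE)
    have e0: "T * vec_index v 0 - \<beta> * vec_index v 1 = z * vec_index v 0" and e1: "vec_index v 0 = z * vec_index v 1"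
      using mv[OF v(1)] v(1) unfolding v(3) by auto
    have "vec_index v 1 \<noteq> 0"
    proof
      assume 0: "vec_index v 1 = 0"
      hence "vec_index v 0 = 0" using e1 by simp
      hence "v = 0\<^sub>v 2" using v(1) 0 by (intro eq_vecI) (auto simp: less_2_cases_iff)
      thus False using v(2) by simp
    qed
    moreover have "(z\<^sup>2 - T * z + \<beta>) * vec_index v 1 = 0"
    proof -
      have "(z\<^sup>2 - T * z + \<beta>) * vec_index v 1 = z * (z * vec_index v 1) - (T * (z * vec_index v 1) - \<beta> * vec_index v 1)"
        by (simp add: algebra_simps power2_eq_square)
      thus ?thesis using e0 unfolding e1[symmetric] by simp
    qed
    ultimately show "z\<^sup>2 - T * z + \<beta> = 0" by simp
  next
    assume z: "z\<^sup>2 - T * z + \<beta> = 0"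
    define v where "v = vec 2 (\<lambda>i. if i = 0 then z else (1 :: complex))"
    have v: "v \<in> carrier_vec 2" "vec_index v 0 = z" "vec_index v 1 = 1" by (simp_all add: v_def)
    have "T * z - \<beta> = z * z - (z\<^sup>2 - T * z + \<beta>)" by (simp add: power2_eq_square)
    hence "T * z - \<beta> = z * z" unfolding z by simp
    hence Av: "?A *\<^sub>v v = z \<cdot>\<^sub>v v"
      using mv[OF v(1)] v dimA by (intro eq_vecI) (auto simp: less_2_cases_iff)
    have vn: "v \<noteq> 0\<^sub>v 2"
    proof
      assume "v = 0\<^sub>v 2"
      hence "vec_index v 1 = 0" by simp
      thus False using v(3) by simp
    qed
    show "\<exists>v. v \<in> carrier_vec 2 \<and> v \<noteq> 0\<^sub>v 2 \<and> ?A *\<^sub>v v = z \<cdot>\<^sub>v v"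
      by (rule exI[of _ v], rule conjI[OF v(1) conjI[OF vn Av]])
  qed
  finally show ?thesis unfolding T_def .
qed

lemma spectral_radius_A_mat:
  assumes "0 \<le> \<beta>"
  shows "spectral_radius (map_mat complex_of_real (A_mat l s \<beta>)) = root_mod \<beta> (1 + \<beta> - s * l)"
proof -
  let ?A = "map_mat complex_of_real (A_mat l s \<beta>)"
  have carr: "?A \<in> carrier_mat 2 2" by (auto simp: A_mat_def mat_of_rows_list_def)
  have spec: "spectrum ?A = {z. z\<^sup>2 - complex_of_real (1 + \<beta> - s * l) * z + \<beta> = 0}"
    unfolding spectrum_def using eigenvalue_A_mat by auto
  have fin: "finite (spectrum ?A)" using card_finite_spectrum(1)[OF carr] .
  show ?thesis unfolding spectral_radius_def
  proof (rule Max_eqI)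
    show "finite (norm ` spectrum ?A)" using fin by simp
    show "r \<le> root_mod \<beta> (1 + \<beta> - s * l)" if "r \<in> norm ` spectrum ?A" for r
      using that quadratic_roots_mod[OF assms] unfolding spec by auto
    show "root_mod \<beta> (1 + \<beta> - s * l) \<in> norm ` spectrum ?A"
      using quadratic_root_exists[OF assms, of "1 + \<beta> - s * l"] unfolding spec by force
  qed
qed

text \<open>The modulus increases with \<open>\<bar>1 + \<beta> - s l\<bar>\<close>, a convex function of \<open>l\<close>, so the maximum sits at an endpoint of the interval.\<close>
lemma rho_q_endpoint:
  assumes \<beta>: "0 \<le> \<beta>" and \<kappa>: "1 \<le> \<kappa>"
  shows "\<exists>l\<in>{1, \<kappa>}. rho_q s \<beta> \<kappa> = root_mod \<beta> (1 + \<beta> - s * l) \<and>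
           (\<forall>l'\<in>{1..\<kappa>}. root_mod \<beta> (1 + \<beta> - s * l') \<le> rho_q s \<beta> \<kappa>)"
proof -
  define T where "T l = 1 + \<beta> - s * l" for l
  define l where "l = (if \<bar>T \<kappa>\<bar> \<le> \<bar>T 1\<bar> then 1 else \<kappa>)"
  have l: "l \<in> {1, \<kappa>}" "\<bar>T 1\<bar> \<le> \<bar>T l\<bar>" "\<bar>T \<kappa>\<bar> \<le> \<bar>T l\<bar>" unfolding l_def by auto
  have bd: "\<bar>T l'\<bar> \<le> \<bar>T l\<bar>" if "l' \<in> {1..\<kappa>}" for l'
  proof -
    have "s * l' \<le> s * \<kappa> \<and> s * 1 \<le> s * l' \<or> s * \<kappa> \<le> s * l' \<and> s * l' \<le> s * 1"
    proof (cases "0 \<le> s")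
      case True
      thus ?thesis using that mult_left_mono[of l' \<kappa> s] mult_left_mono[of 1 l' s] by simp
    next
      case False
      thus ?thesis using that mult_left_mono_neg[of l' \<kappa> s] mult_left_mono_neg[of 1 l' s] by simp
    qed
    hence "\<bar>T l'\<bar> \<le> max \<bar>T 1\<bar> \<bar>T \<kappa>\<bar>" unfolding T_def by auto
    also have "\<dots> \<le> \<bar>T l\<bar>" using l(2,3) by (rule max.boundedI)
    finally show ?thesis .
  qed
  have "rho_q s \<beta> \<kappa> = root_mod \<beta> (T l)"
    unfolding rho_q_def spectral_radius_A_mat[OF \<beta>] T_def[symmetric]
  proof (rule Greatest_equality)
    show "root_mod \<beta> (T l) \<in> (\<lambda>l. root_mod \<beta> (T l)) ` {1..\<kappa>}" using l \<kappa> by auto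
    show "y \<le> root_mod \<beta> (T l)" if "y \<in> (\<lambda>l. root_mod \<beta> (T l)) ` {1..\<kappa>}" for y
      using that bd \<beta> by (auto intro: root_mod_mono)
  qed
  thus ?thesis using l(1) bd \<beta> unfolding T_def by (intro bexI[of _ l]) (auto intro: root_mod_mono)
qed

text \<open>The modulus is at least the square root of the product of the roots; and a monic polynomial is positive to the right of
  its real roots.\<close>
lemma root_mod_less_imp:
  fixes q \<beta> T :: real
  assumes "0 \<le> \<beta>" "0 < q" "root_mod \<beta> T < q"
  shows "\<beta> < q\<^sup>2" "T * q < q\<^sup>2 + \<beta>"
proof -
  have sq: "sqrt \<beta> < q" using root_mod_ge_sqrt[OF assms(1), of T] assms(3) by linarith
  hence "(sqrt \<beta>)\<^sup>2 < q\<^sup>2" using assms(1) by (intro power_strict_mono) auto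
  thus b: "\<beta> < q\<^sup>2" using assms(1) by simp
  show "T * q < q\<^sup>2 + \<beta>"
  proof (cases "T\<^sup>2 \<le> 4 * \<beta>")
    case True
    have "\<bar>T\<bar> = sqrt (T\<^sup>2)" by simp
    also have "\<dots> \<le> sqrt (4 * \<beta>)" using True by (rule real_sqrt_le_mono)
    finally have "T \<le> 2 * sqrt \<beta>" by (simp add: real_sqrt_mult)
    hence "T * q \<le> 2 * sqrt \<beta> * q" using assms(2) by (intro mult_right_mono) auto
    also have "\<dots> < q\<^sup>2 + \<beta>"
    proof -
      have "0 < (q - sqrt \<beta>)\<^sup>2" using sq by simp
      thus ?thesis using assms(1) by (simp add: power2_diff algebra_simps)
    qed
    finally show ?thesis .
  next
    case False
    define D where "D = sqrt (T\<^sup>2 - 4 * \<beta>)"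
    have D: "D\<^sup>2 = T\<^sup>2 - 4 * \<beta>" "0 \<le> D" unfolding D_def using False by auto
    have "\<bar>T\<bar> + D < 2 * q" using assms(3) False unfolding root_mod_def D_def by simp
    hence "D < 2 * q - T" by linarith
    hence "D\<^sup>2 < (2 * q - T)\<^sup>2" using D(2) by (intro power_strict_mono) auto
    thus ?thesis unfolding D(1) by (simp add: power2_eq_square algebra_simps)
  qed
qed

text \<open>The stability triangle of a quadratic polynomial.\<close>
lemma root_mod_less_1:
  assumes "0 < \<beta>" "\<beta> < 1" "\<bar>T\<bar> < 1 + \<beta>"
  shows "0 < root_mod \<beta> T" "root_mod \<beta> T < 1"
proof -
  show "0 < root_mod \<beta> T" using root_mod_ge_sqrt[OF less_imp_le[OF assms(1)], of T] real_sqrt_gt_zero[OF assms(1)] assms(1) by linarith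
  show "root_mod \<beta> T < 1"
  proof (cases "T\<^sup>2 \<le> 4 * \<beta>")
    case True
    thus ?thesis using assms by (simp add: root_mod_def)
  next
    case False
    have "T\<^sup>2 - 4 * \<beta> < (2 - \<bar>T\<bar>)\<^sup>2"
      using assms(3) by (simp add: power2_diff)
    hence "sqrt (T\<^sup>2 - 4 * \<beta>) < sqrt ((2 - \<bar>T\<bar>)\<^sup>2)" by (rule real_sqrt_less_mono)
    also have "sqrt ((2 - \<bar>T\<bar>)\<^sup>2) = 2 - \<bar>T\<bar>" using assms by simp
    finally show ?thesis using False by (simp add: root_mod_def)
  qed
qed

section \<open>Exact total variation rate for quadratic potentials\<close>

lemma grad_quadratic: "grad (\<lambda>x::'a::euclidean_space. l * (norm x)\<^sup>2 / 2) = (\<lambda>x. l *\<^sub>R x)"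
proof (rule grad_eqI)
  fix x :: 'a
  have "((\<lambda>x::'a. l * (norm x)\<^sup>2 / 2) has_derivative (\<lambda>v. l * (2 * inner x v) / 2)) (at x)"
    unfolding power2_norm_eq_inner
    by (rule has_derivative_eq_rhs, (rule derivative_eq_intros refl)+) (auto simp: inner_commute)
  thus "((\<lambda>x::'a. l * (norm x)\<^sup>2 / 2) has_derivative (\<lambda>v. inner (l *\<^sub>R x) v)) (at x)" by simp
qed

lemma integral_baoab_kernel:
  fixes U :: "'a::euclidean_space \<Rightarrow> real"
  assumes st: "baoab_step h \<gamma> U z \<in> borel_measurable borel"
    and f: "f \<in> borel_measurable borel"
  shows "(\<integral>y. f y \<partial>baoab_kernel h \<gamma> U z) = (\<integral>\<xi>. (f (baoab_step h \<gamma> U z \<xi>) :: real) \<partial>std_gaussian)"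
  unfolding baoab_kernel_def
  by (rule integral_distr) (use st f in \<open>simp_all add: measurable_cong_borel[OF sets_std_gaussian]\<close>)

lemma baoab_step_measurable:
  fixes U :: "'a::euclidean_space \<Rightarrow> real"
  assumes "grad U = g" "continuous_on UNIV g"
  shows "baoab_step h \<gamma> U z \<in> borel_measurable borel"
proof (rule borel_measurable_continuous_onI)
  show "continuous_on UNIV (baoab_step h \<gamma> U z)"
    unfolding baoab_step_def[abs_def] Let_def assms(1)
    by (intro continuous_intros continuous_on_compose2[OF assms(2)]) auto
qed

lemma sin_ge_half: "0 \<le> x \<Longrightarrow> x \<le> 1 \<Longrightarrow> x / 2 \<le> sin x" for x :: real
proof -
  assume x: "0 \<le> x" "x \<le> 1"
  have "sin 0 - 0 / 2 \<le> sin x - x / 2"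
  proof (rule mono_of_deriv_nonneg[where f="\<lambda>x. sin x - x / 2" and f'="\<lambda>x. cos x - 1 / 2", OF x(1)])
    show "((\<lambda>x. sin x - x / 2) has_real_derivative cos u - 1 / 2) (at u)" for u
      by (auto intro!: derivative_eq_intros)
    show "0 \<le> cos u - 1 / 2" if "0 \<le> u" "u \<le> x" for u
    proof -
      have "cos (pi / 3) \<le> cos u" using that x pi_gt3 by (intro cos_monotone_0_pi_le) auto
      thus ?thesis by (simp add: cos_60)
    qed
  qed
  thus ?thesis by simp
qed

text \<open>Tested against the sine of a linear functional, the \<open>n\<close>-step law shows the deterministic phase with an amplitude
  \<open>exp (- S)\<close> that does not decay in \<open>n\<close>.  Pulling the functional back through one step is again a heavy-ball step, in the
  coefficients \<open>(p, r)\<close>, so the functionals decay geometrically and the noise they collect has a finite sum.\<close>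
lemma quadratic_fourier_lower:
  fixes l \<beta> h \<gamma> s T k \<tau> \<rho> c C :: real and \<zeta> :: complex
  assumes h: "h > 0" and \<beta>: "\<beta> = exp (- \<gamma> * h)" "0 < \<beta>" and s: "s = h\<^sup>2 / 2 * (1 + \<beta>)" and T: "T = 1 + \<beta> - s * l"
    and \<zeta>: "\<zeta>\<^sup>2 = T * \<zeta> - \<beta>"
    and ly: "0 \<le> \<rho>" "\<rho> < 1" "0 < c" and lyc: "\<And>a b::real^2. c * ((norm a)\<^sup>2 + (norm b)\<^sup>2) \<le> lyap k \<tau> a b"
    and lys: "\<And>a b e f::real^2. lyap k \<tau> (T *\<^sub>R a - \<beta> *\<^sub>R b + e) (a + f) \<le> \<rho> * lyap k \<tau> a b + C * ((norm e)\<^sup>2 + (norm f)\<^sup>2)"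
  defines "U \<equiv> (\<lambda>x::real^2. l * (norm x)\<^sup>2 / 2)"
  shows "\<exists>D\<ge>0. \<forall>n p r. \<exists>S. 0 \<le> S \<and> S \<le> D * lyap k \<tau> p r \<and>
    (\<forall>z w. next_pos h \<beta> (\<lambda>x. l *\<^sub>R x) z = of_C (w * \<zeta>) \<longrightarrow> fst z = of_C w \<longrightarrow>
       (\<integral>y. sin (inner p (next_pos h \<beta> (\<lambda>x. l *\<^sub>R x) y) - \<beta> * inner r (fst y)) \<partial>law_from (baoab_kernel h \<gamma> U) z n)
        = exp (- S) * sin (inner p (of_C (w * \<zeta> ^ Suc n)) - \<beta> * inner r (of_C (w * \<zeta> ^ n))))"
proof -
  define g where "g = (\<lambda>x::real^2. l *\<^sub>R x)"
  have gU: "grad U = g" unfolding U_def g_def by (rule grad_quadratic)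
  have gc: "continuous_on UNIV g" unfolding g_def by (intro continuous_intros)
  define Q where "Q = baoab_kernel h \<gamma> U"
  have Qk: "Q \<in> borel \<rightarrow>\<^sub>M prob_algebra borel"
    unfolding Q_def by (rule baoab_kernel_measurable[OF gU gc prob_space_std_gaussian])
  define \<sigma> where "\<sigma> = noise_scale h \<beta>"
  let ?a = "next_pos h \<beta> g"
  note st = baoab_step_coordinates[OF gU h \<beta>(1)]
  define F where "F p r y = sin (inner p (?a y) - \<beta> * inner r (fst y))" for p r y
  have am: "?a \<in> borel_measurable borel"
    unfolding next_pos_def[abs_def] g_def by (intro borel_measurable_continuous_onI continuous_intros)
  have Fm[measurable]: "F p r \<in> borel_measurable borel" for p r
    unfolding F_def[abs_def] next_pos_def g_def by (intro borel_measurable_continuous_onI continuous_intros)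
  \<comment> \<open>The functional \<open>(p, r)\<close> reads the noise of a step through this vector.\<close>
  define E where "E p r = (\<sigma> *\<^sub>R ((T + 1) *\<^sub>R p - \<beta> *\<^sub>R r))" for p r :: "real^2"
  have one: "(\<integral>y. F p r y \<partial>Q z) = exp (- (norm (E p r))\<^sup>2 / 2) * F (T *\<^sub>R p - \<beta> *\<^sub>R r) p z" for p r z
  proof -
    have "F p r (baoab_step h \<gamma> U z \<xi>) = sin ((inner (T *\<^sub>R p - \<beta> *\<^sub>R r) (?a z) - \<beta> * inner p (fst z)) + inner (E p r) \<xi>)" for \<xi>
    proof -
      have x: "fst (baoab_step h \<gamma> U z \<xi>) = ?a z + \<sigma> *\<^sub>R \<xi>" unfolding st(1) \<sigma>_def ..
      have sl: "(h\<^sup>2 / 2 * (1 + \<beta>)) *\<^sub>R g u = (1 + \<beta> - T) *\<^sub>R u" for u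
        unfolding s[symmetric] g_def T by (simp add: mult.commute)
      have a: "?a (baoab_step h \<gamma> U z \<xi>) = T *\<^sub>R (?a z + \<sigma> *\<^sub>R \<xi>) - \<beta> *\<^sub>R fst z + \<sigma> *\<^sub>R \<xi>"
        unfolding st(3) x sl \<sigma>_def by (simp add: algebra_simps)
      show ?thesis unfolding F_def x a E_def
        by (rule arg_cong[where f=sin]) (simp add: inner_add inner_diff inner_commute algebra_simps)
    qed
    hence "(\<integral>y. F p r y \<partial>Q z) = (\<integral>\<xi>. sin ((inner (T *\<^sub>R p - \<beta> *\<^sub>R r) (?a z) - \<beta> * inner p (fst z)) + inner (E p r) \<xi>) \<partial>std_gaussian)"
      unfolding Q_def by (subst integral_baoab_kernel[OF baoab_step_measurable[OF gU gc] Fm]) simp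
    thus ?thesis unfolding gaussian_integral_sin F_def .
  qed
  define C' where "C' = \<sigma>\<^sup>2 * ((T + 1)\<^sup>2 + \<beta>\<^sup>2) / c"
  have C'0: "0 \<le> C'" unfolding C'_def using ly by simp
  have Eb: "(norm (E p r))\<^sup>2 / 2 \<le> C' * lyap k \<tau> p r" for p r
  proof -
    have "norm ((T + 1) *\<^sub>R p - \<beta> *\<^sub>R r) \<le> \<bar>T + 1\<bar> * norm p + \<beta> * norm r"
      using norm_triangle_ineq4[of "(T + 1) *\<^sub>R p" "\<beta> *\<^sub>R r"] \<beta>(2) by simp
    hence "(norm ((T + 1) *\<^sub>R p - \<beta> *\<^sub>R r))\<^sup>2 \<le> (\<bar>T + 1\<bar> * norm p + \<beta> * norm r)\<^sup>2" by (intro power_mono) auto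
    also have "\<dots> \<le> ((T + 1)\<^sup>2 + \<beta>\<^sup>2) * ((norm p)\<^sup>2 + (norm r)\<^sup>2)"
    proof -
      have "0 \<le> (\<bar>T + 1\<bar> * norm r - \<beta> * norm p)\<^sup>2" by simp
      moreover have "(\<bar>T + 1\<bar>)\<^sup>2 = (T + 1)\<^sup>2" by simp
      ultimately show ?thesis by (simp add: power2_eq_square algebra_simps)
    qed
    finally have "(norm (E p r))\<^sup>2 \<le> \<sigma>\<^sup>2 * (((T + 1)\<^sup>2 + \<beta>\<^sup>2) * ((norm p)\<^sup>2 + (norm r)\<^sup>2))"
      unfolding E_def by (simp add: power_mult_distrib mult_left_mono)
    also have "\<dots> \<le> \<sigma>\<^sup>2 * (((T + 1)\<^sup>2 + \<beta>\<^sup>2) * (lyap k \<tau> p r / c))"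
      using lyc[of p r] ly by (intro mult_left_mono) (auto simp: field_simps)
    also have "\<dots> = C' * lyap k \<tau> p r" by (simp add: C'_def)
    finally show ?thesis using zero_le_power2[of "norm (E p r)"] by linarith
  qed
  define D where "D = C' / (1 - \<rho>)"
  have D: "0 \<le> D" "C' + D * \<rho> = D" unfolding D_def using C'0 ly by (auto simp: field_simps)
  have lyn: "0 \<le> lyap k \<tau> p r" for p r :: "real^2"
    using lyc[of p r] ly by (smt (verit) mult_nonneg_nonneg zero_le_power2)
  have main: "\<exists>S. 0 \<le> S \<and> S \<le> D * lyap k \<tau> p r \<and>
    (\<forall>z w. ?a z = of_C (w * \<zeta>) \<longrightarrow> fst z = of_C w \<longrightarrow>
       (\<integral>y. F p r y \<partial>law_from Q z n) = exp (- S) * sin (inner p (of_C (w * \<zeta> ^ Suc n)) - \<beta> * inner r (of_C (w * \<zeta> ^ n))))" for n p r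
  proof (induction n arbitrary: p r)
    case 0
    have "(\<integral>y. F p r y \<partial>law_from Q z 0) = F p r z" for z
      unfolding law_from_0 by (rule integral_return) auto
    thus ?case using D(1) lyn[of p r] by (intro exI[of _ 0]) (auto simp: F_def)
  next
    case (Suc n)
    obtain S where S: "0 \<le> S" "S \<le> D * lyap k \<tau> (T *\<^sub>R p - \<beta> *\<^sub>R r) p"
      "\<And>z w. ?a z = of_C (w * \<zeta>) \<Longrightarrow> fst z = of_C w \<Longrightarrow>
       (\<integral>y. F (T *\<^sub>R p - \<beta> *\<^sub>R r) p y \<partial>law_from Q z n) = exp (- S) * sin (inner (T *\<^sub>R p - \<beta> *\<^sub>R r) (of_C (w * \<zeta> ^ Suc n)) - \<beta> * inner p (of_C (w * \<zeta> ^ n)))"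
      using Suc[of "T *\<^sub>R p - \<beta> *\<^sub>R r" p] by (elim exE conjE) blast
    define S' where "S' = (norm (E p r))\<^sup>2 / 2 + S"
    have S': "0 \<le> S'" "S' \<le> D * lyap k \<tau> p r"
    proof -
      show "0 \<le> S'" unfolding S'_def using S(1) by simp
      have "lyap k \<tau> (T *\<^sub>R p - \<beta> *\<^sub>R r) p \<le> \<rho> * lyap k \<tau> p r" using lys[of p r 0 0] by simp
      hence "S \<le> D * (\<rho> * lyap k \<tau> p r)" using S(2) D(1) by (meson mult_left_mono order_trans)
      hence "S' \<le> C' * lyap k \<tau> p r + D * (\<rho> * lyap k \<tau> p r)" unfolding S'_def using Eb[of p r] by linarith
      also have "\<dots> = (C' + D * \<rho>) * lyap k \<tau> p r" by (simp add: algebra_simps)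
      finally show "S' \<le> D * lyap k \<tau> p r" unfolding D(2) .
    qed
    have "(\<integral>y. F p r y \<partial>law_from Q z (Suc n)) = exp (- S') * sin (inner p (of_C (w * \<zeta> ^ Suc (Suc n))) - \<beta> * inner r (of_C (w * \<zeta> ^ Suc n)))"
      if z: "?a z = of_C (w * \<zeta>)" "fst z = of_C w" for z w
    proof -
      have "(\<integral>y. F p r y \<partial>law_from Q z (Suc n)) = (\<integral>y. (\<integral>u. F p r u \<partial>Q y) \<partial>law_from Q z n)"
        unfolding law_from_Suc
        by (rule integral_bind_kernel[OF Qk kernel_prob(3)[OF measurable_law_from[OF Qk]] Fm, where B=1]) (simp add: F_def)
      also have "\<dots> = exp (- (norm (E p r))\<^sup>2 / 2) * (\<integral>y. F (T *\<^sub>R p - \<beta> *\<^sub>R r) p y \<partial>law_from Q z n)"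
        unfolding one by simp
      also have "\<dots> = exp (- S') * sin (inner (T *\<^sub>R p - \<beta> *\<^sub>R r) (of_C (w * \<zeta> ^ Suc n)) - \<beta> * inner p (of_C (w * \<zeta> ^ n)))"
        unfolding S(3)[OF z] S'_def by (simp add: exp_add[symmetric] mult.assoc[symmetric])
      also have "inner (T *\<^sub>R p - \<beta> *\<^sub>R r) (of_C (w * \<zeta> ^ Suc n)) - \<beta> * inner p (of_C (w * \<zeta> ^ n))
          = inner p (of_C (w * \<zeta> ^ Suc (Suc n))) - \<beta> * inner r (of_C (w * \<zeta> ^ Suc n))"
      proof -
        have "w * \<zeta> ^ Suc (Suc n) = w * \<zeta> ^ n * \<zeta>\<^sup>2" by (simp add: power2_eq_square)
        also have "\<dots> = T *\<^sub>R (w * \<zeta> ^ Suc n) - \<beta> *\<^sub>R (w * \<zeta> ^ n)"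
          unfolding \<zeta> by (simp add: scaleR_conv_of_real algebra_simps)
        finally have "of_C (w * \<zeta> ^ Suc (Suc n)) = T *\<^sub>R of_C (w * \<zeta> ^ Suc n) - \<beta> *\<^sub>R of_C (w * \<zeta> ^ n)"
          by (simp only: linear_diff[OF linear_of_C] linear_scale[OF linear_of_C])
        hence "inner p (of_C (w * \<zeta> ^ Suc (Suc n))) = T * inner p (of_C (w * \<zeta> ^ Suc n)) - \<beta> * inner p (of_C (w * \<zeta> ^ n))"
          by (simp only: inner_diff_right inner_scaleR_right)
        thus ?thesis by (simp only: inner_diff_left inner_scaleR_left)
      qed
      finally show ?thesis .
    qed
    thus ?case using S' by (intro exI[of _ S'] conjI allI impI)
  qed
  show ?thesis
    by (rule exI[of _ D], intro conjI allI D(1)) (use main in \<open>simp only: F_def Q_def g_def\<close>)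
qed

text \<open>A state difference along the eigenvector is multiplied by \<open>\<zeta>\<close> in every step when both chains use the same noise.  In the last two
  steps, shifting the two noises by amounts proportional to the current difference makes the chains meet exactly;
  the shifts cost total variation proportional to their size.\<close>
lemma quadratic_shift_upper:
  fixes l \<beta> h \<gamma> s T :: real and \<zeta> :: complex
  assumes h: "h > 0" and \<beta>: "\<beta> = exp (- \<gamma> * h)" "0 < \<beta>" "\<beta> < 1" and s: "s = h\<^sup>2 / 2 * (1 + \<beta>)" and T: "T = 1 + \<beta> - s * l" "\<bar>T\<bar> < 1 + \<beta>"
    and \<zeta>: "\<zeta>\<^sup>2 = T * \<zeta> - \<beta>"
  defines "U \<equiv> (\<lambda>x::real^2. l * (norm x)\<^sup>2 / 2)"
  shows "\<exists>C\<ge>0. \<forall>n z z' w A. A \<in> sets borel \<longrightarrow> next_pos h \<beta> (\<lambda>x. l *\<^sub>R x) z' - next_pos h \<beta> (\<lambda>x. l *\<^sub>R x) z = of_C (w * \<zeta>) \<longrightarrow>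
      fst z' - fst z = of_C w \<longrightarrow>
     \<bar>measure (law_from (baoab_kernel h \<gamma> U) z (Suc (Suc n))) A - measure (law_from (baoab_kernel h \<gamma> U) z' (Suc (Suc n))) A\<bar> \<le> C * norm (w * \<zeta> ^ n)"
proof -
  define g where "g = (\<lambda>x::real^2. l *\<^sub>R x)"
  have gU: "grad U = g" unfolding U_def g_def by (rule grad_quadratic)
  have gc: "continuous_on UNIV g" unfolding g_def by (intro continuous_intros)
  define Q where "Q = baoab_kernel h \<gamma> U"
  have Qk: "Q \<in> borel \<rightarrow>\<^sub>M prob_algebra borel"
    unfolding Q_def by (rule baoab_kernel_measurable[OF gU gc prob_space_std_gaussian])
  define \<sigma> where "\<sigma> = noise_scale h \<beta>"
  have \<sigma>: "0 < \<sigma>" unfolding \<sigma>_def noise_scale_def using h \<beta> by (simp add: power_less_one_iff abs_square_less_1)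
  let ?a = "next_pos h \<beta> g" and ?st = "baoab_step h \<gamma> U"
  have x: "fst (?st z \<xi>) = ?a z + \<sigma> *\<^sub>R \<xi>" for z \<xi>
    unfolding baoab_step_coordinates(1)[OF gU h \<beta>(1)] \<sigma>_def ..
  have sl: "(h\<^sup>2 / 2 * (1 + \<beta>)) *\<^sub>R g u = (1 + \<beta> - T) *\<^sub>R u" for u
    unfolding s[symmetric] g_def T by (simp add: mult.commute)
  have a: "?a (?st z \<xi>) = T *\<^sub>R (?a z + \<sigma> *\<^sub>R \<xi>) - \<beta> *\<^sub>R fst z + \<sigma> *\<^sub>R \<xi>" for z \<xi>
    unfolding baoab_step_coordinates(3)[OF gU h \<beta>(1)] x sl \<sigma>_def by (simp add: algebra_simps)
  have inj: "z = z'" if "fst z = fst z'" "?a z = ?a z'" for z z'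
  proof -
    have "(h / 2 * (1 + \<beta>)) *\<^sub>R (snd z - (h / 2) *\<^sub>R g (fst z')) = (h / 2 * (1 + \<beta>)) *\<^sub>R (snd z' - (h / 2) *\<^sub>R g (fst z'))"
      using that unfolding next_pos_def by simp
    hence "(h / 2 * (1 + \<beta>)) *\<^sub>R ((snd z - (h / 2) *\<^sub>R g (fst z')) - (snd z' - (h / 2) *\<^sub>R g (fst z'))) = 0"
      by (simp only: scaleR_right_diff_distrib right_minus_eq)
    moreover have "h / 2 * (1 + \<beta>) \<noteq> 0"
      by (rule less_imp_neq[symmetric]) (use h \<beta>(2) in \<open>intro mult_pos_pos; simp\<close>)
    ultimately have "(snd z - (h / 2) *\<^sub>R g (fst z')) - (snd z' - (h / 2) *\<^sub>R g (fst z')) = 0"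
      by (simp only: scaleR_eq_0_iff simp_thms)
    hence "snd z = snd z'" by simp
    thus ?thesis using that(1) by (simp add: prod_eq_iff)
  qed
  have stm: "?st z \<in> borel_measurable borel" for z by (rule baoab_step_measurable[OF gU gc])
  have stm': "?st z \<in> std_gaussian \<rightarrow>\<^sub>M borel" for z using stm by (simp add: measurable_cong_borel[OF sets_std_gaussian])
  have meas: "measure (Q z) A = measure std_gaussian {\<xi>. ?st z \<xi> \<in> A}" if "A \<in> sets borel" for z A
    unfolding Q_def baoab_kernel_def using that by (subst measure_distr[OF stm']) (auto simp: vimage_def)
  have front: "measure (law_from Q z (Suc n)) A = (\<integral>\<xi>. measure (law_from Q (?st z \<xi>) n) A \<partial>std_gaussian)"
    if A: "A \<in> sets borel" for z n A
  proof -
    have "measure (law_from Q z (Suc n)) A = (\<integral>y. measure (law_from Q y n) A \<partial>Q z)"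
      unfolding law_from_Suc_front[OF Qk]
      by (rule measure_bind_kernel[OF measurable_law_from[OF Qk] kernel_prob(3)[OF Qk] A])
    thus ?thesis unfolding Q_def
      by (subst (asm) integral_baoab_kernel[OF stm measurable_kernel_measure[OF measurable_law_from[OF Qk[unfolded Q_def]] A]])
  qed
  have lawm: "(\<lambda>\<xi>. measure (law_from Q (?st z \<xi>) n) A) \<in> borel_measurable borel" if "A \<in> sets borel" for z n A
    by (rule measurable_compose[OF stm measurable_kernel_measure[OF measurable_law_from[OF Qk] that]])
  have law1: "0 \<le> measure (law_from Q z n) A" "measure (law_from Q z n) A \<le> 1" for z n A
    using measure_set_le_1[OF kernel_prob(1)[OF measurable_law_from[OF Qk]]] by auto
  obtain Cg where Cg: "Cg \<ge> 0" "\<And>(e::real^2) A. A \<in> sets borel \<Longrightarrow>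
     \<bar>measure std_gaussian {\<xi>. \<xi> \<in> A} - measure std_gaussian {\<xi>. \<xi> + e \<in> A}\<bar> \<le> Cg * norm e"
    using gaussian_shift_tv[where 'a="real^2"] by blast
  have gU1: "measure (std_gaussian :: (real^2) measure) UNIV = 1"
    using prob_space.prob_space[OF prob_space_std_gaussian[where 'a="real^2"]] by simp
  \<comment> \<open>The two shifts solve a linear system: the new positions and the new predictions have to agree after the second step.\<close>
  define c1 where "c1 = - ((T + \<beta>) * \<zeta> - \<beta>) / (complex_of_real (T + 1 + \<beta>) * complex_of_real \<sigma>)"
  define c2 where "c2 = - ((T * \<zeta> - \<beta>) + (T + 1) * \<sigma> * c1) / \<sigma>"
  define C where "C = Cg * (norm c1 + norm c2)"
  have C0: "0 \<le> C" unfolding C_def using Cg(1) by simp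
  have base: "measure (law_from Q z 2) A - measure (law_from Q z' 2) A \<le> C * norm w"
    if A: "A \<in> sets borel" and za: "?a z' - ?a z = of_C (w * \<zeta>)" and zf: "fst z' - fst z = of_C w" for z z' w A
  proof -
    define e1 where "e1 = of_C (w * c1)"
    define e2 where "e2 = of_C (w * c2)"
    have T1: "complex_of_real (T + 1 + \<beta>) \<noteq> 0" using T(2) by (simp only: of_real_eq_0_iff)
    have s1: "\<sigma> *\<^sub>R e1 = of_C (w * (\<sigma> * c1))" "\<sigma> *\<^sub>R e2 = of_C (w * (\<sigma> * c2))"
      unfolding e1_def e2_def linear_scale[OF linear_of_C, symmetric] by (simp_all add: scaleR_conv_of_real mult_ac)
    have k1: "complex_of_real (T + 1 + \<beta>) * (complex_of_real \<sigma> * c1) = - ((T + \<beta>) * \<zeta> - \<beta>)"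
      unfolding c1_def using T1 \<sigma> by (simp del: of_real_add)
    have k2: "\<sigma> * c2 = - ((T * \<zeta> - \<beta>) + (T + 1) * (\<sigma> * c1))" unfolding c2_def using \<sigma> by simp
    have D1: "fst (?st z' (\<xi> + e1)) - fst (?st z \<xi>) = of_C (w * (\<zeta> + \<sigma> * c1))" for \<xi>
    proof -
      have "fst (?st z' (\<xi> + e1)) - fst (?st z \<xi>) = (?a z' - ?a z) + \<sigma> *\<^sub>R e1" unfolding x by (simp add: algebra_simps)
      thus ?thesis unfolding za s1 linear_add[OF linear_of_C, symmetric] by (simp add: algebra_simps)
    qed
    have D2: "?a (?st z' (\<xi> + e1)) - ?a (?st z \<xi>) = of_C (- (w * (\<sigma> * c2)))" for \<xi>
    proof -
      have "?a (?st z' (\<xi> + e1)) - ?a (?st z \<xi>) = T *\<^sub>R (?a z' - ?a z) - \<beta> *\<^sub>R (fst z' - fst z) + (T + 1) *\<^sub>R (\<sigma> *\<^sub>R e1)"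
        unfolding a by (simp add: algebra_simps)
      also have "\<dots> = of_C (T *\<^sub>R (w * \<zeta>) - \<beta> *\<^sub>R w + (T + 1) *\<^sub>R (w * (\<sigma> * c1)))"
        unfolding za zf s1 by (simp only: linear_diff[OF linear_of_C] linear_add[OF linear_of_C] linear_scale[OF linear_of_C])
      also have "T *\<^sub>R (w * \<zeta>) - \<beta> *\<^sub>R w + (T + 1) *\<^sub>R (w * (\<sigma> * c1)) = - (w * (\<sigma> * c2))"
        unfolding k2 by (simp add: scaleR_conv_of_real algebra_simps)
      finally show ?thesis .
    qed
    have kk: "\<sigma> * c2 = \<beta> * (\<zeta> + \<sigma> * c1)"
      using k1 unfolding k2 by (simp add: algebra_simps)
    have match: "?st (?st z' (\<xi>1 + e1)) (\<xi>2 + e2) = ?st (?st z \<xi>1) \<xi>2" for \<xi>1 \<xi>2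
    proof (rule inj)
      let ?y' = "?st z' (\<xi>1 + e1)" and ?y = "?st z \<xi>1"
      have 0: "(?a ?y' - ?a ?y) + \<sigma> *\<^sub>R e2 = 0"
        unfolding D2 s1 linear_add[OF linear_of_C, symmetric] by (simp add: linear_0[OF linear_of_C])
      hence eq: "?a ?y' + \<sigma> *\<^sub>R (\<xi>2 + e2) = ?a ?y + \<sigma> *\<^sub>R \<xi>2" by (simp add: algebra_simps)
      show "fst (?st ?y' (\<xi>2 + e2)) = fst (?st ?y \<xi>2)" unfolding x eq ..
      have "\<sigma> *\<^sub>R e2 = \<beta> *\<^sub>R (fst ?y' - fst ?y)"
        unfolding D1 s1 kk linear_scale[OF linear_of_C, symmetric] by (simp add: scaleR_conv_of_real mult_ac)
      thus "?a (?st ?y' (\<xi>2 + e2)) = ?a (?st ?y \<xi>2)" unfolding a[of ?y'] a[of ?y] eq by (simp add: algebra_simps)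
    qed
    have two: "measure (law_from Q u 2) A = (\<integral>\<xi>. measure (Q (?st u \<xi>)) A \<partial>std_gaussian)" for u
      using front[OF A, of u "Suc 0"] by (simp add: numeral_2_eq_2 law_from_1[OF Qk])
    define J where "J \<xi> = measure (Q (?st z' \<xi>)) A" for \<xi>
    have Jm[measurable]: "J \<in> borel_measurable borel" using lawm[OF A, of z' "Suc 0"] unfolding J_def law_from_1[OF Qk] .
    have J01: "0 \<le> J \<xi>" "J \<xi> \<le> 1" for \<xi> unfolding J_def using law1[of _ "Suc 0"] by (auto simp: law_from_1[OF Qk])
    have zm: "(\<lambda>\<xi>. measure (Q (?st z \<xi>)) A) \<in> borel_measurable borel" using lawm[OF A, of z "Suc 0"] unfolding law_from_1[OF Qk] .
    have near: "measure (Q (?st z \<xi>)) A \<le> J (\<xi> + e1) + Cg * norm e2" for \<xi>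
    proof -
      have "{\<xi>2. ?st (?st z' (\<xi> + e1)) \<xi>2 \<in> A} \<in> sets borel" using measurable_sets[OF stm A] by (simp add: vimage_def)
      from Cg(2)[OF this, of e2] show ?thesis
        unfolding J_def meas[OF A] mem_Collect_eq match by linarith
    qed
    have i: "integrable std_gaussian (\<lambda>\<xi>. measure (Q (?st z \<xi>)) A)" "integrable std_gaussian (\<lambda>\<xi>. J (\<xi> + e1))"
    proof -
      show "integrable std_gaussian (\<lambda>\<xi>. measure (Q (?st z \<xi>)) A)"
      proof (rule gauss.integrable_const_bound[where B=1])
        have "norm (measure (Q u) A) \<le> 1" for u using law1[of u "Suc 0" A] unfolding law_from_1[OF Qk] by simp
        thus "AE \<xi> in std_gaussian. norm (measure (Q (?st z \<xi>)) A) \<le> 1" by simp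
      qed (use zm in \<open>simp add: measurable_cong_borel[OF sets_std_gaussian]\<close>)
      show "integrable std_gaussian (\<lambda>\<xi>. J (\<xi> + e1))"
      proof (rule gauss.integrable_const_bound[where B=1])
        show "AE \<xi> in std_gaussian. norm (J (\<xi> + e1)) \<le> 1" using J01 by simp
      qed (simp add: measurable_cong_borel[OF sets_std_gaussian])
    qed
    have "measure (law_from Q z 2) A \<le> (\<integral>\<xi>. J (\<xi> + e1) + Cg * norm e2 \<partial>std_gaussian)"
      unfolding two using i near by (intro integral_mono) auto
    also have "\<dots> = (\<integral>\<xi>. J (\<xi> + e1) \<partial>std_gaussian) + Cg * norm e2" using i by (simp add: gU1)
    finally have 1: "measure (law_from Q z 2) A \<le> (\<integral>\<xi>. J (\<xi> + e1) \<partial>std_gaussian) + Cg * norm e2" .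
    have sm: "(\<lambda>\<xi>. \<xi> + e1) \<in> std_gaussian \<rightarrow>\<^sub>M borel" by (simp add: measurable_cong_borel[OF sets_std_gaussian])
    have g1: "(std_gaussian :: (real^2) measure) \<in> space (prob_algebra borel)"
      by (simp add: space_prob_algebra prob_space_std_gaussian)
    have g2: "distr std_gaussian borel (\<lambda>\<xi>. \<xi> + e1) \<in> space (prob_algebra borel)"
      using gauss.prob_space_distr[OF sm] by (simp add: space_prob_algebra)
    have "(\<integral>\<xi>. J \<xi> \<partial>distr std_gaussian borel (\<lambda>\<xi>. \<xi> + e1)) - (\<integral>\<xi>. J \<xi> \<partial>std_gaussian) \<le> Cg * norm e1"
    proof (rule integral_diff_le_of_sets[OF g2 g1 Jm J01])
      fix B :: "(real^2) set" assume B: "B \<in> sets borel"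
      have "measure (distr std_gaussian borel (\<lambda>\<xi>. \<xi> + e1)) B = measure std_gaussian {\<xi>. \<xi> + e1 \<in> B}"
        using B by (subst measure_distr[OF sm]) (auto simp: vimage_def)
      thus "measure (distr std_gaussian borel (\<lambda>\<xi>. \<xi> + e1)) B - measure std_gaussian B \<le> Cg * norm e1"
        using Cg(2)[OF B, of e1] by (simp add: abs_le_iff)
    qed
    hence 2: "(\<integral>\<xi>. J (\<xi> + e1) \<partial>std_gaussian) \<le> measure (law_from Q z' 2) A + Cg * norm e1"
      unfolding two J_def[symmetric] by (subst (asm) integral_distr[OF sm Jm]) simp
    have "Cg * norm e1 + Cg * norm e2 = C * norm w"
      unfolding C_def e1_def e2_def by (simp add: norm_mult algebra_simps)
    thus ?thesis using 1 2 by linarith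
  qed
  have oC: "of_C (- u) = - of_C u" for u by (rule linear_neg[OF linear_of_C])
  have base2: "\<bar>measure (law_from Q z 2) A - measure (law_from Q z' 2) A\<bar> \<le> C * norm w"
    if A: "A \<in> sets borel" and za: "?a z' - ?a z = of_C (w * \<zeta>)" and zf: "fst z' - fst z = of_C w" for z z' w A
  proof -
    have "?a z - ?a z' = of_C ((- w) * \<zeta>)" "fst z - fst z' = of_C (- w)"
      using za zf by (simp_all add: oC) (metis minus_diff_eq)+
    from base[OF A this] base[OF A za zf] show ?thesis by (simp add: abs_le_iff)
  qed
  have main: "\<bar>measure (law_from Q z (Suc (Suc n))) A - measure (law_from Q z' (Suc (Suc n))) A\<bar> \<le> C * norm (w * \<zeta> ^ n)"
    if A: "A \<in> sets borel" and "?a z' - ?a z = of_C (w * \<zeta>)" and "fst z' - fst z = of_C w" for n z z' w A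
    using that(2,3)
  proof (induction n arbitrary: z z' w)
    case 0
    thus ?case using base2[OF A 0] by (simp add: numeral_2_eq_2)
  next
    case (Suc n)
    let ?f = "\<lambda>u \<xi>. measure (law_from Q (?st u \<xi>) (Suc (Suc n))) A"
    have i: "integrable std_gaussian (?f u)" for u
    proof (rule gauss.integrable_const_bound[where B=1])
      have "norm (measure (law_from Q v (Suc (Suc n))) A) \<le> 1" for v using law1[of v "Suc (Suc n)" A] by simp
      thus "AE \<xi> in std_gaussian. norm (?f u \<xi>) \<le> 1" by simp
    qed (use lawm[OF A, of u "Suc (Suc n)"] in \<open>simp add: measurable_cong_borel[OF sets_std_gaussian]\<close>)
    have step: "\<bar>?f z \<xi> - ?f z' \<xi>\<bar> \<le> C * norm (w * \<zeta> * \<zeta> ^ n)" for \<xi>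
    proof (rule Suc.IH)
      show "fst (?st z' \<xi>) - fst (?st z \<xi>) = of_C (w * \<zeta>)" unfolding x using Suc.prems(1) by simp
      have "?a (?st z' \<xi>) - ?a (?st z \<xi>) = T *\<^sub>R (?a z' - ?a z) - \<beta> *\<^sub>R (fst z' - fst z)" unfolding a by (simp add: algebra_simps)
      also have "\<dots> = of_C (T *\<^sub>R (w * \<zeta>) - \<beta> *\<^sub>R w)"
        unfolding Suc.prems by (simp only: linear_diff[OF linear_of_C] linear_scale[OF linear_of_C])
      also have "T *\<^sub>R (w * \<zeta>) - \<beta> *\<^sub>R w = w * \<zeta> * \<zeta>"
      proof -
        have "w * \<zeta> * \<zeta> = w * \<zeta>\<^sup>2" by (simp add: power2_eq_square)
        thus ?thesis unfolding \<zeta> by (simp add: scaleR_conv_of_real algebra_simps)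
      qed
      finally show "?a (?st z' \<xi>) - ?a (?st z \<xi>) = of_C (w * \<zeta> * \<zeta>)" .
    qed
    have "\<bar>\<integral>\<xi>. ?f z \<xi> - ?f z' \<xi> \<partial>std_gaussian\<bar> \<le> (\<integral>\<xi>. \<bar>?f z \<xi> - ?f z' \<xi>\<bar> \<partial>std_gaussian)" by (rule integral_abs_bound)
    also have "\<dots> \<le> (\<integral>(\<xi>::real^2). C * norm (w * \<zeta> * \<zeta> ^ n) \<partial>std_gaussian)"
      by (rule integral_mono) (use i step in auto)
    also have "\<dots> = C * norm (w * \<zeta> ^ Suc n)" by (simp add: gU1 mult.assoc)
    finally show ?case unfolding front[OF A, of z "Suc (Suc n)"] front[OF A, of z' "Suc (Suc n)"] using i by simp
  qed
  show ?thesis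
    by (rule exI[of _ C], intro conjI allI impI C0) (rule main[unfolded Q_def g_def])
qed

text \<open>Both bounds are multiples of \<open>\<bar>\<zeta>\<bar>\<^sup>n\<close>, so the \<open>n\<close>-th roots converge.\<close>
theorem quadratic_tv_rate:
  fixes l \<beta> h \<gamma> s T :: real
  assumes h: "h > 0" and \<beta>: "\<beta> = exp (- \<gamma> * h)" "0 < \<beta>" "\<beta> < 1" and s: "s = h\<^sup>2 / 2 * (1 + \<beta>)"
    and T: "T = 1 + \<beta> - s * l" "\<bar>T\<bar> < 1 + \<beta>"
  defines "Q \<equiv> baoab_kernel h \<gamma> (\<lambda>x::real^2. l * (norm x)\<^sup>2 / 2)"
  shows "\<exists>z z'. (\<lambda>n. root n (tv_dist (law_from Q z n) (law_from Q z' n))) \<longlonglongrightarrow> root_mod \<beta> T"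
proof -
  obtain \<zeta> :: complex where \<zeta>0: "\<zeta>\<^sup>2 - T * \<zeta> + \<beta> = 0" and \<zeta>n: "norm \<zeta> = root_mod \<beta> T"
    using quadratic_root_exists[of \<beta> T] \<beta> by auto
  have "\<zeta>\<^sup>2 = (\<zeta>\<^sup>2 - T * \<zeta> + \<beta>) + (T * \<zeta> - \<beta>)" by simp
  hence \<zeta>: "\<zeta>\<^sup>2 = T * \<zeta> - \<beta>" unfolding \<zeta>0 by simp
  define \<rho> where "\<rho> = root_mod \<beta> T"
  have \<rho>: "0 < \<rho>" "\<rho> < 1" "norm \<zeta> = \<rho>" unfolding \<rho>_def using root_mod_less_1[OF \<beta>(2,3) T(2)] \<zeta>n by auto
  define g where "g = (\<lambda>x::real^2. l *\<^sub>R x)"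
  have gU: "grad (\<lambda>x::real^2. l * (norm x)\<^sup>2 / 2) = g" unfolding g_def by (rule grad_quadratic)
  have gc: "continuous_on UNIV g" unfolding g_def by (intro continuous_intros)
  have Qk: "Q \<in> borel \<rightarrow>\<^sub>M prob_algebra borel"
    unfolding Q_def by (rule baoab_kernel_measurable[OF gU gc prob_space_std_gaussian])
  let ?a = "next_pos h \<beta> (\<lambda>x::real^2. l *\<^sub>R x)"
  define m where "m = h / 2 * (1 + \<beta>)"
  have m: "0 < m" unfolding m_def using h \<beta>(2) by (intro mult_pos_pos) auto
  define z :: "(real^2) \<times> (real^2)" where "z = (0, 0)"
  define z' where "z' = (of_C 1, (1 / m) *\<^sub>R (of_C \<zeta> - of_C 1) + (h / 2 * l) *\<^sub>R of_C 1)"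
  have z: "?a z = of_C (0 * \<zeta>)" "fst z = of_C 0"
    unfolding z_def next_pos_def by (simp_all add: linear_0[OF linear_of_C])
  have z': "?a z' = of_C (1 * \<zeta>)" "fst z' = of_C 1"
    unfolding z'_def next_pos_def m_def[symmetric] fst_conv snd_conv using m by simp_all
  have dz: "?a z' - ?a z = of_C (1 * \<zeta>)" "fst z' - fst z = of_C 1"
    unfolding z z' by (simp_all add: linear_0[OF linear_of_C])
  define tv where "tv n = tv_dist (law_from Q z n) (law_from Q z' n)" for n
  have lp: "prob_space (law_from Q u n)" "sets (law_from Q u n) = sets borel" "law_from Q u n \<in> space (prob_algebra borel)" for u n
    using kernel_prob[OF measurable_law_from[OF Qk]] by blast+
  note shift = quadratic_shift_upper[OF h \<beta> s T \<zeta>, folded Q_def]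
  obtain C where CC: "0 \<le> C \<and> (\<forall>n z z' w A. A \<in> sets borel \<longrightarrow> ?a z' - ?a z = of_C (w * \<zeta>) \<longrightarrow> fst z' - fst z = of_C w \<longrightarrow>
     \<bar>measure (law_from Q z (Suc (Suc n))) A - measure (law_from Q z' (Suc (Suc n))) A\<bar> \<le> C * norm (w * \<zeta> ^ n))"
    using shift by (rule exE)
  have C: "C \<ge> 0" "\<And>n A. A \<in> sets borel \<Longrightarrow>
     \<bar>measure (law_from Q z (Suc (Suc n))) A - measure (law_from Q z' (Suc (Suc n))) A\<bar> \<le> C * norm (1 * \<zeta> ^ n)"
    by (rule CC[THEN conjunct1], rule CC[THEN conjunct2, rule_format, OF _ dz])
  define C1 where "C1 = (C + 1) / \<rho>\<^sup>2"
  have C1: "0 < C1" unfolding C1_def using C(1) \<rho> by simp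
  have upper: "tv n \<le> C1 * \<rho> ^ n" if n2: "n \<ge> 2" for n
  proof -
    obtain j where "n = 2 + j" using le_Suc_ex[OF n2] by (rule exE)
    hence j: "n = Suc (Suc j)" by simp
    have "tv n \<le> C * norm (1 * \<zeta> ^ j)"
      unfolding tv_def by (rule tv_dist_least) (use C(2) lp(2) j in simp)
    also have "\<dots> = C * \<rho> ^ j" by (simp add: norm_power \<rho>)
    also have "\<dots> \<le> (C + 1) * \<rho> ^ j" using \<rho> by (intro mult_right_mono) auto
    also have "\<dots> = C1 * \<rho> ^ n" unfolding C1_def j using \<rho> by (simp add: power2_eq_square)
    finally show ?thesis .
  qed
  obtain k \<tau> r c E where ly: "0 \<le> r" "r < 1" "0 < c" "0 < E"
    and lyc: "\<And>a b::real^2. c * ((norm a)\<^sup>2 + (norm b)\<^sup>2) \<le> lyap k \<tau> a b \<and> lyap k \<tau> a b \<le> 2 * ((norm a)\<^sup>2 + (norm b)\<^sup>2)"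
    and lys: "\<And>a b e f::real^2. lyap k \<tau> (T *\<^sub>R a - \<beta> *\<^sub>R b + e) (a + f) \<le> r * lyap k \<tau> a b + E * ((norm e)\<^sup>2 + (norm f)\<^sup>2)"
    using heavy_ball_lyapunov[OF \<beta>(2,3) T(2), where 'a="real^2"] by (elim exE conjE) blast
  have lyc1: "\<And>a b::real^2. c * ((norm a)\<^sup>2 + (norm b)\<^sup>2) \<le> lyap k \<tau> a b" using lyc by blast
  note fourier = quadratic_fourier_lower[OF h \<beta>(1,2) s T(1) \<zeta> ly(1-3) lyc1 lys, folded Q_def]
  obtain D where DD: "0 \<le> D \<and> (\<forall>n p r. \<exists>S. 0 \<le> S \<and> S \<le> D * lyap k \<tau> p r \<and>
    (\<forall>z w. ?a z = of_C (w * \<zeta>) \<longrightarrow> fst z = of_C w \<longrightarrow>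
       (\<integral>y. sin (inner p (?a y) - \<beta> * inner r (fst y)) \<partial>law_from Q z n)
        = exp (- S) * sin (inner p (of_C (w * \<zeta> ^ Suc n)) - \<beta> * inner r (of_C (w * \<zeta> ^ n)))))"
    using fourier by (rule exE)
  note D = DD[THEN conjunct1] and fou = DD[THEN conjunct2, rule_format]
  define c0 where "c0 = exp (- (2 * D / \<beta>\<^sup>2)) / 4"
  have c0: "0 < c0" unfolding c0_def by simp
  have lower: "c0 * \<rho> ^ n \<le> tv n" for n
  proof -
    \<comment> \<open>The test functional points in the direction of the difference at time \<open>n\<close>, so that its phase is exactly \<open>\<rho>\<^sup>n\<close>.\<close>
    define u where "u = (1 / \<rho> ^ n) *\<^sub>R of_C (\<zeta> ^ n)"
    have nu: "norm u = 1" unfolding u_def using \<rho> by (simp add: norm_power)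
    define v where "v = (- 1 / \<beta>) *\<^sub>R u"
    have bv: "- \<beta> * inner v x = inner u x" for x unfolding v_def using \<beta>(2) by simp
    obtain S where SS: "0 \<le> S \<and> S \<le> D * lyap k \<tau> 0 v \<and> (\<forall>z w. ?a z = of_C (w * \<zeta>) \<longrightarrow> fst z = of_C w \<longrightarrow>
       (\<integral>y. sin (inner 0 (?a y) - \<beta> * inner v (fst y)) \<partial>law_from Q z n)
        = exp (- S) * sin (inner 0 (of_C (w * \<zeta> ^ Suc n)) - \<beta> * inner v (of_C (w * \<zeta> ^ n))))"
      using fou[where n=n and p=0 and r=v] by (rule exE)
    note S = SS[THEN conjunct1] SS[THEN conjunct2, THEN conjunct1] and eq = SS[THEN conjunct2, THEN conjunct2, rule_format]
    have eq': "(\<integral>y. sin (inner u (fst y)) \<partial>law_from Q z n) = exp (- S) * sin (inner u (of_C (w * \<zeta> ^ n)))"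
      if "?a z = of_C (w * \<zeta>)" "fst z = of_C w" for z w
    proof -
      have b: "inner 0 x - \<beta> * inner v y = inner u y" for x y :: "real^2" using bv[of y] by simp
      show ?thesis using eq[OF that] unfolding b .
    qed
    have i0: "(\<integral>y. sin (inner u (fst y)) \<partial>law_from Q z n) = 0" unfolding eq'[OF z] by (simp add: linear_0[OF linear_of_C])
    have "inner u (of_C (1 * \<zeta> ^ n)) = \<rho> ^ n"
    proof -
      have "inner u (of_C (\<zeta> ^ n)) = (norm (of_C (\<zeta> ^ n)))\<^sup>2 / \<rho> ^ n" unfolding u_def power2_norm_eq_inner by simp
      also have "\<dots> = \<rho> ^ n" using \<rho> by (simp add: norm_power power2_eq_square)
      finally show ?thesis by simp
    qed
    hence i1: "(\<integral>y. sin (inner u (fst y)) \<partial>law_from Q z' n) = exp (- S) * sin (\<rho> ^ n)" unfolding eq'[OF z'] by simp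
    have SS: "S \<le> 2 * D / \<beta>\<^sup>2"
    proof -
      have "lyap k \<tau> 0 v \<le> 2 * (norm v)\<^sup>2" using lyc[of 0 v] by simp
      also have "(norm v)\<^sup>2 = 1 / \<beta>\<^sup>2" unfolding v_def using nu by (simp add: power_divide)
      finally have "D * lyap k \<tau> 0 v \<le> D * (2 * (1 / \<beta>\<^sup>2))" using D by (intro mult_left_mono)
      thus ?thesis using S(2) by (simp add: mult.commute)
    qed
    have "exp (- (2 * D / \<beta>\<^sup>2)) * (\<rho> ^ n / 2) \<le> exp (- S) * sin (\<rho> ^ n)"
      using SS sin_ge_half[of "\<rho> ^ n"] \<rho> by (intro mult_mono) (auto simp: power_le_one)
    hence big: "2 * (c0 * \<rho> ^ n) \<le> (\<integral>y. sin (inner u (fst y)) \<partial>law_from Q z' n) - (\<integral>y. sin (inner u (fst y)) \<partial>law_from Q z n)"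
      unfolding i0 i1 c0_def by (simp add: mult.commute mult.left_commute)
    have cont: "continuous_on UNIV (\<lambda>y::(real^2) \<times> (real^2). sin (inner u (fst y)))" by (intro continuous_intros)
    hence sm: "(\<lambda>y::(real^2) \<times> (real^2). sin (inner u (fst y))) \<in> borel_measurable borel" by (rule borel_measurable_continuous_onI)
    have int: "integrable (law_from Q x n) (\<lambda>y. sin (inner u (fst y)))" for x
    proof (rule finite_measure.integrable_const_bound[where B=1])
      show "finite_measure (law_from Q x n)" using lp(1) by (simp add: prob_space_def)
    qed (use sm in \<open>simp_all add: measurable_cong_borel[OF lp(2)]\<close>)
    have "(\<integral>y. (sin (inner u (fst y)) + 1) / 2 \<partial>law_from Q z' n) - (\<integral>y. (sin (inner u (fst y)) + 1) / 2 \<partial>law_from Q z n) \<le> tv n"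
    proof (rule integral_diff_le_of_sets[OF lp(3) lp(3)])
      show "(\<lambda>y::(real^2) \<times> (real^2). (sin (inner u (fst y)) + 1) / 2) \<in> borel_measurable borel" using sm by measurable
      show "0 \<le> (sin (inner u (fst y)) + 1) / 2" "(sin (inner u (fst y)) + 1) / 2 \<le> 1" for y :: "(real^2) \<times> (real^2)"
        using sin_ge_minus_one[of "inner u (fst y)"] sin_le_one[of "inner u (fst y)"] by (simp_all del: sin_ge_minus_one sin_le_one)
      show "measure (law_from Q z' n) A - measure (law_from Q z n) A \<le> tv n" if "A \<in> sets borel" for A
        using tv_dist_upper[OF lp(1) lp(1), of A z n z' n] that lp(2) unfolding tv_def by (simp add: abs_le_iff)
    qed
    moreover have "(\<integral>y. (sin (inner u (fst y)) + 1) / 2 \<partial>law_from Q x n) = ((\<integral>y. sin (inner u (fst y)) \<partial>law_from Q x n) + 1) / 2" for x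
    proof -
      interpret P: prob_space "law_from Q x n" by (rule lp(1))
      show ?thesis using int[of x] by (simp add: P.prob_space)
    qed
    ultimately show ?thesis using big by (simp add: field_simps)
  qed
  have lim: "(\<lambda>n. root n (c * \<rho> ^ n)) \<longlonglongrightarrow> \<rho>" if "0 < c" for c
  proof -
    have "(\<lambda>n. root n c * \<rho>) \<longlonglongrightarrow> 1 * \<rho>" by (intro tendsto_intros LIMSEQ_root_const that)
    moreover have "\<forall>\<^sub>F n in sequentially. root n c * \<rho> = root n (c * \<rho> ^ n)"
      using eventually_gt_at_top[of 0] by eventually_elim (use \<rho> in \<open>simp add: real_root_mult real_root_power_cancel\<close>)
    ultimately show ?thesis by (simp add: Lim_transform_eventually)
  qed
  have "(\<lambda>n. root n (tv n)) \<longlonglongrightarrow> \<rho>"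
  proof (rule tendsto_sandwich[OF _ _ lim[OF c0] lim[OF C1]])
    show "\<forall>\<^sub>F n in sequentially. root n (c0 * \<rho> ^ n) \<le> root n (tv n)"
      using eventually_gt_at_top[of 0] by eventually_elim (use lower in simp)
    show "\<forall>\<^sub>F n in sequentially. root n (tv n) \<le> root n (C1 * \<rho> ^ n)"
      using eventually_ge_at_top[of 2] by eventually_elim (use upper in simp)
  qed
  thus ?thesis unfolding tv_def \<rho>_def by blast
qed

section \<open>Overlap after two steps for bounded perturbations of a linear force\<close>

lemma abs_det_two_le:
  fixes f :: "real^2 \<Rightarrow> real^2"
  assumes L: "\<And>v. norm (f v) \<le> L * norm v"
  shows "\<bar>Determinants.det (matrix f)\<bar> \<le> 2 * L\<^sup>2"
proof -
  have e: "\<bar>vec_nth (vec_nth (matrix f) i) j\<bar> \<le> L" for i j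
  proof -
    have "\<bar>vec_nth (f (axis j 1)) i\<bar> \<le> norm (f (axis j 1))" by (rule component_le_norm_cart)
    also have "\<dots> \<le> L" using L[of "axis j 1"] by (simp add: norm_axis_1)
    finally show ?thesis by (simp add: matrix_def)
  qed
  have p: "\<bar>vec_nth (vec_nth (matrix f) i) j * vec_nth (vec_nth (matrix f) i') j'\<bar> \<le> L * L" for i j i' j'
    unfolding abs_mult by (rule mult_mono'[OF e e]) auto
  show ?thesis unfolding det_2 power2_eq_square
    by (rule order_trans[OF abs_triangle_ineq4]) (use p[of 1 1 2 2] p[of 1 2 2 1] in linarith)
qed

text \<open>A Lipschitz change of variables contracts Lebesgue measure by a controlled factor only, so any map
  that covers the unit ball from a bounded ball pushes the Gaussian law to one dominating a multiple of Lebesgue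
  measure on the unit ball.  The multiple depends on the map only through its Lipschitz constant.\<close>
lemma gaussian_image_lower_bound:
  assumes "0 \<le> r" "0 \<le> L"
  shows "\<exists>\<epsilon>>0. \<forall>(f :: real^2 \<Rightarrow> real^2) f'. (\<forall>x. (f has_derivative f' x) (at x)) \<longrightarrow> (\<forall>x v. norm (f' x v) \<le> L * norm v) \<longrightarrow>
     cball 0 1 \<subseteq> f ` cball 0 r \<longrightarrow>
     density lborel (\<lambda>x. ennreal \<epsilon> * indicator (cball 0 1) x) \<le> distr std_gaussian borel f"
proof -
  obtain \<epsilon> where \<epsilon>: "0 < \<epsilon>" "\<And>S. S \<in> sets borel \<Longrightarrow> S \<subseteq> cball (0::real^2) r \<Longrightarrow> ennreal \<epsilon> * emeasure lborel S \<le> emeasure std_gaussian S"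
    using gaussian_ball_lower_bound[OF assms(1), where 'a="real^2"] by blast
  define D where "D = 2 * L\<^sup>2 + 1"
  have D: "0 < D" unfolding D_def by (simp add: add_nonneg_pos)
  show ?thesis
  proof (rule exI[of _ "\<epsilon> / D"], intro conjI allI impI)
    show "0 < \<epsilon> / D" using \<epsilon> D by simp
    fix f :: "real^2 \<Rightarrow> real^2" and f'
    assume f: "\<forall>x. (f has_derivative f' x) (at x)" and L: "\<forall>x v. norm (f' x v) \<le> L * norm v" and cov: "cball 0 1 \<subseteq> f ` cball 0 r"
    have fc: "continuous_on UNIV f"
      by (rule continuous_at_imp_continuous_on) (use f in \<open>auto intro: has_derivative_continuous\<close>)
    have fm[measurable]: "f \<in> borel_measurable borel" by (rule borel_measurable_continuous_onI[OF fc])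
    have fm': "f \<in> std_gaussian \<rightarrow>\<^sub>M borel" using fm by (simp add: measurable_cong_borel[OF sets_std_gaussian])
    define M where "M = density lborel (\<lambda>x::real^2. ennreal (\<epsilon> / D) * indicator (cball 0 1) x)"
    have "emeasure M A \<le> emeasure (distr std_gaussian borel f) A" if "A \<in> sets M" for A
    proof -
      have A[measurable]: "A \<in> sets borel" using that unfolding M_def by simp
      define E where "E = A \<inter> cball 0 1"
      have E[measurable]: "E \<in> sets borel" unfolding E_def by simp
      define S where "S = f -` E \<inter> cball 0 r"
      have "f -` E \<in> sets borel" using measurable_sets[OF fm E] by simp
      hence S: "S \<in> sets borel" unfolding S_def by simp
      have fS: "f ` S = E" unfolding S_def using cov by (auto simp: E_def)
      have bS: "bounded S" unfolding S_def by (rule bounded_subset[OF bounded_cball]) blast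
      have bE: "bounded E" unfolding E_def by (rule bounded_subset[OF bounded_cball]) blast
      have Sl: "S \<in> lmeasurable" using S bS by (intro bounded_set_imp_lmeasurable) (auto simp: sets_completionI_sets)
      have df: "(f has_derivative f' x) (at x within S)" for x using f by (auto intro: has_derivative_at_withinI)
      have db: "\<bar>Determinants.det (matrix (f' x))\<bar> \<le> D" for x
      proof -
        have "\<bar>Determinants.det (matrix (f' x))\<bar> \<le> 2 * L\<^sup>2" by (rule abs_det_two_le) (use L in simp)
        thus ?thesis unfolding D_def by simp
      qed
      have mdet: "(\<lambda>x. Determinants.det (matrix (f' x))) \<in> borel_measurable (lebesgue_on S)"
        by (rule borel_measurable_det_Jacobian[OF fmeasurableD[OF Sl] df])
      have di: "(\<lambda>x. \<bar>Determinants.det (matrix (f' x))\<bar>) integrable_on S"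
      proof (rule measurable_bounded_by_integrable_imp_integrable[where g="\<lambda>_. D"])
        show "(\<lambda>x. \<bar>Determinants.det (matrix (f' x))\<bar>) \<in> borel_measurable (lebesgue_on S)"
          by (rule borel_measurable_abs[OF mdet])
        show "(\<lambda>_. D) integrable_on S" by (rule integrable_on_const[OF Sl])
        show "norm \<bar>Determinants.det (matrix (f' x))\<bar> \<le> D" for x using db[of x] by simp
        show "S \<in> sets lebesgue" by (rule fmeasurableD[OF Sl])
      qed
      have "measure lebesgue (f ` S) \<le> D * measure lebesgue S"
        by (rule measure_bounded_differentiable_image[OF Sl df di db])
      hence le: "measure lborel E \<le> D * measure lborel S" unfolding fS using S E by simp
      have eS: "emeasure lborel S = ennreal (measure lborel S)" "emeasure lborel E = ennreal (measure lborel E)"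
        using emeasure_bounded_finite[OF bS] emeasure_bounded_finite[OF bE]
        by (simp_all add: emeasure_eq_ennreal_measure)
      have "ennreal (\<epsilon> / D) * emeasure lborel E \<le> ennreal (\<epsilon> / D) * ennreal (D * measure lborel S)"
        unfolding eS by (intro mult_left_mono ennreal_leI le) simp
      also have "\<dots> = ennreal \<epsilon> * emeasure lborel S"
        unfolding eS using \<epsilon>(1) D by (simp add: ennreal_mult[symmetric])
      also have "\<dots> \<le> emeasure std_gaussian S" by (rule \<epsilon>(2)[OF S]) (simp add: S_def)
      also have "\<dots> \<le> emeasure std_gaussian (f -` A \<inter> space std_gaussian)"
        by (rule emeasure_mono) (use measurable_sets[OF fm' A] in \<open>auto simp: S_def E_def space_std_gaussian\<close>)
      also have "\<dots> = emeasure (distr std_gaussian borel f) A" by (rule emeasure_distr[symmetric, OF fm' A])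
      finally have *: "ennreal (\<epsilon> / D) * emeasure lborel E \<le> emeasure (distr std_gaussian borel f) A" .
      have ind: "(\<lambda>x::real^2. ennreal (\<epsilon> / D) * indicator (cball 0 1) x) \<in> borel_measurable lborel"
        by (intro borel_measurable_times_ennreal borel_measurable_const borel_measurable_indicator) simp_all
      have "emeasure M A = (\<integral>\<^sup>+x. ennreal (\<epsilon> / D) * indicator E x \<partial>lborel)"
        unfolding M_def E_def by (subst emeasure_density[OF ind]) (auto intro!: nn_integral_cong split: split_indicator)
      also have "\<dots> = ennreal (\<epsilon> / D) * emeasure lborel E" by (rule nn_integral_cmult_indicator) simp
      finally show ?thesis using * by simp
    qed
    hence "M \<le> distr std_gaussian borel f" by (subst le_measure) (auto simp: M_def)
    thus "density lborel (\<lambda>x. ennreal (\<epsilon> / D) * indicator (cball 0 1) x) \<le> distr std_gaussian borel f"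
      unfolding M_def .
  qed
qed

text \<open>The force differs from a linear one by a bounded vector field.  The bound on \<open>h\<close> is the stability condition for the
  linear part; it makes \<open>half_kick\<close> a bounded perturbation of a positive multiple of the identity.\<close>
locale bounded_force_chain =
  fixes h \<gamma> \<beta> \<kappa> B :: real and U :: "real^2 \<Rightarrow> real" and g :: "real^2 \<Rightarrow> real^2"
  assumes h: "0 < h" "h < 2" and \<beta>: "\<beta> = exp (- \<gamma> * h)" "0 < \<beta>" "\<beta> < 1"
    and U: "\<And>x. (U has_derivative (\<lambda>v. inner (g x) v)) (at x)"
    and g': "\<And>x. \<exists>H. (g has_derivative H) (at x) \<and> (\<forall>v. norm (H v) \<le> \<kappa> * norm v)"
    and gB: "\<And>x. norm (g x - x) \<le> B"
begin

abbreviation "pos \<equiv> next_pos h \<beta> g"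
abbreviation "kick \<equiv> half_kick h g"
abbreviation "\<sigma> \<equiv> noise_scale h \<beta>"
abbreviation "step \<equiv> baoab_step h \<gamma> U"
abbreviation "Q \<equiv> baoab_kernel h \<gamma> U"
abbreviation "m \<equiv> h / 2 * (1 + \<beta>)"

lemma grad_U: "grad U = g" by (rule grad_eqI[OF U])

lemma continuous_g: "continuous_on UNIV g"
proof (rule continuous_at_imp_continuous_on, rule ballI)
  fix x
  obtain H where "(g has_derivative H) (at x) \<and> (\<forall>v. norm (H v) \<le> \<kappa> * norm v)" using g'[of x] by (rule exE)
  thus "isCont g x" by (elim conjE has_derivative_continuous)
qed

lemma Q_measurable: "Q \<in> borel \<rightarrow>\<^sub>M prob_algebra borel"
  by (rule baoab_kernel_measurable[OF grad_U continuous_g prob_space_std_gaussian])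

lemma step_measurable: "step z \<in> borel_measurable borel"
  by (rule baoab_step_measurable[OF grad_U continuous_g])

lemma step_measurable_gaussian: "step z \<in> std_gaussian \<rightarrow>\<^sub>M borel"
  using step_measurable by (simp add: measurable_cong_borel[OF sets_std_gaussian])

lemma nn_integral_Q:
  assumes "f \<in> borel_measurable borel"
  shows "(\<integral>\<^sup>+y. f y \<partial>Q z) = (\<integral>\<^sup>+\<xi>. f (step z \<xi>) \<partial>std_gaussian)"
  unfolding baoab_kernel_def by (rule nn_integral_distr[OF step_measurable_gaussian]) (use assms in simp)

lemmas step_pos = fst_baoab_step[OF grad_U h(1) \<beta>(1)]
lemmas step_vel = snd_baoab_step[OF grad_U h(1) \<beta>(1)]
lemmas step_next = next_pos_baoab_step[OF grad_U h(1) \<beta>(1)]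

lemma \<sigma>_pos: "0 < \<sigma>"
  unfolding noise_scale_def using h \<beta> by (intro mult_pos_pos) (auto simp: power_less_one_iff abs_square_less_1)

lemma m_pos: "0 < m" using h \<beta>(2) by (intro mult_pos_pos) auto

lemma B_nonneg: "0 \<le> B" by (rule order_trans[OF norm_ge_zero gB[of 0]])

lemma \<kappa>_nonneg: "0 \<le> \<kappa>"
proof -
  obtain H where H: "(g has_derivative H) (at 0) \<and> (\<forall>v. norm (H v) \<le> \<kappa> * norm v)" using g'[of 0] by (rule exE)
  hence "norm (H (axis 1 1)) \<le> \<kappa> * norm (axis 1 1 :: real^2)" by blast
  thus ?thesis using norm_ge_zero[of "H (axis 1 1)"] by (simp add: norm_axis_1 del: norm_ge_zero)
qed

definition slope :: real where "slope = 2 / h - h / 2"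

lemma slope_pos: "0 < slope"
proof -
  have "h * h < 2 * 2" using h by (intro mult_strict_mono) auto
  thus ?thesis unfolding slope_def using h by (simp add: field_simps)
qed

lemma kick_eq: "kick x = slope *\<^sub>R x - (h / 2) *\<^sub>R (g x - x)"
  unfolding half_kick_def slope_def by (simp add: algebra_simps)

lemma kick_lower: "slope * norm x \<le> norm (kick x) + h / 2 * B"
proof -
  have "slope *\<^sub>R x = kick x + (h / 2) *\<^sub>R (g x - x)" unfolding kick_eq by simp
  hence "norm (slope *\<^sub>R x) \<le> norm (kick x) + norm ((h / 2) *\<^sub>R (g x - x))" by (simp only: norm_triangle_ineq)
  also have "norm (slope *\<^sub>R x) = slope * norm x" using slope_pos by simp
  also have "norm ((h / 2) *\<^sub>R (g x - x)) \<le> h / 2 * B" using gB[of x] h by (simp add: mult_left_mono)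
  finally show ?thesis by simp
qed

text \<open>A bounded perturbation of an invertible linear map is onto: solve for the point by Brouwer's theorem
  on a ball that absorbs the perturbation.\<close>
lemma kick_surj: "\<exists>x. kick x = y"
proof -
  define \<rho> where "\<rho> = (norm y + h / 2 * B) / slope"
  define f where "f x = (1 / slope) *\<^sub>R (y + (h / 2) *\<^sub>R (g x - x))" for x
  have \<rho>: "0 \<le> \<rho>" unfolding \<rho>_def using slope_pos B_nonneg h by simp
  have "norm (f x) \<le> \<rho>" for x
  proof -
    have "norm (y + (h / 2) *\<^sub>R (g x - x)) \<le> norm y + norm ((h / 2) *\<^sub>R (g x - x))" by (rule norm_triangle_ineq)
    also have "norm ((h / 2) *\<^sub>R (g x - x)) \<le> h / 2 * B" using gB[of x] h by (simp add: mult_left_mono)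
    finally show ?thesis unfolding f_def \<rho>_def using slope_pos by (simp add: divide_right_mono)
  qed
  hence fim: "f \<in> cball 0 \<rho> \<rightarrow> cball 0 \<rho>" by simp
  have fc: "continuous_on (cball 0 \<rho>) f" unfolding f_def
    by (intro continuous_intros continuous_on_subset[OF continuous_g]) auto
  obtain x where x: "f x = x"
    by (rule brouwer[OF compact_cball convex_cball _ fc fim]) (use \<rho> in auto)
  have "slope *\<^sub>R f x = y + (h / 2) *\<^sub>R (g x - x)" unfolding f_def using slope_pos by simp
  hence "kick x = y" unfolding kick_eq x by simp
  thus ?thesis ..
qed

text \<open>Once the new position is known, the new velocity depends on the old state only through this vector.
  It changes by reflection at each step, so the noise reaches it with one step of delay; hence two
  steps are needed for overlap.\<close>
definition memory :: "(real^2) \<times> (real^2) \<Rightarrow> real^2" where "memory z = kick (fst z) + snd z"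

lemma pos_memory: "pos z = m *\<^sub>R memory z - \<beta> *\<^sub>R fst z"
proof -
  have "m *\<^sub>R ((2 / h) *\<^sub>R fst z) = (1 + \<beta>) *\<^sub>R fst z" using h by simp
  thus ?thesis unfolding next_pos_def memory_def half_kick_def by (simp add: algebra_simps)
qed

lemma memory_step: "memory (step z \<xi>) = 2 *\<^sub>R kick (pos z + \<sigma> *\<^sub>R \<xi>) - memory z"
  unfolding memory_def step_vel step_pos by (simp add: algebra_simps scaleR_2)

lemma snd_memory: "snd z = memory z - kick (fst z)" unfolding memory_def by simp

lemma kick_derivative:
  "\<exists>D. (kick has_derivative D) (at x) \<and> (\<forall>v. norm (D v) \<le> (2 / h + h / 2 * \<kappa>) * norm v)"
proof -
  obtain H where H: "(g has_derivative H) (at x)" "\<forall>v. norm (H v) \<le> \<kappa> * norm v" using g'[of x] by (elim exE conjE)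
  have "(kick has_derivative (\<lambda>v. (2 / h) *\<^sub>R v - (h / 2) *\<^sub>R H v)) (at x)"
    unfolding half_kick_def[abs_def] by (intro derivative_intros H(1))
  moreover have "norm ((2 / h) *\<^sub>R v - (h / 2) *\<^sub>R H v) \<le> (2 / h + h / 2 * \<kappa>) * norm v" for v
  proof -
    have "norm ((2 / h) *\<^sub>R v - (h / 2) *\<^sub>R H v) \<le> 2 / h * norm v + h / 2 * norm (H v)"
      using norm_triangle_ineq4[of "(2 / h) *\<^sub>R v" "(h / 2) *\<^sub>R H v"] h by simp
    also have "\<dots> \<le> 2 / h * norm v + h / 2 * (\<kappa> * norm v)"
      using H(2) h by (intro add_left_mono mult_left_mono) auto
    finally show ?thesis by (simp add: algebra_simps)
  qed
  ultimately show ?thesis by (intro exI conjI allI)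
qed

end

context bounded_force_chain
begin

lemma kick_measurable: "kick \<in> borel_measurable borel"
  unfolding half_kick_def[abs_def]
  by (intro borel_measurable_continuous_onI continuous_intros continuous_on_subset[OF continuous_g]) simp

text \<open>Lebesgue measure of the positions in the unit ball that a state with memory \<open>y\<close> before the last step can combine with to land in \<open>A\<close>.\<close>
definition common_part :: "((real^2) \<times> (real^2)) set \<Rightarrow> real^2 \<Rightarrow> ennreal" where
  "common_part A y = (\<integral>\<^sup>+x. indicator A (x, kick x - y) * indicator (cball 0 1) x \<partial>lborel)"

lemma common_part_measurable:
  assumes A[measurable]: "A \<in> sets borel"
  shows "common_part A \<in> borel_measurable borel"
proof -
  have "(\<lambda>(y, x). (x, kick x - y)) \<in> borel \<Otimes>\<^sub>M lborel \<rightarrow>\<^sub>M borel"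
    unfolding borel_prod[symmetric] using kick_measurable by measurable
  hence "(\<lambda>(y, x). indicator A (x, kick x - y) * indicator (cball 0 1) x :: ennreal) \<in> borel_measurable (borel \<Otimes>\<^sub>M lborel)"
    unfolding split_beta'
    by (intro borel_measurable_times_ennreal measurable_compose[OF _ borel_measurable_indicator[OF A]]
       measurable_compose[OF measurable_snd borel_measurable_indicator]) simp_all
  thus ?thesis unfolding common_part_def[abs_def] by (rule lborel.borel_measurable_nn_integral)
qed

lemma memory_bound:
  assumes "norm (pos z) + norm (fst z) \<le> r"
  shows "norm (memory z) \<le> r / m"
proof -
  have "m *\<^sub>R memory z = pos z + \<beta> *\<^sub>R fst z" unfolding pos_memory by simp
  hence "m * norm (memory z) = norm (pos z + \<beta> *\<^sub>R fst z)" using m_pos by (metis norm_scaleR abs_of_pos)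
  also have "\<dots> \<le> norm (pos z) + \<beta> * norm (fst z)" using norm_triangle_ineq[of "pos z" "\<beta> *\<^sub>R fst z"] \<beta> by simp
  also have "\<dots> \<le> norm (pos z) + 1 * norm (fst z)" using \<beta> by (intro add_left_mono mult_right_mono) auto
  finally have "m * norm (memory z) \<le> r" using assms by simp
  thus ?thesis using m_pos by (simp add: pos_le_divide_eq mult.commute)
qed

text \<open>The first noise moves the memory, the second the position; each does so through a map to which
  \<open>gaussian_image_lower_bound\<close> applies.  The second map is affine, with an offset that is bounded because the memory
  after the first step may be assumed to lie in the unit ball, and this bounds the intermediate position.\<close>
lemma two_step_lower_bound:
  assumes r: "0 \<le> r"
  shows "\<exists>\<epsilon>>0. \<forall>z A. norm (pos z) + norm (fst z) \<le> r \<longrightarrow> A \<in> sets borel \<longrightarrow>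
     ennreal \<epsilon> * (\<integral>\<^sup>+y. common_part A y * indicator (cball 0 1) y \<partial>lborel) \<le> emeasure (law_from Q z 2) A"
proof -
  define M where "M = r / m"
  have M: "0 \<le> M" unfolding M_def using r m_pos by simp
  define X where "X = ((1 + M) / 2 + h / 2 * B) / slope"
  have X: "0 \<le> X" unfolding X_def using M slope_pos B_nonneg h by simp
  define W where "W = m + X"
  have W: "0 \<le> W" unfolding W_def using X m_pos by simp
  have xb: "norm x \<le> X" if "2 *\<^sub>R kick x - memory z = y" "norm y \<le> 1" "norm (pos z) + norm (fst z) \<le> r" for x y z
  proof -
    have "2 *\<^sub>R kick x = y + memory z" using that(1) by (simp add: algebra_simps)
    hence "2 * norm (kick x) = norm (y + memory z)" by (metis norm_scaleR abs_numeral)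
    also have "\<dots> \<le> 1 + M" using norm_triangle_ineq[of y "memory z"] that(2) memory_bound[OF that(3)] unfolding M_def by linarith
    finally have "norm (kick x) \<le> (1 + M) / 2" by simp
    hence "slope * norm x \<le> (1 + M) / 2 + h / 2 * B" by (rule order_trans[OF kick_lower add_right_mono])
    thus ?thesis unfolding X_def using slope_pos by (simp add: pos_le_divide_eq mult.commute)
  qed
  define L1 where "L1 = 2 * \<sigma> * (2 / h + h / 2 * \<kappa>)"
  have L1: "0 \<le> L1" unfolding L1_def using \<sigma>_pos h \<kappa>_nonneg by simp
  obtain e1 where e1: "0 < e1 \<and> (\<forall>(f :: real^2 \<Rightarrow> real^2) f'. (\<forall>x. (f has_derivative f' x) (at x)) \<longrightarrow> (\<forall>x v. norm (f' x v) \<le> L1 * norm v) \<longrightarrow>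
     cball 0 1 \<subseteq> f ` cball 0 ((X + r) / \<sigma>) \<longrightarrow>
     density lborel (\<lambda>x. ennreal e1 * indicator (cball 0 1) x) \<le> distr std_gaussian borel f)"
    using gaussian_image_lower_bound[of "(X + r) / \<sigma>" L1] X r \<sigma>_pos L1 by (elim meta_impE exE) simp_all
  obtain e2 where e2: "0 < e2 \<and> (\<forall>(f :: real^2 \<Rightarrow> real^2) f'. (\<forall>x. (f has_derivative f' x) (at x)) \<longrightarrow> (\<forall>x v. norm (f' x v) \<le> \<sigma> * norm v) \<longrightarrow>
     cball 0 1 \<subseteq> f ` cball 0 ((1 + W) / \<sigma>) \<longrightarrow>
     density lborel (\<lambda>x. ennreal e2 * indicator (cball 0 1) x) \<le> distr std_gaussian borel f)"
    using gaussian_image_lower_bound[of "(1 + W) / \<sigma>" \<sigma>] W \<sigma>_pos by (elim meta_impE exE) simp_all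
  have ind: "(\<lambda>x::real^2. ennreal e * indicator (cball 0 1) x) \<in> borel_measurable lborel" for e
    by (intro borel_measurable_times_ennreal borel_measurable_const borel_measurable_indicator) simp_all
  have dom: "(\<integral>\<^sup>+x. ennreal e * indicator (cball 0 1) x * G x \<partial>lborel) \<le> (\<integral>\<^sup>+\<xi>. G (f \<xi>) \<partial>std_gaussian)"
    if "density lborel (\<lambda>x. ennreal e * indicator (cball 0 1) x) \<le> distr std_gaussian borel f"
      "f \<in> borel_measurable borel" "G \<in> borel_measurable borel" for e and f :: "real^2 \<Rightarrow> real^2" and G
  proof -
    have "(\<integral>\<^sup>+x. ennreal e * indicator (cball 0 1) x * G x \<partial>lborel)
        = (\<integral>\<^sup>+x. G x \<partial>density lborel (\<lambda>x. ennreal e * indicator (cball 0 1) x))"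
      by (rule nn_integral_density[symmetric, OF ind]) (use that(3) in simp)
    also have "\<dots> \<le> (\<integral>\<^sup>+x. G x \<partial>distr std_gaussian borel f)"
      by (rule nn_integral_mono_measure[OF _ that(1)]) simp
    also have "\<dots> = (\<integral>\<^sup>+\<xi>. G (f \<xi>) \<partial>std_gaussian)"
      by (rule nn_integral_distr) (use that(2,3) in \<open>simp_all add: measurable_cong_borel[OF sets_std_gaussian]\<close>)
    finally show ?thesis .
  qed
  have inner: "ennreal e2 * common_part A (memory z) \<le> (\<integral>\<^sup>+\<xi>. indicator A (step z \<xi>) \<partial>std_gaussian)"
    if w: "norm (pos z) \<le> W" and A[measurable]: "A \<in> sets borel" for z A
  proof -
    define f where "f \<xi> = pos z + \<sigma> *\<^sub>R \<xi>" for \<xi> :: "real^2"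
    have "density lborel (\<lambda>x. ennreal e2 * indicator (cball 0 1) x) \<le> distr std_gaussian borel f"
    proof (rule e2[THEN conjunct2, rule_format])
      show "(f has_derivative (\<lambda>v. \<sigma> *\<^sub>R v)) (at x)" for x unfolding f_def by (auto intro!: derivative_eq_intros)
      show "norm (\<sigma> *\<^sub>R v) \<le> \<sigma> * norm v" for v :: "real^2" using \<sigma>_pos by simp
      show "cball 0 1 \<subseteq> f ` cball 0 ((1 + W) / \<sigma>)"
      proof
        fix y :: "real^2" assume y: "y \<in> cball 0 1"
        have "norm (y - pos z) \<le> 1 + W" using norm_triangle_ineq4[of y "pos z"] w y by simp
        hence "norm ((1 / \<sigma>) *\<^sub>R (y - pos z)) \<le> (1 + W) / \<sigma>" using \<sigma>_pos by (simp add: divide_right_mono)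
        moreover have "f ((1 / \<sigma>) *\<^sub>R (y - pos z)) = y" unfolding f_def using \<sigma>_pos by simp
        ultimately show "y \<in> f ` cball 0 ((1 + W) / \<sigma>)" by (intro image_eqI[of _ _ "(1 / \<sigma>) *\<^sub>R (y - pos z)"]) simp_all
      qed
    qed
    hence "(\<integral>\<^sup>+x. ennreal e2 * indicator (cball 0 1) x * indicator A (x, kick x - memory z) \<partial>lborel)
        \<le> (\<integral>\<^sup>+\<xi>. indicator A (f \<xi>, kick (f \<xi>) - memory z) \<partial>std_gaussian)"
    proof (rule dom)
      show "f \<in> borel_measurable borel" unfolding f_def[abs_def] by measurable
      have "(\<lambda>x. (x, kick x - memory z)) \<in> borel \<rightarrow>\<^sub>M borel"
        unfolding borel_prod[symmetric] using kick_measurable by measurable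
      thus "(\<lambda>x. indicator A (x, kick x - memory z)) \<in> borel_measurable borel"
        by (rule measurable_compose) (rule borel_measurable_indicator[OF A])
    qed
    moreover have "step z \<xi> = (f \<xi>, kick (f \<xi>) - memory z)" for \<xi>
    proof (rule prod_eqI)
      show "fst (step z \<xi>) = fst (f \<xi>, kick (f \<xi>) - memory z)" unfolding step_pos f_def by simp
      show "snd (step z \<xi>) = snd (f \<xi>, kick (f \<xi>) - memory z)"
        unfolding snd_memory[of "step z \<xi>"] memory_step step_pos f_def by (simp add: scaleR_2)
    qed
    moreover have "(\<integral>\<^sup>+x. ennreal e2 * indicator (cball 0 1) x * indicator A (x, kick x - memory z) \<partial>lborel) = ennreal e2 * common_part A (memory z)"
    proof -
      have "(\<lambda>x. (x, kick x - memory z)) \<in> borel \<rightarrow>\<^sub>M borel"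
        unfolding borel_prod[symmetric] using kick_measurable by measurable
      hence "(\<lambda>x. indicator A (x, kick x - memory z) :: ennreal) \<in> borel_measurable borel"
        by (rule measurable_compose) (rule borel_measurable_indicator[OF A])
      hence "(\<lambda>x. indicator A (x, kick x - memory z) * indicator (cball 0 1) x :: ennreal) \<in> borel_measurable lborel"
        by (intro borel_measurable_times_ennreal borel_measurable_indicator) simp_all
      thus ?thesis unfolding common_part_def by (subst nn_integral_cmult[symmetric]) (simp_all add: mult_ac)
    qed
    ultimately show ?thesis by simp
  qed
  show ?thesis
  proof (rule exI[of _ "e1 * e2"], intro conjI allI impI)
    show "0 < e1 * e2" using e1 e2 by simp
    fix z A assume z: "norm (pos z) + norm (fst z) \<le> r" and A: "A \<in> sets (borel :: ((real^2) \<times> (real^2)) measure)"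
    define f where "f \<xi> = 2 *\<^sub>R kick (pos z + \<sigma> *\<^sub>R \<xi>) - memory z" for \<xi> :: "real^2"
    have fmem: "f \<xi> = memory (step z \<xi>)" for \<xi> unfolding f_def memory_step ..
    define D where "D x = (SOME D. (kick has_derivative D) (at x) \<and> (\<forall>v. norm (D v) \<le> (2 / h + h / 2 * \<kappa>) * norm v))" for x
    have DD: "(kick has_derivative D x) (at x) \<and> (\<forall>v. norm (D x v) \<le> (2 / h + h / 2 * \<kappa>) * norm v)" for x
      using someI_ex[OF kick_derivative[of x]] unfolding D_def[symmetric] .
    have D: "(kick has_derivative D x) (at x)" "norm (D x v) \<le> (2 / h + h / 2 * \<kappa>) * norm v" for x v
      by (rule DD[THEN conjunct1], rule DD[THEN conjunct2, rule_format])
    have fc: "(f has_derivative (\<lambda>v. 2 *\<^sub>R D (pos z + \<sigma> *\<^sub>R x) (\<sigma> *\<^sub>R v))) (at x)" for x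
    proof -
      have "((\<lambda>\<xi>. pos z + \<sigma> *\<^sub>R \<xi>) has_derivative (\<lambda>v. \<sigma> *\<^sub>R v)) (at x)" by (auto intro!: derivative_eq_intros)
      from has_derivative_compose[OF this D(1)]
      have "((\<lambda>\<xi>. kick (pos z + \<sigma> *\<^sub>R \<xi>)) has_derivative (\<lambda>v. D (pos z + \<sigma> *\<^sub>R x) (\<sigma> *\<^sub>R v))) (at x)" .
      hence "((\<lambda>\<xi>. 2 *\<^sub>R kick (pos z + \<sigma> *\<^sub>R \<xi>) - memory z) has_derivative (\<lambda>v. 2 *\<^sub>R D (pos z + \<sigma> *\<^sub>R x) (\<sigma> *\<^sub>R v) - 0)) (at x)"
        by (intro has_derivative_diff has_derivative_scaleR_right has_derivative_const)
      thus ?thesis unfolding f_def by simp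
    qed
    have "density lborel (\<lambda>x. ennreal e1 * indicator (cball 0 1) x) \<le> distr std_gaussian borel f"
    proof (rule e1[THEN conjunct2, rule_format])
      show "(f has_derivative (\<lambda>v. 2 *\<^sub>R D (pos z + \<sigma> *\<^sub>R x) (\<sigma> *\<^sub>R v))) (at x)" for x by (rule fc)
      show "norm (2 *\<^sub>R D (pos z + \<sigma> *\<^sub>R x) (\<sigma> *\<^sub>R v)) \<le> L1 * norm v" for x v
      proof -
        have "norm (2 *\<^sub>R D (pos z + \<sigma> *\<^sub>R x) (\<sigma> *\<^sub>R v)) \<le> 2 * ((2 / h + h / 2 * \<kappa>) * norm (\<sigma> *\<^sub>R v))"
          using D(2)[of "pos z + \<sigma> *\<^sub>R x" "\<sigma> *\<^sub>R v"] by simp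
        also have "\<dots> = L1 * norm v" unfolding L1_def using \<sigma>_pos by (simp only: norm_scaleR abs_of_pos mult_ac)
        finally show ?thesis .
      qed
      show "cball 0 1 \<subseteq> f ` cball 0 ((X + r) / \<sigma>)"
      proof
        fix y :: "real^2" assume y: "y \<in> cball 0 1"
        obtain x where x: "kick x = (1 / 2) *\<^sub>R (y + memory z)" using kick_surj by (rule exE)
        have x2: "2 *\<^sub>R kick x - memory z = y" unfolding x by simp
        have "norm x \<le> X" by (rule xb[OF x2 _ z]) (use y in simp)
        moreover have "norm (pos z) \<le> r" using z norm_ge_zero[of "fst z"] by linarith
        ultimately have "norm (x - pos z) \<le> X + r" using norm_triangle_ineq4[of x "pos z"] by linarith
        hence "norm ((1 / \<sigma>) *\<^sub>R (x - pos z)) \<le> (X + r) / \<sigma>" using \<sigma>_pos by (simp add: divide_right_mono)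
        moreover have "f ((1 / \<sigma>) *\<^sub>R (x - pos z)) = y" unfolding f_def using \<sigma>_pos x2 by simp
        ultimately show "y \<in> f ` cball 0 ((X + r) / \<sigma>)" by (intro image_eqI[of _ _ "(1 / \<sigma>) *\<^sub>R (x - pos z)"]) simp_all
      qed
    qed
    hence "(\<integral>\<^sup>+x. ennreal e1 * indicator (cball 0 1) x * (indicator (cball 0 1) x * (ennreal e2 * common_part A x)) \<partial>lborel)
        \<le> (\<integral>\<^sup>+\<xi>. indicator (cball 0 1) (f \<xi>) * (ennreal e2 * common_part A (f \<xi>)) \<partial>std_gaussian)"
    proof (rule dom)
      show "f \<in> borel_measurable borel"
        unfolding f_def[abs_def] using kick_measurable by measurable
      show "(\<lambda>x. indicator (cball 0 1) x * (ennreal e2 * common_part A x)) \<in> borel_measurable borel"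
        by (intro borel_measurable_times_ennreal borel_measurable_const borel_measurable_indicator common_part_measurable[OF A]) simp_all
    qed
    also have "\<dots> \<le> (\<integral>\<^sup>+\<xi>. emeasure (Q (step z \<xi>)) A \<partial>std_gaussian)"
    proof (rule nn_integral_mono)
      fix \<xi> :: "real^2"
      have Qe: "emeasure (Q y) A = (\<integral>\<^sup>+\<xi>. indicator A (step y \<xi>) \<partial>std_gaussian)" for y
      proof -
        have "emeasure (Q y) A = (\<integral>\<^sup>+u. indicator A u \<partial>Q y)"
          by (rule nn_integral_indicator[symmetric]) (simp add: kernel_prob(2)[OF Q_measurable] A)
        thus ?thesis by (simp add: nn_integral_Q[OF borel_measurable_indicator[OF A]])
      qed
      show "indicator (cball 0 1) (f \<xi>) * (ennreal e2 * common_part A (f \<xi>)) \<le> emeasure (Q (step z \<xi>)) A"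
      proof (cases "norm (f \<xi>) \<le> 1")
        case True
        have "norm (fst (step z \<xi>)) \<le> X"
          by (rule xb[OF _ True z]) (simp add: f_def step_pos)
        hence "\<beta> * norm (fst (step z \<xi>)) \<le> 1 * X" using \<beta> by (intro mult_mono) auto
        moreover have "norm (pos (step z \<xi>)) \<le> m * norm (f \<xi>) + \<beta> * norm (fst (step z \<xi>))"
          unfolding pos_memory[of "step z \<xi>"] fmem[symmetric]
          by (rule order_trans[OF norm_triangle_ineq4]) (use m_pos \<beta> in simp)
        moreover have "m * norm (f \<xi>) \<le> m * 1" using True m_pos by (intro mult_left_mono) auto
        ultimately have "norm (pos (step z \<xi>)) \<le> W" unfolding W_def by linarith
        from inner[OF this A] show ?thesis unfolding Qe fmem[symmetric] using True by simp
      qed simp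
    qed
    also have "\<dots> = (\<integral>\<^sup>+y. emeasure (Q y) A \<partial>Q z)"
      by (rule nn_integral_Q[symmetric]) (rule measurable_emeasure_kernel[OF measurable_prob_algebraD[OF Q_measurable] A])
    also have "\<dots> = emeasure (law_from Q z 2) A"
      unfolding numeral_2_eq_2 law_from_Suc[of Q z "Suc 0"] law_from_1[OF Q_measurable]
      by (rule emeasure_bind[symmetric, where N=borel])
        (use measurable_prob_algebraD[OF Q_measurable] A in \<open>simp_all add: measurable_cong_borel[OF kernel_prob(2)[OF Q_measurable]]
           prob_space.not_empty[OF kernel_prob(1)[OF Q_measurable]]\<close>)
    also have "(\<integral>\<^sup>+x. ennreal e1 * indicator (cball 0 1) x * (indicator (cball 0 1) x * (ennreal e2 * common_part A x)) \<partial>lborel)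
        = (\<integral>\<^sup>+x. ennreal (e1 * e2) * (common_part A x * indicator (cball 0 1) x) \<partial>lborel)"
      using e1 e2 by (intro nn_integral_cong) (auto simp: ennreal_mult mult_ac split: split_indicator)
    also have "\<dots> = ennreal (e1 * e2) * (\<integral>\<^sup>+x. common_part A x * indicator (cball 0 1) x \<partial>lborel)"
      by (rule nn_integral_cmult) (use common_part_measurable[OF A] in \<open>intro borel_measurable_times_ennreal borel_measurable_indicator; simp\<close>)
    finally show "ennreal (e1 * e2) * (\<integral>\<^sup>+y. common_part A y * indicator (cball 0 1) y \<partial>lborel) \<le> emeasure (law_from Q z 2) A" .
  qed
qed

text \<open>The lower bound does not depend on the initial state, so it is a common part of any two of the laws.\<close>
lemma two_step_overlap:
  "\<exists>\<alpha>>0. \<forall>z z' A. norm (pos z) + norm (fst z) \<le> r \<longrightarrow> norm (pos z') + norm (fst z') \<le> r \<longrightarrow> A \<in> sets borel \<longrightarrow>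
     measure (law_from Q z 2) A - measure (law_from Q z' 2) A \<le> 1 - \<alpha>"
proof -
  obtain e where e: "0 < e \<and> (\<forall>z A. norm (pos z) + norm (fst z) \<le> \<bar>r\<bar> \<longrightarrow> A \<in> sets borel \<longrightarrow>
     ennreal e * (\<integral>\<^sup>+y. common_part A y * indicator (cball 0 1) y \<partial>lborel) \<le> emeasure (law_from Q z 2) A)"
    using two_step_lower_bound[of "\<bar>r\<bar>", OF abs_ge_zero] by (rule exE)
  define I where "I A = (\<integral>\<^sup>+y. common_part A y * indicator (cball 0 1) y \<partial>lborel)" for A
  define v where "v = measure lborel (cball (0::real^2) 1)"
  have v: "0 < v" unfolding v_def by (simp add: content_cball)
  have ev: "emeasure lborel (cball (0::real^2) 1) = ennreal v"
    unfolding v_def using emeasure_bounded_finite[OF bounded_cball, of "0::real^2" 1] by (simp add: emeasure_eq_ennreal_measure)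
  have sum: "I A + I (- A) = ennreal (v * v)" if A: "A \<in> sets borel" for A
  proof -
    have mA: "(\<lambda>x. indicator C (x, kick x - y) * indicator (cball 0 1) x :: ennreal) \<in> borel_measurable lborel" if "C \<in> sets borel" for C y
    proof -
      have "(\<lambda>x. (x, kick x - y)) \<in> borel \<rightarrow>\<^sub>M borel"
        unfolding borel_prod[symmetric] using kick_measurable by measurable
      hence "(\<lambda>x. indicator C (x, kick x - y) :: ennreal) \<in> borel_measurable borel"
        by (rule measurable_compose) (rule borel_measurable_indicator[OF that])
      thus ?thesis by (intro borel_measurable_times_ennreal borel_measurable_indicator) simp_all
    qed
    have cA: "- A \<in> sets borel" using sets.compl_sets[OF A] by (simp add: Compl_eq_Diff_UNIV)
    have "common_part A y + common_part (- A) y = ennreal v" for y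
    proof -
      have "common_part A y + common_part (- A) y
          = (\<integral>\<^sup>+x. indicator A (x, kick x - y) * indicator (cball 0 1) x + indicator (- A) (x, kick x - y) * indicator (cball 0 1) x \<partial>lborel)"
        unfolding common_part_def by (rule nn_integral_add[symmetric, OF mA[OF A] mA[OF cA]])
      also have "\<dots> = (\<integral>\<^sup>+x. indicator (cball (0::real^2) 1) x \<partial>lborel)"
        by (intro nn_integral_cong) (auto split: split_indicator)
      finally show ?thesis by (simp add: ev)
    qed
    hence "(\<integral>\<^sup>+y. common_part A y * indicator (cball 0 1) y + common_part (- A) y * indicator (cball 0 1) y \<partial>lborel)
        = (\<integral>\<^sup>+y. ennreal v * indicator (cball (0::real^2) 1) y \<partial>lborel)"
      by (simp only: distrib_right[symmetric])
    also have "\<dots> = ennreal v * ennreal v" by (subst nn_integral_cmult_indicator) (simp_all add: ev)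
    also have "\<dots> = ennreal (v * v)" using v by (simp add: ennreal_mult)
    finally have "(\<integral>\<^sup>+y. common_part A y * indicator (cball 0 1) y + common_part (- A) y * indicator (cball 0 1) y \<partial>lborel) = ennreal (v * v)" .
    moreover have "(\<lambda>y. common_part C y * indicator (cball 0 1) y) \<in> borel_measurable lborel" if "C \<in> sets borel" for C
      using common_part_measurable[OF that] by (intro borel_measurable_times_ennreal borel_measurable_indicator) simp_all
    ultimately show ?thesis unfolding I_def by (subst nn_integral_add[symmetric]) (use A cA in simp_all)
  qed
  show ?thesis
  proof (rule exI[of _ "e * (v * v)"], intro conjI allI impI)
    show "0 < e * (v * v)" using e v by simp
    fix z z' A assume z: "norm (pos z) + norm (fst z) \<le> r" "norm (pos z') + norm (fst z') \<le> r" and A: "A \<in> sets (borel :: ((real^2) \<times> (real^2)) measure)"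
    have cA: "- A \<in> sets borel" using sets.compl_sets[OF A] by (simp add: Compl_eq_Diff_UNIV)
    have r: "r \<le> \<bar>r\<bar>" by simp
    have lb: "ennreal e * I C \<le> emeasure (law_from Q u 2) C" if "norm (pos u) + norm (fst u) \<le> r" "C \<in> sets borel" for u C
      unfolding I_def by (rule e[THEN conjunct2, rule_format, OF order_trans[OF that(1) r] that(2)])
    interpret P: prob_space "law_from Q z 2" by (rule kernel_prob(1)[OF measurable_law_from[OF Q_measurable]])
    interpret P': prob_space "law_from Q z' 2" by (rule kernel_prob(1)[OF measurable_law_from[OF Q_measurable]])
    have "ennreal (e * (v * v)) = ennreal e * (I (- A) + I A)"
      using sum[OF A] e v by (simp add: ennreal_mult add.commute)
    also have "\<dots> \<le> emeasure (law_from Q z 2) (- A) + emeasure (law_from Q z' 2) A"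
      unfolding distrib_left by (intro add_mono lb z A cA)
    also have "\<dots> = ennreal (measure (law_from Q z 2) (- A) + measure (law_from Q z' 2) A)"
      by (simp add: P.emeasure_eq_measure P'.emeasure_eq_measure)
    finally have "e * (v * v) \<le> measure (law_from Q z 2) (- A) + measure (law_from Q z' 2) A"
      by (subst (asm) ennreal_le_iff) simp_all
    moreover have "measure (law_from Q z 2) (- A) = 1 - measure (law_from Q z 2) A"
    proof -
      have s: "sets (law_from Q z 2) = sets borel" by (rule kernel_prob(2)[OF measurable_law_from[OF Q_measurable]])
      have "space (law_from Q z 2) = UNIV" using sets_eq_imp_space_eq[OF s] by simp
      thus ?thesis using P.prob_compl[of A] A s by (simp add: Compl_eq_Diff_UNIV)
    qed
    ultimately show "measure (law_from Q z 2) A - measure (law_from Q z' 2) A \<le> 1 - e * (v * v)" by linarith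
  qed
qed

end

section \<open>The invariant law and its second moment\<close>

text \<open>Transport cost of the product coupling.\<close>
lemma W2_return_le:
  fixes z :: "'s::euclidean_space"
  assumes \<pi>: "prob_space \<pi>" "sets \<pi> = sets borel" and b: "0 \<le> b"
    and le: "(\<integral>\<^sup>+y. ennreal ((dist z y)\<^sup>2) \<partial>\<pi>) \<le> ennreal (b\<^sup>2)"
  shows "W2 (return borel z) \<pi> \<le> ennreal b"
proof -
  interpret prob_space \<pi> by (rule \<pi>(1))
  define P where "P = distr \<pi> (borel \<Otimes>\<^sub>M borel) (\<lambda>y. (z, y))"
  have idm: "(\<lambda>y. y) \<in> \<pi> \<rightarrow>\<^sub>M borel" using measurable_ident_sets[OF \<pi>(2)] by simp
  have pm: "(\<lambda>y. (z, y)) \<in> \<pi> \<rightarrow>\<^sub>M borel \<Otimes>\<^sub>M borel" by (intro measurable_Pair measurable_const idm) simp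
  have setsP: "sets P = sets (borel \<Otimes>\<^sub>M borel)" unfolding P_def by simp
  have "P \<in> couplings (return borel z) \<pi>"
  proof -
    have 1: "sets P = sets (return borel z \<Otimes>\<^sub>M \<pi>)"
      unfolding setsP by (rule sets_pair_measure_cong) (simp_all add: \<pi>(2))
    have "distr P (return borel z) fst = distr \<pi> (return borel z) (\<lambda>y. z)"
      unfolding P_def by (subst distr_distr[OF _ pm]) (auto simp: comp_def measurable_cong_sets[OF refl sets_return])
    also have "\<dots> = return (return borel z) z" by (rule distr_const) simp
    also have "\<dots> = return borel z" by (rule return_cong) simp
    finally have 2: "distr P (return borel z) fst = return borel z" .
    have "distr P \<pi> snd = distr \<pi> \<pi> (\<lambda>y. y)"
      unfolding P_def by (subst distr_distr[OF _ pm]) (auto simp: comp_def measurable_cong_sets[OF refl \<pi>(2)])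
    hence 3: "distr P \<pi> snd = \<pi>" by simp
    show ?thesis unfolding couplings_def using 1 2 3 by simp
  qed
  hence "(INF \<pi>'\<in>couplings (return borel z) \<pi>. \<integral>\<^sup>+p. ennreal ((dist (fst p) (snd p))\<^sup>2) \<partial>\<pi>') \<le> (\<integral>\<^sup>+p. ennreal ((dist (fst p) (snd p))\<^sup>2) \<partial>P)"
    by (rule INF_lower)
  also have "\<dots> = (\<integral>\<^sup>+y. ennreal ((dist z y)\<^sup>2) \<partial>\<pi>)"
    unfolding P_def by (subst nn_integral_distr[OF pm]) (auto intro!: measurable_compose[OF _ measurable_ennreal] borel_measurable_power borel_measurable_dist)
  finally have c: "(INF \<pi>'\<in>couplings (return borel z) \<pi>. \<integral>\<^sup>+p. ennreal ((dist (fst p) (snd p))\<^sup>2) \<partial>\<pi>') \<le> ennreal (b\<^sup>2)"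
    using le by (rule order_trans)
  define c where "c = (INF \<pi>'\<in>couplings (return borel z) \<pi>. \<integral>\<^sup>+p. ennreal ((dist (fst p) (snd p))\<^sup>2) \<partial>\<pi>')"
  have cb: "c \<le> ennreal (b\<^sup>2)" using c unfolding c_def .
  have ci: "c \<noteq> \<infinity>" using neq_top_trans[OF ennreal_neq_top cb] by simp
  have "enn2real c \<le> b\<^sup>2" using cb by (simp add: enn2real_leI)
  hence "sqrt (enn2real c) \<le> b" using b by (simp add: real_le_lsqrt)
  thus ?thesis unfolding W2_def Let_def c_def[symmetric] using ci by (simp add: ennreal_leI)
qed

text \<open>A crude value, from \<open>x \<le> 4 exp (x / 4)\<close>.\<close>
lemma gaussian_second_moment:
  "(\<integral>\<^sup>+\<xi>. ennreal ((norm \<xi>)\<^sup>2) \<partial>(std_gaussian :: (real^2) measure)) \<le> ennreal 8"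
proof -
  have "(\<integral>\<^sup>+\<xi>. ennreal ((norm \<xi>)\<^sup>2) \<partial>(std_gaussian :: (real^2) measure)) \<le> (\<integral>\<^sup>+\<xi>. ennreal 4 * ennreal (exp ((norm \<xi>)\<^sup>2 / 4)) \<partial>(std_gaussian :: (real^2) measure))"
  proof (rule nn_integral_mono)
    fix \<xi> :: "real^2"
    have u: "4 * u \<le> 4 * exp u" for u :: real using exp_ge_add_one_self[of u] by linarith
    have "(norm \<xi>)\<^sup>2 \<le> 4 * exp ((norm \<xi>)\<^sup>2 / 4)" using u[of "(norm \<xi>)\<^sup>2 / 4"] by simp
    thus "ennreal ((norm \<xi>)\<^sup>2) \<le> ennreal 4 * ennreal (exp ((norm \<xi>)\<^sup>2 / 4))"
      by (simp add: ennreal_mult[symmetric] del: ennreal_numeral)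
  qed
  also have "\<dots> = ennreal 4 * (\<integral>\<^sup>+\<xi>. ennreal (exp ((norm \<xi>)\<^sup>2 / 4)) \<partial>(std_gaussian :: (real^2) measure))"
    by (rule nn_integral_cmult) (simp add: measurable_cong_borel[OF sets_std_gaussian])
  also have "\<dots> = ennreal 8" unfolding nn_integral_gaussian_exp_square by (simp add: ennreal_mult[symmetric] del: ennreal_numeral)
  finally show ?thesis .
qed

lemma heavy_ball_rearrange:
  fixes p f b G :: "'a::real_vector"
  assumes "T = 1 + \<beta> - s"
  shows "(1 + \<beta>) *\<^sub>R (p + f) - \<beta> *\<^sub>R b - s *\<^sub>R G + f = T *\<^sub>R p - \<beta> *\<^sub>R b + ((T + 1) *\<^sub>R f - s *\<^sub>R (G - (p + f)))"
  unfolding assms by (simp add: algebra_simps scaleR_2)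

text \<open>A quadratic form that contracts along the heavy-ball map of unit curvature.  Its constants are parameters, as they must
  not depend on the dilation factor that enters through the potential.\<close>
locale lyapunov_chain = bounded_force_chain +
  fixes s T k \<tau> \<rho> c C :: real
  assumes s: "s = h\<^sup>2 / 2 * (1 + \<beta>)" and T: "T = 1 + \<beta> - s" "\<bar>T\<bar> < 1 + \<beta>"
    and ly: "0 \<le> \<rho>" "\<rho> < 1" "0 < c" "0 < C"
    and lyc: "\<And>a b::real^2. c * ((norm a)\<^sup>2 + (norm b)\<^sup>2) \<le> lyap k \<tau> a b" "\<And>a b::real^2. lyap k \<tau> a b \<le> 2 * ((norm a)\<^sup>2 + (norm b)\<^sup>2)"
    and lys: "\<And>a b e f::real^2. lyap k \<tau> (T *\<^sub>R a - \<beta> *\<^sub>R b + e) (a + f) \<le> \<rho> * lyap k \<tau> a b + C * ((norm e)\<^sup>2 + (norm f)\<^sup>2)"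
begin

abbreviation "V z \<equiv> lyap k \<tau> (pos z) (fst z)"

lemma lyap_nonneg: "0 \<le> lyap k \<tau> a b" for a b :: "real^2"
  by (rule order_trans[OF _ lyc(1)]) (use ly(3) in \<open>intro mult_nonneg_nonneg add_nonneg_nonneg; simp\<close>)

lemma s_nonneg: "0 \<le> s" unfolding s using \<beta>(2) by simp

lemma T1: "\<bar>T + 1\<bar> \<le> 3" using T(2) \<beta>(3) by (simp only: abs_le_iff abs_less_iff) linarith

lemma pos_step: "pos (step z \<xi>) = T *\<^sub>R pos z - \<beta> *\<^sub>R fst z + ((T + 1) *\<^sub>R (\<sigma> *\<^sub>R \<xi>) - s *\<^sub>R (g (pos z + \<sigma> *\<^sub>R \<xi>) - (pos z + \<sigma> *\<^sub>R \<xi>)))"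
  unfolding step_next step_pos s[symmetric] by (rule heavy_ball_rearrange[OF T(1)])

lemma pos_measurable: "pos \<in> borel_measurable borel"
  unfolding next_pos_def[abs_def]
  by (intro borel_measurable_continuous_onI continuous_intros continuous_on_compose2[OF continuous_g]) auto

lemma lyap_measurable:
  fixes f f' :: "'x::topological_space \<Rightarrow> real^2"
  assumes "f \<in> borel_measurable borel" "f' \<in> borel_measurable borel"
  shows "(\<lambda>z. lyap k \<tau> (f z) (f' z)) \<in> borel_measurable borel"
proof -
  note [measurable] = assms
  show ?thesis unfolding lyap_def by measurable
qed

lemma fst_measurable: "fst \<in> borel_measurable (borel :: ((real^2) \<times> (real^2)) measure)"
  by (intro borel_measurable_continuous_onI continuous_intros)

text \<open>Explicit, because its growth with the bound on the perturbation has to be tracked.\<close>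
definition drift :: real where "drift = C * (2 * (s * B)\<^sup>2 + 152 * \<sigma>\<^sup>2)"

lemma drift_nonneg: "0 \<le> drift" unfolding drift_def using ly by simp

lemma V_step: "V (step z \<xi>) \<le> (\<rho> * V z + C * (2 * (s * B)\<^sup>2)) + C * (19 * \<sigma>\<^sup>2) * (norm \<xi>)\<^sup>2"
proof -
  define f where "f = \<sigma> *\<^sub>R \<xi>"
  define e where "e = (T + 1) *\<^sub>R f - s *\<^sub>R (g (pos z + f) - (pos z + f))"
  have nf: "(norm f)\<^sup>2 = \<sigma>\<^sup>2 * (norm \<xi>)\<^sup>2" unfolding f_def by (simp add: power_mult_distrib)
  have "norm e \<le> 3 * norm f + s * B"
  proof -
    have "norm e \<le> norm ((T + 1) *\<^sub>R f) + norm (s *\<^sub>R (g (pos z + f) - (pos z + f)))" unfolding e_def by (rule norm_triangle_ineq4)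
    moreover have "norm ((T + 1) *\<^sub>R f) \<le> 3 * norm f" using T1 by (simp add: mult_right_mono)
    moreover have "norm (s *\<^sub>R (g (pos z + f) - (pos z + f))) \<le> s * B" using s_nonneg gB by (simp add: mult_left_mono)
    ultimately show ?thesis by linarith
  qed
  hence "(norm e)\<^sup>2 \<le> (3 * norm f + s * B)\<^sup>2" by (intro power_mono) auto
  also have "\<dots> \<le> 18 * (norm f)\<^sup>2 + 2 * (s * B)\<^sup>2"
  proof -
    have "0 \<le> (3 * norm f - s * B)\<^sup>2" by simp
    thus ?thesis by (simp add: power2_eq_square algebra_simps)
  qed
  finally have "C * ((norm e)\<^sup>2 + (norm f)\<^sup>2) \<le> C * (18 * (norm f)\<^sup>2 + 2 * (s * B)\<^sup>2 + (norm f)\<^sup>2)"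
    using ly(4) by (intro mult_left_mono) auto
  also have "\<dots> = C * (2 * (s * B)\<^sup>2) + C * (19 * \<sigma>\<^sup>2) * (norm \<xi>)\<^sup>2"
    unfolding nf by (simp add: algebra_simps)
  finally show ?thesis
    using lys[of "pos z" "fst z" e f] unfolding pos_step step_pos f_def[symmetric] e_def[symmetric] by linarith
qed

lemma V_drift: "(\<integral>\<^sup>+y. ennreal (V y) \<partial>Q z) \<le> ennreal (\<rho> * V z + drift)"
proof -
  define A where "A = \<rho> * V z + C * (2 * (s * B)\<^sup>2)"
  define D where "D = C * (19 * \<sigma>\<^sup>2)"
  have A: "0 \<le> A" unfolding A_def using ly lyap_nonneg[of "pos z" "fst z"] by simp
  have D: "0 \<le> D" unfolding D_def using ly by simp
  have "(\<integral>\<^sup>+y. ennreal (V y) \<partial>Q z) = (\<integral>\<^sup>+\<xi>. ennreal (V (step z \<xi>)) \<partial>std_gaussian)"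
    by (rule nn_integral_Q) (intro measurable_compose[OF _ measurable_ennreal] lyap_measurable pos_measurable fst_measurable)
  also have "\<dots> \<le> (\<integral>\<^sup>+\<xi>. ennreal A + ennreal D * ennreal ((norm \<xi>)\<^sup>2) \<partial>(std_gaussian :: (real^2) measure))"
  proof (rule nn_integral_mono)
    fix \<xi> :: "real^2"
    have "ennreal (V (step z \<xi>)) \<le> ennreal (A + D * (norm \<xi>)\<^sup>2)" unfolding A_def D_def by (rule ennreal_leI[OF V_step])
    thus "ennreal (V (step z \<xi>)) \<le> ennreal A + ennreal D * ennreal ((norm \<xi>)\<^sup>2)" using A D by (simp add: ennreal_mult)
  qed
  also have "\<dots> = ennreal A + ennreal D * (\<integral>\<^sup>+\<xi>. ennreal ((norm \<xi>)\<^sup>2) \<partial>(std_gaussian :: (real^2) measure))"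
    using gauss.emeasure_space_1[where 'a="real^2"]
    by (subst nn_integral_add) (simp_all add: nn_integral_cmult measurable_cong_borel[OF sets_std_gaussian])
  also have "\<dots> \<le> ennreal A + ennreal D * ennreal 8"
    by (intro add_left_mono mult_left_mono gaussian_second_moment) simp
  also have "\<dots> = ennreal (\<rho> * V z + drift)"
    using A D by (simp add: ennreal_mult[symmetric] ennreal_plus[symmetric] del: ennreal_numeral ennreal_plus)
      (simp add: A_def D_def drift_def algebra_simps)
  finally show ?thesis .
qed

theorem unique_invariant_law:
  "\<exists>\<pi>. invariant_law Q \<pi> \<and> (\<forall>\<pi>'. invariant_law Q \<pi>' \<longrightarrow> \<pi>' = \<pi>) \<and>
     (\<integral>\<^sup>+z. ennreal (V z) \<partial>\<pi>) \<le> ennreal (drift / (1 - \<rho>))"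
proof (rule harris_invariant_law_two_step[OF Q_measurable _ lyap_nonneg ly(1,2) drift_nonneg V_drift])
  show "V \<in> borel_measurable borel" by (intro lyap_measurable pos_measurable fst_measurable)
  fix r :: real
  have lev: "norm (pos x) + norm (fst x) \<le> r / c + 2" if "V x \<le> r" for x
  proof -
    have "t \<le> t\<^sup>2 + 1" for t :: real
    proof -
      have "0 \<le> (t - 1)\<^sup>2 + t\<^sup>2 + 1" by simp
      thus ?thesis by (simp add: power2_eq_square algebra_simps)
    qed
    from this[of "norm (pos x)"] this[of "norm (fst x)"]
    have "norm (pos x) + norm (fst x) \<le> ((norm (pos x))\<^sup>2 + (norm (fst x))\<^sup>2) + 2" by linarith
    moreover have "c * ((norm (pos x))\<^sup>2 + (norm (fst x))\<^sup>2) \<le> r" by (rule order_trans[OF lyc(1) that])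
    hence "(norm (pos x))\<^sup>2 + (norm (fst x))\<^sup>2 \<le> r / c" using ly(3) by (simp add: pos_le_divide_eq mult.commute)
    ultimately show ?thesis by linarith
  qed
  obtain \<alpha> where \<alpha>: "0 < \<alpha> \<and> (\<forall>z z' A. norm (pos z) + norm (fst z) \<le> r / c + 2 \<longrightarrow> norm (pos z') + norm (fst z') \<le> r / c + 2 \<longrightarrow> A \<in> sets borel \<longrightarrow>
     measure (law_from Q z 2) A - measure (law_from Q z' 2) A \<le> 1 - \<alpha>)"
    using two_step_overlap[of "r / c + 2"] by (rule exE)
  show "\<exists>\<alpha>>0. \<forall>x y A. V x \<le> r \<longrightarrow> V y \<le> r \<longrightarrow> A \<in> sets borel \<longrightarrow>
                     measure (law_from Q x 2) A - measure (law_from Q y 2) A \<le> 1 - \<alpha>"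
    by (rule exI[of _ \<alpha>], intro conjI allI impI \<alpha>[THEN conjunct1], rule \<alpha>[THEN conjunct2, rule_format, OF lev lev])
qed


text \<open>The energy controls the squared distance to any fixed state, because the velocity is an affine
  function of the two positions up to a bounded error.\<close>
text \<open>Explicit for the same reason as \<open>drift\<close>: it does not involve the bound on the perturbation.\<close>
definition distance_factor :: real where
  "distance_factor = 2 * ((1 + 1 / m + slope + h / 2)\<^sup>2 * 3 / c + (1 + 1 / m + slope + h / 2)\<^sup>2 * 6)"

lemma dist_square_bound:
  "0 < distance_factor" "(dist z w)\<^sup>2 \<le> distance_factor * (V w + V z + B\<^sup>2)"
proof -
  define a where "a = 1 + 1 / m + slope + h / 2"
  have a: "0 < a" unfolding a_def using m_pos slope_pos h by (simp add: add_pos_nonneg)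
  have nz: "(norm z)\<^sup>2 \<le> a\<^sup>2 * 3 / c * V z + a\<^sup>2 * 3 * B\<^sup>2" for z :: "(real^2) \<times> (real^2)"
  proof -
    have "norm (snd z) \<le> norm (memory z) + norm (kick (fst z))" unfolding snd_memory by (rule norm_triangle_ineq4)
    moreover have "norm (memory z) \<le> 1 / m * (norm (pos z) + norm (fst z))"
      using memory_bound[OF order_refl, of z] by (simp only: times_divide_eq_left mult_1_left)
    moreover have "norm (kick (fst z)) \<le> slope * norm (fst z) + h / 2 * B"
    proof -
      have "norm (kick (fst z)) \<le> norm (slope *\<^sub>R fst z) + norm ((h / 2) *\<^sub>R (g (fst z) - fst z))"
        unfolding kick_eq by (rule norm_triangle_ineq4)
      moreover have "norm ((h / 2) *\<^sub>R (g (fst z) - fst z)) \<le> h / 2 * B" using gB[of "fst z"] h by (simp add: mult_left_mono)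
      ultimately show ?thesis using slope_pos by simp
    qed
    moreover have "norm z \<le> norm (fst z) + norm (snd z)" unfolding norm_prod_def by (rule sqrt_sum_squares_le_sum) simp_all
    ultimately have 1: "norm z \<le> norm (fst z) + (1 / m * (norm (pos z) + norm (fst z)) + (slope * norm (fst z) + h / 2 * B))" by linarith
    have "1 * norm (fst z) \<le> 1 * (norm (pos z) + norm (fst z) + B)" "slope * norm (fst z) \<le> slope * (norm (pos z) + norm (fst z) + B)"
       "h / 2 * B \<le> h / 2 * (norm (pos z) + norm (fst z) + B)" "1 / m * (norm (pos z) + norm (fst z)) \<le> 1 / m * (norm (pos z) + norm (fst z) + B)"
      by (intro mult_left_mono; use B_nonneg slope_pos h m_pos in simp)+
    hence "norm z \<le> a * (norm (pos z) + norm (fst z) + B)" unfolding a_def distrib_right using 1 by linarith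
    hence "(norm z)\<^sup>2 \<le> (a * (norm (pos z) + norm (fst z) + B))\<^sup>2" by (intro power_mono) auto
    also have "\<dots> = a\<^sup>2 * (norm (pos z) + norm (fst z) + B)\<^sup>2" by (rule power_mult_distrib)
    also have "\<dots> \<le> a\<^sup>2 * (3 * ((norm (pos z))\<^sup>2 + (norm (fst z))\<^sup>2) + 3 * B\<^sup>2)"
    proof (rule mult_left_mono)
      have "0 \<le> (p - q)\<^sup>2 + (p - b)\<^sup>2 + (q - b)\<^sup>2" for p q b :: real by simp
      hence "(p + q + b)\<^sup>2 \<le> 3 * (p\<^sup>2 + q\<^sup>2) + 3 * b\<^sup>2" for p q b :: real
        by (simp add: power2_eq_square algebra_simps)
      thus "(norm (pos z) + norm (fst z) + B)\<^sup>2 \<le> 3 * ((norm (pos z))\<^sup>2 + (norm (fst z))\<^sup>2) + 3 * B\<^sup>2" .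
    qed simp
    also have "\<dots> \<le> a\<^sup>2 * (3 * (V z / c) + 3 * B\<^sup>2)"
    proof -
      have "(norm (pos z))\<^sup>2 + (norm (fst z))\<^sup>2 \<le> V z / c" using lyc(1)[of "pos z" "fst z"] ly(3) by (simp add: pos_le_divide_eq mult.commute)
      thus ?thesis by (intro mult_left_mono add_right_mono) auto
    qed
    finally show ?thesis by (simp add: algebra_simps)
  qed
  have D: "distance_factor = 2 * (a\<^sup>2 * 3 / c + a\<^sup>2 * 6)" unfolding distance_factor_def a_def ..
  have ac: "0 < a\<^sup>2 * 3 / c" "0 < a\<^sup>2 * 6" using a ly(3) by simp_all
  show "0 < distance_factor" unfolding D using ac by (intro mult_pos_pos add_pos_pos) simp_all
  show "(dist z w)\<^sup>2 \<le> distance_factor * (V w + V z + B\<^sup>2)"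
  proof -
    have "(dist z w)\<^sup>2 \<le> (norm z + norm w)\<^sup>2" unfolding dist_norm by (intro power_mono norm_triangle_ineq4) simp
    also have "\<dots> \<le> 2 * ((norm z)\<^sup>2 + (norm w)\<^sup>2)"
    proof -
      have "0 \<le> (norm z - norm w)\<^sup>2" by simp
      thus ?thesis by (simp add: power2_eq_square algebra_simps)
    qed
    also have "\<dots> \<le> 2 * (a\<^sup>2 * 3 / c * (V w + V z) + a\<^sup>2 * 6 * B\<^sup>2)"
      using nz[of z] nz[of w] by (simp add: distrib_left)
    also have "\<dots> \<le> distance_factor * (V w + V z + B\<^sup>2)"
    proof -
      have "0 \<le> a\<^sup>2 * 6 * (V w + V z)" using lyap_nonneg by (intro mult_nonneg_nonneg add_nonneg_nonneg) auto
      moreover have "0 \<le> a\<^sup>2 * 3 / c * B\<^sup>2" by (rule mult_nonneg_nonneg[OF less_imp_le[OF ac(1)] zero_le_power2])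
      ultimately show ?thesis unfolding D by (simp add: algebra_simps)
    qed
    finally show ?thesis .
  qed
qed

lemma W2_dirac_invariant:
  assumes \<pi>: "invariant_law Q \<pi>" "(\<integral>\<^sup>+z. ennreal (V z) \<partial>\<pi>) \<le> ennreal (drift / (1 - \<rho>))"
  shows "W2 (return borel z) \<pi> \<le> ennreal (sqrt (distance_factor * (drift / (1 - \<rho>) + V z + B\<^sup>2)))"
proof (rule W2_return_le)
  show p: "prob_space \<pi>" and ss: "sets \<pi> = sets borel" using \<pi>(1) unfolding invariant_law_def by simp_all
  interpret prob_space \<pi> by (rule p)
  define b where "b = V z + B\<^sup>2"
  have b: "0 \<le> b" unfolding b_def using lyap_nonneg by simp
  have dr: "0 \<le> drift / (1 - \<rho>)" using drift_nonneg ly by simp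
  have D: "0 \<le> distance_factor" using dist_square_bound(1) by simp
  have t: "0 \<le> distance_factor * (drift / (1 - \<rho>) + V z + B\<^sup>2)"
    using D dr b unfolding b_def by (intro mult_nonneg_nonneg) simp_all
  thus "0 \<le> sqrt (distance_factor * (drift / (1 - \<rho>) + V z + B\<^sup>2))" by simp
  have "(\<integral>\<^sup>+w. ennreal ((dist z w)\<^sup>2) \<partial>\<pi>) \<le> (\<integral>\<^sup>+w. ennreal distance_factor * (ennreal (V w) + ennreal b) \<partial>\<pi>)"
  proof (rule nn_integral_mono)
    fix w
    have "ennreal ((dist z w)\<^sup>2) \<le> ennreal (distance_factor * (V w + b))"
      unfolding b_def by (rule ennreal_leI) (use dist_square_bound(2)[of z w] in \<open>simp add: add.assoc\<close>)
    thus "ennreal ((dist z w)\<^sup>2) \<le> ennreal distance_factor * (ennreal (V w) + ennreal b)"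
      using D b lyap_nonneg[of "pos w" "fst w"] by (simp add: ennreal_mult)
  qed
  also have "\<dots> = ennreal distance_factor * ((\<integral>\<^sup>+w. ennreal (V w) \<partial>\<pi>) + ennreal b)"
  proof -
    have Vm: "(\<lambda>w. ennreal (V w)) \<in> borel_measurable \<pi>"
      unfolding measurable_cong_borel[OF ss]
      by (intro measurable_compose[OF _ measurable_ennreal] lyap_measurable pos_measurable fst_measurable)
    have "(\<integral>\<^sup>+w. ennreal distance_factor * (ennreal (V w) + ennreal b) \<partial>\<pi>) = ennreal distance_factor * (\<integral>\<^sup>+w. ennreal (V w) + ennreal b \<partial>\<pi>)"
      by (rule nn_integral_cmult) (intro borel_measurable_add Vm borel_measurable_const)
    also have "(\<integral>\<^sup>+w. ennreal (V w) + ennreal b \<partial>\<pi>) = (\<integral>\<^sup>+w. ennreal (V w) \<partial>\<pi>) + ennreal b"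
      by (subst nn_integral_add[OF Vm]) (simp_all add: emeasure_space_1)
    finally show ?thesis .
  qed
  also have "\<dots> \<le> ennreal distance_factor * (ennreal (drift / (1 - \<rho>)) + ennreal b)"
    by (intro mult_left_mono add_right_mono \<pi>(2)) simp
  also have "\<dots> = ennreal (distance_factor * (drift / (1 - \<rho>) + b))"
    using D dr b by (simp add: ennreal_mult)
  also have "distance_factor * (drift / (1 - \<rho>) + b) = (sqrt (distance_factor * (drift / (1 - \<rho>) + V z + B\<^sup>2)))\<^sup>2"
    using t unfolding b_def by (simp add: add.assoc)
  finally show "(\<integral>\<^sup>+w. ennreal ((dist z w)\<^sup>2) \<partial>\<pi>) \<le> ennreal ((sqrt (distance_factor * (drift / (1 - \<rho>) + V z + B\<^sup>2)))\<^sup>2)" .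
qed

end

section \<open>Tubes around deterministic trajectories\<close>

context lyapunov_chain
begin

text \<open>Sublevel sets of the form around a moving reference trajectory; the level is such that positions stay within \<open>r / 2\<close>.\<close>
definition tube :: "(nat \<Rightarrow> real^2) \<Rightarrow> real \<Rightarrow> nat \<Rightarrow> ((real^2) \<times> (real^2)) set" where
  "tube y r n = {z. lyap k \<tau> (pos z - y (Suc n)) (fst z - y n) \<le> c * r\<^sup>2 / 4}"

lemma tube_measurable: "tube y r n \<in> sets borel"
proof -
  have "(\<lambda>z. lyap k \<tau> (pos z - y (Suc n)) (fst z - y n)) \<in> borel_measurable borel"
    by (intro lyap_measurable borel_measurable_diff pos_measurable fst_measurable borel_measurable_const)
  from measurable_sets[OF this, of "{.. c * r\<^sup>2 / 4}"]
  show ?thesis unfolding tube_def by (simp add: vimage_def)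
qed

lemma tube_near:
  assumes "z \<in> tube y r n" "0 \<le> r"
  shows "norm (pos z - y (Suc n)) \<le> r / 2" "norm (fst z - y n) \<le> r / 2"
proof -
  let ?p = "pos z - y (Suc n)" and ?q = "fst z - y n"
  have "c * ((norm ?p)\<^sup>2 + (norm ?q)\<^sup>2) \<le> c * (r / 2)\<^sup>2"
  proof -
    have "lyap k \<tau> ?p ?q \<le> c * r\<^sup>2 / 4" using assms(1) unfolding tube_def by simp
    from order_trans[OF lyc(1) this] show ?thesis by (simp add: power_divide)
  qed
  hence "(norm ?p)\<^sup>2 + (norm ?q)\<^sup>2 \<le> (r / 2)\<^sup>2" using ly(3) by (simp only: mult_le_cancel_left_pos)
  hence "(norm ?p)\<^sup>2 \<le> (r / 2)\<^sup>2" "(norm ?q)\<^sup>2 \<le> (r / 2)\<^sup>2"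
    using zero_le_power2[of "norm ?p"] zero_le_power2[of "norm ?q"] by linarith+
  thus "norm ?p \<le> r / 2" "norm ?q \<le> r / 2" using assms(2) by (auto intro: power2_le_imp_le)
qed

text \<open>Inside the tube the force is a translate of the identity, so the deviation from the trajectory obeys the linear
  heavy-ball recursion; noise below a fixed multiple of \<open>r\<close> is absorbed by the contraction.\<close>
lemma tube_step:
  assumes cyc: "\<And>n. y (Suc (Suc n)) = (1 + \<beta>) *\<^sub>R y (Suc n) - \<beta> *\<^sub>R y n - s *\<^sub>R g (y (Suc n))"
    and loc: "\<And>n e. norm e \<le> r \<Longrightarrow> g (y n + e) = g (y n) + e"
    and r: "0 \<le> r" and a: "0 \<le> a" "\<sigma> * a \<le> 1 / 2" "10 * C * \<sigma>\<^sup>2 * a\<^sup>2 \<le> (1 - \<rho>) * (c / 4)"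
    and z: "z \<in> tube y r n" and \<xi>: "norm \<xi> \<le> a * r"
  shows "step z \<xi> \<in> tube y r (Suc n)"
proof -
  define f where "f = \<sigma> *\<^sub>R \<xi>"
  define p where "p = pos z - y (Suc n)"
  define q where "q = fst z - y n"
  have nf: "norm f \<le> \<sigma> * (a * r)" unfolding f_def using \<xi> \<sigma>_pos by (simp add: mult_left_mono)
  have "\<sigma> * (a * r) \<le> 1 / 2 * r" unfolding mult.assoc[symmetric] by (rule mult_right_mono[OF a(2) r])
  hence "norm f \<le> r / 2" using nf by linarith
  moreover have "norm p \<le> r / 2" unfolding p_def by (rule tube_near[OF z r])
  ultimately have "norm (p + f) \<le> r" using norm_triangle_ineq[of p f] by linarith
  from loc[OF this, of "Suc n"] have gx: "g (pos z + f) = g (y (Suc n)) + (p + f)" unfolding p_def by (simp add: add.assoc[symmetric])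
  have x: "fst (step z \<xi>) - y (Suc n) = p + f" unfolding step_pos p_def f_def by simp
  have "pos (step z \<xi>) - y (Suc (Suc n)) = T *\<^sub>R p - \<beta> *\<^sub>R q + (T + 1) *\<^sub>R f"
    unfolding pos_step f_def[symmetric] gx cyc p_def q_def T(1) by (simp add: algebra_simps)
  hence "lyap k \<tau> (pos (step z \<xi>) - y (Suc (Suc n))) (fst (step z \<xi>) - y (Suc n)) \<le> \<rho> * lyap k \<tau> p q + C * ((norm ((T + 1) *\<^sub>R f))\<^sup>2 + (norm f)\<^sup>2)"
    unfolding x using lys[of p q "(T + 1) *\<^sub>R f" f] by simp
  also have "\<dots> \<le> \<rho> * (c * r\<^sup>2 / 4) + C * (10 * (\<sigma> * (a * r))\<^sup>2)"
  proof (intro add_mono mult_left_mono)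
    show "lyap k \<tau> p q \<le> c * r\<^sup>2 / 4" using z unfolding tube_def p_def q_def by simp
    have "norm ((T + 1) *\<^sub>R f) \<le> 3 * norm f" using T1 by (simp add: mult_right_mono)
    hence "(norm ((T + 1) *\<^sub>R f))\<^sup>2 \<le> (3 * norm f)\<^sup>2" by (intro power_mono) auto
    moreover have "(norm f)\<^sup>2 \<le> (\<sigma> * (a * r))\<^sup>2" using nf by (intro power_mono) auto
    ultimately show "(norm ((T + 1) *\<^sub>R f))\<^sup>2 + (norm f)\<^sup>2 \<le> 10 * (\<sigma> * (a * r))\<^sup>2" by (simp add: power_mult_distrib)
  qed (use ly in simp_all)
  also have "C * (10 * (\<sigma> * (a * r))\<^sup>2) = (10 * C * \<sigma>\<^sup>2 * a\<^sup>2) * r\<^sup>2" by (simp add: power_mult_distrib)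
  also have "\<rho> * (c * r\<^sup>2 / 4) + (10 * C * \<sigma>\<^sup>2 * a\<^sup>2) * r\<^sup>2 \<le> \<rho> * (c * r\<^sup>2 / 4) + ((1 - \<rho>) * (c / 4)) * r\<^sup>2"
    by (intro add_left_mono mult_right_mono a(3)) simp
  also have "\<dots> = c * r\<^sup>2 / 4" by (simp add: field_simps)
  finally show ?thesis unfolding tube_def by simp
qed

text \<open>Union bound over the noises.\<close>
lemma tube_mass:
  assumes cyc: "\<And>n. y (Suc (Suc n)) = (1 + \<beta>) *\<^sub>R y (Suc n) - \<beta> *\<^sub>R y n - s *\<^sub>R g (y (Suc n))"
    and loc: "\<And>n e. norm e \<le> r \<Longrightarrow> g (y n + e) = g (y n) + e"
    and r: "0 \<le> r" and a: "0 \<le> a" "\<sigma> * a \<le> 1 / 2" "10 * C * \<sigma>\<^sup>2 * a\<^sup>2 \<le> (1 - \<rho>) * (c / 4)"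
    and z: "z \<in> tube y r 0"
  shows "1 - real n * (2 * exp (- (a * r)\<^sup>2 / 4)) \<le> measure (law_from Q z n) (tube y r n)"
proof (induction n)
  case 0
  show ?case using z tube_measurable[of y r 0] by (simp add: measure_return)
next
  case (Suc n)
  define \<delta> where "\<delta> = 2 * exp (- (a * r)\<^sup>2 / 4)"
  have ar: "0 \<le> a * r" using a(1) r by simp
  have stay: "1 - \<delta> \<le> measure (Q x) (tube y r (Suc n))" if x: "x \<in> tube y r n" for x
  proof -
    have "1 - measure std_gaussian {\<xi>::real^2. norm \<xi> > a * r} = measure std_gaussian {\<xi>::real^2. norm \<xi> \<le> a * r}"
    proof -
      have "{\<xi>::real^2. norm \<xi> > a * r} \<in> sets std_gaussian" unfolding sets_std_gaussian by measurable
      from gauss.prob_compl[OF this] show ?thesis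
        by (simp add: space_std_gaussian Compl_eq_Diff_UNIV[symmetric] Collect_neg_eq[symmetric] not_less)
    qed
    also have "\<dots> \<le> measure std_gaussian (step x -` tube y r (Suc n) \<inter> space std_gaussian)"
    proof (rule gauss.finite_measure_mono)
      show "{\<xi>::real^2. norm \<xi> \<le> a * r} \<subseteq> step x -` tube y r (Suc n) \<inter> space std_gaussian"
        using tube_step[OF cyc loc r a x] by (auto simp: space_std_gaussian)
      show "step x -` tube y r (Suc n) \<inter> space std_gaussian \<in> sets std_gaussian"
        by (rule measurable_sets[OF step_measurable_gaussian tube_measurable])
    qed
    also have "\<dots> = measure (Q x) (tube y r (Suc n))"
      unfolding baoab_kernel_def by (rule measure_distr[symmetric, OF step_measurable_gaussian tube_measurable])
    finally show ?thesis using gaussian_tail[OF ar, where 'a="real^2"] unfolding \<delta>_def by simp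
  qed
  let ?\<mu> = "law_from Q z n"
  note lp = kernel_prob[OF measurable_law_from[OF Q_measurable], of z n]
  interpret P: prob_space ?\<mu> by (rule lp(1))
  have tm: "tube y r n \<in> sets ?\<mu>" unfolding lp(2) by (rule tube_measurable)
  have "1 - real (Suc n) * \<delta> \<le> measure ?\<mu> (tube y r n) - \<delta>"
    using Suc unfolding \<delta>_def[symmetric] by (simp add: algebra_simps)
  also have "\<dots> \<le> (1 - \<delta>) * measure ?\<mu> (tube y r n)"
  proof -
    have "\<delta> * measure ?\<mu> (tube y r n) \<le> \<delta> * 1" unfolding \<delta>_def by (intro mult_left_mono P.prob_le_1) simp
    thus ?thesis by (simp add: algebra_simps)
  qed
  also have "\<dots> = (\<integral>x. (1 - \<delta>) * indicator (tube y r n) x \<partial>?\<mu>)" using tm by simp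
  also have "\<dots> \<le> (\<integral>x. measure (Q x) (tube y r (Suc n)) \<partial>?\<mu>)"
  proof (rule integral_mono)
    show "integrable ?\<mu> (\<lambda>x. (1 - \<delta>) * indicator (tube y r n) x)"
      by (intro integrable_mult_right integrable_real_indicator tm) (simp add: P.emeasure_eq_measure)
    show "integrable ?\<mu> (\<lambda>x. measure (Q x) (tube y r (Suc n)))"
    proof (rule P.integrable_const_bound[where B=1])
      show "(\<lambda>x. measure (Q x) (tube y r (Suc n))) \<in> borel_measurable ?\<mu>"
        unfolding measurable_cong_borel[OF lp(2)] by (rule measurable_kernel_measure[OF Q_measurable tube_measurable])
      show "AE x in ?\<mu>. norm (measure (Q x) (tube y r (Suc n))) \<le> 1"
        using measure_set_le_1[OF kernel_prob(1)[OF Q_measurable]] by simp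
    qed
    show "(1 - \<delta>) * indicator (tube y r n) x \<le> measure (Q x) (tube y r (Suc n))" for x
      using stay[of x] by (auto split: split_indicator)
  qed
  also have "\<dots> = measure (law_from Q z (Suc n)) (tube y r (Suc n))"
    unfolding law_from_Suc by (rule measure_bind_kernel[symmetric, OF Q_measurable lp(3) tube_measurable])
  finally show ?case unfolding \<delta>_def .
qed

text \<open>The constant trajectory at the origin and the cycle have disjoint tubes, so the invariant law gives one of them mass at most
  \<open>1 / 2\<close>.  The chain is started in that tube.\<close>
theorem cycle_blocks_mixing:
  assumes cyc: "\<And>n. y (Suc (Suc n)) = (1 + \<beta>) *\<^sub>R y (Suc n) - \<beta> *\<^sub>R y n - s *\<^sub>R g (y (Suc n))"
    and loc: "\<And>n e. norm e \<le> r \<Longrightarrow> g (y n + e) = g (y n) + e" and loc0: "\<And>x. norm x \<le> r \<Longrightarrow> g x = x"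
    and ny: "\<And>n. norm (y n) = R" and r: "0 \<le> r" "r < R"
    and a: "0 \<le> a" "\<sigma> * a \<le> 1 / 2" "10 * C * \<sigma>\<^sup>2 * a\<^sup>2 \<le> (1 - \<rho>) * (c / 4)"
  shows "\<exists>\<pi>. invariant_law Q \<pi> \<and> (\<forall>\<pi>'. invariant_law Q \<pi>' \<longrightarrow> \<pi>' = \<pi>) \<and>
     (\<exists>z. W2 (return borel z) \<pi> \<le> ennreal (sqrt (distance_factor * (drift / (1 - \<rho>) + 4 * R\<^sup>2 + B\<^sup>2))) \<and>
       (\<forall>n. real n * (2 * exp (- (a * r)\<^sup>2 / 4)) \<le> 1 / 8 \<longrightarrow> 3 / 8 \<le> tv_dist (law_from Q z n) \<pi>))"
proof -
  obtain \<pi> where \<pi>: "invariant_law Q \<pi> \<and> (\<forall>\<pi>'. invariant_law Q \<pi>' \<longrightarrow> \<pi>' = \<pi>) \<and>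
     (\<integral>\<^sup>+z. ennreal (V z) \<partial>\<pi>) \<le> ennreal (drift / (1 - \<rho>))" using unique_invariant_law by (rule exE)
  have p: "prob_space \<pi>" "sets \<pi> = sets borel" using \<pi> unfolding invariant_law_def by simp_all
  interpret prob_space \<pi> by (rule p(1))
  have W: "W2 (return borel z) \<pi> \<le> ennreal (sqrt (distance_factor * (drift / (1 - \<rho>) + 4 * R\<^sup>2 + B\<^sup>2)))" if "V z \<le> 4 * R\<^sup>2" for z
  proof (rule order_trans[OF W2_dirac_invariant[of \<pi> z]])
    show "invariant_law Q \<pi>" "(\<integral>\<^sup>+z. ennreal (V z) \<partial>\<pi>) \<le> ennreal (drift / (1 - \<rho>))" using \<pi> by simp_all
    show "ennreal (sqrt (distance_factor * (drift / (1 - \<rho>) + V z + B\<^sup>2))) \<le> ennreal (sqrt (distance_factor * (drift / (1 - \<rho>) + 4 * R\<^sup>2 + B\<^sup>2)))"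
      using that dist_square_bound(1) by (intro ennreal_leI real_sqrt_le_mono mult_left_mono add_mono) simp_all
  qed
  have tv: "3 / 8 \<le> tv_dist (law_from Q z n) \<pi>"
    if "7 / 8 \<le> measure (law_from Q z n) A" "measure \<pi> A \<le> 1 / 2" "A \<in> sets borel" for z n A
  proof -
    note lp = kernel_prob[OF measurable_law_from[OF Q_measurable], of z n]
    have "\<bar>measure (law_from Q z n) A - measure \<pi> A\<bar> \<le> tv_dist (law_from Q z n) \<pi>"
      by (rule tv_dist_upper[OF lp(1) p(1)]) (simp add: lp(2) that(3))
    thus ?thesis using that(1,2) by linarith
  qed
  define rest where "rest n = (0 :: real^2)" for n :: nat
  have g0: "g 0 = 0" by (rule loc0) (simp add: r)
  have cyc0: "rest (Suc (Suc n)) = (1 + \<beta>) *\<^sub>R rest (Suc n) - \<beta> *\<^sub>R rest n - s *\<^sub>R g (rest (Suc n))" for n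
    unfolding rest_def g0 by simp
  have loc0': "g (rest n + e) = g (rest n) + e" if "norm e \<le> r" for n e
    unfolding rest_def g0 using loc0[OF that] by simp
  have lyap0: "lyap k \<tau> 0 0 = 0" unfolding lyap_def by simp
  have mass: "7 / 8 \<le> 1 - real n * (2 * exp (- (a * r)\<^sup>2 / 4))" if "real n * (2 * exp (- (a * r)\<^sup>2 / 4)) \<le> 1 / 8" for n
    using that by linarith
  have c0: "0 \<le> c * r\<^sup>2 / 4" using ly(3) by simp
  have "\<exists>z. V z \<le> 4 * R\<^sup>2 \<and> (\<forall>n. real n * (2 * exp (- (a * r)\<^sup>2 / 4)) \<le> 1 / 8 \<longrightarrow> 3 / 8 \<le> tv_dist (law_from Q z n) \<pi>)"
  proof (cases "measure \<pi> (tube rest r 0) \<le> 1 / 2")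
    case True
    have z: "pos (0, 0) = 0" unfolding next_pos_def fst_conv snd_conv g0 by simp
    have t: "(0, 0) \<in> tube rest r 0" unfolding tube_def using c0 by (simp add: z rest_def lyap0)
    have eq: "tube rest r n = tube rest r 0" for n unfolding tube_def rest_def ..
    have "3 / 8 \<le> tv_dist (law_from Q (0, 0) n) \<pi>" if "real n * (2 * exp (- (a * r)\<^sup>2 / 4)) \<le> 1 / 8" for n
    proof (rule tv[OF _ True tube_measurable])
      show "7 / 8 \<le> measure (law_from Q (0, 0) n) (tube rest r 0)"
        using order_trans[OF mass[OF that] tube_mass[OF cyc0 loc0' r(1) a t]] unfolding eq[of n] .
    qed
    moreover have "V (0, 0) \<le> 4 * R\<^sup>2" unfolding z fst_conv lyap0 by simp
    ultimately show ?thesis by (intro exI[of _ "(0, 0)"] conjI allI impI)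
  next
    case False
    define d where "d = m"
    have d: "0 < d" unfolding d_def by (rule m_pos)
    define z where "z = (y 0, (1 / d) *\<^sub>R (y 1 - y 0) + (h / 2) *\<^sub>R g (y 0))"
    have z: "pos z = y 1" "fst z = y 0" unfolding z_def next_pos_def fst_conv snd_conv d_def[symmetric] using d by simp_all
    have t: "z \<in> tube y r 0" unfolding tube_def using c0 by (simp add: z lyap0)
    have "3 / 8 \<le> tv_dist (law_from Q z n) \<pi>" if "real n * (2 * exp (- (a * r)\<^sup>2 / 4)) \<le> 1 / 8" for n
    proof (rule tv[OF _ _ tube_measurable])
      show "7 / 8 \<le> measure (law_from Q z n) (tube y r n)"
        by (rule order_trans[OF mass[OF that] tube_mass[OF cyc loc r(1) a t]])
      have "tube y r n \<inter> tube rest r 0 = {}"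
      proof (rule ccontr)
        assume "tube y r n \<inter> tube rest r 0 \<noteq> {}"
        then obtain x where x: "x \<in> tube y r n" "x \<in> tube rest r 0" by blast
        have "norm (fst x - y n) \<le> r / 2" "norm (fst x - 0) \<le> r / 2"
          using tube_near(2)[OF x(1) r(1)] tube_near(2)[OF x(2) r(1)] unfolding rest_def .
        moreover have "norm (y n) \<le> norm (fst x - 0) + norm (fst x - y n)"
          using norm_triangle_ineq4[of "fst x - 0" "fst x - y n"] by simp
        ultimately show False using ny[of n] r(2) by linarith
      qed
      hence "measure \<pi> (tube y r n) + measure \<pi> (tube rest r 0) = measure \<pi> (tube y r n \<union> tube rest r 0)"
        by (intro finite_measure_Union[symmetric]) (simp_all add: p(2) tube_measurable)
      also have "\<dots> \<le> 1" by (rule prob_le_1)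
      finally show "measure \<pi> (tube y r n) \<le> 1 / 2" using False by linarith
    qed
    moreover have "V z \<le> 4 * R\<^sup>2" unfolding z using lyc(2)[of "y 1" "y 0"] unfolding ny by simp
    ultimately show ?thesis by (intro exI[of _ z] conjI allI impI)
  qed
  then obtain z where z: "V z \<le> 4 * R\<^sup>2 \<and> (\<forall>n. real n * (2 * exp (- (a * r)\<^sup>2 / 4)) \<le> 1 / 8 \<longrightarrow> 3 / 8 \<le> tv_dist (law_from Q z n) \<pi>)"
    by (rule exE)
  show ?thesis
    by (rule exI[of _ \<pi>], intro conjI \<pi>[THEN conjunct1] \<pi>[THEN conjunct2, THEN conjunct1], rule exI[of _ z],
        intro conjI W[OF z[THEN conjunct1]] z[THEN conjunct2])
qed

end

section \<open>Dilations and the dichotomy\<close>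

text \<open>Dilation leaves the Hessians as a set unchanged, and scales the gradient like the argument.\<close>
lemma dilated_potential:
  fixes U :: "real^2 \<Rightarrow> real" and g :: "real^2 \<Rightarrow> real^2"
  assumes U: "\<And>k. ck k UNIV U" "\<And>x. (U has_derivative (\<lambda>v. inner (g x) v)) (at x)"
    and H: "\<And>x. \<exists>H. (g has_derivative H) (at x) \<and> (\<forall>v. (norm v)\<^sup>2 \<le> inner (H v) v \<and> inner (H v) v \<le> \<kappa> * (norm v)\<^sup>2) \<and> (\<forall>v. norm (H v) \<le> \<kappa> * norm v)"
    and R: "0 < R"
  defines "U' \<equiv> (\<lambda>x. R\<^sup>2 * U (x /\<^sub>R R))" and "g' \<equiv> (\<lambda>x. R *\<^sub>R g (x /\<^sub>R R))"
  shows "(U' has_derivative (\<lambda>v. inner (g' x) v)) (at x)"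
    and "\<exists>H. (g' has_derivative H) (at x) \<and> (\<forall>v. (norm v)\<^sup>2 \<le> inner (H v) v \<and> inner (H v) v \<le> \<kappa> * (norm v)\<^sup>2) \<and> (\<forall>v. norm (H v) \<le> \<kappa> * norm v)"
    and "U' \<in> potential_class \<kappa>"
proof -
  have sc: "((\<lambda>x::real^2. x /\<^sub>R R) has_derivative (\<lambda>v. v /\<^sub>R R)) (at x)" for x
    by (rule bounded_linear_imp_has_derivative) (rule bounded_linear_scaleR_right)
  have Ud: "(U' has_derivative (\<lambda>v. inner (g' x) v)) (at x)" for x
  proof -
    have "((\<lambda>x. U (x /\<^sub>R R)) has_derivative (\<lambda>v. inner (g (x /\<^sub>R R)) (v /\<^sub>R R))) (at x)"
      by (rule has_derivative_compose[OF sc U(2)])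
    hence "(U' has_derivative (\<lambda>v. R\<^sup>2 * inner (g (x /\<^sub>R R)) (v /\<^sub>R R))) (at x)"
      unfolding U'_def by (rule has_derivative_mult_right)
    moreover have "R\<^sup>2 * inner (g (x /\<^sub>R R)) (v /\<^sub>R R) = inner (g' x) v" for v
      unfolding g'_def using R by (simp add: power2_eq_square)
    ultimately show ?thesis by simp
  qed
  have Hd: "\<exists>H. (g' has_derivative H) (at x) \<and> (\<forall>v. (norm v)\<^sup>2 \<le> inner (H v) v \<and> inner (H v) v \<le> \<kappa> * (norm v)\<^sup>2) \<and> (\<forall>v. norm (H v) \<le> \<kappa> * norm v)" for x
  proof -
    obtain H where H: "(g has_derivative H) (at (x /\<^sub>R R)) \<and> (\<forall>v. (norm v)\<^sup>2 \<le> inner (H v) v \<and> inner (H v) v \<le> \<kappa> * (norm v)\<^sup>2) \<and> (\<forall>v. norm (H v) \<le> \<kappa> * norm v)"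
      using H[of "x /\<^sub>R R"] by (rule exE)
    have "((\<lambda>x. g (x /\<^sub>R R)) has_derivative (\<lambda>v. H (v /\<^sub>R R))) (at x)"
      by (rule has_derivative_compose[OF sc H[THEN conjunct1]])
    hence "(g' has_derivative (\<lambda>v. R *\<^sub>R H (v /\<^sub>R R))) (at x)"
      unfolding g'_def by (rule has_derivative_scaleR_right)
    moreover have "R *\<^sub>R H (v /\<^sub>R R) = H v" for v
      using linear_scale[OF has_derivative_linear[OF H[THEN conjunct1]], of "inverse R" v] R by simp
    ultimately have "(g' has_derivative H) (at x)" by simp
    show ?thesis by (rule exI[of _ H]) (rule conjI[OF \<open>(g' has_derivative H) (at x)\<close> H[THEN conjunct2]])
  qed
  show "(U' has_derivative (\<lambda>v. inner (g' x) v)) (at x)" by (rule Ud)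
  show "\<exists>H. (g' has_derivative H) (at x) \<and> (\<forall>v. (norm v)\<^sup>2 \<le> inner (H v) v \<and> inner (H v) v \<le> \<kappa> * (norm v)\<^sup>2) \<and> (\<forall>v. norm (H v) \<le> \<kappa> * norm v)"
    by (rule Hd)
  have Uk: "ck k UNIV U'" for k unfolding U'_def
    by (intro ck_cmult open_UNIV ck_compose_linear[OF bounded_linear_scaleR_right] U(1))
  show "U' \<in> potential_class \<kappa>"
  proof (rule potential_classI[OF Uk Ud])
    fix x
    obtain H where "(g' has_derivative H) (at x) \<and> (\<forall>v. (norm v)\<^sup>2 \<le> inner (H v) v \<and> inner (H v) v \<le> \<kappa> * (norm v)\<^sup>2) \<and> (\<forall>v. norm (H v) \<le> \<kappa> * norm v)"
      using Hd[of x] by (rule exE)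
    thus "\<exists>H. (g' has_derivative H) (at x) \<and> (\<forall>v. (norm v)\<^sup>2 \<le> inner (H v) v \<and> inner (H v) v \<le> \<kappa> * (norm v)\<^sup>2)"
      by (elim conjE) (intro exI conjI)
  qed
qed

text \<open>The form and its constants come from unit curvature and are the same for all \<open>R\<close>; the bound on the perturbation, the cycle and
  the tubes scale with \<open>R\<close>.  The escape time is therefore exponential in \<open>R\<^sup>2\<close>, while the second moment of
  the invariant law stays quadratic.\<close>
theorem metastable_dilations:
  fixes U :: "real^2 \<Rightarrow> real" and g :: "real^2 \<Rightarrow> real^2" and y :: "nat \<Rightarrow> real^2"
  assumes h: "0 < h" "h < 2" and \<beta>: "\<beta> = exp (- \<gamma> * h)" "0 < \<beta>" "\<beta> < 1" and s: "s = h\<^sup>2 / 2 * (1 + \<beta>)"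
    and U: "\<And>k. ck k UNIV U" "\<And>x. (U has_derivative (\<lambda>v. inner (g x) v)) (at x)"
    and H: "\<And>x. \<exists>H. (g has_derivative H) (at x) \<and> (\<forall>v. (norm v)\<^sup>2 \<le> inner (H v) v \<and> inner (H v) v \<le> \<kappa> * (norm v)\<^sup>2) \<and> (\<forall>v. norm (H v) \<le> \<kappa> * norm v)"
    and B: "\<And>x. norm (g x - x) \<le> B" and r: "0 < r" "\<And>x. norm x \<le> r \<Longrightarrow> g x = x"
    and y: "\<And>n. norm (y n) = 1" "\<And>n. y (Suc (Suc n)) = (1 + \<beta>) *\<^sub>R y (Suc n) - \<beta> *\<^sub>R y n - s *\<^sub>R g (y (Suc n))"
      "\<And>n e. norm e \<le> r \<Longrightarrow> g (y n + e) = g (y n) + e"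
  shows "\<exists>c0 > 0. \<exists>C0 > 0. \<forall>R \<ge> (1::real).
        let U\<^sub>R = (\<lambda>x. R\<^sup>2 * U (x /\<^sub>R R));
            Q = baoab_kernel h \<gamma> U\<^sub>R in
          U\<^sub>R \<in> potential_class \<kappa> \<and>
          (\<exists>\<pi>. invariant_law Q \<pi> \<and> (\<forall>\<pi>'. invariant_law Q \<pi>' \<longrightarrow> \<pi>' = \<pi>) \<and>
             (\<exists>z. W2 (return borel z) \<pi> \<le> ennreal (C0 * (1 + R)) \<and>
                (\<forall>n::nat. int n \<le> \<lfloor>1 / 32 * exp (c0 * R\<^sup>2)\<rfloor> \<longrightarrow>
                   tv_dist (law_from Q z n) \<pi> \<ge> 3 / 8)))"
proof -
  define T where "T = 1 + \<beta> - s"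
  have T: "\<bar>T\<bar> < 1 + \<beta>"
  proof -
    have "h * h < 2 * 2" using h by (intro mult_strict_mono) auto
    hence "h\<^sup>2 / 2 * (1 + \<beta>) < 2 * (1 + \<beta>)" using \<beta>(2) by (intro mult_strict_right_mono) (auto simp: power2_eq_square)
    moreover have "0 < s" unfolding s using h \<beta>(2) by (intro mult_pos_pos) auto
    ultimately show ?thesis unfolding T_def s[symmetric] by (simp add: abs_less_iff)
  qed
  obtain k \<tau> \<rho> c C where ly: "0 \<le> \<rho>" "\<rho> < 1" "0 < c" "0 < C"
    and lyc: "\<And>a b::real^2. c * ((norm a)\<^sup>2 + (norm b)\<^sup>2) \<le> lyap k \<tau> a b \<and> lyap k \<tau> a b \<le> 2 * ((norm a)\<^sup>2 + (norm b)\<^sup>2)"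
    and lys: "\<And>a b e f::real^2. lyap k \<tau> (T *\<^sub>R a - \<beta> *\<^sub>R b + e) (a + f) \<le> \<rho> * lyap k \<tau> a b + C * ((norm e)\<^sup>2 + (norm f)\<^sup>2)"
    using heavy_ball_lyapunov[OF \<beta>(2,3) T, where 'a="real^2"] by (elim exE conjE) blast
  define \<sigma> where "\<sigma> = noise_scale h \<beta>"
  have \<sigma>: "0 < \<sigma>"
    unfolding \<sigma>_def noise_scale_def using h \<beta> by (intro mult_pos_pos) (auto simp: power_less_one_iff abs_square_less_1)
  define a where "a = min (1 / (2 * \<sigma>)) (sqrt ((1 - \<rho>) * (c / 4) / (10 * C * \<sigma>\<^sup>2)))"
  have a: "0 < a" "\<sigma> * a \<le> 1 / 2" "10 * C * \<sigma>\<^sup>2 * a\<^sup>2 \<le> (1 - \<rho>) * (c / 4)"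
  proof -
    show a0: "0 < a" unfolding a_def using \<sigma> ly by simp
    have "\<sigma> * a \<le> \<sigma> * (1 / (2 * \<sigma>))" unfolding a_def using \<sigma> by (intro mult_left_mono) auto
    thus "\<sigma> * a \<le> 1 / 2" using \<sigma> by simp
    have D: "0 < 10 * C * \<sigma>\<^sup>2" using \<sigma> ly by simp
    have "a\<^sup>2 \<le> (sqrt ((1 - \<rho>) * (c / 4) / (10 * C * \<sigma>\<^sup>2)))\<^sup>2" using a0 unfolding a_def by (intro power_mono) auto
    also have "\<dots> = (1 - \<rho>) * (c / 4) / (10 * C * \<sigma>\<^sup>2)" using ly D by (intro real_sqrt_pow2) simp
    finally show "10 * C * \<sigma>\<^sup>2 * a\<^sup>2 \<le> (1 - \<rho>) * (c / 4)" using D by (simp only: pos_le_divide_eq mult.commute)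
  qed
  \<comment> \<open>Below the radius \<open>1\<close> of the cycle, to keep the two tubes apart.\<close>
  define r0 where "r0 = min r (1 / 2)"
  have r0: "0 < r0" "r0 \<le> r" "r0 < 1" unfolding r0_def using r(1) by auto
  define df where "df = lyapunov_chain.distance_factor h \<beta> c"
  define K where "K = C * (2 * (s * B)\<^sup>2 + 152 * \<sigma>\<^sup>2) / (1 - \<rho>) + 4 + B\<^sup>2"
  have K: "0 \<le> K" unfolding K_def using ly by simp
  define c0 where "c0 = (a * r0)\<^sup>2 / 4"
  define C0 where "C0 = sqrt (df * K) + 1"
  have main: "let U\<^sub>R = (\<lambda>x. R\<^sup>2 * U (x /\<^sub>R R));
            Q = baoab_kernel h \<gamma> U\<^sub>R in
          U\<^sub>R \<in> potential_class \<kappa> \<and>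
          (\<exists>\<pi>. invariant_law Q \<pi> \<and> (\<forall>\<pi>'. invariant_law Q \<pi>' \<longrightarrow> \<pi>' = \<pi>) \<and>
             (\<exists>z. W2 (return borel z) \<pi> \<le> ennreal (C0 * (1 + R)) \<and>
                (\<forall>n::nat. int n \<le> \<lfloor>1 / 32 * exp (c0 * R\<^sup>2)\<rfloor> \<longrightarrow>
                   tv_dist (law_from Q z n) \<pi> \<ge> 3 / 8))) \<and> 0 < C0" if R1: "1 \<le> R" for R :: real
  proof -
    have R: "0 < R" using R1 by simp
    define U' where "U' = (\<lambda>x. R\<^sup>2 * U (x /\<^sub>R R))"
    define g' where "g' = (\<lambda>x. R *\<^sub>R g (x /\<^sub>R R))"
    note dil = dilated_potential[OF U H R, folded U'_def g'_def]
    have g'B: "norm (g' x - x) \<le> B * R" for x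
    proof -
      have "g' x - x = R *\<^sub>R (g (x /\<^sub>R R) - x /\<^sub>R R)" unfolding g'_def using R by (simp add: algebra_simps)
      thus ?thesis using B[of "x /\<^sub>R R"] R by simp
    qed
    interpret L: lyapunov_chain h \<gamma> \<beta> \<kappa> "B * R" U' g' s T k \<tau> \<rho> c C
    proof (unfold_locales)
      show "\<exists>H. (g' has_derivative H) (at x) \<and> (\<forall>v. norm (H v) \<le> \<kappa> * norm v)" for x
      proof -
        obtain H where "(g' has_derivative H) (at x) \<and> (\<forall>v. (norm v)\<^sup>2 \<le> inner (H v) v \<and> inner (H v) v \<le> \<kappa> * (norm v)\<^sup>2) \<and> (\<forall>v. norm (H v) \<le> \<kappa> * norm v)"
          using dil(2)[of x] by (rule exE)
        thus ?thesis by (elim conjE) (intro exI conjI)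
      qed
      show "T = 1 + \<beta> - s" by (rule T_def)
      show "c * ((norm a)\<^sup>2 + (norm b)\<^sup>2) \<le> lyap k \<tau> a b" "lyap k \<tau> a b \<le> 2 * ((norm a)\<^sup>2 + (norm b)\<^sup>2)" for a b :: "real^2"
        using lyc[of a b] by simp_all
      show "(U' has_derivative (\<lambda>v. inner (g' x) v)) (at x)" for x unfolding g'_def by (rule dil(1))
      show "norm (g' x - x) \<le> B * R" for x by (rule g'B)
      show "lyap k \<tau> (T *\<^sub>R a - \<beta> *\<^sub>R b + e) (a + f) \<le> \<rho> * lyap k \<tau> a b + C * ((norm e)\<^sup>2 + (norm f)\<^sup>2)" for a b e f :: "real^2"
        by (rule lys)
    qed (fact h \<beta> s T ly)+
    have yR: "norm (R *\<^sub>R y n) = R" for n using y(1) R by simp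
    have cycR: "R *\<^sub>R y (Suc (Suc n)) = (1 + \<beta>) *\<^sub>R (R *\<^sub>R y (Suc n)) - \<beta> *\<^sub>R (R *\<^sub>R y n) - s *\<^sub>R g' (R *\<^sub>R y (Suc n))" for n
      unfolding g'_def y(2)[of n] using R by (simp add: algebra_simps)
    have small: "norm (e /\<^sub>R R) \<le> r" if "norm e \<le> r0 * R" for e :: "real^2"
      using that r0(2) R by (simp add: divide_inverse[symmetric] mult.commute[of "inverse R"] pos_divide_le_eq) (meson mult_right_mono order_trans less_imp_le)
    have locR: "g' (R *\<^sub>R y n + e) = g' (R *\<^sub>R y n) + e" if "norm e \<le> r0 * R" for n e
    proof -
      have "g' (R *\<^sub>R y n + e) = R *\<^sub>R g (y n + e /\<^sub>R R)" unfolding g'_def using R by (simp add: scaleR_add_right)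
      also have "\<dots> = R *\<^sub>R g (y n) + e" unfolding y(3)[OF small[OF that]] using R by (simp add: scaleR_add_right)
      finally show ?thesis unfolding g'_def using R by simp
    qed
    have loc0: "g' x = x" if "norm x \<le> r0 * R" for x
      unfolding g'_def r(2)[OF small[OF that]] using R by simp
    have rR: "0 \<le> r0 * R" "r0 * R < R" using r0 R by auto
    obtain \<pi> where \<pi>: "invariant_law (baoab_kernel h \<gamma> U') \<pi> \<and> (\<forall>\<pi>'. invariant_law (baoab_kernel h \<gamma> U') \<pi>' \<longrightarrow> \<pi>' = \<pi>) \<and>
     (\<exists>z. W2 (return borel z) \<pi> \<le> ennreal (sqrt (L.distance_factor * (L.drift / (1 - \<rho>) + 4 * R\<^sup>2 + (B * R)\<^sup>2))) \<and>
       (\<forall>n. real n * (2 * exp (- (a * (r0 * R))\<^sup>2 / 4)) \<le> 1 / 8 \<longrightarrow> 3 / 8 \<le> tv_dist (law_from (baoab_kernel h \<gamma> U') z n) \<pi>))"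
      using L.cycle_blocks_mixing[where y="\<lambda>n. R *\<^sub>R y n", OF cycR locR loc0 yR rR less_imp_le[OF a(1)] a(2,3)[unfolded \<sigma>_def]] by (rule exE)
    obtain z where z: "W2 (return borel z) \<pi> \<le> ennreal (sqrt (L.distance_factor * (L.drift / (1 - \<rho>) + 4 * R\<^sup>2 + (B * R)\<^sup>2))) \<and>
       (\<forall>n. real n * (2 * exp (- (a * (r0 * R))\<^sup>2 / 4)) \<le> 1 / 8 \<longrightarrow> 3 / 8 \<le> tv_dist (law_from (baoab_kernel h \<gamma> U') z n) \<pi>)"
      using \<pi>[THEN conjunct2, THEN conjunct2] by (rule exE)
    have df: "0 < df" "L.distance_factor = df" using L.dist_square_bound(1) unfolding df_def by simp_all
    have C0: "0 < C0" unfolding C0_def using df(1) K by (intro add_nonneg_pos) simp_all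
    have R2: "1 \<le> R\<^sup>2" using R1 by simp
    have "sqrt (L.distance_factor * (L.drift / (1 - \<rho>) + 4 * R\<^sup>2 + (B * R)\<^sup>2)) \<le> C0 * (1 + R)"
    proof -
      have "L.drift \<le> C * (2 * (s * B)\<^sup>2 + 152 * \<sigma>\<^sup>2) * R\<^sup>2"
      proof -
        have "152 * \<sigma>\<^sup>2 * 1 \<le> 152 * \<sigma>\<^sup>2 * R\<^sup>2" using R2 by (intro mult_left_mono) auto
        hence "2 * (s * (B * R))\<^sup>2 + 152 * \<sigma>\<^sup>2 \<le> (2 * (s * B)\<^sup>2 + 152 * \<sigma>\<^sup>2) * R\<^sup>2" by (simp add: power_mult_distrib algebra_simps)
        hence "C * (2 * (s * (B * R))\<^sup>2 + 152 * \<sigma>\<^sup>2) \<le> C * ((2 * (s * B)\<^sup>2 + 152 * \<sigma>\<^sup>2) * R\<^sup>2)" using ly(4) by (intro mult_left_mono) auto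
        thus ?thesis unfolding L.drift_def \<sigma>_def[symmetric] by (simp add: mult.assoc)
      qed
      hence "L.drift / (1 - \<rho>) \<le> C * (2 * (s * B)\<^sup>2 + 152 * \<sigma>\<^sup>2) * R\<^sup>2 / (1 - \<rho>)" using ly(2) by (intro divide_right_mono) auto
      hence "L.drift / (1 - \<rho>) + 4 * R\<^sup>2 + (B * R)\<^sup>2 \<le> K * R\<^sup>2" unfolding K_def by (simp add: algebra_simps power_mult_distrib)
      hence "df * (L.drift / (1 - \<rho>) + 4 * R\<^sup>2 + (B * R)\<^sup>2) \<le> df * (K * R\<^sup>2)" using df by (intro mult_left_mono) auto
      hence "sqrt (df * (L.drift / (1 - \<rho>) + 4 * R\<^sup>2 + (B * R)\<^sup>2)) \<le> sqrt (df * K * R\<^sup>2)" by (simp add: mult.assoc)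
      also have "\<dots> = sqrt (df * K) * R" using R by (simp add: real_sqrt_mult)
      also have "\<dots> \<le> C0 * (1 + R)" using R df(1) K unfolding C0_def by (intro mult_mono) auto
      finally show ?thesis unfolding df(2) .
    qed
    hence W: "W2 (return borel z) \<pi> \<le> ennreal (C0 * (1 + R))" by (rule order_trans[OF z[THEN conjunct1] ennreal_leI])
    have tv: "3 / 8 \<le> tv_dist (law_from (baoab_kernel h \<gamma> U') z n) \<pi>" if n: "int n \<le> \<lfloor>1 / 32 * exp (c0 * R\<^sup>2)\<rfloor>" for n
    proof (rule z[THEN conjunct2, rule_format])
      have "real n \<le> 1 / 32 * exp (c0 * R\<^sup>2)" using n by (simp add: le_floor_iff)
      hence "real n * (2 * exp (- (c0 * R\<^sup>2))) \<le> 1 / 32 * exp (c0 * R\<^sup>2) * (2 * exp (- (c0 * R\<^sup>2)))" by (rule mult_right_mono) simp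
      also have "\<dots> = 1 / 16" by (simp add: exp_minus)
      finally show "real n * (2 * exp (- (a * (r0 * R))\<^sup>2 / 4)) \<le> 1 / 8" unfolding c0_def by (simp add: power_mult_distrib mult_ac)
    qed
    show ?thesis unfolding Let_def U'_def[symmetric]
      by (intro conjI dil(3) C0, rule exI[of _ \<pi>], intro conjI \<pi>[THEN conjunct1] \<pi>[THEN conjunct2, THEN conjunct1], rule exI[of _ z], intro conjI W allI impI tv)
  qed
  have c0: "0 < c0" unfolding c0_def using a(1) r0(1) by simp
  have C0: "0 < C0" using main[OF order_refl] unfolding Let_def by (elim conjE)
  show ?thesis
    by (rule exI[of _ c0], intro conjI c0, rule exI[of _ C0], intro conjI C0 allI impI) (use main in \<open>simp only: Let_def simp_thms\<close>)
qed

theorem theorem6p3: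
  fixes C\<^sub>s \<kappa> h \<gamma> \<beta> s q :: real
  assumes "C\<^sub>s > (3 + sqrt 5)\<^sup>2"
    and "\<kappa> \<ge> 2 * C\<^sub>s"
    and "h > 0" and "\<gamma> > 0" and "h < 2 / sqrt \<kappa>"
    and "\<beta> = exp (- \<gamma> * h)"
    and "s = h\<^sup>2 / 2 * (1 + \<beta>)"
    and "q = (1 - C\<^sub>s / \<kappa>) / (1 + C\<^sub>s / \<kappa>)"
  shows
    "(\<exists>l\<in>{1..\<kappa>}. \<exists>z z' :: (real^2) \<times> (real^2).
        let Q = baoab_kernel h \<gamma> (\<lambda>x :: real^2. l * (norm x)\<^sup>2 / 2) in
          (\<lambda>n. root n (tv_dist (law_from Q z n) (law_from Q z' n)))
             \<longlonglongrightarrow> rho_q s \<beta> \<kappa> \<and>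
          rho_q s \<beta> \<kappa> \<ge> q)
     \<or>
     (\<exists>U \<in> (potential_class \<kappa> :: (real^2 \<Rightarrow> real) set). \<exists>c0 > 0. \<exists>C0 > 0. \<forall>R \<ge> (1::real).
        let U\<^sub>R = (\<lambda>x. R\<^sup>2 * U (x /\<^sub>R R));
            Q = baoab_kernel h \<gamma> U\<^sub>R in
          U\<^sub>R \<in> potential_class \<kappa> \<and>
          (\<exists>\<pi>. invariant_law Q \<pi> \<and> (\<forall>\<pi>'. invariant_law Q \<pi>' \<longrightarrow> \<pi>' = \<pi>) \<and>
             (\<exists>z. W2 (return borel z) \<pi> \<le> ennreal (C0 * (1 + R)) \<and>
                (\<forall>n::nat. int n \<le> \<lfloor>1 / 32 * exp (c0 * R\<^sup>2)\<rfloor> \<longrightarrow>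
                   tv_dist (law_from Q z n) \<pi> \<ge> 3 / 8))))"
proof -
  note h = assms(3) and \<beta>' = assms(6) and s = assms(7)
  have \<beta>: "0 < \<beta>" "\<beta> < 1" unfolding \<beta>' using assms(3,4) by simp_all
  have Cs: "9 < C\<^sub>s"
  proof -
    have "3\<^sup>2 \<le> (3 + sqrt 5)\<^sup>2" by (intro power_mono) auto
    thus ?thesis using assms(1) by simp
  qed
  have \<kappa>: "1 < \<kappa>" using Cs assms(2) by linarith
  have s0: "0 < s" unfolding s using h \<beta> by (intro mult_pos_pos) auto
  have hk: "h\<^sup>2 * \<kappa> < 4"
  proof -
    have "h * sqrt \<kappa> < 2" using assms(5) \<kappa> by (simp add: pos_less_divide_eq)
    hence "(h * sqrt \<kappa>)\<^sup>2 < 2\<^sup>2" using h \<kappa> by (intro power_strict_mono) auto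
    thus ?thesis using \<kappa> by (simp add: power_mult_distrib)
  qed
  have stable: "s * \<kappa> < 2 * (1 + \<beta>)"
  proof -
    have "s * \<kappa> = (h\<^sup>2 * \<kappa>) * ((1 + \<beta>) / 2)" unfolding s by simp
    also have "\<dots> < 4 * ((1 + \<beta>) / 2)" using hk \<beta> by (intro mult_strict_right_mono) auto
    finally show ?thesis by simp
  qed
  have h2: "h < 2"
  proof (rule ccontr)
    assume "\<not> h < 2"
    hence "2\<^sup>2 \<le> h\<^sup>2" by (intro power_mono) auto
    hence "4 * 1 \<le> h\<^sup>2 * \<kappa>" using \<kappa> by (intro mult_mono) auto
    thus False using hk by linarith
  qed
  have q0: "0 < q"
  proof -
    have "C\<^sub>s / \<kappa> < 1" "0 < C\<^sub>s / \<kappa>" using Cs assms(2) by (simp_all add: pos_divide_less_eq)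
    thus ?thesis unfolding assms(8) by simp
  qed
  have rq: "\<exists>l\<in>{1, \<kappa>}. rho_q s \<beta> \<kappa> = root_mod \<beta> (1 + \<beta> - s * l) \<and>
           (\<forall>l'\<in>{1..\<kappa>}. root_mod \<beta> (1 + \<beta> - s * l') \<le> rho_q s \<beta> \<kappa>)"
    by (rule rho_q_endpoint) (use \<beta> \<kappa> in simp_all)
  show ?thesis
  proof (cases "q \<le> rho_q s \<beta> \<kappa>")
    case True
    obtain l where l: "l \<in> {1, \<kappa>}" and rl: "rho_q s \<beta> \<kappa> = root_mod \<beta> (1 + \<beta> - s * l)" using rq by (elim bexE conjE)
    have l1: "1 \<le> l" "l \<le> \<kappa>" using l \<kappa> by auto
    have "s * l \<le> s * \<kappa>" "0 < s * l" using s0 l1 by auto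
    hence Tl: "\<bar>1 + \<beta> - s * l\<bar> < 1 + \<beta>" using stable by (simp add: abs_less_iff)
    have "\<exists>z z'. (\<lambda>n. root n (tv_dist (law_from (baoab_kernel h \<gamma> (\<lambda>x::real^2. l * (norm x)\<^sup>2 / 2)) z n) (law_from (baoab_kernel h \<gamma> (\<lambda>x::real^2. l * (norm x)\<^sup>2 / 2)) z' n))) \<longlonglongrightarrow> rho_q s \<beta> \<kappa>"
      unfolding rl by (rule quadratic_tv_rate[OF h \<beta>' \<beta> s refl Tl])
    then obtain z z' where zz: "(\<lambda>n. root n (tv_dist (law_from (baoab_kernel h \<gamma> (\<lambda>x::real^2. l * (norm x)\<^sup>2 / 2)) z n) (law_from (baoab_kernel h \<gamma> (\<lambda>x::real^2. l * (norm x)\<^sup>2 / 2)) z' n))) \<longlonglongrightarrow> rho_q s \<beta> \<kappa>"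
      by (elim exE)
    show ?thesis unfolding Let_def
      by (rule disjI1, rule bexI[of _ l], rule exI[of _ z], rule exI[of _ z'], intro conjI zz True) (use l1 in simp)
  next
    case False
    have "root_mod \<beta> (1 + \<beta> - s * 1) \<le> rho_q s \<beta> \<kappa>"
    proof -
      obtain l where "\<forall>l'\<in>{1..\<kappa>}. root_mod \<beta> (1 + \<beta> - s * l') \<le> rho_q s \<beta> \<kappa>" using rq by (elim bexE conjE)
      thus ?thesis by (rule bspec) (use \<kappa> in simp)
    qed
    hence rm: "root_mod \<beta> (1 + \<beta> - s) < q" using False by simp
    note slow = root_mod_less_imp[OF less_imp_le[OF \<beta>(1)] q0 rm]
    have slow2: "(1 - q) * (q - \<beta>) < s * q" using slow(2) by (simp add: power2_eq_square algebra_simps)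
    note ineq = not_fast_imp_inequalities[OF assms(1,2) \<beta> assms(8) slow(1) slow2 stable]
    obtain K \<epsilon> w1 w2 g1 g2 where par: "(3::nat) \<le> K" "0 < g1" "0 < g2" "0 < w1" "w1 < w2" "arctan (g2 / g1) + w2 < pi / K" "0 < \<epsilon>" "\<epsilon> < 1"
    "(1 + \<epsilon>)\<^sup>2 * ((g1\<^sup>2 + g2\<^sup>2) / g1) *
       (1 / (cos (pi / K))\<^sup>2 + (sin (pi / K))\<^sup>2 + sqrt (1 / (cos (pi / K))\<^sup>2 + (sin (pi / K))\<^sup>2) * (sin (pi / K) / ((1 - \<epsilon>) * sin w1))) \<le> \<kappa> - 1"
    "s * (1 + g1) = (1 + \<beta>) * (1 - cos (2 * pi / K))" "s * g2 = (1 - \<beta>) * sin (2 * pi / K)"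
      using cycle_parameters[OF \<beta> s0 stable ineq] by (elim exE conjE)
    obtain U :: "real^2 \<Rightarrow> real" and g B r and y :: "nat \<Rightarrow> real^2" where
      U: "U \<in> potential_class \<kappa>" "\<forall>k. ck k UNIV U" "\<forall>x. (U has_derivative (\<lambda>v. inner (g x) v)) (at x)"
      and H: "\<forall>x. \<exists>H. (g has_derivative H) (at x) \<and> (\<forall>v. (norm v)\<^sup>2 \<le> inner (H v) v \<and> inner (H v) v \<le> \<kappa> * (norm v)\<^sup>2) \<and> (\<forall>v. norm (H v) \<le> \<kappa> * norm v)"
      and B: "\<forall>x. norm (g x - x) \<le> B" and r: "0 < r" "\<forall>x. norm x \<le> r \<longrightarrow> g x = x"
      and y: "\<forall>n. norm (y n) = 1" "\<forall>n. y (Suc (Suc n)) = (1 + \<beta>) *\<^sub>R y (Suc n) - \<beta> *\<^sub>R y n - s *\<^sub>R g (y (Suc n))"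
        "\<forall>n e. norm e \<le> r \<longrightarrow> g (y n + e) = g (y n) + e"
      using cycle_potential_plane[OF par] by (elim exE conjE)
    show ?thesis
      by (rule disjI2, rule bexI[OF _ U(1)],
        rule metastable_dilations[where U=U and g=g and y=y and B=B and r=r, OF h h2 \<beta>' \<beta> s U(2)[THEN spec] U(3)[THEN spec] H[THEN spec] B[THEN spec] r(1) r(2)[rule_format] y(1)[THEN spec] y(2)[THEN spec] y(3)[rule_format]])
  qed
qed

end
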